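(* The spectrum of the boundary value problem $L$ is a countable set of real eigenvalues $\{\lambda_{nk}\}_{(n,k)\in J}$ (counted with multiplicities), numbered in non-decreasing order: $\lambda_{n_1k_1}\le\lambda_{n_2k_2}$ if $(n_1,k_1)<(n_2,k_2)$. The following asymptotic relation holds: $$\rho_{nk}:=\sqrt{\lambda_{nk}}=n+r_k+\varkappa_{nk},\quad (n,k)\in J,\qquad \{\varkappa_{nk}\}\in l_2,$$ where $$J:=\{(n,k)\colon n\in\mathbb N,\ k=1,\dots,m\}\cup\{(0,k)\colon k=p^{\perp}+1,\dots,m\},\qquad p^{\perp}:=\dim(\operatorname{Ker}T_1\cap\operatorname{Ker}T_2),$$ and $\{r_k\}_{k=1}^m$ are the zeros, counted with multiplicities and in non-decreasing order, of the function $w^0(\rho):=\det(W^0(\rho))$ on $[0,1)$, $$W^0(\rho):=(T_2T_1+T_2^{\perp}T_1^{\perp})\sin\rho\pi+(T_2^{\perp}T_1-T_2T_1^{\perp})\cos\rho\pi.$$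
   Context: Let $m\ge 1$; $\dagger$ denotes conjugate transpose and $I$ the unit $(m\times m)$-matrix. Let $\sigma\in L_2((0,\pi);\mathbb C^{m\times m})$ with $\sigma(x)=(\sigma(x))^\dagger$. For an $m$-vector function $Y$ put $Y^{[1]}:=Y'-\sigma Y$ (quasi-derivative) and $\ell Y:=-(Y^{[1]})'-\sigma Y^{[1]}-\sigma^2Y$. Let $T_j,H_j\in\mathbb C^{m\times m}$, $j=1,2$, satisfy $T_j=T_j^\dagger=T_j^2$, $T_j^\perp:=I-T_j$, $H_j=H_j^\dagger=T_jH_jT_j$. Denote $$V_1(Y):=T_1(Y^{[1]}(0)-H_1Y(0))-T_1^\perp Y(0),\qquad V_2(Y):=T_2(Y^{[1]}(\pi)-H_2Y(\pi))-T_2^\perp Y(\pi).$$ $L$ is the boundary value problem $\ell Y=\lambda Y$ on $(0,\pi)$, $V_1(Y)=0$, $V_2(Y)=0$, considered for $Y$ such that $Y,Y^{[1]}$ are absolutely continuous on $[0,\pi]$ and $\ell Y\in L_2((0,\pi);\mathbb C^m)$. The multiplicity of an eigenvalue is the number of linearly independent vector eigenfunctions corresponding to it; zeros of analytic functions are counted with multiplicities. The square root is taken with $\arg\sqrt\lambda\in[-\pi/2,\pi/2)$. Pairs $(n,k)$ are ordered lexicographically. $\mathbb N=\{1,2,\dots\}$. *)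

theory Defs
  imports "HOL-Complex_Analysis.Complex_Analysis" "HOL-Library.Function_Algebras"
begin

section \<open>Matrices\<close>

definition dagger :: "complex^'n^'m \<Rightarrow> complex^'m^'n" where
  "dagger A = map_matrix cnj (transpose A)"

definition perp :: "complex^'m^'m \<Rightarrow> complex^'m^'m" where
  "perp T = mat 1 - T"

section \<open>Function spaces on the interval\<close>

definition L2 :: "(real \<Rightarrow> 'a::euclidean_space) \<Rightarrow> bool" where
  "L2 f \<longleftrightarrow> f \<in> borel_measurable (lebesgue_on {0<..<pi}) \<and>
     integrable (lebesgue_on {0<..<pi}) (\<lambda>x. (norm (f x))\<^sup>2)"

definition L2_norm :: "(real \<Rightarrow> 'a::euclidean_space) \<Rightarrow> real" where
  "L2_norm f = sqrt (integral\<^sup>L (lebesgue_on {0<..<pi}) (\<lambda>x. (norm (f x))\<^sup>2))"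

text \<open>A finite family of non-overlapping compact intervals is a \<^const>\<open>division_of\<close> its own union.\<close>

definition abs_cont_on :: "real \<Rightarrow> real \<Rightarrow> (real \<Rightarrow> 'a::real_normed_vector) \<Rightarrow> bool" where
  "abs_cont_on a b f \<longleftrightarrow>
     (\<forall>\<epsilon>>0. \<exists>\<delta>>0. \<forall>\<I>. \<I> division_of \<Union>\<I> \<longrightarrow> \<Union>\<I> \<subseteq> {a..b} \<longrightarrow>
        (\<Sum>I\<in>\<I>. Sup I - Inf I) < \<delta> \<longrightarrow> (\<Sum>I\<in>\<I>. norm (f (Sup I) - f (Inf I))) < \<epsilon>)"

section \<open>The boundary value problem\<close>

text \<open>
  The derivatives below exist only almost everywhere, so the quasi-derivative and the
  differential expression are relations: \<open>quasi_deriv \<sigma> Y Z\<close> says \<open>Z = Y' - \<sigma> Y\<close> a.e., and, for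
  such a \<open>Z\<close>, \<open>diff_expr \<sigma> Y Z F\<close> says \<open>F = - Z' - \<sigma> Z - \<sigma>\<^sup>2 Y\<close> a.e.
\<close>

definition quasi_deriv ::
  "(real \<Rightarrow> complex^'m^'m) \<Rightarrow> (real \<Rightarrow> complex^'m) \<Rightarrow> (real \<Rightarrow> complex^'m) \<Rightarrow> bool" where
  "quasi_deriv \<sigma> Y Z \<longleftrightarrow>
     (AE x in lebesgue_on {0<..<pi}. \<exists>Y'. (Y has_vector_derivative Y') (at x) \<and>
        Z x = Y' - \<sigma> x *v Y x)"

definition diff_expr ::
  "(real \<Rightarrow> complex^'m^'m) \<Rightarrow> (real \<Rightarrow> complex^'m) \<Rightarrow> (real \<Rightarrow> complex^'m) \<Rightarrow>
   (real \<Rightarrow> complex^'m) \<Rightarrow> bool" where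
  "diff_expr \<sigma> Y Z F \<longleftrightarrow>
     (AE x in lebesgue_on {0<..<pi}. \<exists>Z'. (Z has_vector_derivative Z') (at x) \<and>
        F x = - Z' - \<sigma> x *v Z x - (\<sigma> x ** \<sigma> x) *v Y x)"

definition boundary_form ::
  "complex^'m^'m \<Rightarrow> complex^'m^'m \<Rightarrow> complex^'m \<Rightarrow> complex^'m \<Rightarrow> complex^'m" where
  "boundary_form T H y z = T *v (z - H *v y) - perp T *v y"

text \<open>
  \<open>bvp_graph \<sigma> T1 H1 T2 H2 Y F\<close>: \<open>Y\<close> is in the domain of the problem, satisfies the two
  boundary conditions, and \<open>\<ell> Y = F\<close>. The absolutely continuous function \<open>Z\<close> is the continuous
  representative of the quasi-derivative of \<open>Y\<close>. Functions on \<open>[0, \<pi>]\<close> are represented by their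
  extensions by zero, so that distinct elements of the domain differ on \<open>[0, \<pi>]\<close>.
\<close>

definition bvp_graph ::
  "(real \<Rightarrow> complex^'m^'m) \<Rightarrow> complex^'m^'m \<Rightarrow> complex^'m^'m \<Rightarrow> complex^'m^'m \<Rightarrow> complex^'m^'m \<Rightarrow>
   (real \<Rightarrow> complex^'m) \<Rightarrow> (real \<Rightarrow> complex^'m) \<Rightarrow> bool" where
  "bvp_graph \<sigma> T1 H1 T2 H2 Y F \<longleftrightarrow>
     (\<forall>x. x \<notin> {0..pi} \<longrightarrow> Y x = 0) \<and> L2 F \<and>
     (\<exists>Z. abs_cont_on 0 pi Y \<and> abs_cont_on 0 pi Z \<and>
        quasi_deriv \<sigma> Y Z \<and> diff_expr \<sigma> Y Z F \<and>
        boundary_form T1 H1 (Y 0) (Z 0) = 0 \<and> boundary_form T2 H2 (Y pi) (Z pi) = 0)"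

definition bvp_eigenspace ::
  "(real \<Rightarrow> complex^'m^'m) \<Rightarrow> complex^'m^'m \<Rightarrow> complex^'m^'m \<Rightarrow> complex^'m^'m \<Rightarrow> complex^'m^'m \<Rightarrow>
   complex \<Rightarrow> (real \<Rightarrow> complex^'m) set" where
  "bvp_eigenspace \<sigma> T1 H1 T2 H2 \<mu> = {Y. bvp_graph \<sigma> T1 H1 T2 H2 Y (\<lambda>x. \<mu> *s Y x)}"

definition bvp_eigenvalues ::
  "(real \<Rightarrow> complex^'m^'m) \<Rightarrow> complex^'m^'m \<Rightarrow> complex^'m^'m \<Rightarrow> complex^'m^'m \<Rightarrow> complex^'m^'m \<Rightarrow>
   complex set" where
  "bvp_eigenvalues \<sigma> T1 H1 T2 H2 = {\<mu>. \<exists>Y\<in>bvp_eigenspace \<sigma> T1 H1 T2 H2 \<mu>. Y \<noteq> 0}"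

definition bvp_multiplicity ::
  "(real \<Rightarrow> complex^'m^'m) \<Rightarrow> complex^'m^'m \<Rightarrow> complex^'m^'m \<Rightarrow> complex^'m^'m \<Rightarrow> complex^'m^'m \<Rightarrow>
   complex \<Rightarrow> nat" where
  "bvp_multiplicity \<sigma> T1 H1 T2 H2 \<mu> =
     vector_space.dim (\<lambda>c Y x. c *s Y x) (bvp_eigenspace \<sigma> T1 H1 T2 H2 \<mu>)"

lemma vector_space_fun_vec:
  "vector_space (\<lambda>(c::complex) (Y :: real \<Rightarrow> complex^'m) x. c *s Y x)"
  by unfold_locales (auto simp: fun_eq_iff vector_add_ldistrib vector_sadd_rdistrib)

text \<open>Complement of the set of \<open>\<mu>\<close> for which \<open>L - \<mu>\<close> has a bounded inverse on all of \<open>L\<^sub>2\<close>.\<close>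

definition bvp_spectrum ::
  "(real \<Rightarrow> complex^'m^'m) \<Rightarrow> complex^'m^'m \<Rightarrow> complex^'m^'m \<Rightarrow> complex^'m^'m \<Rightarrow> complex^'m^'m \<Rightarrow>
   complex set" where
  "bvp_spectrum \<sigma> T1 H1 T2 H2 = - {\<mu>. \<exists>C. \<forall>F. L2 F \<longrightarrow>
     (\<exists>!Y. bvp_graph \<sigma> T1 H1 T2 H2 Y (\<lambda>x. F x + \<mu> *s Y x)) \<and>
     (\<forall>Y. bvp_graph \<sigma> T1 H1 T2 H2 Y (\<lambda>x. F x + \<mu> *s Y x) \<longrightarrow> L2_norm Y \<le> C * L2_norm F)}"

section \<open>Ingredients of the asymptotics\<close>

definition branch_sqrt :: "complex \<Rightarrow> complex" where
  "branch_sqrt z = (THE \<rho>. \<rho>\<^sup>2 = z \<and> Arg \<rho> \<in> {-(pi/2)..<pi/2})"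

definition p_perp :: "complex^'m^'m \<Rightarrow> complex^'m^'m \<Rightarrow> nat" where
  "p_perp T1 T2 = vec.dim ({v. T1 *v v = 0} \<inter> {v. T2 *v v = 0})"

definition index_set :: "complex^'m^'m \<Rightarrow> complex^'m^'m \<Rightarrow> (nat \<times> nat) set" where
  "index_set T1 T2 = {1..} \<times> {1..CARD('m)} \<union> {0} \<times> {p_perp T1 T2 + 1..CARD('m)}"

definition W0 :: "complex^'m^'m \<Rightarrow> complex^'m^'m \<Rightarrow> complex \<Rightarrow> complex^'m^'m" where
  "W0 T1 T2 \<rho> =
     map_matrix ((*) (sin (\<rho> * of_real pi))) (T2 ** T1 + perp T2 ** perp T1) +
     map_matrix ((*) (cos (\<rho> * of_real pi))) (perp T2 ** T1 - T2 ** perp T1)"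

definition w0 :: "complex^'m^'m \<Rightarrow> complex^'m^'m \<Rightarrow> complex \<Rightarrow> complex" where
  "w0 T1 T2 \<rho> = det (W0 T1 T2 \<rho>)"

text \<open>\<open>r 1 \<le> \<dots> \<le> r m\<close> are all the zeros of \<open>f\<close> on the real interval \<open>[0, 1)\<close>, repeated
  according to their order.\<close>

definition zeros_listing :: "(complex \<Rightarrow> complex) \<Rightarrow> nat \<Rightarrow> (nat \<Rightarrow> real) \<Rightarrow> bool" where
  "zeros_listing f m r \<longleftrightarrow> mono_on {1..m} r \<and>
     complex_of_real ` r ` {1..m} = {z. f z = 0 \<and> z \<in> complex_of_real ` {0..<1}} \<and>
     (\<forall>x\<in>r ` {1..m}. int (card {k\<in>{1..m}. r k = x}) = zorder f (of_real x))"

end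

theory Submission
  imports Defs
begin

text \<open>
  Written as a first order system for \<open>(Y, Y\<^sup>[\<^sup>1\<^sup>])\<close>, the equation has integrable coefficients. The eigenvalues are
  the zeros of the determinant of the characteristic matrix, obtained by inserting the solutions that
  satisfy the first boundary condition into the second one. By self-adjointness this matrix is semisimple at
  its zeros, so that the order of each zero of the determinant is the dimension of the eigenspace.

  Multiply \<open>\<sigma>\<close>, \<open>H\<^sub>1\<close>, \<open>H\<^sub>2\<close> by \<open>t \<in> [0, 1]\<close>. All problems of this family are self-adjoint and bounded below
  uniformly in \<open>t\<close>, hence as long as a real point is not an eigenvalue for any \<open>t\<close>, the number of
  eigenvalues below it is the same for \<open>t = 0\<close> and \<open>t = 1\<close>. For \<open>t = 0\<close> the eigenvalues are the squares of the
  nonnegative zeros \<open>n + r\<^sub>k\<close> of \<open>w\<^sup>0\<close>, except that \<open>0\<close> has lost \<open>p\<^sup>\<bottom>\<close> of its multiplicity. These zeros are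
  counted through the eigenvalues of the unitary matrix \<open>(2 T\<^sub>2 - I) (2 T\<^sub>1 - I)\<close>.

  For each \<open>t\<close>, an eigenvalue \<open>\<rho>\<^sup>2\<close> with \<open>\<rho>\<close> near \<open>n\<close> lies within \<open>C \<kappa>\<^sub>n\<close> of a zero of \<open>w\<^sup>0\<close>, where \<open>\<kappa>\<^sub>n\<close>
  collects \<open>1/n\<close> and averages of the \<open>n\<close>-th Fourier coefficients of the truncations of \<open>\<sigma>\<close>; it is square summable by
  Bessel's inequality. This produces the points which no eigenvalue crosses, and at \<open>t = 1\<close> it is the
  asserted asymptotics.
\<close>

section \<open>Absolute continuity and the fundamental theorem of calculus\<close>

text \<open>Since \<sigma> is only square integrable, derivatives exist merely almost everywhere.
  All analysis is therefore done with integral equations (\<open>primitive_on\<close>); the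
  fundamental theorem for absolutely continuous functions and Lebesgue differentiation serve to pass
  between these and the pointwise definitions. Two obstacles shape the rest. Counting eigenvalues by
  a comparison of determinants on large contours would need asymptotics for complex \<lambda>. Here
  the zeros are real along the whole homotopy, so a circle whose diameter is a real interval can be
  crossed only at the two endpoints, and estimates for real \<rho> suffice. Moreover, closeness of
  determinants is too weak: near a zero of order k a perturbation of size \<kappa> may move zeros by
  as much as the k-th root of \<kappa>, which need not be square summable. Semisimplicity provides
  instead a bound for vectors that is linear in the distance to the nearest relevant zero
  (\<open>W0_lower_bound\<close>). Applied to the initial vector of an eigenfunction, it gives a
  displacement of order \<kappa> whatever the multiplicity.\<close>

lemma abs_cont_on_subinterval:
  assumes "abs_cont_on a b f" "a \<le> c" "d \<le> b"
  shows "abs_cont_on c d f"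
proof -
  have "{c..d} \<subseteq> {a..b}" using assms by auto
  then show ?thesis using assms(1) unfolding abs_cont_on_def by (meson order_trans)
qed

lemma division_of_single: "u \<le> v \<Longrightarrow> {{u..v::real}} division_of \<Union>{{u..v}}"
  using division_of_self[of u v] by auto

lemma abs_cont_on_imp_continuous_on:
  fixes f :: "real \<Rightarrow> 'a::real_normed_vector"
  assumes "abs_cont_on a b f"
  shows "continuous_on {a..b} f"
  unfolding continuous_on_iff
proof (intro ballI allI impI)
  fix x e :: real assume x: "x \<in> {a..b}" and "e > 0"
  then obtain d where "d > 0" and d: "\<And>\<I>. \<lbrakk>\<I> division_of \<Union>\<I>; \<Union>\<I> \<subseteq> {a..b}; (\<Sum>I\<in>\<I>. Sup I - Inf I) < d\<rbrakk> \<Longrightarrow>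
     (\<Sum>I\<in>\<I>. norm (f (Sup I) - f (Inf I))) < e"
    using assms unfolding abs_cont_on_def by meson
  have 1: "norm (f v - f u) < e" if "u \<le> v" "u \<in> {a..b}" "v \<in> {a..b}" "v - u < d" for u v
    using d[OF division_of_single[OF that(1)]] that by auto
  have "dist (f y) (f x) < e" if "y \<in> {a..b}" "dist y x < d" for y
    using 1[of x y] 1[of y x] that x by (cases "x \<le> y") (auto simp: dist_norm norm_minus_commute)
  with \<open>d > 0\<close> show "\<exists>d>0. \<forall>y\<in>{a..b}. dist y x < d \<longrightarrow> dist (f y) (f x) < e" by blast
qed

text \<open>Two dominating functions are allowed because the increments of a product or of a pair
  are controlled by those of its two constituents.\<close>

lemma abs_cont_on_dominated:
  fixes f :: "real \<Rightarrow> 'a::real_normed_vector" and g :: "real \<Rightarrow> 'b::real_normed_vector"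
    and h :: "real \<Rightarrow> 'c::real_normed_vector"
  assumes g: "abs_cont_on a b g" and h: "abs_cont_on a b h" and "C \<ge> 0"
    and le: "\<And>u v. \<lbrakk>u \<in> {a..b}; v \<in> {a..b}; u \<le> v\<rbrakk> \<Longrightarrow> norm (f v - f u) \<le> C * (norm (g v - g u) + norm (h v - h u))"
  shows "abs_cont_on a b f"
  unfolding abs_cont_on_def
proof (intro allI impI)
  fix e :: real assume "e > 0"
  \<comment> \<open>The \<open>+ 1\<close> keeps the denominator positive when
    \<open>C = 0\<close>.\<close>
  define e' where "e' = e / (2 * (C + 1))"
  have e': "e' > 0" using \<open>e > 0\<close> \<open>C \<ge> 0\<close> by (auto simp: e'_def)
  obtain d1 where "d1 > 0" and d1: "\<And>\<I>. \<lbrakk>\<I> division_of \<Union>\<I>; \<Union>\<I> \<subseteq> {a..b}; (\<Sum>I\<in>\<I>. Sup I - Inf I) < d1\<rbrakk> \<Longrightarrow>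
     (\<Sum>I\<in>\<I>. norm (g (Sup I) - g (Inf I))) < e'"
    using g e' unfolding abs_cont_on_def by meson
  obtain d2 where "d2 > 0" and d2: "\<And>\<I>. \<lbrakk>\<I> division_of \<Union>\<I>; \<Union>\<I> \<subseteq> {a..b}; (\<Sum>I\<in>\<I>. Sup I - Inf I) < d2\<rbrakk> \<Longrightarrow>
     (\<Sum>I\<in>\<I>. norm (h (Sup I) - h (Inf I))) < e'"
    using h e' unfolding abs_cont_on_def by meson
  have "(\<Sum>I\<in>\<I>. norm (f (Sup I) - f (Inf I))) < e"
    if I: "\<I> division_of \<Union>\<I>" "\<Union>\<I> \<subseteq> {a..b}" "(\<Sum>I\<in>\<I>. Sup I - Inf I) < min d1 d2" for \<I>
  proof -
    have "(\<Sum>I\<in>\<I>. norm (f (Sup I) - f (Inf I))) \<le> (\<Sum>I\<in>\<I>. C * (norm (g (Sup I) - g (Inf I)) + norm (h (Sup I) - h (Inf I))))"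
    proof (rule sum_mono)
      fix I assume "I \<in> \<I>"
      then obtain u v where "I = cbox u v" "I \<noteq> {}" using division_ofD(3,4)[OF I(1)] by blast
      then have "I = {u..v}" "u \<le> v" by auto
      moreover have "I \<subseteq> {a..b}" using \<open>I \<in> \<I>\<close> I(2) by blast
      ultimately show "norm (f (Sup I) - f (Inf I)) \<le> C * (norm (g (Sup I) - g (Inf I)) + norm (h (Sup I) - h (Inf I)))"
        using le[of u v] by auto
    qed
    also have "\<dots> = C * ((\<Sum>I\<in>\<I>. norm (g (Sup I) - g (Inf I))) + (\<Sum>I\<in>\<I>. norm (h (Sup I) - h (Inf I))))"
      by (simp add: sum.distrib flip: sum_distrib_left)
    also have "\<dots> \<le> C * (e' + e')"
      using d1[OF I(1,2)] d2[OF I(1,2)] I(3) \<open>C \<ge> 0\<close> by (intro mult_left_mono) auto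
    also have "\<dots> < (C + 1) * (e' + e')" using e' by simp
    also have "\<dots> = e' * (2 * (C + 1))" by (simp add: algebra_simps)
    also have "\<dots> = e" using \<open>C \<ge> 0\<close> by (simp add: e'_def)
    finally show ?thesis .
  qed
  then show "\<exists>d>0. \<forall>\<I>. \<I> division_of \<Union>\<I> \<longrightarrow> \<Union>\<I> \<subseteq> {a..b} \<longrightarrow> (\<Sum>I\<in>\<I>. Sup I - Inf I) < d \<longrightarrow>
      (\<Sum>I\<in>\<I>. norm (f (Sup I) - f (Inf I))) < e"
    using \<open>d1 > 0\<close> \<open>d2 > 0\<close> by (intro exI[of _ "min d1 d2"]) auto
qed

lemma abs_cont_on_bilinear:
  assumes "bounded_bilinear mul" and f: "abs_cont_on a b f" and g: "abs_cont_on a b g"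
  shows "abs_cont_on a b (\<lambda>x. mul (f x) (g x))"
proof -
  interpret bounded_bilinear mul by fact
  obtain K where K: "K \<ge> 0" "\<And>x y. norm (mul x y) \<le> norm x * norm y * K" using nonneg_bounded by blast
  obtain B1 where B1: "\<And>x. x \<in> {a..b} \<Longrightarrow> norm (f x) \<le> B1" "B1 > 0"
    using compact_imp_bounded[OF compact_continuous_image[OF abs_cont_on_imp_continuous_on[OF f] compact_Icc]]
    unfolding bounded_pos by (metis imageI)
  obtain B2 where B2: "\<And>x. x \<in> {a..b} \<Longrightarrow> norm (g x) \<le> B2" "B2 > 0"
    using compact_imp_bounded[OF compact_continuous_image[OF abs_cont_on_imp_continuous_on[OF g] compact_Icc]]
    unfolding bounded_pos by (metis imageI)
  show ?thesis
  proof (rule abs_cont_on_dominated[OF f g, of "K * (B1 + B2)"])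
    show "0 \<le> K * (B1 + B2)" using K B1 B2 by simp
    fix u v assume u: "u \<in> {a..b}" and v: "v \<in> {a..b}"
    have "mul (f v) (g v) - mul (f u) (g u) = mul (f v - f u) (g v) + mul (f u) (g v - g u)"
      by (simp add: diff_left diff_right)
    then have "norm (mul (f v) (g v) - mul (f u) (g u)) \<le> norm (f v - f u) * norm (g v) * K + norm (f u) * norm (g v - g u) * K"
      by (simp only:) (rule order_trans[OF norm_triangle_ineq add_mono[OF K(2) K(2)]])
    also have "\<dots> \<le> norm (f v - f u) * B2 * K + B1 * norm (g v - g u) * K"
      using K B1 B2 u v by (intro add_mono mult_right_mono mult_left_mono mult_mono) auto
    also have "\<dots> \<le> K * (B1 + B2) * (norm (f v - f u) + norm (g v - g u))"
      using K B1 B2 by (simp add: algebra_simps)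
    finally show "norm (mul (f v) (g v) - mul (f u) (g u)) \<le> K * (B1 + B2) * (norm (f v - f u) + norm (g v - g u))" .
  qed
qed

lemma abs_cont_on_Lipschitz_compose:
  fixes f :: "real \<Rightarrow> 'a::real_normed_vector" and h :: "'a \<Rightarrow> 'b::real_normed_vector"
  assumes f: "abs_cont_on a b f" and "C \<ge> 0"
    and le: "\<And>u v. \<lbrakk>u \<in> f ` {a..b}; v \<in> f ` {a..b}\<rbrakk> \<Longrightarrow> norm (h v - h u) \<le> C * norm (v - u)"
  shows "abs_cont_on a b (\<lambda>x. h (f x))"
proof (rule abs_cont_on_dominated[OF f f \<open>C \<ge> 0\<close>])
  fix u v assume u: "u \<in> {a..b}" and v: "v \<in> {a..b}"
  have "norm (h (f v) - h (f u)) \<le> C * norm (f v - f u)" using u v by (intro le) auto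
  also have "\<dots> \<le> C * (norm (f v - f u) + norm (f v - f u))" using \<open>C \<ge> 0\<close> by (intro mult_left_mono) auto
  finally show "norm (h (f v) - h (f u)) \<le> C * (norm (f v - f u) + norm (f v - f u))" .
qed

text \<open>Gauge argument. Off \<open>N\<close>, differentiability makes each tagged interval
  contribute an error proportional to its length. Tags in \<open>N\<close> are confined to an open
  set of small measure, so their intervals have small total length and absolute continuity bounds
  the increments of \<open>F\<close> over them.\<close>

theorem fundamental_theorem_of_calculus_abs_cont:
  fixes F :: "real \<Rightarrow> 'a::euclidean_space"
  assumes "a \<le> b" and ac: "abs_cont_on a b F" and N: "negligible N"
    and deriv: "\<And>x. x \<in> {a..b} - N \<Longrightarrow> (F has_vector_derivative f x) (at x within {a..b})"
  shows "(f has_integral (F b - F a)) {a..b}"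
proof -
  \<comment> \<open>With the integrand put to 0 on \<open>N\<close>, an interval tagged there
    contributes nothing but an increment of \<open>F\<close>.\<close>
  define g where "g x = (if x \<in> N then 0 else f x)" for x
  have "(g has_integral (F b - F a)) {a..b}"
    unfolding has_integral_real
  proof (intro allI impI)
    fix e :: real assume "e > 0"
    define e' where "e' = e / (3 * (b - a + 1))"
    have e': "e' > 0" using \<open>e > 0\<close> \<open>a \<le> b\<close> by (auto simp: e'_def)
    obtain d where "d > 0" and d: "\<And>\<I>. \<lbrakk>\<I> division_of \<Union>\<I>; \<Union>\<I> \<subseteq> {a..b}; (\<Sum>I\<in>\<I>. Sup I - Inf I) < d\<rbrakk> \<Longrightarrow>
       (\<Sum>I\<in>\<I>. norm (F (Sup I) - F (Inf I))) < e / 3"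
      using ac[unfolded abs_cont_on_def, rule_format, of "e / 3"] \<open>e > 0\<close> by auto
    obtain T where T: "open T" "N \<subseteq> T" "T - N \<in> lmeasurable" "emeasure lebesgue (T - N) < ennreal d"
      using sets_lebesgue_outer_open[of N d] N \<open>d > 0\<close> by (auto simp: negligible_imp_sets)
    have TN: "(T - N) \<union> N = T" using T by blast
    have Nl: "N \<in> lmeasurable" using N by (rule negligible_imp_measurable)
    have Tl: "T \<in> lmeasurable" using fmeasurable.Un[OF T(3) Nl] TN by simp
    have Tm: "measure lebesgue T < d"
    proof -
      have "measure lebesgue T \<le> measure lebesgue (T - N) + measure lebesgue N"
        using measure_Un_le[of "T - N" lebesgue N] T(3) Nl TN by (simp add: fmeasurableD)
      also have "measure lebesgue N = 0" using N by (rule negligible_imp_measure0)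
      also have "measure lebesgue (T - N) < d"
        using T(3,4) \<open>d > 0\<close> by (simp add: emeasure_eq_measure2 ennreal_less_iff)
      finally show ?thesis by simp
    qed
    have "\<exists>r>0. \<forall>y\<in>{a..b}. \<bar>y - x\<bar> < r \<longrightarrow> norm (F y - F x - (y - x) *\<^sub>R f x) \<le> e' * \<bar>y - x\<bar>"
      if "x \<in> {a..b} - N" for x
      using deriv[OF that] e' unfolding has_vector_derivative_def has_derivative_within_alt by auto
    then obtain r where r: "\<And>x. x \<in> {a..b} - N \<Longrightarrow> r x > 0"
        "\<And>x y. \<lbrakk>x \<in> {a..b} - N; y \<in> {a..b}; \<bar>y - x\<bar> < r x\<rbrakk> \<Longrightarrow> norm (F y - F x - (y - x) *\<^sub>R f x) \<le> e' * \<bar>y - x\<bar>"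
      by metis
    define \<gamma> where "\<gamma> x = (if x \<in> N then T else if x \<in> {a..b} then ball x (r x) else UNIV)" for x
    have "gauge \<gamma>" using T r by (auto simp: gauge_def \<gamma>_def)
    moreover have "norm ((\<Sum>(x,K)\<in>\<D>. measure lborel K *\<^sub>R g x) - (F b - F a)) < e"
      if p: "\<D> tagged_division_of {a..b}" and fine: "\<gamma> fine \<D>" for \<D>
    proof -
      have fin: "finite \<D>" using p by blast
      have K: "\<exists>u v. K = {u..v} \<and> u \<le> x \<and> x \<le> v \<and> u \<in> {a..b} \<and> v \<in> {a..b}" if xK: "(x,K) \<in> \<D>" for x K
      proof -
        obtain u v where "K = cbox u v" using tagged_division_ofD(4)[OF p xK] by blast
        moreover have "x \<in> K" "K \<subseteq> {a..b}" using tagged_division_ofD(2,3)[OF p xK] by auto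
        ultimately show ?thesis by (intro exI[of _ u] exI[of _ v]) auto
      qed
      define D where "D = {p\<in>\<D>. fst p \<in> N}"
      have DD: "D \<subseteq> \<D>" by (auto simp: D_def)
      have "(\<Sum>(x,K)\<in>\<D>. measure lborel K *\<^sub>R g x) - (F b - F a) = (\<Sum>(x,K)\<in>\<D>. measure lborel K *\<^sub>R g x - (F (Sup K) - F (Inf K)))"
        using additive_tagged_division_1[OF \<open>a \<le> b\<close> p, of F] by (simp add: sum_subtractf split_def)
      also have "\<dots> = (\<Sum>(x,K)\<in>D. measure lborel K *\<^sub>R g x - (F (Sup K) - F (Inf K))) + (\<Sum>(x,K)\<in>\<D> - D. measure lborel K *\<^sub>R g x - (F (Sup K) - F (Inf K)))"
        using sum.subset_diff[OF DD fin] by (simp add: add.commute)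
      finally have "norm ((\<Sum>(x,K)\<in>\<D>. measure lborel K *\<^sub>R g x) - (F b - F a)) \<le>
          norm (\<Sum>(x,K)\<in>D. measure lborel K *\<^sub>R g x - (F (Sup K) - F (Inf K))) + norm (\<Sum>(x,K)\<in>\<D> - D. measure lborel K *\<^sub>R g x - (F (Sup K) - F (Inf K)))"
        by (simp add: norm_triangle_ineq)
      moreover have "norm (\<Sum>(x,K)\<in>\<D> - D. measure lborel K *\<^sub>R g x - (F (Sup K) - F (Inf K))) \<le> e' * (b - a)"
      proof -
        have "norm (\<Sum>(x,K)\<in>\<D> - D. measure lborel K *\<^sub>R g x - (F (Sup K) - F (Inf K))) \<le> (\<Sum>(x,K)\<in>\<D> - D. e' * measure lborel K)"
          unfolding split_def
        proof (rule sum_norm_le)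
          fix z assume z: "z \<in> \<D> - D"
          obtain x Kz where [simp]: "z = (x, Kz)" by (cases z)
          obtain u v where uv: "Kz = {u..v}" "u \<le> x" "x \<le> v" "u \<in> {a..b}" "v \<in> {a..b}" using K z by force
          have x: "x \<in> {a..b} - N" using z uv by (auto simp: D_def)
          have "Kz \<subseteq> ball x (r x)" using fine z x by (force simp: fine_def \<gamma>_def)
          moreover have "u \<in> Kz" "v \<in> Kz" using uv by auto
          ultimately have "\<bar>u - x\<bar> < r x" "\<bar>v - x\<bar> < r x"
            by (auto simp: subset_iff dist_real_def abs_minus_commute)
          then have 1: "norm (F u - F x - (u - x) *\<^sub>R f x) \<le> e' * \<bar>u - x\<bar>" "norm (F v - F x - (v - x) *\<^sub>R f x) \<le> e' * \<bar>v - x\<bar>"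
            using r(2)[OF x uv(4)] r(2)[OF x uv(5)] by auto
          have "measure lborel Kz *\<^sub>R g x - (F (Sup Kz) - F (Inf Kz)) = (F u - F x - (u - x) *\<^sub>R f x) - (F v - F x - (v - x) *\<^sub>R f x)"
            using uv x by (simp add: g_def algebra_simps)
          then have "norm (measure lborel Kz *\<^sub>R g x - (F (Sup Kz) - F (Inf Kz))) \<le> e' * \<bar>u - x\<bar> + e' * \<bar>v - x\<bar>"
            by (simp only:) (rule order_trans[OF norm_triangle_ineq4 add_mono[OF 1]])
          also have "\<dots> = e' * measure lborel Kz" using uv by (simp add: algebra_simps)
          finally show "norm (measure lborel (snd z) *\<^sub>R g (fst z) - (F (Sup (snd z)) - F (Inf (snd z)))) \<le> e' * measure lborel (snd z)" by simp
        qed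
        also have "\<dots> \<le> (\<Sum>(x,K)\<in>\<D>. e' * measure lborel K)"
          using fin e' by (intro sum_mono2) (auto simp: split_def)
        also have "\<dots> = e' * (b - a)"
          using additive_content_tagged_division[of \<D> a b] p \<open>a \<le> b\<close> by (simp add: split_def flip: sum_distrib_left)
        finally show ?thesis .
      qed
      moreover have "e' * (b - a) < 2 * e / 3"
      proof -
        have "e' * (b - a) \<le> e' * (b - a + 1)" using e' by simp
        also have "e' * (b - a + 1) = e / 3"
        proof -
          have *: "e / (3 * c) * c = e / 3" if "c \<noteq> 0" for c using that by simp
          show ?thesis unfolding e'_def using \<open>a \<le> b\<close> by (intro *) simp
        qed
        finally show ?thesis using \<open>e > 0\<close> by simp
      qed
      moreover have "norm (\<Sum>(x,K)\<in>D. measure lborel K *\<^sub>R g x - (F (Sup K) - F (Inf K))) < e / 3"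
      proof -
        have pD: "D tagged_partial_division_of {a..b}"
          using p DD by (meson tagged_division_of_def tagged_partial_division_subset)
        then have Ddiv: "D tagged_division_of \<Union>(snd ` D)"
          by (rule tagged_partial_division_of_Union_self)
        have div: "snd ` D division_of \<Union>(snd ` D)"
          using pD by (rule partial_division_of_tagged_division)
        have ne: "{} \<notin> snd ` D" using division_ofD(3)[OF div] by blast
        have sub: "\<Union>(snd ` D) \<subseteq> {a..b}" using pD by (force simp: tagged_partial_division_of_def)
        have "norm (\<Sum>(x,K)\<in>D. measure lborel K *\<^sub>R g x - (F (Sup K) - F (Inf K))) \<le> (\<Sum>(x,K)\<in>D. norm (F (Sup K) - F (Inf K)))"
          unfolding split_def by (rule sum_norm_le) (auto simp: D_def g_def norm_minus_commute)
        \<comment> \<open>Reindexing from tagged intervals to intervals needs a summand that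
          vanishes on degenerate ones; the case distinction enforces this for the empty set, whose
          \<open>Sup\<close> and \<open>Inf\<close> carry no meaning.\<close>
        also have "\<dots> = (\<Sum>(x,K)\<in>D. if K = {} then 0 else norm (F (Sup K) - F (Inf K)))"
          using ne by (intro sum.cong refl) force
        also have "\<dots> = (\<Sum>K\<in>snd ` D. if K = {} then 0 else norm (F (Sup K) - F (Inf K)))"
        proof (rule sum.over_tagged_division_lemma[OF Ddiv])
          fix u v :: real assume "box u v = {}"
          then have "v \<le> u" by (simp add: box_real)
          then show "(if cbox u v = {} then 0 else norm (F (Sup (cbox u v)) - F (Inf (cbox u v)))) = 0"
            by (cases "u = v") auto
        qed
        also have "\<dots> = (\<Sum>K\<in>snd ` D. norm (F (Sup K) - F (Inf K)))"
          using ne by (intro sum.cong refl) auto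
        also have "\<dots> < e / 3"
        proof (rule d[OF div sub])
          have "(\<Sum>I\<in>snd ` D. Sup I - Inf I) = (\<Sum>I\<in>snd ` D. measure lebesgue I)"
          proof (rule sum.cong[OF refl])
            fix I assume "I \<in> snd ` D"
            then obtain u v where "I = {u..v}" "u \<le> v" using K DD by force
            then show "Sup I - Inf I = measure lebesgue I" by simp
          qed
          also have "\<dots> = measure lebesgue (\<Union>(snd ` D))"
            using content_division[OF div] by simp
          also have "\<dots> \<le> measure lebesgue T"
          proof (rule measure_mono_fmeasurable[OF _ _ Tl])
            show "\<Union> (snd ` D) \<subseteq> T" using fine by (force simp: fine_def \<gamma>_def D_def split: if_splits)
            show "\<Union> (snd ` D) \<in> sets lebesgue"
            proof (rule sets.finite_Union[OF division_of_finite[OF div]], rule subsetI)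
              fix I assume "I \<in> snd ` D"
              then obtain u v where "I = cbox u v" using division_ofD(4)[OF div] by blast
              then show "I \<in> sets lebesgue" by auto
            qed
          qed
          finally show "(\<Sum>I\<in>snd ` D. Sup I - Inf I) < d" using Tm by simp
        qed
        finally show ?thesis .
      qed
      ultimately show ?thesis by linarith
    qed
    ultimately show "\<exists>\<gamma>. gauge \<gamma> \<and> (\<forall>\<D>. \<D> tagged_division_of {a..b} \<and> \<gamma> fine \<D> \<longrightarrow>
       norm ((\<Sum>(x, k)\<in>\<D>. measure lborel k *\<^sub>R g x) - (F b - F a)) < e)"
      by (intro exI[of _ \<gamma>] conjI allI impI) auto
  qed
  moreover have "f x = g x" if "x \<in> {a..b} - N" for x using that by (simp add: g_def)
  ultimately show ?thesis using has_integral_spike[OF N] by blast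
qed


text \<open>Split \<open>norm (f x) \<le> n + h n x\<close> at a height \<open>n\<close> for which
  the excess \<open>h n\<close> has integral below \<open>e / 2\<close>, by dominated convergence;
  the bounded part costs at most \<open>n\<close> times the total length.\<close>

lemma abs_cont_on_indefinite_integral:
  fixes f :: "real \<Rightarrow> 'a::euclidean_space"
  assumes f: "f absolutely_integrable_on {a..b}"
  shows "abs_cont_on a b (\<lambda>x. integral {a..x} f)"
  unfolding abs_cont_on_def
proof (intro allI impI)
  fix e :: real assume "e > 0"
  define g where "g x = norm (f x)" for x
  have g: "g absolutely_integrable_on {a..b}" unfolding g_def using f by (rule absolutely_integrable_norm[unfolded o_def])
  define h where "h n x = max 0 (g x - real n)" for n x
  have h: "h n absolutely_integrable_on {a..b}" for n
    unfolding h_def by (intro absolutely_integrable_max_1 set_integral_diff(1) g) auto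
  have "(\<lambda>n. integral {a..b} (h n)) \<longlonglongrightarrow> integral {a..b} (\<lambda>x. 0)"
  proof (rule dominated_convergence(2)[where h = g])
    show "h n integrable_on {a..b}" for n using h absolutely_integrable_on_def by blast
    show "g integrable_on {a..b}" using g absolutely_integrable_on_def by blast
    show "norm (h n x) \<le> g x" for n x by (simp add: h_def g_def)
    fix x
    obtain N :: nat where "g x \<le> real N" using real_arch_simple by blast
    then have "\<forall>n\<ge>N. h n x = 0" by (auto simp: h_def)
    then show "(\<lambda>n. h n x) \<longlonglongrightarrow> 0" by (intro tendsto_eventually eventually_sequentiallyI[of N]) auto
  qed
  then have "(\<lambda>n. integral {a..b} (h n)) \<longlonglongrightarrow> 0" by simp
  from LIMSEQ_D[OF this, of "e/2"] \<open>e > 0\<close>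
  obtain n where n: "\<bar>integral {a..b} (h n)\<bar> < e / 2" by auto
  \<comment> \<open>\<open>n + 1\<close> instead of \<open>n\<close>, which may be 0.\<close>
  define d where "d = e / (2 * (real n + 1))"
  have "d > 0" using \<open>e > 0\<close> by (simp add: d_def)
  have "(\<Sum>I\<in>\<I>. norm (integral {a..Sup I} f - integral {a..Inf I} f)) < e"
    if I: "\<I> division_of \<Union>\<I>" "\<Union>\<I> \<subseteq> {a..b}" "(\<Sum>I\<in>\<I>. Sup I - Inf I) < d" for \<I>
  proof -
    have sub: "I \<subseteq> {a..b}" if "I \<in> \<I>" for I using that I(2) by blast
    have I': "\<exists>u v. I = {u..v} \<and> u \<le> v \<and> u \<in> {a..b} \<and> v \<in> {a..b}" if mem: "I \<in> \<I>" for I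
    proof -
      obtain u v where "I = cbox u v" "I \<noteq> {}" using division_ofD(3,4)[OF I(1) mem] by blast
      then show ?thesis using sub[OF mem] by (intro exI[of _ u] exI[of _ v]) auto
    qed
    have hI: "h n integrable_on I" if "I \<in> \<I>" for I
      using I'[OF that] h[of n] absolutely_integrable_on_def integrable_on_subinterval by (metis sub that)
    have "(\<Sum>I\<in>\<I>. norm (integral {a..Sup I} f - integral {a..Inf I} f)) \<le> (\<Sum>I\<in>\<I>. real n * (Sup I - Inf I) + integral I (h n))"
    proof (rule sum_mono)
      fix I assume "I \<in> \<I>"
      then obtain u v where uv: "I = {u..v}" "u \<le> v" "u \<in> {a..b}" "v \<in> {a..b}" using I' by blast
      have fi: "f absolutely_integrable_on {u..v}" using f uv by (auto intro: absolutely_integrable_on_subinterval)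
      have "integral {a..u} f + integral {u..v} f = integral {a..v} f"
        using f uv by (intro Henstock_Kurzweil_Integration.integral_combine) (auto simp: absolutely_integrable_on_def intro: integrable_on_subinterval)
      then have "norm (integral {a..Sup I} f - integral {a..Inf I} f) = norm (integral {u..v} f)"
        using uv by (simp add: algebra_simps flip: eq_diff_eq)
      also have "\<dots> \<le> integral {u..v} (\<lambda>x. real n + h n x)"
        using hI[OF \<open>I \<in> \<I>\<close>] uv fi
        by (intro integral_norm_bound_integral integrable_add integrable_const_ivl) (auto simp: absolutely_integrable_on_def h_def[abs_def] g_def)
      also have "\<dots> = real n * (v - u) + integral {u..v} (h n)"
        using hI[OF \<open>I \<in> \<I>\<close>] uv by (subst Henstock_Kurzweil_Integration.integral_add) auto
      finally show "norm (integral {a..Sup I} f - integral {a..Inf I} f) \<le> real n * (Sup I - Inf I) + integral I (h n)"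
        using uv by simp
    qed
    also have "\<dots> = real n * (\<Sum>I\<in>\<I>. Sup I - Inf I) + (\<Sum>I\<in>\<I>. integral I (h n))"
      by (simp add: sum.distrib flip: sum_distrib_left)
    also have "(\<Sum>I\<in>\<I>. integral I (h n)) = integral (\<Union>\<I>) (h n)"
      using integral_combine_division_bottomup[OF I(1) hI] by simp
    also have "integral (\<Union>\<I>) (h n) \<le> integral {a..b} (h n)"
      using h[of n] I(2) integrable_combine_division[OF I(1) hI]
      by (intro integral_subset_le) (auto simp: h_def absolutely_integrable_on_def)
    also have "\<dots> < e / 2" using n by simp
    also have "real n * (\<Sum>I\<in>\<I>. Sup I - Inf I) \<le> real n * d" using I(3) by (intro mult_left_mono) auto
    also have "real n * d \<le> (real n + 1) * d" using \<open>d > 0\<close> by simp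
    also have "(real n + 1) * d = e / 2"
    proof -
      have *: "c * (e / (2 * c)) = e / 2" if "c \<noteq> 0" for c using that by simp
      show ?thesis unfolding d_def by (rule *) simp
    qed
    finally show ?thesis by simp
  qed
  then show "\<exists>d>0. \<forall>\<I>. \<I> division_of \<Union>\<I> \<longrightarrow> \<Union>\<I> \<subseteq> {a..b} \<longrightarrow> (\<Sum>I\<in>\<I>. Sup I - Inf I) < d \<longrightarrow>
      (\<Sum>I\<in>\<I>. norm (integral {a..Sup I} f - integral {a..Inf I} f)) < e"
    using \<open>d > 0\<close> by blast
qed

text \<open>If differentiation fails at a point \<open>x\<close>, then for some \<open>n\<close>
  there are arbitrarily short intervals with endpoint \<open>x\<close> on which the increment of
  \<open>F\<close> deviates from the linear one by more than 1/(n+1) of their length. A disjoint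
  Vitali selection of such intervals is a fine partial division, so Henstock's lemma bounds their
  total length, and fivefold enlargements cover the bad set.\<close>

theorem Lebesgue_differentiation_real:
  fixes f :: "real \<Rightarrow> 'a::euclidean_space"
  assumes f: "f integrable_on {a..b}"
  shows "negligible {x \<in> {a<..<b}. \<not> ((\<lambda>x. integral {a..x} f) has_vector_derivative f x) (at x)}"
proof -
  define F where "F x = integral {a..x} f" for x
  define S where "S n = {x \<in> {a<..<b}. \<forall>d>0. \<exists>y\<in>{a..b}. y \<noteq> x \<and> \<bar>y - x\<bar> < d \<and>
       norm (F y - F x - (y - x) *\<^sub>R f x) > \<bar>y - x\<bar> / real (Suc n)}" for n
  have combine: "F v - F u = integral {u..v} f" if "a \<le> u" "u \<le> v" "v \<le> b" for u v
  proof -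
    have "integral {a..u} f + integral {u..v} f = integral {a..v} f"
      using f that by (intro Henstock_Kurzweil_Integration.integral_combine) (auto intro: integrable_on_subinterval)
    then show ?thesis by (simp add: F_def algebra_simps)
  qed
  have "negligible (S n)" for n
    unfolding negligible_outer_le
  proof (intro allI impI)
    fix e :: real assume "e > 0"
    \<comment> \<open>Henstock's lemma bounds the sum of the selected radii by
      \<open>real (Suc n) * \<eta>\<close>, and a ball of five times the radius has ten times the
      radius as its length; hence the factor 10.\<close>
    define \<eta> where "\<eta> = e / (10 * real (Suc n))"
    have \<eta>: "\<eta> > 0" using \<open>e > 0\<close> by (simp add: \<eta>_def)
    obtain \<gamma> where "gauge \<gamma>" and \<gamma>: "\<And>p. \<lbrakk>p tagged_partial_division_of (cbox a b); \<gamma> fine p\<rbrakk> \<Longrightarrow>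
             sum (\<lambda>(x,k). norm(measure lborel k *\<^sub>R f x - integral k f)) p < \<eta>"
      using Henstock_lemma[of f a b \<eta>] f \<eta> by auto
    have "\<exists>r>0. cball x r \<subseteq> \<gamma> x" for x
      using \<open>gauge \<gamma>\<close> unfolding gauge_def by (metis open_contains_cball_eq)
    then obtain rr where rr: "\<And>x. rr x > 0" "\<And>x. cball x (rr x) \<subseteq> \<gamma> x" by metis
    define K where "K = {(x, y). x \<in> S n \<and> y \<in> {a..b} \<and> y \<noteq> x \<and> \<bar>y - x\<bar> < min 1 (rr x) \<and>
       norm (F y - F x - (y - x) *\<^sub>R f x) > \<bar>y - x\<bar> / real (Suc n)}"
    define r where "r p = \<bar>snd p - fst p\<bar>" for p :: "real \<times> real"
    have Kr: "0 < r i \<and> r i \<le> 1" if "i \<in> K" for i using that by (auto simp: K_def r_def)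
    obtain C where C: "countable C" "C \<subseteq> K"
      and disj: "pairwise (\<lambda>i j. disjnt (cball (fst i) (r i)) (cball (fst j) (r j))) C"
      and cov: "\<And>i. i \<in> K \<Longrightarrow> \<exists>j. j \<in> C \<and> \<not> disjnt (cball (fst i) (r i)) (cball (fst j) (r j)) \<and>
                        cball (fst i) (r i) \<subseteq> ball (fst j) (5 * r j)"
      by (rule Vitali_covering_lemma_cballs_balls[of K r 1 fst, OF Kr]) blast+
    have bound: "(\<Sum>j\<in>C'. r j) \<le> real (Suc n) * \<eta>" if C': "finite C'" "C' \<subseteq> C" for C'
    proof -
      \<comment> \<open>The interval between the two points is tagged by its endpoint
        \<open>fst p\<close> and lies in the selected ball about it, so disjoint balls give disjoint
        intervals.\<close>
      define I where "I p = {min (fst p) (snd p)..max (fst p) (snd p)}" for p :: "real \<times> real"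
      have Isub: "I p \<subseteq> cball (fst p) (r p)" for p by (auto simp: I_def r_def dist_real_def)
      define P where "P = (\<lambda>p. (fst p, I p)) ` C'"
      have disj': "I p \<inter> I q = {}" if "p \<in> C'" "q \<in> C'" "p \<noteq> q" for p q
        using disj that C' Isub[of p] Isub[of q] unfolding pairwise_def disjnt_def by blast
      have inj: "inj_on (\<lambda>p. (fst p, I p)) C'"
      proof (rule inj_onI)
        fix p q assume pq: "p \<in> C'" "q \<in> C'" "(fst p, I p) = (fst q, I q)"
        show "p = q"
        proof (rule ccontr)
          assume "p \<noteq> q"
          then have "I p \<inter> I q = {}" using disj' pq by blast
          moreover have "fst p \<in> I p" "fst p \<in> I q" using pq by (auto simp: I_def)
          ultimately show False by blast
        qed
      qed
      have CK: "p \<in> K" if "p \<in> C'" for p using that C' C by auto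
      have "P tagged_partial_division_of cbox a b"
        unfolding tagged_partial_division_of_def
      proof (intro conjI allI impI)
        show "finite P" using C' by (simp add: P_def)
        fix x k assume "(x, k) \<in> P"
        then obtain p where p: "p \<in> C'" "x = fst p" "k = I p" by (auto simp: P_def)
        show "x \<in> k" using p by (auto simp: I_def)
        show "k \<subseteq> cbox a b" using p CK[OF p(1)] by (auto simp: I_def K_def S_def)
        have "k = cbox (min (fst p) (snd p)) (max (fst p) (snd p))" using p by (simp add: I_def)
        then show "\<exists>a b. k = cbox a b" by blast
      next
        fix x k x' k' assume *: "(x, k) \<in> P \<and> (x', k') \<in> P \<and> (x, k) \<noteq> (x', k')"
        then obtain p where p: "p \<in> C'" "x = fst p" "k = I p" by (auto simp: P_def)
        from * obtain q where q: "q \<in> C'" "x' = fst q" "k' = I q" "p \<noteq> q" using p by (auto simp: P_def)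
        show "interior k \<inter> interior k' = {}"
          using disj'[OF p(1) q(1) q(4)] p q interior_subset by blast
      qed
      moreover have "\<gamma> fine P"
        unfolding fine_def
      proof clarify
        fix x k z assume "(x, k) \<in> P" "z \<in> k"
        then obtain p where p: "p \<in> C'" "x = fst p" "k = I p" by (auto simp: P_def)
        then show "z \<in> \<gamma> x" using \<open>z \<in> k\<close> Isub[of p] rr(2)[of x] CK[OF p(1)] by (fastforce simp: K_def r_def)
      qed
      ultimately have "sum (\<lambda>(x,k). norm(measure lborel k *\<^sub>R f x - integral k f)) P < \<eta>" by (rule \<gamma>)
      also have "sum (\<lambda>(x,k). norm(measure lborel k *\<^sub>R f x - integral k f)) P =
          (\<Sum>p\<in>C'. norm (measure lborel (I p) *\<^sub>R f (fst p) - integral (I p) f))"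
        unfolding P_def by (subst sum.reindex[OF inj]) (simp add: o_def)
      finally have *: "(\<Sum>p\<in>C'. norm (measure lborel (I p) *\<^sub>R f (fst p) - integral (I p) f)) < \<eta>" .
      have "r p / real (Suc n) \<le> norm (measure lborel (I p) *\<^sub>R f (fst p) - integral (I p) f)" if "p \<in> C'" for p
      proof -
        obtain x y where xy: "p = (x, y)" by (cases p)
        have x: "x \<in> {a..b}" "y \<in> {a..b}" and le: "norm (F y - F x - (y - x) *\<^sub>R f x) > \<bar>y - x\<bar> / real (Suc n)"
          using CK[OF that] unfolding xy K_def S_def by auto
        have "norm (measure lborel (I p) *\<^sub>R f (fst p) - integral (I p) f) = norm (F y - F x - (y - x) *\<^sub>R f x)"
        proof (cases "x \<le> y")
          case True
          then have "I p = {x..y}" by (simp add: I_def xy)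
          then show ?thesis using combine[of x y] True x by (simp add: xy norm_minus_commute)
        next
          case False
          then have "I p = {y..x}" by (simp add: I_def xy)
          moreover have "integral {y..x} f = F x - F y" using combine[of y x] False x by simp
          ultimately have "measure lborel (I p) *\<^sub>R f (fst p) - integral (I p) f = F y - F x - (y - x) *\<^sub>R f x"
            using False by (simp add: xy algebra_simps)
          then show ?thesis by simp
        qed
        with le show ?thesis by (simp add: r_def xy)
      qed
      then have "(\<Sum>p\<in>C'. r p / real (Suc n)) \<le> (\<Sum>p\<in>C'. norm (measure lborel (I p) *\<^sub>R f (fst p) - integral (I p) f))"
        by (rule sum_mono)
      with * have "(\<Sum>p\<in>C'. r p) / real (Suc n) \<le> \<eta>" by (simp add: sum_divide_distrib)
      then show ?thesis by (simp add: divide_le_eq mult.commute)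
    qed
    define T where "T = (\<Union>j\<in>C. ball (fst j) (5 * r j))"
    have bb: "measure lebesgue (\<Union>j\<in>C'. ball (fst j) (5 * r j)) \<le> e" if C': "finite C'" "C' \<subseteq> C" for C'
    proof -
      have "measure lebesgue (\<Union>j\<in>C'. ball (fst j) (5 * r j)) \<le> (\<Sum>j\<in>C'. measure lebesgue (ball (fst j) (5 * r j)))"
        using C' by (intro measure_UNION_le) auto
      also have "\<dots> = (\<Sum>j\<in>C'. 10 * r j)"
      proof (rule sum.cong[OF refl])
        fix j assume "j \<in> C'"
        then have "r j > 0" using Kr C' C by blast
        then show "measure lebesgue (ball (fst j) (5 * r j)) = 10 * r j"
          by (simp add: ball_eq_greaterThanLessThan)
      qed
      also have "\<dots> = 10 * (\<Sum>j\<in>C'. r j)" by (simp add: sum_distrib_left)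
      also have "\<dots> \<le> 10 * (real (Suc n) * \<eta>)" using bound[OF C'] by simp
      also have "\<dots> = e"
      proof -
        have *: "10 * (c * (e / (10 * c))) = e" if "c \<noteq> 0" for c using that by simp
        show ?thesis unfolding \<eta>_def by (rule *) simp
      qed
      finally show ?thesis .
    qed
    have T: "T \<in> lmeasurable" unfolding T_def
      by (rule fmeasurable_UN_bound[OF C(1)]) (use bb in auto)
    have Tm: "measure lebesgue T \<le> e" unfolding T_def
      by (rule measure_UN_bound[OF C(1)]) (use bb in auto)
    have "S n \<subseteq> T"
    proof
      fix x assume x: "x \<in> S n"
      have "min 1 (rr x) > 0" using rr by simp
      with x obtain y where "(x, y) \<in> K" unfolding K_def S_def by blast
      from cov[OF this] obtain j where "j \<in> C" "cball x (r (x, y)) \<subseteq> ball (fst j) (5 * r j)" by auto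
      moreover have "x \<in> cball x (r (x, y))" using Kr[OF \<open>(x, y) \<in> K\<close>] by auto
      ultimately show "x \<in> T" unfolding T_def by blast
    qed
    with T Tm show "\<exists>T. S n \<subseteq> T \<and> T \<in> lmeasurable \<and> measure lebesgue T \<le> e" by blast
  qed
  then have "negligible (\<Union>n. S n)" by (intro negligible_countable_Union) auto
  moreover have "{x \<in> {a<..<b}. \<not> ((\<lambda>x. integral {a..x} f) has_vector_derivative f x) (at x)} \<subseteq> (\<Union>n. S n)"
  proof safe
    fix x assume x: "x \<in> {a<..<b}" and nd: "\<not> ((\<lambda>x. integral {a..x} f) has_vector_derivative f x) (at x)"
    show "x \<in> (\<Union>n. S n)"
    proof (rule ccontr)
      assume "x \<notin> (\<Union>n. S n)"
      then have *: "\<exists>d>0. \<forall>y\<in>{a..b}. y \<noteq> x \<and> \<bar>y - x\<bar> < d \<longrightarrow> norm (F y - F x - (y - x) *\<^sub>R f x) \<le> \<bar>y - x\<bar> / real (Suc n)" for n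
        using x unfolding S_def by (force simp: not_less)
      have "(F has_vector_derivative f x) (at x)"
        unfolding has_vector_derivative_def has_derivative_at_alt
      proof (intro conjI allI impI)
        show "bounded_linear (\<lambda>h. h *\<^sub>R f x)" by (rule bounded_linear_scaleR_left)
        fix e :: real assume "e > 0"
        obtain n where n: "1 / real (Suc n) < e" using \<open>e > 0\<close> reals_Archimedean by (metis inverse_eq_divide)
        obtain d where d: "d > 0" "\<And>y. \<lbrakk>y\<in>{a..b}; y \<noteq> x; \<bar>y - x\<bar> < d\<rbrakk> \<Longrightarrow> norm (F y - F x - (y - x) *\<^sub>R f x) \<le> \<bar>y - x\<bar> / real (Suc n)"
          using *[of n] by blast
        define d' where "d' = min d (min (x - a) (b - x))"
        have "norm (F y - F x - (y - x) *\<^sub>R f x) \<le> e * norm (y - x)" if y: "norm (y - x) < d'" for y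
        proof (cases "y = x")
          case False
          have "norm (F y - F x - (y - x) *\<^sub>R f x) \<le> \<bar>y - x\<bar> / real (Suc n)"
            using y False by (intro d(2)) (auto simp: d'_def)
          also have "\<dots> = 1 / real (Suc n) * \<bar>y - x\<bar>" by simp
          also have "\<dots> \<le> e * \<bar>y - x\<bar>" using n by (intro mult_right_mono) auto
          finally show ?thesis by simp
        qed simp
        moreover have "d' > 0" using d x by (simp add: d'_def)
        ultimately show "\<exists>d>0. \<forall>y. norm (y - x) < d \<longrightarrow> norm (F y - F x - (y - x) *\<^sub>R f x) \<le> e * norm (y - x)" by blast
      qed
      then show False using nd by (simp add: F_def[abs_def])
    qed
  qed
  ultimately show ?thesis by (rule negligible_subset)
qed


subsection \<open>Primitives of integrable functions\<close>

text \<open>Integral form of \<open>F' = f\<close> almost everywhere. By the theorems above it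
  amounts to absolute continuity together with the derivative off a null set
  (\<open>primitive_onI\<close>, \<open>primitive_on_has_vector_derivative\<close>), but no
  exceptional sets have to be carried along.\<close>

definition primitive_on :: "real \<Rightarrow> real \<Rightarrow> (real \<Rightarrow> 'a::euclidean_space) \<Rightarrow> (real \<Rightarrow> 'a) \<Rightarrow> bool" where
  "primitive_on a b F f \<longleftrightarrow>
     f absolutely_integrable_on {a..b} \<and> (\<forall>x\<in>{a..b}. F x = F a + integral {a..x} f)"

lemma primitive_onD:
  assumes "primitive_on a b F f"
  shows "f absolutely_integrable_on {a..b}" "f integrable_on {a..b}"
    "\<And>c d. \<lbrakk>a \<le> c; d \<le> b\<rbrakk> \<Longrightarrow> f integrable_on {c..d}"
    "\<And>x. x \<in> {a..b} \<Longrightarrow> F x = F a + integral {a..x} f"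
proof -
  show "f absolutely_integrable_on {a..b}" "\<And>x. x \<in> {a..b} \<Longrightarrow> F x = F a + integral {a..x} f"
    using assms unfolding primitive_on_def by blast+
  then show *: "f integrable_on {a..b}" using absolutely_integrable_on_def by blast
  show "f integrable_on {c..d}" if "a \<le> c" "d \<le> b" for c d
    by (rule integrable_on_subinterval[OF *]) (use that in auto)
qed

lemma absolutely_integrable_on_continuous_bilinear:
  fixes f :: "real \<Rightarrow> 'a::euclidean_space" and g :: "real \<Rightarrow> 'b::euclidean_space" and mul :: "'a \<Rightarrow> 'b \<Rightarrow> 'c::euclidean_space"
  assumes "bounded_bilinear mul" "continuous_on {a..b} f" "g absolutely_integrable_on {a..b}"
  shows "(\<lambda>x. mul (f x) (g x)) absolutely_integrable_on {a..b}"
proof (rule absolutely_integrable_bounded_measurable_product[where h = mul])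
  show "bilinear mul" using assms(1) by (simp add: bilinear_conv_bounded_bilinear)
  show "f \<in> borel_measurable (lebesgue_on {a..b})"
    using assms(2) by (rule continuous_imp_measurable_on_sets_lebesgue) auto
  show "bounded (f ` {a..b})"
    using assms(2) compact_continuous_image compact_imp_bounded by blast
qed (use assms in auto)

lemma primitive_on_integral:
  assumes "f absolutely_integrable_on {a..b}"
  shows "primitive_on a b (\<lambda>x. c + integral {a..x} f) f"
  using assms by (simp add: primitive_on_def)

lemma primitive_on_combine:
  assumes "primitive_on a b F f" "a \<le> c" "c \<le> d" "d \<le> b"
  shows "F d - F c = integral {c..d} f"
proof -
  have "integral {a..c} f + integral {c..d} f = integral {a..d} f"
    using assms primitive_onD(3)[OF assms(1), of a d] by (intro Henstock_Kurzweil_Integration.integral_combine) auto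
  moreover have "F c = F a + integral {a..c} f" "F d = F a + integral {a..d} f"
    by (rule primitive_onD(4)[OF assms(1)], use assms in auto)+
  ultimately show ?thesis by (metis add_diff_cancel_left add_diff_cancel_left')
qed

lemma primitive_on_cong:
  assumes "primitive_on a b F f" "\<And>x. x \<in> {a..b} \<Longrightarrow> F x = G x" "negligible N" "\<And>x. x \<in> {a..b} - N \<Longrightarrow> f x = g x"
  shows "primitive_on a b G g"
  unfolding primitive_on_def
proof (intro conjI ballI)
  note f = primitive_onD(1)[OF assms(1)]
  show "g absolutely_integrable_on {a..b}"
    by (rule absolutely_integrable_spike[OF f assms(3)]) (use assms(4) in auto)
  fix x assume x: "x \<in> {a..b}"
  have "integral {a..x} f = integral {a..x} g"
    by (rule integral_spike[OF assms(3)]) (use assms(4) x in auto)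
  then show "G x = G a + integral {a..x} g"
    using primitive_onD(4)[OF assms(1) x] assms(2)[OF x] assms(2)[of a] x by simp
qed

lemma primitive_on_abs_cont_on:
  assumes "primitive_on a b F f"
  shows "abs_cont_on a b F"
proof -
  have "abs_cont_on a b (\<lambda>x. integral {a..x} f)" by (rule abs_cont_on_indefinite_integral[OF primitive_onD(1)[OF assms]])
  then show ?thesis
  proof (rule abs_cont_on_dominated[where C = 1, OF _ \<open>abs_cont_on a b (\<lambda>x. integral {a..x} f)\<close>])
    fix u v assume "u \<in> {a..b}" "v \<in> {a..b}"
    then have "F u = F a + integral {a..u} f" "F v = F a + integral {a..v} f"
      by (intro primitive_onD(4)[OF assms]; simp)+
    then have "F v - F u = integral {a..v} f - integral {a..u} f" by simp
    then show "norm (F v - F u) \<le> 1 * (norm (integral {a..v} f - integral {a..u} f) + norm (integral {a..v} f - integral {a..u} f))"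
      by simp
  qed simp
qed

lemma primitive_on_continuous_on:
  assumes "primitive_on a b F f" shows "continuous_on {a..b} F"
  using assms by (intro abs_cont_on_imp_continuous_on primitive_on_abs_cont_on)

lemma primitive_on_has_vector_derivative:
  fixes f :: "real \<Rightarrow> 'a::euclidean_space"
  assumes "primitive_on a b F f"
  obtains N where "negligible N" "\<And>x. x \<in> {a<..<b} - N \<Longrightarrow> (F has_vector_derivative f x) (at x)"
proof
  let ?N = "{x \<in> {a<..<b}. \<not> ((\<lambda>x. integral {a..x} f) has_vector_derivative f x) (at x)}"
  show "negligible ?N"
    by (rule Lebesgue_differentiation_real[OF primitive_onD(2)[OF assms]])
  fix x assume x: "x \<in> {a<..<b} - ?N"
  then have "((\<lambda>x. F a + integral {a..x} f) has_vector_derivative f x) (at x)"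
    by (auto intro!: derivative_eq_intros)
  then show "(F has_vector_derivative f x) (at x)"
  proof (rule has_vector_derivative_transform_within_open[where S = "{a<..<b}"])
    show "F a + integral {a..y} f = F y" if "y \<in> {a<..<b}" for y
      using primitive_onD(4)[OF assms, of y] that by simp
  qed (use x in auto)
qed

lemma primitive_onI:
  fixes f :: "real \<Rightarrow> 'a::euclidean_space"
  assumes "abs_cont_on a b F" "f absolutely_integrable_on {a..b}" "negligible N"
    "\<And>x. x \<in> {a<..<b} - N \<Longrightarrow> (F has_vector_derivative f x) (at x)"
  shows "primitive_on a b F f"
  unfolding primitive_on_def
proof (intro conjI ballI assms)
  fix x assume x: "x \<in> {a..b}"
  have "(f has_integral F x - F a) {a..x}"
  proof (rule fundamental_theorem_of_calculus_abs_cont)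
    show "negligible (N \<union> {a, b})" using assms(3) by (simp add: negligible_Un)
    show "abs_cont_on a x F" using abs_cont_on_subinterval[OF assms(1), of a x] x by simp
    fix y assume "y \<in> {a..x} - (N \<union> {a, b})"
    then have "y \<in> {a<..<b} - N" using x by auto
    then show "(F has_vector_derivative f y) (at y within {a..x})" 
      using assms(4) has_vector_derivative_at_within by blast
  qed (use x in auto)
  then show "F x = F a + integral {a..x} f" by (simp add: integral_unique)
qed

text \<open>The Leibniz rule holds off the union of two null sets and the product is absolutely
  continuous, so \<open>primitive_onI\<close> recovers the integral form without any interchange of
  integrals.\<close>

lemma primitive_on_bilinear:
  fixes F f :: "real \<Rightarrow> 'a::euclidean_space" and G g :: "real \<Rightarrow> 'b::euclidean_space" and mul :: "'a \<Rightarrow> 'b \<Rightarrow> 'c::euclidean_space"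
  assumes mul: "bounded_bilinear mul" and F: "primitive_on a b F f" and G: "primitive_on a b G g"
  shows "primitive_on a b (\<lambda>x. mul (F x) (G x)) (\<lambda>x. mul (F x) (g x) + mul (f x) (G x))"
proof -
  obtain N where N: "negligible N" "\<And>x. x \<in> {a<..<b} - N \<Longrightarrow> (F has_vector_derivative f x) (at x)"
    using primitive_on_has_vector_derivative[OF F] by blast
  obtain M where M: "negligible M" "\<And>x. x \<in> {a<..<b} - M \<Longrightarrow> (G has_vector_derivative g x) (at x)"
    using primitive_on_has_vector_derivative[OF G] by blast
  show ?thesis
  proof (rule primitive_onI)
    show "abs_cont_on a b (\<lambda>x. mul (F x) (G x))"
      by (intro abs_cont_on_bilinear[OF mul] primitive_on_abs_cont_on[OF F] primitive_on_abs_cont_on[OF G])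
    show "(\<lambda>x. mul (F x) (g x) + mul (f x) (G x)) absolutely_integrable_on {a..b}"
    proof (rule set_integral_add)
      show "(\<lambda>x. mul (F x) (g x)) absolutely_integrable_on {a..b}"
        by (rule absolutely_integrable_on_continuous_bilinear[OF mul primitive_on_continuous_on[OF F] primitive_onD(1)[OF G]])
      show "(\<lambda>x. mul (f x) (G x)) absolutely_integrable_on {a..b}"
        by (rule absolutely_integrable_on_continuous_bilinear[OF bounded_bilinear.flip[OF mul] primitive_on_continuous_on[OF G] primitive_onD(1)[OF F]])
    qed
    show "negligible (N \<union> M)" using N M by (simp add: negligible_Un)
    show "((\<lambda>x. mul (F x) (G x)) has_vector_derivative mul (F x) (g x) + mul (f x) (G x)) (at x)"
      if "x \<in> {a<..<b} - (N \<union> M)" for x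
      using that N M by (intro bounded_bilinear.has_vector_derivative[OF mul]) auto
  qed
qed

lemma primitive_on_linear:
  fixes F :: "real \<Rightarrow> 'a::euclidean_space" and h :: "'a \<Rightarrow> 'b::euclidean_space"
  assumes "bounded_linear h" "primitive_on a b F f"
  shows "primitive_on a b (\<lambda>x. h (F x)) (\<lambda>x. h (f x))"
  unfolding primitive_on_def
proof (intro conjI ballI)
  interpret bounded_linear h by fact
  show "(\<lambda>x. h (f x)) absolutely_integrable_on {a..b}"
    using absolutely_integrable_linear[OF primitive_onD(1)[OF assms(2)] assms(1)] by (simp add: o_def)
  fix x assume x: "x \<in> {a..b}"
  have "f integrable_on {a..x}" using x by (intro primitive_onD(3)[OF assms(2)]) auto
  then have "integral {a..x} (h \<circ> f) = h (integral {a..x} f)" using assms(1) by (intro integral_linear)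
  then show "h (F x) = h (F a) + integral {a..x} (\<lambda>x. h (f x))" 
    using arg_cong[OF primitive_onD(4)[OF assms(2) x], of h] by (simp add: o_def add)
qed

lemma primitive_on_add:
  assumes "primitive_on a b F f" "primitive_on a b G g"
  shows "primitive_on a b (\<lambda>x. F x + G x) (\<lambda>x. f x + g x)"
  unfolding primitive_on_def
proof (intro conjI ballI)
  show "(\<lambda>x. f x + g x) absolutely_integrable_on {a..b}"
    by (intro set_integral_add(1) primitive_onD(1)[OF assms(1)] primitive_onD(1)[OF assms(2)])
  fix x assume x: "x \<in> {a..b}"
  have "f integrable_on {a..x}" "g integrable_on {a..x}"
    using x by (auto intro: primitive_onD(3)[OF assms(1)] primitive_onD(3)[OF assms(2)])
  then have "integral {a..x} (\<lambda>x. f x + g x) = integral {a..x} f + integral {a..x} g" by (rule Henstock_Kurzweil_Integration.integral_add)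
  then show "F x + G x = F a + G a + integral {a..x} (\<lambda>x. f x + g x)" 
    using primitive_onD(4)[OF assms(1) x] primitive_onD(4)[OF assms(2) x] by (simp add: algebra_simps)
qed

lemma primitive_on_diff:
  assumes "primitive_on a b F f" "primitive_on a b G g"
  shows "primitive_on a b (\<lambda>x. F x - G x) (\<lambda>x. f x - g x)"
  using primitive_on_add[OF assms(1) primitive_on_linear[OF bounded_linear_minus[OF bounded_linear_ident] assms(2)]] by simp

lemma primitive_on_C1:
  fixes F :: "real \<Rightarrow> 'a::euclidean_space"
  assumes "\<And>x. x \<in> {a..b} \<Longrightarrow> (F has_vector_derivative f x) (at x within {a..b})" "continuous_on {a..b} f"
  shows "primitive_on a b F f"
  unfolding primitive_on_def
proof (intro conjI ballI)
  show "f absolutely_integrable_on {a..b}" using assms(2) by (rule absolutely_integrable_continuous_real)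
  fix x assume x: "x \<in> {a..b}"
  have "(f has_integral F x - F a) {a..x}"
    using x by (intro fundamental_theorem_of_calculus) (auto intro: has_vector_derivative_within_subset[OF assms(1)])
  then show "F x = F a + integral {a..x} f" by (simp add: integral_unique)
qed

text \<open>Chain rule: the exponential is Lipschitz on the bounded range of \<open>F\<close>, hence
  absolute continuity survives the composition.\<close>

lemma primitive_on_exp:
  fixes F :: "real \<Rightarrow> real"
  assumes F: "primitive_on a b F f"
  shows "primitive_on a b (\<lambda>x. exp (F x)) (\<lambda>x. exp (F x) * f x)"
proof -
  obtain N where N: "negligible N" "\<And>x. x \<in> {a<..<b} - N \<Longrightarrow> (F has_vector_derivative f x) (at x)"
    using primitive_on_has_vector_derivative[OF F] by blast
  have cont: "continuous_on {a..b} F" by (rule primitive_on_continuous_on[OF F])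
  obtain B where B: "\<And>x. x \<in> {a..b} \<Longrightarrow> \<bar>F x\<bar> \<le> B"
    using compact_imp_bounded[OF compact_continuous_image[OF cont compact_Icc]]
    unfolding bounded_iff by fastforce
  show ?thesis
  proof (rule primitive_onI)
    show "abs_cont_on a b (\<lambda>x. exp (F x))"
    proof (rule abs_cont_on_Lipschitz_compose[OF primitive_on_abs_cont_on[OF F]])
      show "0 \<le> exp B" by simp
      fix u v assume uv: "u \<in> F ` {a..b}" "v \<in> F ` {a..b}"
      have *: "norm (exp v - exp u) \<le> exp B * norm (v - u)" if "u \<le> v" "v \<le> B" for u v :: real
      proof -
        have "exp v - exp u = exp v * (1 - exp (u - v))" by (simp add: exp_diff algebra_simps)
        also have "\<dots> \<le> exp v * (v - u)"
          using exp_ge_add_one_self[of "u - v"] by (intro mult_left_mono) (linarith, simp)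
        also have "\<dots> \<le> exp B * (v - u)" using that by (intro mult_right_mono) auto
        finally show ?thesis using that by simp
      qed
      have "u \<le> B" "v \<le> B" using uv B by force+
      then show "norm (exp v - exp u) \<le> exp B * norm (v - u)"
        using *[of u v] *[of v u] by (cases "u \<le> v") (auto simp: abs_minus_commute)
    qed
    show "(\<lambda>x. exp (F x) * f x) absolutely_integrable_on {a..b}"
      by (intro absolutely_integrable_on_continuous_bilinear[OF bounded_bilinear_mult] continuous_intros cont primitive_onD(1)[OF F])
    show "negligible N" by fact
    show "((\<lambda>x. exp (F x)) has_vector_derivative exp (F x) * f x) (at x)" if "x \<in> {a<..<b} - N" for x
      using N(2)[OF that] by (auto simp: has_real_derivative_iff_has_vector_derivative[symmetric] intro!: derivative_eq_intros)
  qed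
qed

lemma primitive_on_antimono:
  fixes F :: "real \<Rightarrow> real"
  assumes "primitive_on a b F f" "\<And>x. x \<in> {a..b} \<Longrightarrow> f x \<le> 0" "x \<in> {a..b}"
  shows "F x \<le> F a"
proof -
  have "f integrable_on {a..x}" using assms(3) by (intro primitive_onD(3)[OF assms(1)]) auto
  then have "integral {a..x} f \<le> integral {a..x} (\<lambda>x. 0)" using assms by (intro integral_le) auto
  then show ?thesis using primitive_onD(4)[OF assms(1,3)] by simp
qed

text \<open>The right-hand side \<open>g\<close> of the assumed inequality majorizes
  \<open>v\<close>, so its derivative \<open>k * v\<close> is at most \<open>k * g\<close> and
  \<open>g * exp (- K)\<close> does not increase. As \<open>k\<close> is merely integrable, this
  monotonicity is read off from the integral form.\<close>

lemma Gronwall_integrable: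
  fixes v k :: "real \<Rightarrow> real"
  assumes v: "continuous_on {a..b} v" and k: "k absolutely_integrable_on {a..b}" "\<And>x. x \<in> {a..b} \<Longrightarrow> k x \<ge> 0"
    and le: "\<And>x. x \<in> {a..b} \<Longrightarrow> v x \<le> c + integral {a..x} (\<lambda>s. k s * v s)"
    and x: "x \<in> {a..b}"
  shows "v x \<le> c * exp (integral {a..x} k)"
proof -
  define g where "g x = c + integral {a..x} (\<lambda>s. k s * v s)" for x
  define K where "K x = 0 + integral {a..x} k" for x
  have kv: "(\<lambda>s. k s * v s) absolutely_integrable_on {a..b}"
    using absolutely_integrable_on_continuous_bilinear[OF bounded_bilinear_mult v k(1)] by (simp add: mult.commute)
  have g: "primitive_on a b g (\<lambda>s. k s * v s)" unfolding g_def by (rule primitive_on_integral[OF kv])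
  have "primitive_on a b K k" unfolding K_def by (rule primitive_on_integral[OF k(1)])
  then have "primitive_on a b (\<lambda>x. - K x) (\<lambda>x. - k x)" by (rule primitive_on_linear[OF bounded_linear_minus[OF bounded_linear_ident]])
  then have "primitive_on a b (\<lambda>x. exp (- K x)) (\<lambda>x. exp (- K x) * (- k x))" by (rule primitive_on_exp)
  from primitive_on_bilinear[OF bounded_bilinear_mult g this]
  have "g x * exp (- K x) \<le> g a * exp (- K a)"
  proof (rule primitive_on_antimono)
    fix x assume x: "x \<in> {a..b}"
    have "g x * (exp (- K x) * - k x) + k x * v x * exp (- K x) = k x * exp (- K x) * (v x - g x)"
      by (simp add: algebra_simps)
    also have "\<dots> \<le> 0" using k(2)[OF x] le[OF x] by (intro mult_nonneg_nonpos) (auto simp: g_def)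
    finally show "g x * (exp (- K x) * - k x) + k x * v x * exp (- K x) \<le> 0" .
  qed (rule x)
  then have "g x \<le> c * exp (K x)" by (simp add: g_def K_def exp_minus field_simps)
  with le[OF x] show ?thesis by (simp add: g_def K_def)
qed


section \<open>Linear systems with integrable coefficients\<close>

lemma borel_measurable_lebesgue_on_Icc_iff_Ioo:
  fixes f :: "real \<Rightarrow> 'a::euclidean_space"
  shows "f \<in> borel_measurable (lebesgue_on {a..b}) \<longleftrightarrow> f \<in> borel_measurable (lebesgue_on {a<..<b})"
proof -
  have neg: "negligible (({a..b} - {a<..<b}) \<union> ({a<..<b} - {a..b}))"
    by (rule negligible_subset[of "{a,b}"]) auto
  have neg': "negligible (({a<..<b} - {a..b}) \<union> ({a..b} - {a<..<b}))"
    by (rule negligible_subset[of "{a,b}"]) auto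
  have "f measurable_on {a..b} \<longleftrightarrow> f measurable_on {a<..<b}"
    using measurable_on_spike_set[OF _ neg, of f] measurable_on_spike_set[OF _ neg', of f] by blast
  then show ?thesis by (simp add: measurable_on_iff_borel_measurable)
qed

lemma integrable_lebesgue_on_iff:
  fixes f :: "real \<Rightarrow> 'a::euclidean_space"
  assumes "S \<in> sets lebesgue"
  shows "integrable (lebesgue_on S) f \<longleftrightarrow> f absolutely_integrable_on S"
  using assms by (simp add: set_integrable_def integrable_restrict_space)

lemma integral_Ioo_eq_Icc: "integral {a<..<b} f = integral {a..b} f" for f :: "real \<Rightarrow> 'a::banach"
  using integral_open_interval[of a b f] by (simp add: box_real)

lemma L2_iff:
  fixes f :: "real \<Rightarrow> 'a::euclidean_space"
  shows "L2 f \<longleftrightarrow> f \<in> borel_measurable (lebesgue_on {0..pi}) \<and> (\<lambda>x. (norm (f x))\<^sup>2) absolutely_integrable_on {0..pi}"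
  by (simp add: L2_def borel_measurable_lebesgue_on_Icc_iff_Ioo integrable_lebesgue_on_iff absolutely_integrable_on_Icc_iff_Ioo)

lemma L2_norm_eq: "L2 f \<Longrightarrow> L2_norm f = sqrt (integral {0..pi} (\<lambda>x. (norm (f x))\<^sup>2))"
  unfolding L2_def L2_norm_def by (subst lebesgue_integral_eq_integral) (auto simp: integral_Ioo_eq_Icc)

lemma AE_lebesgue_on_iff_negligible:
  assumes "S \<in> sets lebesgue"
  shows "(AE x in lebesgue_on S. P x) \<longleftrightarrow> (\<exists>N. negligible N \<and> (\<forall>x\<in>S - N. P x))"
proof -
  have "(AE x in lebesgue_on S. P x) \<longleftrightarrow> (AE x in lebesgue. x \<in> S \<longrightarrow> P x)"
    using assms by (simp add: AE_restrict_space_iff)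
  also have "\<dots> \<longleftrightarrow> (\<exists>N. negligible N \<and> (\<forall>x\<in>S - N. P x))"
  proof
    assume "AE x in lebesgue. x \<in> S \<longrightarrow> P x"
    then obtain N where "N \<in> null_sets lebesgue" "{x \<in> space lebesgue. \<not> (x \<in> S \<longrightarrow> P x)} \<subseteq> N"
      unfolding eventually_ae_filter by blast
    then show "\<exists>N. negligible N \<and> (\<forall>x\<in>S - N. P x)" by (intro exI[of _ N]) (auto simp: negligible_iff_null_sets)
  next
    assume "\<exists>N. negligible N \<and> (\<forall>x\<in>S - N. P x)"
    then show "AE x in lebesgue. x \<in> S \<longrightarrow> P x"
    proof (elim exE)
      fix N assume N: "negligible N \<and> (\<forall>x\<in>S - N. P x)"
      then have "N \<in> null_sets lebesgue" "{x \<in> space lebesgue. \<not> (x \<in> S \<longrightarrow> P x)} \<subseteq> N"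
        by (auto simp: negligible_iff_null_sets)
      then show "AE x in lebesgue. x \<in> S \<longrightarrow> P x" unfolding eventually_ae_filter by blast
    qed
  qed
  finally show ?thesis .
qed

text \<open>The integral of \<open>(s * f + t * g)\<^sup>2\<close> is a nonnegative quadratic form
  in \<open>s\<close> and \<open>t\<close>; it is evaluated at \<open>s = - B\<close>,
  \<open>t = A\<close>. If \<open>A = 0\<close>, a large \<open>s\<close> of the right sign shows
  that \<open>B\<close> vanishes.\<close>

lemma Cauchy_Schwarz_integral:
  fixes f g :: "real \<Rightarrow> real"
  assumes fg: "(\<lambda>x. f x * g x) integrable_on S" and f: "(\<lambda>x. (f x)\<^sup>2) integrable_on S" and g: "(\<lambda>x. (g x)\<^sup>2) integrable_on S"
  shows "(integral S (\<lambda>x. f x * g x))\<^sup>2 \<le> integral S (\<lambda>x. (f x)\<^sup>2) * integral S (\<lambda>x. (g x)\<^sup>2)"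
proof -
  define A B C where "A = integral S (\<lambda>x. (f x)\<^sup>2)" and "B = integral S (\<lambda>x. f x * g x)" and "C = integral S (\<lambda>x. (g x)\<^sup>2)"
  have pos: "0 \<le> s\<^sup>2 * A + 2 * s * t * B + t\<^sup>2 * C" for s t
  proof -
    have 1: "(\<lambda>x. s\<^sup>2 * (f x)\<^sup>2) integrable_on S" "(\<lambda>x. 2 * s * t * (f x * g x)) integrable_on S" "(\<lambda>x. t\<^sup>2 * (g x)\<^sup>2) integrable_on S"
      using f g fg by (auto intro: integrable_on_mult_right)
    have "0 \<le> integral S (\<lambda>x. s\<^sup>2 * (f x)\<^sup>2 + 2 * s * t * (f x * g x) + t\<^sup>2 * (g x)\<^sup>2)"
    proof (intro integral_nonneg integrable_add 1)
      fix x
      have "s\<^sup>2 * (f x)\<^sup>2 + 2 * s * t * (f x * g x) + t\<^sup>2 * (g x)\<^sup>2 = (s * f x + t * g x)\<^sup>2"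
        by (simp add: power2_eq_square algebra_simps)
      then show "0 \<le> s\<^sup>2 * (f x)\<^sup>2 + 2 * s * t * (f x * g x) + t\<^sup>2 * (g x)\<^sup>2" by simp
    qed
    also have "\<dots> = s\<^sup>2 * A + 2 * s * t * B + t\<^sup>2 * C"
      using 1 by (simp add: Henstock_Kurzweil_Integration.integral_add integrable_add A_def B_def C_def)
    finally show ?thesis .
  qed
  have "A \<ge> 0" "C \<ge> 0" using pos[of 1 0] pos[of 0 1] by auto
  have "B\<^sup>2 \<le> A * C"
  proof (cases "A = 0")
    case True
    have "B = 0"
    proof (rule ccontr)
      assume "B \<noteq> 0"
      have "0 \<le> 2 * (- (C + 1) / B) * 1 * B + 1\<^sup>2 * C" using pos[of "- (C + 1) / B" 1] True by simp
      then show False using \<open>B \<noteq> 0\<close> \<open>C \<ge> 0\<close> by simp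
    qed
    then show ?thesis using \<open>A \<ge> 0\<close> \<open>C \<ge> 0\<close> by simp
  next
    case False
    then have "A > 0" using \<open>A \<ge> 0\<close> by simp
    have "0 \<le> A * (A * C - B\<^sup>2)" using pos[of "- B" A] by (simp add: power2_eq_square algebra_simps)
    then show ?thesis using \<open>A > 0\<close> by (simp add: zero_le_mult_iff)
  qed
  then show ?thesis by (simp add: A_def B_def C_def)
qed

text \<open>Caratheodory's setting: the coefficients are dominated by an integrable \<open>k\<close>
  and may be unbounded. Measurability for constant vectors suffices, since a continuous argument can
  be expanded in the basis.\<close>

locale linear_ode =
  fixes A :: "real \<Rightarrow> 'a::euclidean_space \<Rightarrow> 'a" and k :: "real \<Rightarrow> real" and a b :: real
  assumes linear_A: "\<And>x. linear (A x)"
    and measurable_A: "\<And>w. (\<lambda>x. A x w) \<in> borel_measurable (lebesgue_on {a..b})"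
    and bound_A: "\<And>x w. x \<in> {a..b} \<Longrightarrow> norm (A x w) \<le> k x * norm w"
    and k_integrable: "k absolutely_integrable_on {a..b}"
    and k_nonneg: "\<And>x. x \<in> {a..b} \<Longrightarrow> k x \<ge> 0"
    and a_le_b: "a \<le> b"
begin

lemma A_continuous_integrable:
  assumes u: "continuous_on {a..b} u"
  shows "(\<lambda>x. A x (u x)) absolutely_integrable_on {a..b}"
proof (rule measurable_bounded_by_integrable_imp_absolutely_integrable[where g = "\<lambda>x. k x * norm (u x)"])
  have "A x (u x) = (\<Sum>i\<in>Basis. (u x \<bullet> i) *\<^sub>R A x i)" for x
    using linear_A[of x] by (subst euclidean_representation[symmetric, of "u x"]) (simp add: linear_sum linear_scale)
  moreover have "(\<lambda>x. \<Sum>i\<in>Basis. (u x \<bullet> i) *\<^sub>R A x i) \<in> borel_measurable (lebesgue_on {a..b})"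
    by (intro borel_measurable_sum borel_measurable_scaleR measurable_A continuous_imp_measurable_on_sets_lebesgue continuous_intros u) auto
  ultimately show "(\<lambda>x. A x (u x)) \<in> borel_measurable (lebesgue_on {a..b})" by simp
  have "(\<lambda>x. norm (u x) * k x) absolutely_integrable_on {a..b}"
    by (intro absolutely_integrable_on_continuous_bilinear[OF bounded_bilinear_mult] k_integrable continuous_intros u)
  then show "(\<lambda>x. k x * norm (u x)) integrable_on {a..b}" by (simp add: absolutely_integrable_on_def mult.commute)
qed (use bound_A in auto)

text \<open>The forcing enters only through the integral of its norm. This is what the comparison of
  flows and the resolvent estimate need, where the forcing is small or controlled only in the
  mean.\<close>

lemma solution_bound:
  assumes f: "f absolutely_integrable_on {a..b}" and u: "primitive_on a b u (\<lambda>x. A x (u x) + f x)" and x: "x \<in> {a..b}"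
  shows "norm (u x) \<le> (norm (u a) + integral {a..b} (\<lambda>x. norm (f x))) * exp (integral {a..b} k)"
proof -
  define c where "c = norm (u a) + integral {a..b} (\<lambda>x. norm (f x))"
  have cont: "continuous_on {a..b} u" by (rule primitive_on_continuous_on[OF u])
  have nf: "(\<lambda>x. norm (f x)) integrable_on {a..b}" using f by (simp add: absolutely_integrable_on_def)
  have c: "c \<ge> 0" using nf by (auto simp: c_def intro!: add_nonneg_nonneg integral_nonneg)
  have Au: "(\<lambda>x. A x (u x)) absolutely_integrable_on {a..b}" by (rule A_continuous_integrable[OF cont])
  have kn: "k integrable_on {a..b}" using k_integrable by (simp add: absolutely_integrable_on_def)
  have "norm (u x) \<le> c * exp (integral {a..x} k)"
  proof (rule Gronwall_integrable[OF continuous_on_norm[OF cont] k_integrable k_nonneg _ x])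
    fix x assume x: "x \<in> {a..b}"
    have sub: "{a..x} \<subseteq> {a..b}" using x by auto
    have i: "(\<lambda>x. A x (u x)) integrable_on {a..x}" "f integrable_on {a..x}" "(\<lambda>x. norm (f x)) integrable_on {a..x}"
      "(\<lambda>s. k s * norm (u s)) integrable_on {a..x}"
    proof -
      show "(\<lambda>x. A x (u x)) integrable_on {a..x}" "f integrable_on {a..x}" "(\<lambda>x. norm (f x)) integrable_on {a..x}"
        using Au f integrable_on_subinterval sub unfolding absolutely_integrable_on_def by blast+
      have "(\<lambda>x. norm (u x) * k x) absolutely_integrable_on {a..b}"
        by (intro absolutely_integrable_on_continuous_bilinear[OF bounded_bilinear_mult] k_integrable continuous_intros cont)
      then have "(\<lambda>x. norm (u x) * k x) integrable_on {a..x}"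
        using integrable_on_subinterval sub unfolding absolutely_integrable_on_def by blast
      then show "(\<lambda>s. k s * norm (u s)) integrable_on {a..x}" by (simp add: mult.commute)
    qed
    have "u x = u a + integral {a..x} (\<lambda>x. A x (u x)) + integral {a..x} f"
      using primitive_onD(4)[OF u x] i by (simp add: Henstock_Kurzweil_Integration.integral_add)
    then have "norm (u x) \<le> norm (u a) + norm (integral {a..x} (\<lambda>x. A x (u x))) + norm (integral {a..x} f)"
      by (metis norm_triangle_le norm_triangle_ineq add_right_mono)
    also have "norm (integral {a..x} (\<lambda>x. A x (u x))) \<le> integral {a..x} (\<lambda>s. k s * norm (u s))"
      using i sub bound_A by (intro integral_norm_bound_integral) auto
    also have "norm (integral {a..x} f) \<le> integral {a..x} (\<lambda>x. norm (f x))"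
      using i by (intro integral_norm_bound_integral) auto
    also have "\<dots> \<le> integral {a..b} (\<lambda>x. norm (f x))"
      using i nf sub by (intro integral_subset_le) auto
    finally show "norm (u x) \<le> c + integral {a..x} (\<lambda>s. k s * norm (u s))" by (simp add: c_def)
  qed
  also have "\<dots> \<le> c * exp (integral {a..b} k)"
  proof -
    have "integral {a..x} k \<le> integral {a..b} k"
      using x kn k_nonneg by (intro integral_subset_le) (auto intro: integrable_on_subinterval)
    then show ?thesis using c by (intro mult_left_mono) auto
  qed
  finally show ?thesis by (simp add: c_def)
qed

lemma solution_unique:
  assumes f: "f absolutely_integrable_on {a..b}" and u: "primitive_on a b u (\<lambda>x. A x (u x) + f x)"
    and v: "primitive_on a b v (\<lambda>x. A x (v x) + f x)" and "u a = v a" and x: "x \<in> {a..b}"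
  shows "u x = v x"
proof -
  have "primitive_on a b (\<lambda>x. u x - v x) (\<lambda>x. A x (u x - v x) + 0)"
    using primitive_on_diff[OF u v] by (simp add: linear_diff[OF linear_A])
  from solution_bound[OF _ this x] show ?thesis using \<open>u a = v a\<close> by simp
qed

text \<open>Picard iteration, contracting by a factor 1/2 for the norm weighted with \<open>exp (- 2 \<integral> k)\<close>.\<close>

lemma solution_exists:
  assumes f: "f absolutely_integrable_on {a..b}"
  shows "\<exists>u. u a = u0 \<and> primitive_on a b u (\<lambda>x. A x (u x) + f x)"
proof -
  \<comment> \<open>Doubling \<open>k\<close> in the weight is what produces the contraction factor:
    the integral of \<open>k * exp K\<close> from \<open>a\<close> to \<open>x\<close> is half of
    \<open>exp (K x) - 1\<close>.\<close>
  define K where "K x = 0 + integral {a..x} (\<lambda>x. 2 * k x)" for x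
  have "primitive_on a b K (\<lambda>x. 2 * k x)" unfolding K_def
    using k_integrable by (intro primitive_on_integral) (auto intro: set_integrable_mult_right)
  then have K: "primitive_on a b K (\<lambda>x. 2 * k x)" and K0: "K a = 0" by (auto simp: K_def)
  have Kc: "continuous_on {a..b} K" by (rule primitive_on_continuous_on[OF K])
  \<comment> \<open>Clamping the argument to \<open>{a..b}\<close> makes every continuous function
    on the interval a bounded continuous function on the line, the complete space in which the fixed
    point is sought. The unknown there is \<open>exp (- K x) *\<^sub>R u x\<close>.\<close>
  define c where "c x = max a (min b x)" for x
  have c: "c x \<in> {a..b}" for x using a_le_b by (auto simp: c_def)
  have cc: "continuous_on UNIV c" unfolding c_def by (intro continuous_intros)
  have c_id: "c x = x" if "x \<in> {a..b}" for x using that by (auto simp: c_def)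
  define h where "h v x = A x (exp (K x) *\<^sub>R v x) + f x" for v :: "real \<Rightarrow> 'a" and x
  define w where "w v x = u0 + integral {a..x} (h v)" for v x
  have h: "h v absolutely_integrable_on {a..b}" if "continuous_on {a..b} v" for v
    unfolding h_def by (intro set_integral_add(1) f A_continuous_integrable continuous_intros that Kc)
  have w: "primitive_on a b (w v) (h v)" if "continuous_on {a..b} v" for v
    unfolding w_def by (rule primitive_on_integral[OF h[OF that]])
  define \<Phi> where "\<Phi> v x = exp (- K (c x)) *\<^sub>R w v (c x)" for v x
  have \<Phi>: "\<Phi> v \<in> bcontfun" if "continuous_on {a..b} v" for v
  proof -
    have cont: "continuous_on {a..b} (\<lambda>x. exp (- K x) *\<^sub>R w v x)"
      using primitive_on_continuous_on[OF w[OF that]] Kc by (intro continuous_intros)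
    have "continuous_on UNIV (\<lambda>x. exp (- K (c x)) *\<^sub>R w v (c x))"
      by (rule continuous_on_compose2[OF cont cc]) (use c in auto)
    moreover obtain B where "\<And>x. x \<in> {a..b} \<Longrightarrow> norm (exp (- K x) *\<^sub>R w v x) \<le> B"
      using compact_imp_bounded[OF compact_continuous_image[OF cont compact_Icc]] unfolding bounded_iff by blast
    ultimately show ?thesis unfolding \<Phi>_def using c by (intro bcontfun_normI[where b = B]) auto
  qed
  define \<Psi> where "\<Psi> v = Bcontfun (\<Phi> (apply_bcontfun v))" for v
  have \<Psi>: "apply_bcontfun (\<Psi> v) = \<Phi> (apply_bcontfun v)" for v
    unfolding \<Psi>_def by (rule Bcontfun_inverse[OF \<Phi>]) simp
  have "\<exists>!v. \<Psi> v = v"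
  proof (rule banach_fix_type[of "1/2"])
    show "\<forall>v1 v2. dist (\<Psi> v1) (\<Psi> v2) \<le> 1/2 * dist v1 v2"
    proof (intro allI dist_bound)
      fix v1 v2 :: "real \<Rightarrow>\<^sub>C 'a" and y :: real
      define x where "x = c y"
      have x: "x \<in> {a..b}" using c by (simp add: x_def)
      have E: "primitive_on a b (\<lambda>x. exp (K x)) (\<lambda>x. exp (K x) * (2 * k x))" by (rule primitive_on_exp[OF K])
      have wd: "primitive_on a b (\<lambda>x. w v1 x - w v2 x) (\<lambda>x. h v1 x - h v2 x)" by (intro primitive_on_diff w) auto
      have "w v1 x - w v2 x = integral {a..x} (\<lambda>x. h v1 x - h v2 x)"
        using primitive_onD(4)[OF wd x] by (simp add: w_def)
      also have "norm \<dots> \<le> integral {a..x} (\<lambda>x. dist v1 v2 / 2 * (exp (K x) * (2 * k x)))"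
      proof (rule integral_norm_bound_integral)
        show "(\<lambda>x. h v1 x - h v2 x) integrable_on {a..x}" using x by (intro primitive_onD(3)[OF wd]) auto
        show "(\<lambda>x. dist v1 v2 / 2 * (exp (K x) * (2 * k x))) integrable_on {a..x}"
          using x by (intro integrable_on_mult_right primitive_onD(3)[OF E]) auto
        fix s assume "s \<in> {a..x}"
        then have s: "s \<in> {a..b}" using x by auto
        have "h v1 s - h v2 s = A s (exp (K s) *\<^sub>R (v1 s - v2 s))"
          by (simp add: h_def linear_diff[OF linear_A] scaleR_diff_right)
        also have "norm \<dots> \<le> k s * norm (exp (K s) *\<^sub>R (v1 s - v2 s))" by (rule bound_A[OF s])
        also have "\<dots> = k s * exp (K s) * dist (v1 s) (v2 s)" by (simp add: dist_norm)
        also have "\<dots> \<le> k s * exp (K s) * dist v1 v2" using k_nonneg[OF s] by (intro mult_left_mono dist_bounded) auto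
        finally show "norm (h v1 s - h v2 s) \<le> dist v1 v2 / 2 * (exp (K s) * (2 * k s))" by (simp add: mult_ac)
      qed
      also have "\<dots> = dist v1 v2 / 2 * (exp (K x) - 1)"
      proof -
        have "integral {a..x} (\<lambda>x. exp (K x) * (2 * k x)) = exp (K x) - 1"
          using primitive_onD(4)[OF E x] unfolding K0 by (metis add_diff_cancel_left' exp_zero)
        then show ?thesis by (simp only: integral_mult_right)
      qed
      also have "\<dots> \<le> dist v1 v2 / 2 * exp (K x)" by (intro mult_left_mono) auto
      finally have *: "norm (w v1 x - w v2 x) \<le> dist v1 v2 / 2 * exp (K x)" .
      have "dist (\<Psi> v1 y) (\<Psi> v2 y) = exp (- K x) * norm (w v1 x - w v2 x)"
        by (simp add: \<Psi> \<Phi>_def x_def dist_norm flip: scaleR_diff_right)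
      also have "\<dots> \<le> exp (- K x) * (dist v1 v2 / 2 * exp (K x))" using * by (intro mult_left_mono) auto
      also have "\<dots> = 1/2 * dist v1 v2" by (simp add: exp_minus field_simps)
      finally show "dist (\<Psi> v1 y) (\<Psi> v2 y) \<le> 1/2 * dist v1 v2" .
    qed
  qed auto
  then obtain v where v: "\<Psi> v = v" by blast
  define u where "u x = w v x" for x
  have vw: "v x = exp (- K x) *\<^sub>R w v x" if "x \<in> {a..b}" for x
    using arg_cong[OF v, of "\<lambda>v. apply_bcontfun v x"] that by (simp add: \<Psi> \<Phi>_def c_id)
  have "primitive_on a b u (\<lambda>x. A x (u x) + f x)"
  proof (rule primitive_on_cong[OF w[of v]])
    show "h v x = A x (u x) + f x" if "x \<in> {a..b} - {}" for x
      using vw[of x] that by (simp add: h_def u_def flip: exp_add)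
  qed (auto simp: u_def)
  moreover have "u a = u0" by (simp add: u_def w_def)
  ultimately show ?thesis by blast
qed

end


section \<open>Complex vectors and matrices\<close>

definition cinner :: "complex^'n \<Rightarrow> complex^'n \<Rightarrow> complex" where
  "cinner x y = (\<Sum>i\<in>UNIV. x $ i * cnj (y $ i))"

lemma cinner_simps:
  "cinner (x + x') y = cinner x y + cinner x' y" "cinner x (y + y') = cinner x y + cinner x y'"
  "cinner (x - x') y = cinner x y - cinner x' y" "cinner x (y - y') = cinner x y - cinner x y'"
  "cinner (c *s x) y = c * cinner x y" "cinner x (c *s y) = cnj c * cinner x y"
  "cinner (- x) y = - cinner x y" "cinner x (- y) = - cinner x y"
  "cinner 0 y = 0" "cinner x 0 = 0"
  by (simp_all add: cinner_def algebra_simps sum.distrib sum_subtractf sum_negf sum_distrib_left)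

lemma scaleR_eq_vector_scalar_mult: "r *\<^sub>R (x :: complex^'n) = complex_of_real r *s x"
  by (simp add: vec_eq_iff) (simp add: scaleR_conv_of_real)

lemma bounded_bilinear_cinner: "bounded_bilinear (cinner :: complex^'n \<Rightarrow> _)"
  unfolding bilinear_conv_bounded_bilinear[symmetric]
  by (auto simp: bilinear_def scaleR_eq_vector_scalar_mult cinner_simps scaleR_conv_of_real intro!: linearI)

lemma cinner_self: "cinner x x = of_real ((norm x)\<^sup>2)"
proof -
  have "(norm x)\<^sup>2 = (\<Sum>i\<in>UNIV. (norm (x $ i))\<^sup>2)"
    by (simp add: norm_vec_def L2_set_def sum_nonneg)
  then show ?thesis by (simp add: cinner_def flip: complex_norm_square)
qed

lemma norm_cinner_le: "norm (cinner x y) \<le> norm x * norm y"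
proof -
  have "norm (cinner x y) \<le> (\<Sum>i\<in>UNIV. norm (x $ i) * norm (y $ i))"
    unfolding cinner_def by (rule sum_norm_le) (simp add: norm_mult)
  also have "\<dots> \<le> norm x * norm y"
    unfolding norm_vec_def using L2_set_mult_ineq[of "\<lambda>i. norm (x $ i)" "\<lambda>i. norm (y $ i)" UNIV] by simp
  finally show ?thesis .
qed

lemma norm_matrix_vector_mult_le: "norm (A *v x) \<le> norm A * norm x" for A :: "complex^'n^'m"
proof -
  have "norm ((A *v x) $ i) \<le> norm (A $ i) * norm x" for i
  proof -
    have "(A *v x) $ i = cinner (A $ i) (\<chi> j. cnj (x $ j))"
      by (simp add: matrix_vector_mult_def cinner_def)
    moreover have "norm (\<chi> j. cnj (x $ j)) = norm x" by (simp add: norm_vec_def)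
    ultimately show ?thesis using norm_cinner_le[of "A $ i" "\<chi> j. cnj (x $ j)"] by simp
  qed
  then have "norm (A *v x) \<le> L2_set (\<lambda>i. norm (A $ i) * norm x) UNIV"
    unfolding norm_vec_def[of "A *v x"] by (intro L2_set_mono) auto
  also have "\<dots> = norm A * norm x"
    by (simp add: norm_vec_def[of A] L2_set_left_distrib)
  finally show ?thesis .
qed

lemma cinner_dagger: "cinner (A *v x) y = cinner x (dagger A *v y)"
  by (simp add: cinner_def matrix_vector_mult_def dagger_def transpose_def map_matrix_def
      sum_distrib_left sum_distrib_right mult_ac) (subst sum.swap, simp add: mult_ac)

lemma matrix_vector_mult_scale: "A *v (c *s x) = c *s (A *v x)" for A :: "complex^'n^'m"
  by (simp add: vec_eq_iff matrix_vector_mult_def sum_distrib_left mult_ac)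

lemma scaleR_matrix_vector_mult: "(r *\<^sub>R A) *v x = r *\<^sub>R (A *v x)" for A :: "complex^'n^'m"
  by (simp add: vec_eq_iff matrix_vector_mult_def scaleR_sum_right)

lemma matrix_vector_mult_scaleR: "A *v (r *\<^sub>R x) = r *\<^sub>R (A *v x)" for A :: "complex^'n^'m"
  by (simp add: vec_eq_iff matrix_vector_mult_def scaleR_sum_right)

lemma bounded_bilinear_matrix_vector_mult: "bounded_bilinear ((*v) :: complex^'n^'m \<Rightarrow> _)"
  unfolding bilinear_conv_bounded_bilinear[symmetric]
  by (auto simp: bilinear_def matrix_vector_mult_add_rdistrib matrix_vector_right_distrib
      scaleR_matrix_vector_mult matrix_vector_mult_scaleR intro!: linearI)

lemma vector_scalar_mult_minus: "(c - d) *s x = c *s x - d *s (x :: complex^'n)" "c *s (x - y) = c *s x - c *s (y :: complex^'n)"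
  by (simp_all add: vec_eq_iff algebra_simps)

lemma norm_vector_scalar_mult: "norm (c *s x) = cmod c * norm (x :: complex^'n)"
  by (simp add: norm_vec_def norm_mult L2_set_right_distrib)

lemma linear_vector_scalar_mult: "linear (\<lambda>x. c *s (x :: complex^'n))"
  by (rule linearI) (simp_all add: vec_eq_iff algebra_simps)

lemma bounded_linear_vector_scalar_mult: "bounded_linear (\<lambda>x. c *s (x :: complex^'n))"
  using linear_vector_scalar_mult linear_conv_bounded_linear by blast

lemma cnj_inj_zero: "cinner x x = 0 \<longleftrightarrow> x = 0"
  by (simp add: cinner_self)

section \<open>The first order system\<close>

definition sys :: "(real \<Rightarrow> complex^'m^'m) \<Rightarrow> complex \<Rightarrow> real \<Rightarrow> (complex^'m) \<times> (complex^'m) \<Rightarrow> (complex^'m) \<times> (complex^'m)" where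
  "sys \<sigma> \<mu> x u = (\<sigma> x *v fst u + snd u, - (\<mu> *s fst u) - \<sigma> x *v snd u - (\<sigma> x ** \<sigma> x) *v fst u)"

definition sys_bound :: "(real \<Rightarrow> complex^'m^'m) \<Rightarrow> complex \<Rightarrow> real \<Rightarrow> real" where
  "sys_bound \<sigma> \<mu> x = norm \<mu> + (1 + norm (\<sigma> x))\<^sup>2"

text \<open>The product type carries only a real vector space structure, so complex multiples of
  solutions need an operation of their own.\<close>

definition csmult :: "complex \<Rightarrow> (complex^'m) \<times> (complex^'m) \<Rightarrow> (complex^'m) \<times> (complex^'m)" where
  "csmult c u = (c *s fst u, c *s snd u)"

lemma sys_diff: "sys \<sigma> \<mu> x (u - v) = sys \<sigma> \<mu> x u - sys \<sigma> \<mu> x v"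
  by (simp add: sys_def matrix_vector_mult_diff_distrib vector_scalar_mult_minus algebra_simps)

lemma sys_add: "sys \<sigma> \<mu> x (u + v) = sys \<sigma> \<mu> x u + sys \<sigma> \<mu> x v"
  by (simp add: sys_def matrix_vector_right_distrib vec.scale_right_distrib algebra_simps)

lemma sys_csmult: "sys \<sigma> \<mu> x (csmult c u) = csmult c (sys \<sigma> \<mu> x u)"
  by (simp add: sys_def csmult_def matrix_vector_mult_scale vec.scale_right_distrib vec.scale_right_diff_distrib mult.commute)

lemma linear_csmult: "linear (csmult c)"
  by (rule linearI) (simp_all add: csmult_def vec.scale_right_distrib scaleR_eq_vector_scalar_mult mult.commute)

lemma csmult_of_real: "csmult (of_real r) u = r *\<^sub>R u"
  by (simp add: csmult_def scaleR_eq_vector_scalar_mult prod_eq_iff)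

lemma norm_fst_snd: "norm (fst u) \<le> norm u" "norm (snd u) \<le> norm u" "norm u \<le> norm (fst u) + norm (snd u)"
  by (simp_all add: norm_fst_le norm_snd_le norm_prod_def sqrt_sum_squares_le_sum split: prod.splits)

lemma norm_sys_le: "norm (sys \<sigma> \<mu> x u) \<le> sys_bound \<sigma> \<mu> x * norm u"
proof -
  let ?s = "norm (\<sigma> x)" and ?y = "norm (fst u)" and ?z = "norm (snd u)"
  have 1: "norm (\<sigma> x *v fst u + snd u) \<le> ?s * ?y + ?z"
    using norm_matrix_vector_mult_le[of "\<sigma> x" "fst u"] by (meson add_right_mono norm_triangle_le order_refl add_mono order_trans norm_triangle_ineq)
  have 2: "norm ((\<sigma> x ** \<sigma> x) *v fst u) \<le> ?s * (?s * ?y)"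
    unfolding matrix_vector_mul_assoc[symmetric]
    by (rule order_trans[OF norm_matrix_vector_mult_le mult_left_mono[OF norm_matrix_vector_mult_le]]) simp
  have "norm (- (\<mu> *s fst u) - \<sigma> x *v snd u - (\<sigma> x ** \<sigma> x) *v fst u) \<le> norm \<mu> * ?y + ?s * ?z + ?s * (?s * ?y)"
    using norm_triangle_ineq4[of "- (\<mu> *s fst u) - \<sigma> x *v snd u" "(\<sigma> x ** \<sigma> x) *v fst u"]
      norm_triangle_ineq4[of "- (\<mu> *s fst u)" "\<sigma> x *v snd u"] 2 norm_matrix_vector_mult_le[of "\<sigma> x" "snd u"]
    by (simp add: norm_vector_scalar_mult)
  with 1 have "norm (sys \<sigma> \<mu> x u) \<le> ?s * ?y + ?z + (norm \<mu> * ?y + ?s * ?z + ?s * (?s * ?y))"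
    using norm_fst_snd(3)[of "sys \<sigma> \<mu> x u"] by (simp add: sys_def)
  also have "\<dots> = (?s + norm \<mu> + ?s * ?s) * ?y + (1 + ?s) * ?z" by (simp add: algebra_simps)
  also have "\<dots> \<le> (?s + norm \<mu> + ?s * ?s) * norm u + (1 + ?s) * norm u"
    by (intro add_mono mult_left_mono norm_fst_snd) auto
  also have "\<dots> = sys_bound \<sigma> \<mu> x * norm u" by (simp add: sys_bound_def power2_eq_square algebra_simps)
  finally show ?thesis .
qed

lemma L2_imp_integrable:
  assumes "L2 f"
  shows "f absolutely_integrable_on {0..pi}" "(\<lambda>x. norm (f x)) absolutely_integrable_on {0..pi}"
    "(\<lambda>x. (norm (f x))\<^sup>2) absolutely_integrable_on {0..pi}"
proof -
  have m: "f \<in> borel_measurable (lebesgue_on {0..pi})" and s: "(\<lambda>x. (norm (f x))\<^sup>2) absolutely_integrable_on {0..pi}"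
    using assms by (auto simp: L2_iff)
  show "(\<lambda>x. (norm (f x))\<^sup>2) absolutely_integrable_on {0..pi}" by fact
  show 1: "f absolutely_integrable_on {0..pi}"
  proof (rule measurable_bounded_by_integrable_imp_absolutely_integrable[OF m])
    show "(\<lambda>x. 1 + (norm (f x))\<^sup>2) integrable_on {0..pi}"
      using s by (intro integrable_add) (auto simp: absolutely_integrable_on_def)
    show "norm (f x) \<le> 1 + (norm (f x))\<^sup>2" for x
      using sum_squares_bound[of 1 "norm (f x)"] norm_ge_zero[of "f x"] unfolding mult_1_right one_power2 by linarith
  qed auto
  show "(\<lambda>x. norm (f x)) absolutely_integrable_on {0..pi}" using absolutely_integrable_norm[OF 1] by (simp add: o_def)
qed

lemma borel_measurable_matrix_mult:
  fixes \<sigma> \<tau> :: "'a \<Rightarrow> complex^'m^'m"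
  assumes "\<sigma> \<in> borel_measurable M" "\<tau> \<in> borel_measurable M"
  shows "(\<lambda>x. \<sigma> x ** \<tau> x) \<in> borel_measurable M"
proof -
  have "bounded_bilinear ((**) :: complex^'m^'m \<Rightarrow> complex^'m^'m \<Rightarrow> complex^'m^'m)"
    unfolding bilinear_conv_bounded_bilinear[symmetric] bilinear_def
    by (auto intro!: linearI simp: vec_eq_iff matrix_matrix_mult_def sum.distrib algebra_simps scaleR_sum_right)
  then have "continuous_on UNIV (\<lambda>p. fst p ** (snd p :: complex^'m^'m) :: complex^'m^'m)"
    by (rule bounded_bilinear.continuous_on) (intro continuous_intros)+
  from borel_measurable_continuous_onI[OF this] assms show ?thesis
    using measurable_compose[OF borel_measurable_Pair[OF assms], of "\<lambda>p. fst p ** snd p" borel] by simp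
qed

lemma borel_measurable_matrix_vector_mult:
  fixes \<sigma> :: "'a \<Rightarrow> complex^'m^'m" and f :: "'a \<Rightarrow> complex^'m"
  assumes "\<sigma> \<in> borel_measurable M" "f \<in> borel_measurable M"
  shows "(\<lambda>x. \<sigma> x *v f x) \<in> borel_measurable M"
proof -
  have "continuous_on UNIV (\<lambda>p. fst p *v (snd p :: complex^'m) :: complex^'m)"
    by (intro bounded_bilinear.continuous_on[OF bounded_bilinear_matrix_vector_mult] continuous_intros)
  from borel_measurable_continuous_onI[OF this] assms show ?thesis
    using measurable_compose[OF borel_measurable_Pair[OF assms], of "\<lambda>p. fst p *v snd p" borel] by simp
qed

lemma linear_ode_sys:
  fixes \<sigma> :: "real \<Rightarrow> complex^'m^'m"
  assumes "L2 \<sigma>"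
  shows "linear_ode (sys \<sigma> \<mu>) (sys_bound \<sigma> \<mu>) 0 pi"
proof (rule linear_ode.intro)
  show "linear (sys \<sigma> \<mu> x)" for x
    by (rule linearI) (simp_all add: sys_add sys_csmult flip: csmult_of_real)
  have \<sigma>: "\<sigma> \<in> borel_measurable (lebesgue_on {0..pi})" using assms by (simp add: L2_iff)
  have const: "(\<lambda>x. c) \<in> borel_measurable (lebesgue_on {0..pi})" for c :: "complex^'m" by simp
  show "(\<lambda>x. sys \<sigma> \<mu> x w) \<in> borel_measurable (lebesgue_on {0..pi})" for w
    unfolding sys_def
    by (intro borel_measurable_Pair borel_measurable_add borel_measurable_diff borel_measurable_matrix_vector_mult[OF _ const]
        borel_measurable_matrix_mult \<sigma> const)
  show "norm (sys \<sigma> \<mu> x w) \<le> sys_bound \<sigma> \<mu> x * norm w" for x w by (rule norm_sys_le)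
  have "(\<lambda>x. norm \<mu> + (1 + 2 * norm (\<sigma> x) + (norm (\<sigma> x))\<^sup>2)) absolutely_integrable_on {0..pi}"
    using L2_imp_integrable[OF assms]
    by (intro set_integral_add set_integrable_mult_right absolutely_integrable_on_const) auto
  then show "sys_bound \<sigma> \<mu> absolutely_integrable_on {0..pi}"
    by (simp add: sys_bound_def[abs_def] power2_eq_square algebra_simps)
  show "sys_bound \<sigma> \<mu> x \<ge> 0" for x by (simp add: sys_bound_def)
qed auto

definition sys_solution ::
  "(real \<Rightarrow> complex^'m^'m) \<Rightarrow> complex \<Rightarrow> (real \<Rightarrow> (complex^'m) \<times> (complex^'m)) \<Rightarrow> (real \<Rightarrow> (complex^'m) \<times> (complex^'m)) \<Rightarrow> bool" where
  "sys_solution \<sigma> \<mu> f u \<longleftrightarrow> primitive_on 0 pi u (\<lambda>x. sys \<sigma> \<mu> x (u x) + f x)"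

lemma sys_solution_add:
  assumes "sys_solution \<sigma> \<mu> f u" "sys_solution \<sigma> \<mu> g v"
  shows "sys_solution \<sigma> \<mu> (\<lambda>x. f x + g x) (\<lambda>x. u x + v x)"
  using primitive_on_add[OF assms[unfolded sys_solution_def]]
  by (simp add: sys_solution_def sys_add algebra_simps)

lemma sys_solution_diff:
  assumes "sys_solution \<sigma> \<mu> f u" "sys_solution \<sigma> \<mu> g v"
  shows "sys_solution \<sigma> \<mu> (\<lambda>x. f x - g x) (\<lambda>x. u x - v x)"
  using primitive_on_diff[OF assms[unfolded sys_solution_def]]
  by (simp add: sys_solution_def sys_diff algebra_simps)

lemma sys_solution_csmult:
  assumes "sys_solution \<sigma> \<mu> f u"
  shows "sys_solution \<sigma> \<mu> (\<lambda>x. csmult c (f x)) (\<lambda>x. csmult c (u x))"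
  using primitive_on_linear[OF _ assms[unfolded sys_solution_def], of "csmult c"] linear_csmult[of c]
  by (simp add: sys_solution_def sys_csmult linear_add[OF linear_csmult] linear_conv_bounded_linear)

lemma sys_solution_continuous_on: "sys_solution \<sigma> \<mu> f u \<Longrightarrow> continuous_on {0..pi} u"
  unfolding sys_solution_def by (rule primitive_on_continuous_on)

text \<open>A change of the coefficients is absorbed into the forcing term. This one device yields
  both continuity and differentiability in the parameters.\<close>

lemma sys_solution_change:
  assumes "sys_solution \<sigma> \<mu> f u"
  shows "sys_solution \<tau> \<nu> (\<lambda>x. f x + (sys \<sigma> \<mu> x (u x) - sys \<tau> \<nu> x (u x))) u"
  using assms by (simp add: sys_solution_def add.commute)

definition flow ::
  "(real \<Rightarrow> complex^'m^'m) \<Rightarrow> complex \<Rightarrow> (complex^'m) \<times> (complex^'m) \<Rightarrow> real \<Rightarrow> (complex^'m) \<times> (complex^'m)" where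
  "flow \<sigma> \<mu> u0 = (SOME u. u 0 = u0 \<and> sys_solution \<sigma> \<mu> (\<lambda>x. 0) u)"

context
  fixes \<sigma> :: "real \<Rightarrow> complex^'m^'m"
  assumes \<sigma>: "L2 \<sigma>"
begin

lemma sys_solution_exists:
  assumes "f absolutely_integrable_on {0..pi}"
  shows "\<exists>u. u 0 = u0 \<and> sys_solution \<sigma> \<mu> f u"
  using linear_ode.solution_exists[OF linear_ode_sys[OF \<sigma>] assms] by (simp add: sys_solution_def)

lemma sys_solution_bound:
  assumes "f absolutely_integrable_on {0..pi}" "sys_solution \<sigma> \<mu> f u" "x \<in> {0..pi}"
  shows "norm (u x) \<le> (norm (u 0) + integral {0..pi} (\<lambda>x. norm (f x))) * exp (integral {0..pi} (sys_bound \<sigma> \<mu>))"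
  using linear_ode.solution_bound[OF linear_ode_sys[OF \<sigma>] assms(1) _ assms(3)] assms(2) by (simp add: sys_solution_def)

lemma sys_solution_unique:
  assumes "f absolutely_integrable_on {0..pi}" "sys_solution \<sigma> \<mu> f u" "sys_solution \<sigma> \<mu> f v" "u 0 = v 0" "x \<in> {0..pi}"
  shows "u x = v x"
  by (rule linear_ode.solution_unique[OF linear_ode_sys[OF \<sigma>] assms(1) assms(2,3)[unfolded sys_solution_def] assms(4,5)])

lemma flow: "flow \<sigma> \<mu> u0 0 = u0" "sys_solution \<sigma> \<mu> (\<lambda>x. 0) (flow \<sigma> \<mu> u0)"
proof -
  have "\<exists>u. u 0 = u0 \<and> sys_solution \<sigma> \<mu> (\<lambda>x. 0) u" by (rule sys_solution_exists) simp
  from someI_ex[OF this] show "flow \<sigma> \<mu> u0 0 = u0" "sys_solution \<sigma> \<mu> (\<lambda>x. 0) (flow \<sigma> \<mu> u0)"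
    unfolding flow_def by auto
qed

lemma flow_eqI:
  assumes "sys_solution \<sigma> \<mu> (\<lambda>x. 0) u" "x \<in> {0..pi}"
  shows "u x = flow \<sigma> \<mu> (u 0) x"
  by (rule sys_solution_unique[OF _ assms(1) flow(2) _ assms(2)]) (auto simp: flow)

lemma flow_add: "x \<in> {0..pi} \<Longrightarrow> flow \<sigma> \<mu> (u + v) x = flow \<sigma> \<mu> u x + flow \<sigma> \<mu> v x"
  using flow_eqI[of \<mu> "\<lambda>x. flow \<sigma> \<mu> u x + flow \<sigma> \<mu> v x" x] sys_solution_add[OF flow(2)[of \<mu> u] flow(2)[of \<mu> v]]
  by (simp add: flow(1))

lemma flow_csmult: "x \<in> {0..pi} \<Longrightarrow> flow \<sigma> \<mu> (csmult c u) x = csmult c (flow \<sigma> \<mu> u x)"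
  using flow_eqI[of \<mu> "\<lambda>x. csmult c (flow \<sigma> \<mu> u x)" x] sys_solution_csmult[OF flow(2)[of \<mu> u], of c]
  by (simp add: flow(1) linear_0[OF linear_csmult])

lemma flow_bound: "x \<in> {0..pi} \<Longrightarrow> norm (flow \<sigma> \<mu> u0 x) \<le> norm u0 * exp (integral {0..pi} (sys_bound \<sigma> \<mu>))"
  using sys_solution_bound[OF _ flow(2), of x \<mu> u0] by (simp add: flow(1))

end


subsection \<open>Dependence on the parameters\<close>

lemma sys_bound_mono_integral:
  assumes "L2 \<sigma>" "L2 \<tau>" "\<And>x. norm (\<sigma> x) \<le> norm (\<tau> x)" "norm \<mu> \<le> norm \<nu>"
  shows "integral {0..pi} (sys_bound \<sigma> \<mu>) \<le> integral {0..pi} (sys_bound \<tau> \<nu>)"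
proof (rule integral_le)
  show "sys_bound \<sigma> \<mu> integrable_on {0..pi}" "sys_bound \<tau> \<nu> integrable_on {0..pi}"
    using linear_ode.k_integrable[OF linear_ode_sys[OF assms(1), of \<mu>]] linear_ode.k_integrable[OF linear_ode_sys[OF assms(2), of \<nu>]]
    by (auto simp: absolutely_integrable_on_def)
  show "sys_bound \<sigma> \<mu> x \<le> sys_bound \<tau> \<nu> x" for x
    unfolding sys_bound_def using assms(3)[of x] assms(4) by (intro add_mono power_mono) auto
qed

lemma L2_scaleR: "L2 \<sigma> \<Longrightarrow> L2 (\<lambda>x. t *\<^sub>R \<sigma> x)"
  by (auto simp: L2_iff power_mult_distrib intro!: set_integrable_mult_right borel_measurable_scaleR)

lemma integral_norm_le_const_mult:
  fixes f :: "real \<Rightarrow> 'a::euclidean_space"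
  assumes "f absolutely_integrable_on {0..pi}" "g integrable_on {0..pi}" "\<And>x. x \<in> {0..pi} \<Longrightarrow> norm (f x) \<le> g x * c"
  shows "integral {0..pi} (\<lambda>x. norm (f x)) \<le> integral {0..pi} g * c"
proof -
  have "integral {0..pi} (\<lambda>x. norm (f x)) \<le> integral {0..pi} (\<lambda>x. g x * c)"
    using assms by (intro integral_le integrable_on_mult_left) (auto simp: absolutely_integrable_on_def)
  then show ?thesis by simp
qed

text \<open>The two solutions are compared through the inhomogeneous system solved by their difference.\<close>

lemma flow_diff_bound:
  fixes \<sigma> :: "real \<Rightarrow> complex^'m^'m"
  assumes \<sigma>: "L2 \<sigma>" and t: "0 \<le> t" "t \<le> 1" and s: "0 \<le> s" "s \<le> 1" and R: "norm \<mu> \<le> R" "norm \<nu> \<le> R"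
    and x: "x \<in> {0..pi}"
  defines "E \<equiv> exp (integral {0..pi} (sys_bound \<sigma> (complex_of_real R)))"
  shows "norm (flow (\<lambda>x. t *\<^sub>R \<sigma> x) \<mu> u x - flow (\<lambda>x. s *\<^sub>R \<sigma> x) \<nu> w x) \<le>
    (norm (u - w) + integral {0..pi} (\<lambda>x. \<bar>t - s\<bar> * (2 * norm (\<sigma> x) + 2 * (norm (\<sigma> x))\<^sup>2) + norm (\<mu> - \<nu>)) * (norm u * E)) * E"
proof -
  define \<sigma>t \<sigma>s where "\<sigma>t = (\<lambda>x. t *\<^sub>R \<sigma> x)" and "\<sigma>s = (\<lambda>x. s *\<^sub>R \<sigma> x)"
  have L2: "L2 \<sigma>t" "L2 \<sigma>s" using \<sigma> by (auto simp: \<sigma>t_def \<sigma>s_def L2_scaleR)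
  have R0: "R \<ge> 0" using R(1) norm_ge_zero order_trans by blast
  have Ebound: "exp (integral {0..pi} (sys_bound (\<lambda>x. r *\<^sub>R \<sigma> x) \<eta>)) \<le> E" if "0 \<le> r" "r \<le> 1" "norm \<eta> \<le> R" for r \<eta>
    unfolding E_def exp_le_cancel_iff
    using that R0 by (intro sys_bound_mono_integral L2_scaleR \<sigma>) (auto intro: mult_left_le_one_le)
  have E0: "E \<ge> 0" by (simp add: E_def)
  define U where "U = flow \<sigma>t \<mu> u"
  define V where "V = flow \<sigma>s \<nu> w"
  define f where "f x = sys \<sigma>t \<mu> x (U x) - sys \<sigma>s \<nu> x (U x)" for x
  have Ub: "norm (U x) \<le> norm u * E" if "x \<in> {0..pi}" for x
    unfolding U_def
    by (rule order_trans[OF flow_bound[OF L2(1) that, of \<mu> u] mult_left_mono[OF Ebound[OF t R(1), folded \<sigma>t_def] norm_ge_zero]])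
  have Uc: "continuous_on {0..pi} U" unfolding U_def by (rule sys_solution_continuous_on[OF flow(2)[OF L2(1)]])
  have fi: "f absolutely_integrable_on {0..pi}" unfolding f_def
    by (intro set_integral_diff(1) linear_ode.A_continuous_integrable[OF linear_ode_sys] L2 Uc)
  have "sys_solution \<sigma>s \<nu> (\<lambda>x. 0 + (sys \<sigma>t \<mu> x (U x) - sys \<sigma>s \<nu> x (U x))) U"
    unfolding U_def by (rule sys_solution_change[OF flow(2)[OF L2(1)]])
  then have "sys_solution \<sigma>s \<nu> f U" by (simp add: f_def[abs_def])
  from sys_solution_diff[OF this flow(2)[OF L2(2), of \<nu> w]]
  have D: "sys_solution \<sigma>s \<nu> f (\<lambda>x. U x - V x)" by (simp add: V_def)
  have "norm (U x - V x) \<le> (norm (U 0 - V 0) + integral {0..pi} (\<lambda>x. norm (f x))) * exp (integral {0..pi} (sys_bound \<sigma>s \<nu>))"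
    using sys_solution_bound[OF L2(2) fi D x] by simp
  also have "\<dots> \<le> (norm (U 0 - V 0) + integral {0..pi} (\<lambda>x. norm (f x))) * E"
    using Ebound[OF s R(2)] fi unfolding \<sigma>s_def
    by (intro mult_left_mono add_nonneg_nonneg integral_nonneg) (auto simp: absolutely_integrable_on_def)
  also have "\<dots> \<le> (norm (U 0 - V 0) + integral {0..pi} (\<lambda>x. \<bar>t - s\<bar> * (2 * norm (\<sigma> x) + 2 * (norm (\<sigma> x))\<^sup>2) + norm (\<mu> - \<nu>)) * (norm u * E)) * E"
  proof (intro mult_right_mono add_left_mono E0 integral_norm_le_const_mult fi)
    have "(\<lambda>x. \<bar>t - s\<bar> * (2 * norm (\<sigma> x) + 2 * (norm (\<sigma> x))\<^sup>2) + norm (\<mu> - \<nu>)) absolutely_integrable_on {0..pi}"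
      using L2_imp_integrable[OF \<sigma>]
      by (intro set_integral_add set_integrable_mult_right absolutely_integrable_on_const) auto
    then show "(\<lambda>x. \<bar>t - s\<bar> * (2 * norm (\<sigma> x) + 2 * (norm (\<sigma> x))\<^sup>2) + norm (\<mu> - \<nu>)) integrable_on {0..pi}"
      by (simp add: absolutely_integrable_on_def)
    fix x assume x: "x \<in> {0..pi}"
    let ?y = "fst (U x)" and ?z = "snd (U x)" and ?n = "norm (\<sigma> x)"
    have "fst (f x) = (t - s) *\<^sub>R (\<sigma> x *v ?y)"
      by (simp add: f_def sys_def \<sigma>t_def \<sigma>s_def scaleR_matrix_vector_mult algebra_simps)
    then have 1: "norm (fst (f x)) \<le> \<bar>t - s\<bar> * (?n * norm ?y)"
      using norm_matrix_vector_mult_le[of "\<sigma> x" ?y] by (simp add: mult_left_mono)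
    have *: "(r *\<^sub>R \<sigma> x ** r *\<^sub>R \<sigma> x) *v ?y = (r * r) *\<^sub>R (\<sigma> x *v (\<sigma> x *v ?y))" for r
      unfolding matrix_vector_mul_assoc[symmetric] by (simp add: scaleR_matrix_vector_mult matrix_vector_mult_scaleR)
    have "snd (f x) = - ((\<mu> - \<nu>) *s ?y) - (t - s) *\<^sub>R (\<sigma> x *v ?z) - (t * t - s * s) *\<^sub>R (\<sigma> x *v (\<sigma> x *v ?y))"
      by (simp add: f_def sys_def \<sigma>t_def \<sigma>s_def * scaleR_matrix_vector_mult vector_scalar_mult_minus algebra_simps)
    also have "norm \<dots> \<le> norm (\<mu> - \<nu>) * norm ?y + \<bar>t - s\<bar> * (?n * norm ?z) + 2 * \<bar>t - s\<bar> * (?n * (?n * norm ?y))"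
    proof -
      have "t * t - s * s = (t + s) * (t - s)" by (simp add: algebra_simps)
      then have "\<bar>t * t - s * s\<bar> = (t + s) * \<bar>t - s\<bar>" using t s by (simp add: abs_mult)
      also have "\<dots> \<le> 2 * \<bar>t - s\<bar>" using t s by (intro mult_right_mono) auto
      finally have ts: "\<bar>t * t - s * s\<bar> \<le> 2 * \<bar>t - s\<bar>" .
      have "norm (\<sigma> x *v (\<sigma> x *v ?y)) \<le> ?n * (?n * norm ?y)"
        by (rule order_trans[OF norm_matrix_vector_mult_le mult_left_mono[OF norm_matrix_vector_mult_le]]) simp
      then have a: "norm ((t * t - s * s) *\<^sub>R (\<sigma> x *v (\<sigma> x *v ?y))) \<le> 2 * \<bar>t - s\<bar> * (?n * (?n * norm ?y))"
        using ts by (simp add: mult_mono)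
      have b: "norm ((t - s) *\<^sub>R (\<sigma> x *v ?z)) \<le> \<bar>t - s\<bar> * (?n * norm ?z)"
        using norm_matrix_vector_mult_le[of "\<sigma> x" ?z] by (simp add: mult_left_mono)
      have c: "norm (- ((\<mu> - \<nu>) *s ?y)) \<le> norm (\<mu> - \<nu>) * norm ?y" unfolding norm_minus_cancel norm_vector_scalar_mult by simp
      show ?thesis
        by (rule order_trans[OF norm_triangle_ineq4 add_mono[OF order_trans[OF norm_triangle_ineq4 add_mono[OF c b]] a]])
    qed
    finally have "norm (f x) \<le> \<bar>t - s\<bar> * (?n * norm ?y) + (norm (\<mu> - \<nu>) * norm ?y + \<bar>t - s\<bar> * (?n * norm ?z) + 2 * \<bar>t - s\<bar> * (?n * (?n * norm ?y)))"
      using norm_fst_snd(3)[of "f x"] 1 by linarith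
    also have "\<dots> \<le> \<bar>t - s\<bar> * (?n * norm (U x)) + (norm (\<mu> - \<nu>) * norm (U x) + \<bar>t - s\<bar> * (?n * norm (U x)) + 2 * \<bar>t - s\<bar> * (?n * (?n * norm (U x))))"
      by (intro add_mono mult_left_mono norm_fst_snd) auto
    \<comment> \<open>Each component contributes one term linear in \<sigma>; the quadratic term
      carries \<open>t * t - s * s\<close>, which is at most \<open>2 * \<bar>t - s\<bar>\<close> in
      modulus for parameters in [0, 1].\<close>
    also have "\<dots> = (\<bar>t - s\<bar> * (2 * ?n + 2 * ?n\<^sup>2) + norm (\<mu> - \<nu>)) * norm (U x)"
      by (simp add: power2_eq_square algebra_simps)
    also have "\<dots> \<le> (\<bar>t - s\<bar> * (2 * ?n + 2 * ?n\<^sup>2) + norm (\<mu> - \<nu>)) * (norm u * E)"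
      using Ub[OF x] by (intro mult_left_mono) auto
    finally show "norm (f x) \<le> (\<bar>t - s\<bar> * (2 * ?n + 2 * ?n\<^sup>2) + norm (\<mu> - \<nu>)) * (norm u * E)" .
  qed
  also have "norm (U 0 - V 0) = norm (u - w)" by (simp add: U_def V_def flow(1)[OF L2(1)] flow(1)[OF L2(2)])
  finally show ?thesis by (simp add: U_def V_def \<sigma>t_def \<sigma>s_def)
qed

text \<open>Joint continuity in the homotopy parameter and the spectral parameter. The initial value
  may depend on the former because \<open>H1\<close>, which enters the initial data, is scaled along
  with \<sigma>.\<close>

lemma continuous_on_flow:
  fixes \<sigma> :: "real \<Rightarrow> complex^'m^'m" and u :: "real \<Rightarrow> _"
  assumes \<sigma>: "L2 \<sigma>" and u: "continuous_on {0..1} u" and x: "x \<in> {0..pi}"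
  shows "continuous_on ({0..1} \<times> UNIV) (\<lambda>p. flow (\<lambda>x. fst p *\<^sub>R \<sigma> x) (snd p) (u (fst p)) x)"
  unfolding continuous_on_def
proof
  fix p :: "real \<times> complex" assume p: "p \<in> {0..1} \<times> UNIV"
  let ?F = "at p within {0..1} \<times> UNIV"
  define R where "R = norm (snd p) + 1"
  define E where "E = exp (integral {0..pi} (sys_bound \<sigma> (complex_of_real R)))"
  define G where "G = integral {0..pi} (\<lambda>x. 2 * norm (\<sigma> x) + 2 * (norm (\<sigma> x))\<^sup>2)"
  define b where "b q = (norm (u (fst q) - u (fst p)) + (\<bar>fst q - fst p\<bar> * G + norm (snd q - snd p) * pi) * (norm (u (fst q)) * E)) * E" for q
  have ulim: "((\<lambda>q. u (fst q)) \<longlongrightarrow> u (fst p)) ?F"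
  proof -
    have "continuous_on ({0..1} \<times> (UNIV :: complex set)) (\<lambda>q. u (fst q))"
      by (rule continuous_on_compose2[OF u]) (auto intro: continuous_intros)
    then show ?thesis using p by (auto simp: continuous_on_def)
  qed
  have "(b \<longlongrightarrow> (norm (u (fst p) - u (fst p)) + (\<bar>fst p - fst p\<bar> * G + norm (snd p - snd p) * pi) * (norm (u (fst p)) * E)) * E) ?F"
    unfolding b_def by (intro tendsto_intros ulim)
  then have b0: "(b \<longlongrightarrow> 0) ?F" by simp
  have Gi: "(\<lambda>x. 2 * norm (\<sigma> x) + 2 * (norm (\<sigma> x))\<^sup>2) integrable_on {0..pi}"
    using L2_imp_integrable[OF \<sigma>] by (intro integrable_add integrable_on_mult_right) (auto simp: absolutely_integrable_on_def)
  have int: "integral {0..pi} (\<lambda>x. r * (2 * norm (\<sigma> x) + 2 * (norm (\<sigma> x))\<^sup>2) + c) = r * G + c * pi" for r c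
    using Gi by (subst Henstock_Kurzweil_Integration.integral_add) (auto simp: G_def intro!: integrable_on_mult_right)
  have "\<forall>\<^sub>F q in ?F. dist (snd q) (snd p) < 1"
    by (rule tendstoD[OF tendsto_snd[OF tendsto_ident_at]]) simp
  moreover have "\<forall>\<^sub>F q in ?F. q \<in> {0..1} \<times> UNIV" by (simp add: eventually_at_filter)
  ultimately have "\<forall>\<^sub>F q in ?F. norm (flow (\<lambda>x. fst q *\<^sub>R \<sigma> x) (snd q) (u (fst q)) x - flow (\<lambda>x. fst p *\<^sub>R \<sigma> x) (snd p) (u (fst p)) x) \<le> b q"
  proof eventually_elim
    case (elim q)
    have "norm (snd q) \<le> R" using elim(1) norm_triangle_ineq2[of "snd q" "snd p"] by (simp add: R_def dist_norm)
    moreover have "norm (snd p) \<le> R" by (simp add: R_def)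
    ultimately show ?case
      using flow_diff_bound[OF \<sigma>, of "fst q" "fst p" "snd q" R "snd p" x "u (fst q)" "u (fst p)"] elim(2) p x
      unfolding b_def E_def int by (simp add: mem_Times_iff)
  qed
  then have "((\<lambda>q. flow (\<lambda>x. fst q *\<^sub>R \<sigma> x) (snd q) (u (fst q)) x - flow (\<lambda>x. fst p *\<^sub>R \<sigma> x) (snd p) (u (fst p)) x) \<longlongrightarrow> 0) ?F"
    by (rule Lim_null_comparison[OF _ b0])
  then show "((\<lambda>q. flow (\<lambda>x. fst q *\<^sub>R \<sigma> x) (snd q) (u (fst q)) x) \<longlongrightarrow> flow (\<lambda>x. fst p *\<^sub>R \<sigma> x) (snd p) (u (fst p)) x) ?F"
    by (simp add: LIM_zero_iff)
qed

text \<open>Solution of the variational equation: \<mu> enters the system only through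
  \<open>- (\<mu> *s fst u)\<close> in the second component, so differentiation in \<mu> leaves the
  forcing \<open>(0, - fst u)\<close> and zero initial data.\<close>

definition flow_deriv ::
  "(real \<Rightarrow> complex^'m^'m) \<Rightarrow> complex \<Rightarrow> (complex^'m) \<times> (complex^'m) \<Rightarrow> real \<Rightarrow> (complex^'m) \<times> (complex^'m)" where
  "flow_deriv \<sigma> \<mu> u0 = (SOME u. u 0 = 0 \<and> sys_solution \<sigma> \<mu> (\<lambda>x. (0, - fst (flow \<sigma> \<mu> u0 x))) u)"

lemma absolutely_integrable_on_snd_forcing:
  fixes f :: "real \<Rightarrow> 'b::euclidean_space"
  assumes "f absolutely_integrable_on {0..pi}"
  shows "(\<lambda>x. (0 :: 'a::euclidean_space, f x)) absolutely_integrable_on {0..pi}"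
  using absolutely_integrable_linear[OF assms, of "\<lambda>z. (0, z)"] by (simp add: o_def bounded_linear_Pair bounded_linear_ident)

lemma flow_deriv:
  fixes \<sigma> :: "real \<Rightarrow> complex^'m^'m"
  assumes "L2 \<sigma>"
  shows "flow_deriv \<sigma> \<mu> u0 0 = 0" "sys_solution \<sigma> \<mu> (\<lambda>x. (0, - fst (flow \<sigma> \<mu> u0 x))) (flow_deriv \<sigma> \<mu> u0)"
proof -
  have "(\<lambda>x. (0 :: complex^'m, - fst (flow \<sigma> \<mu> u0 x))) absolutely_integrable_on {0..pi}"
    by (intro absolutely_integrable_on_snd_forcing absolutely_integrable_continuous_real continuous_intros
        sys_solution_continuous_on[OF flow(2)[OF assms]])
  from sys_solution_exists[OF assms this, of 0 \<mu>, THEN someI_ex]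
  show "flow_deriv \<sigma> \<mu> u0 0 = 0" "sys_solution \<sigma> \<mu> (\<lambda>x. (0, - fst (flow \<sigma> \<mu> u0 x))) (flow_deriv \<sigma> \<mu> u0)"
    by (auto simp: flow_deriv_def)
qed

lemma csmult_inverse: "c \<noteq> 0 \<Longrightarrow> csmult (inverse c) (csmult c u) = u"
  by (simp add: csmult_def prod_eq_iff)

text \<open>The difference quotient minus the candidate derivative solves the system at \<mu> with
  zero initial value and with the difference of the first components of the two flows as forcing,
  which is of order \<open>norm (\<nu> - \<mu>)\<close>.\<close>

lemma flow_has_deriv:
  fixes \<sigma> :: "real \<Rightarrow> complex^'m^'m"
  assumes \<sigma>: "L2 \<sigma>" and x: "x \<in> {0..pi}"
  shows "((\<lambda>\<nu>. csmult (inverse (\<nu> - \<mu>)) (flow \<sigma> \<nu> u0 x - flow \<sigma> \<mu> u0 x)) \<longlongrightarrow> flow_deriv \<sigma> \<mu> u0 x) (at \<mu>)"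
proof -
  define R where "R = norm \<mu> + 1"
  define E where "E = exp (integral {0..pi} (sys_bound \<sigma> (complex_of_real R)))"
  define C where "C = pi * (norm u0 * E) * E"
  have close: "norm (flow \<sigma> \<nu> u0 x - flow \<sigma> \<mu> u0 x) \<le> norm (\<nu> - \<mu>) * C" if "norm \<nu> \<le> R" "x \<in> {0..pi}" for \<nu> x
    using flow_diff_bound[OF \<sigma>, of 1 1 \<nu> R \<mu> x u0 u0] that by (simp add: R_def E_def C_def mult_ac)
  have Emu: "exp (integral {0..pi} (sys_bound \<sigma> \<mu>)) \<le> E"
    unfolding E_def exp_le_cancel_iff by (intro sys_bound_mono_integral \<sigma>) (auto simp: R_def)
  have main: "norm (csmult (inverse (\<nu> - \<mu>)) (flow \<sigma> \<nu> u0 x - flow \<sigma> \<mu> u0 x) - flow_deriv \<sigma> \<mu> u0 x) \<le> norm (\<nu> - \<mu>) * (C * pi * E)"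
    if \<nu>: "norm \<nu> \<le> R" "\<nu> \<noteq> \<mu>" for \<nu>
  proof -
    let ?U = "flow \<sigma> \<nu> u0" and ?V = "flow \<sigma> \<mu> u0"
    define f where "f x = sys \<sigma> \<nu> x (?U x) - sys \<sigma> \<mu> x (?U x)" for x
    have f: "f x = csmult (\<nu> - \<mu>) (0, - fst (?U x))" for x
      by (simp add: f_def sys_def csmult_def vector_scalar_mult_minus)
    have "sys_solution \<sigma> \<mu> (\<lambda>x. 0 + (sys \<sigma> \<nu> x (?U x) - sys \<sigma> \<mu> x (?U x))) ?U"
      by (rule sys_solution_change[OF flow(2)[OF \<sigma>]])
    then have "sys_solution \<sigma> \<mu> f ?U" by (simp add: f_def[abs_def])
    from sys_solution_diff[OF this flow(2)[OF \<sigma>, of \<mu> u0]]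
    have "sys_solution \<sigma> \<mu> f (\<lambda>x. ?U x - ?V x)" by simp
    from sys_solution_csmult[OF this, of "inverse (\<nu> - \<mu>)"] \<nu>
    have "sys_solution \<sigma> \<mu> (\<lambda>x. (0, - fst (?U x))) (\<lambda>x. csmult (inverse (\<nu> - \<mu>)) (?U x - ?V x))"
      by (simp add: f csmult_inverse)
    from sys_solution_diff[OF this flow_deriv(2)[OF \<sigma>, of \<mu> u0]]
    have D: "sys_solution \<sigma> \<mu> (\<lambda>x. (0, fst (?V x) - fst (?U x))) (\<lambda>x. csmult (inverse (\<nu> - \<mu>)) (?U x - ?V x) - flow_deriv \<sigma> \<mu> u0 x)"
      by simp
    have fi: "(\<lambda>x. (0 :: complex^'m, fst (?V x) - fst (?U x))) absolutely_integrable_on {0..pi}"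
      by (intro absolutely_integrable_on_snd_forcing absolutely_integrable_continuous_real continuous_intros
        sys_solution_continuous_on[OF flow(2)[OF \<sigma>]])
    have 0: "csmult (inverse (\<nu> - \<mu>)) (?U 0 - ?V 0) - flow_deriv \<sigma> \<mu> u0 0 = 0"
      by (simp add: flow(1)[OF \<sigma>] flow_deriv(1)[OF \<sigma>] linear_0[OF linear_csmult])
    have le: "integral {0..pi} (\<lambda>x. norm ((0 :: complex^'m, fst (?V x) - fst (?U x)))) \<le> integral {0..pi} (\<lambda>x. 1) * (norm (\<nu> - \<mu>) * C)"
    proof (rule integral_norm_le_const_mult[OF fi])
      fix x assume x: "x \<in> {0..pi}"
      have "norm (fst (?V x) - fst (?U x)) \<le> norm (?V x - ?U x)" using norm_fst_snd(1)[of "?V x - ?U x"] by simp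
      then show "norm (0 :: complex^'m, fst (?V x) - fst (?U x)) \<le> 1 * (norm (\<nu> - \<mu>) * C)"
        using close[OF \<nu>(1) x] by (simp add: norm_Pair norm_minus_commute)
    qed auto
    have "norm (csmult (inverse (\<nu> - \<mu>)) (?U x - ?V x) - flow_deriv \<sigma> \<mu> u0 x) \<le>
      integral {0..pi} (\<lambda>x. norm ((0 :: complex^'m, fst (?V x) - fst (?U x)))) * exp (integral {0..pi} (sys_bound \<sigma> \<mu>))"
      using sys_solution_bound[OF \<sigma> fi D x] 0 by simp
    also have "\<dots> \<le> integral {0..pi} (\<lambda>x. 1) * (norm (\<nu> - \<mu>) * C) * E"
      using le Emu fi by (intro mult_mono le Emu) (auto simp: C_def E_def)
    finally show ?thesis by (simp add: mult_ac)
  qed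
  have "((\<lambda>\<nu>. csmult (inverse (\<nu> - \<mu>)) (flow \<sigma> \<nu> u0 x - flow \<sigma> \<mu> u0 x) - flow_deriv \<sigma> \<mu> u0 x) \<longlongrightarrow> 0) (at \<mu>)"
  proof (rule Lim_null_comparison)
    have "((\<lambda>\<nu>. norm (\<nu> - \<mu>) * (C * pi * E)) \<longlongrightarrow> norm (\<mu> - \<mu>) * (C * pi * E)) (at \<mu>)" by (intro tendsto_intros)
    then show "((\<lambda>\<nu>. norm (\<nu> - \<mu>) * (C * pi * E)) \<longlongrightarrow> 0) (at \<mu>)" by simp
    have "\<forall>\<^sub>F \<nu> in at \<mu>. \<nu> \<noteq> \<mu> \<and> dist \<nu> \<mu> < 1" unfolding eventually_at by (intro exI[of _ 1]) auto
    then show "\<forall>\<^sub>F \<nu> in at \<mu>. norm (csmult (inverse (\<nu> - \<mu>)) (flow \<sigma> \<nu> u0 x - flow \<sigma> \<mu> u0 x) - flow_deriv \<sigma> \<mu> u0 x) \<le> norm (\<nu> - \<mu>) * (C * pi * E)"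
    proof eventually_elim
      case (elim \<nu>)
      then have "norm \<nu> \<le> R" using norm_triangle_ineq2[of \<nu> \<mu>] by (simp add: R_def dist_norm)
      then show ?case using main elim by blast
    qed
  qed
  then show ?thesis by (simp add: LIM_zero_iff)
qed


section \<open>The characteristic matrix\<close>

text \<open>The sesquilinear Lagrange bracket; as its second argument is conjugated, an
  eigenfunction can be paired with itself.\<close>

definition wronskian :: "(complex^'m) \<times> (complex^'m) \<Rightarrow> (complex^'m) \<times> (complex^'m) \<Rightarrow> complex" where
  "wronskian u w = cinner (fst u) (snd w) - cinner (snd u) (fst w)"

text \<open>The two summands of the boundary form lie in the complementary ranges of
  \<open>T\<close> and \<open>perp T\<close>, so applying \<open>T\<close> separates them.\<close>

lemma boundary_form_eq_0_iff:
  assumes "T = T ** T"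
  shows "boundary_form T H y z = 0 \<longleftrightarrow> T *v y = y \<and> T *v z = T *v (H *v y)"
proof
  have TT: "T *v (T *v v) = T *v v" for v using assms by (metis matrix_vector_mul_assoc)
  assume 0: "boundary_form T H y z = 0"
  then have "T *v boundary_form T H y z = 0" by simp
  then have "T *v (z - H *v y) = 0"
    by (simp add: boundary_form_def perp_def matrix_vector_mult_diff_distrib matrix_vector_mult_diff_rdistrib TT)
  with 0 show "T *v y = y \<and> T *v z = T *v (H *v y)"
    by (simp add: boundary_form_def perp_def matrix_vector_mult_diff_distrib matrix_vector_mult_diff_rdistrib)
qed (simp add: boundary_form_def perp_def matrix_vector_mult_diff_distrib matrix_vector_mult_diff_rdistrib)

text \<open>A self-adjoint boundary condition cuts out an isotropic subspace for the bracket: both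
  terms reduce to the form of \<open>H\<close> on the two values, and they cancel because
  \<open>H\<close> is hermitian.\<close>

lemma wronskian_boundary_form:
  assumes T: "T = dagger T" "T = T ** T" and H: "H = dagger H" "H = T ** H ** T"
    and u: "boundary_form T H (fst u) (snd u) = 0" and w: "boundary_form T H (fst w) (snd w) = 0"
  shows "wronskian u w = 0"
proof -
  have TH: "T *v (H *v v) = H *v v" for v
    using H(2) T(2) by (metis matrix_mul_assoc matrix_vector_mul_assoc)
  have u': "T *v fst u = fst u" "T *v snd u = H *v fst u" and w': "T *v fst w = fst w" "T *v snd w = H *v fst w"
    using u w by (auto simp: boundary_form_eq_0_iff[OF T(2)] TH)
  have sT: "cinner (T *v a) b = cinner a (T *v b)" for a b using T(1) cinner_dagger by metis
  have sH: "cinner (H *v a) b = cinner a (H *v b)" for a b using H(1) cinner_dagger by metis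
  have "cinner (fst u) (snd w) = cinner (fst u) (H *v fst w)" using sT u' w' by metis
  moreover have "cinner (snd u) (fst w) = cinner (H *v fst u) (fst w)" using sT u' w' by metis
  ultimately show ?thesis by (simp add: wronskian_def sH)
qed

lemma boundary_form_linear:
  "boundary_form T H (y + y') (z + z') = boundary_form T H y z + boundary_form T H y' z'"
  "boundary_form T H (y - y') (z - z') = boundary_form T H y z - boundary_form T H y' z'"
  "boundary_form T H (c *s y) (c *s z) = c *s boundary_form T H y z"
  by (simp_all add: boundary_form_def perp_def matrix_vector_right_distrib matrix_vector_mult_diff_distrib
      matrix_vector_mult_diff_rdistrib matrix_vector_mult_scale vector_scalar_mult_minus algebra_simps)

locale sturm_liouville =
  fixes \<sigma> :: "real \<Rightarrow> complex^'m^'m" and T1 H1 T2 H2 :: "complex^'m^'m"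
  assumes L2_\<sigma>: "L2 \<sigma>" and hermitian_\<sigma>: "AE x in lebesgue_on {0<..<pi}. \<sigma> x = dagger (\<sigma> x)"
    and T1: "T1 = dagger T1" "T1 = T1 ** T1"
    and T2: "T2 = dagger T2" "T2 = T2 ** T2"
    and H1: "H1 = dagger H1" "H1 = T1 ** H1 ** T1"
    and H2: "H2 = dagger H2" "H2 = T2 ** H2 ** T2"
begin

lemma Lagrange_identity:
  assumes u: "sys_solution \<sigma> \<mu> (\<lambda>x. (0, f x)) u" and w: "sys_solution \<sigma> \<nu> (\<lambda>x. (0, g x)) w"
  shows "primitive_on 0 pi (\<lambda>x. wronskian (u x) (w x))
    (\<lambda>x. (\<mu> - cnj \<nu>) * cinner (fst (u x)) (fst (w x)) + (cinner (fst (u x)) (g x) - cinner (f x) (fst (w x))))"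
proof -
  obtain N where N: "negligible N" "\<And>x. x \<in> {0<..<pi} - N \<Longrightarrow> \<sigma> x = dagger (\<sigma> x)"
    using hermitian_\<sigma> AE_lebesgue_on_iff_negligible[of "{0<..<pi}"] by auto
  note u' = primitive_on_linear[OF bounded_linear_fst u[unfolded sys_solution_def]] primitive_on_linear[OF bounded_linear_snd u[unfolded sys_solution_def]]
  note w' = primitive_on_linear[OF bounded_linear_fst w[unfolded sys_solution_def]] primitive_on_linear[OF bounded_linear_snd w[unfolded sys_solution_def]]
  have neg: "negligible (N \<union> {0, pi})" using N by (simp add: negligible_Un)
  show ?thesis
  proof (rule primitive_on_cong[OF primitive_on_diff[OF primitive_on_bilinear[OF bounded_bilinear_cinner u'(1) w'(2)]
          primitive_on_bilinear[OF bounded_bilinear_cinner u'(2) w'(1)]] _ neg])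
    fix x assume x: "x \<in> {0..pi} - (N \<union> {0, pi})"
    then have "\<sigma> x = dagger (\<sigma> x)" by (intro N(2)) auto
    then have s: "cinner (\<sigma> x *v a) b = cinner a (\<sigma> x *v b)" for a b using cinner_dagger by metis
    show "cinner (fst (u x)) (snd (sys \<sigma> \<nu> x (w x) + (0, g x))) + cinner (fst (sys \<sigma> \<mu> x (u x) + (0, f x))) (snd (w x)) -
         (cinner (snd (u x)) (fst (sys \<sigma> \<nu> x (w x) + (0, g x))) + cinner (snd (sys \<sigma> \<mu> x (u x) + (0, f x))) (fst (w x))) =
         (\<mu> - cnj \<nu>) * cinner (fst (u x)) (fst (w x)) + (cinner (fst (u x)) (g x) - cinner (f x) (fst (w x)))"
      unfolding sys_def matrix_vector_mul_assoc[symmetric] by (simp add: cinner_simps s algebra_simps)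
  qed (simp add: wronskian_def)
qed

definition bc1 :: "(complex^'m) \<times> (complex^'m) \<Rightarrow> complex^'m" where "bc1 u = boundary_form T1 H1 (fst u) (snd u)"
definition bc2 :: "(complex^'m) \<times> (complex^'m) \<Rightarrow> complex^'m" where "bc2 u = boundary_form T2 H2 (fst u) (snd u)"

text \<open>A linear parametrization of all initial data that satisfy the first boundary condition:
  the part of \<open>v\<close> in the range of \<open>T1\<close> is the free value of Y, the
  complementary part is the free part of the quasi-derivative.\<close>

definition init :: "complex^'m \<Rightarrow> (complex^'m) \<times> (complex^'m)" where
  "init v = (T1 *v v, perp T1 *v v + H1 *v (T1 *v v))"

lemma bc2_linear: "bc2 (u + v) = bc2 u + bc2 v" "bc2 (u - v) = bc2 u - bc2 v" "bc2 (csmult c u) = c *s bc2 u"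
  by (simp_all add: bc2_def boundary_form_linear csmult_def)

lemma bc1_linear: "bc1 (u - v) = bc1 u - bc1 v" "bc1 0 = 0"
proof -
  show "bc1 (u - v) = bc1 u - bc1 v" by (simp add: bc1_def boundary_form_linear)
  show "bc1 0 = 0" by (simp add: bc1_def boundary_form_def)
qed

lemma fst_csmult: "fst (csmult c u) = c *s fst u"
  by (simp add: csmult_def)

lemma csmult_0_Pair: "csmult c (0, - y) = (0, - (c *s y))"
  by (simp add: csmult_def)

lemma init_linear: "init (u + v) = init u + init v" "init (c *s v) = csmult c (init v)"
  by (simp_all add: init_def csmult_def matrix_vector_right_distrib matrix_vector_mult_scale vec.scale_right_distrib)

lemma T1_idem: "T1 *v (T1 *v v) = T1 *v v" using T1(2) by (metis matrix_vector_mul_assoc)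
lemma T1_H1: "T1 *v (H1 *v v) = H1 *v v" using H1(2) T1(2) by (metis matrix_mul_assoc matrix_vector_mul_assoc)
lemma H1_T1: "H1 *v (T1 *v v) = H1 *v v" using H1(2) T1(2) by (metis matrix_mul_assoc matrix_vector_mul_assoc)

lemma bc1_init: "bc1 (init v) = 0"
  by (simp add: bc1_def init_def boundary_form_eq_0_iff[OF T1(2)] T1_idem T1_H1 H1_T1 perp_def
      matrix_vector_right_distrib matrix_vector_mult_diff_distrib matrix_vector_mult_diff_rdistrib)

lemma bc1_imp_init:
  assumes "bc1 u = 0" obtains v where "u = init v"
proof
  have u: "T1 *v fst u = fst u" "T1 *v snd u = H1 *v fst u"
    using assms by (auto simp: bc1_def boundary_form_eq_0_iff[OF T1(2)] T1_H1)
  show "u = init (fst u + perp T1 *v snd u)"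
    by (simp add: init_def prod_eq_iff u T1_idem T1_H1 H1_T1 perp_def
        matrix_vector_right_distrib matrix_vector_mult_diff_distrib matrix_vector_mult_diff_rdistrib)
qed

lemma init_eq_0: "init v = 0 \<longleftrightarrow> v = 0"
  by (auto simp: init_def prod_eq_iff perp_def matrix_vector_mult_diff_rdistrib)

definition charmat :: "complex \<Rightarrow> complex^'m^'m" where
  "charmat \<mu> = matrix (\<lambda>v. bc2 (flow \<sigma> \<mu> (init v) pi))"

definition charmat_deriv :: "complex \<Rightarrow> complex^'m^'m" where
  "charmat_deriv \<mu> = matrix (\<lambda>v. bc2 (flow_deriv \<sigma> \<mu> (init v) pi))"

lemma charmat_mult: "charmat \<mu> *v v = bc2 (flow \<sigma> \<mu> (init v) pi)"
  unfolding charmat_def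
proof (rule matrix_works)
  show "Vector_Spaces.linear (*s) (*s) (\<lambda>v. bc2 (flow \<sigma> \<mu> (init v) pi))"
    by unfold_locales
      (simp_all add: init_linear flow_add[OF L2_\<sigma>] flow_csmult[OF L2_\<sigma>] bc2_linear vec.scale_right_distrib vec.scale_left_distrib)
qed

lemma charmat_has_derivative:
  "((\<lambda>\<mu>. charmat \<mu> $ i $ j) has_field_derivative charmat_deriv \<mu> $ i $ j) (at \<mu>)"
proof -
  have "bounded_linear (\<lambda>u. bc2 u $ i)"
    unfolding linear_conv_bounded_linear[symmetric]
    by (rule linearI) (simp_all add: bc2_linear flip: csmult_of_real, simp add: scaleR_conv_of_real)
  moreover have "pi \<in> {0..pi}" by simp
  ultimately
  have "((\<lambda>\<nu>. inverse (\<nu> - \<mu>) * (bc2 (flow \<sigma> \<nu> (init (axis j 1)) pi) $ i - bc2 (flow \<sigma> \<mu> (init (axis j 1)) pi) $ i))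
      \<longlongrightarrow> bc2 (flow_deriv \<sigma> \<mu> (init (axis j 1)) pi) $ i) (at \<mu>)"
    using bounded_linear.tendsto[OF _ flow_has_deriv[OF L2_\<sigma>, of pi \<mu> "init (axis j 1)"], of "\<lambda>u. bc2 u $ i"]
    by (simp only: bc2_linear vector_smult_component vector_minus_component)
  then show ?thesis
    unfolding has_field_derivative_iff by (simp add: charmat_def charmat_deriv_def matrix_def divide_inverse mult.commute)
qed

lemma charmat_holomorphic: "(\<lambda>\<mu>. charmat \<mu> $ i $ j) holomorphic_on UNIV"
  unfolding holomorphic_on_def field_differentiable_def
  using charmat_has_derivative by (meson has_field_derivative_at_within)

lemma flow_deriv_unique:
  assumes "v 0 = 0" "sys_solution \<sigma> \<mu> (\<lambda>x. (0, - fst (flow \<sigma> \<mu> u0 x))) v" "x \<in> {0..pi}"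
  shows "v x = flow_deriv \<sigma> \<mu> u0 x"
proof (rule sys_solution_unique[OF L2_\<sigma> _ assms(2) flow_deriv(2)[OF L2_\<sigma>] _ assms(3)])
  show "(\<lambda>x. (0 :: complex^'m, - fst (flow \<sigma> \<mu> u0 x))) absolutely_integrable_on {0..pi}"
    by (intro absolutely_integrable_on_snd_forcing absolutely_integrable_continuous_real continuous_intros
        sys_solution_continuous_on[OF flow(2)[OF L2_\<sigma>]])
qed (simp add: assms flow_deriv(1)[OF L2_\<sigma>])

lemma charmat_deriv_mult: "charmat_deriv \<mu> *v v = bc2 (flow_deriv \<sigma> \<mu> (init v) pi)"
  unfolding charmat_deriv_def
proof (rule matrix_works)
  have add: "flow_deriv \<sigma> \<mu> (init (v + w)) pi = flow_deriv \<sigma> \<mu> (init v) pi + flow_deriv \<sigma> \<mu> (init w) pi" for v w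
  proof (rule flow_deriv_unique[symmetric, where v = "\<lambda>x. flow_deriv \<sigma> \<mu> (init v) x + flow_deriv \<sigma> \<mu> (init w) x"])
    show "sys_solution \<sigma> \<mu> (\<lambda>x. (0, - fst (flow \<sigma> \<mu> (init (v + w)) x))) (\<lambda>x. flow_deriv \<sigma> \<mu> (init v) x + flow_deriv \<sigma> \<mu> (init w) x)"
      using sys_solution_add[OF flow_deriv(2)[OF L2_\<sigma>, of \<mu> "init v"] flow_deriv(2)[OF L2_\<sigma>, of \<mu> "init w"]]
      unfolding sys_solution_def
      by (rule primitive_on_cong[where N = "{}"]) (auto simp: init_linear flow_add[OF L2_\<sigma>])
  qed (auto simp: flow_deriv(1)[OF L2_\<sigma>])
  have scale: "flow_deriv \<sigma> \<mu> (init (c *s v)) pi = csmult c (flow_deriv \<sigma> \<mu> (init v) pi)" for c v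
  proof (rule flow_deriv_unique[symmetric, where v = "\<lambda>x. csmult c (flow_deriv \<sigma> \<mu> (init v) x)"])
    show "sys_solution \<sigma> \<mu> (\<lambda>x. (0, - fst (flow \<sigma> \<mu> (init (c *s v)) x))) (\<lambda>x. csmult c (flow_deriv \<sigma> \<mu> (init v) x))"
      using sys_solution_csmult[OF flow_deriv(2)[OF L2_\<sigma>, of \<mu> "init v"], of c]
      unfolding sys_solution_def
      by (rule primitive_on_cong[where N = "{}"]) (auto simp: init_linear flow_csmult[OF L2_\<sigma>] fst_csmult csmult_0_Pair)
  qed (auto simp: flow_deriv(1)[OF L2_\<sigma>] linear_0[OF linear_csmult])
  show "Vector_Spaces.linear (*s) (*s) (\<lambda>v. bc2 (flow_deriv \<sigma> \<mu> (init v) pi))"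
    by unfold_locales (simp_all add: add scale bc2_linear vec.scale_right_distrib vec.scale_left_distrib)
qed

text \<open>If the first component vanishes identically, its equation says that the second one has
  integral 0 over every \<open>{0..x}\<close>, hence vanishes by continuity.\<close>

lemma fst_zero_imp_zero:
  assumes u: "sys_solution \<sigma> \<mu> (\<lambda>x. 0) u" and 0: "\<And>x. x \<in> {0..pi} \<Longrightarrow> fst (u x) = 0" and x: "x \<in> {0..pi}"
  shows "u x = 0"
proof -
  have c: "continuous_on {0..pi} (\<lambda>x. snd (u x))"
    by (intro continuous_intros sys_solution_continuous_on[OF u])
  have p: "primitive_on 0 pi (\<lambda>x. fst (u x)) (\<lambda>x. fst (sys \<sigma> \<mu> x (u x) + 0))"
    by (rule primitive_on_linear[OF bounded_linear_fst u[unfolded sys_solution_def]])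
  have p': "primitive_on 0 pi (\<lambda>x. 0) (\<lambda>x. snd (u x))"
    by (rule primitive_on_cong[OF p, where N = "{}"]) (auto simp: 0 sys_def)
  have "((\<lambda>x. integral {0..x} (\<lambda>x. snd (u x))) has_vector_derivative snd (u x)) (at x within {0..pi})"
    by (rule integral_has_vector_derivative[OF c x])
  moreover have "((\<lambda>x. integral {0..x} (\<lambda>x. snd (u x))) has_vector_derivative 0) (at x within {0..pi})"
  proof (rule has_vector_derivative_transform[OF x _ has_vector_derivative_const])
    show "integral {0..x} (\<lambda>x. snd (u x)) = 0" if "x \<in> {0..pi}" for x
      using primitive_onD(4)[OF p' that] by simp
  qed
  ultimately have "snd (u x) = 0"
    using vector_derivative_unique_within_closed_interval[of 0 pi x] x by auto
  then show ?thesis using 0[OF x] by (simp add: prod_eq_iff)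
qed

lemma continuous_integral_norm_zero:
  fixes f :: "real \<Rightarrow> 'b::euclidean_space"
  assumes "continuous_on {0..pi} f" "integral {0..pi} (\<lambda>x. (norm (f x))\<^sup>2) = 0" "x \<in> {0..pi}"
  shows "f x = 0"
proof -
  have "((\<lambda>x. (norm (f x))\<^sup>2) has_integral 0) {0..pi}"
    using assms(1,2) integrable_integral[of "\<lambda>x. (norm (f x))\<^sup>2" "{0..pi}"]
    by (metis continuous_on_norm continuous_on_power integrable_continuous_real)
  then have "(norm (f x))\<^sup>2 = 0"
    using has_integral_0_cbox_imp_0[of 0 pi "\<lambda>x. (norm (f x))\<^sup>2" x] assms
      continuous_on_power[OF continuous_on_norm[OF assms(1)], of 2] by (auto simp: not_le)
  then show ?thesis by simp
qed

lemma flow_integral_zero: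
  assumes "integral {0..pi} (\<lambda>x. cinner (fst (flow \<sigma> \<mu> u0 x)) (fst (flow \<sigma> \<mu> u0 x))) = 0"
  shows "u0 = 0"
proof -
  note f = flow(2)[OF L2_\<sigma>, of \<mu> u0]
  have c: "continuous_on {0..pi} (\<lambda>x. fst (flow \<sigma> \<mu> u0 x))" by (intro continuous_intros sys_solution_continuous_on[OF f])
  have "complex_of_real (integral {0..pi} (\<lambda>x. (norm (fst (flow \<sigma> \<mu> u0 x)))\<^sup>2)) = 0"
    using assms unfolding cinner_self
    by (subst (asm) integral_linear[of _ _ complex_of_real, unfolded o_def])
       (auto intro!: integrable_continuous_real continuous_intros c bounded_linear_of_real)
  then have "integral {0..pi} (\<lambda>x. (norm (fst (flow \<sigma> \<mu> u0 x)))\<^sup>2) = 0" by simp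
  from continuous_integral_norm_zero[OF c this] have "flow \<sigma> \<mu> u0 0 = 0" by (intro fst_zero_imp_zero[OF f]) auto
  then show ?thesis by (simp add: flow(1)[OF L2_\<sigma>])
qed

text \<open>The bracket of the eigenfunction with itself vanishes at both ends, so the Lagrange
  identity makes \<open>\<mu> - cnj \<mu>\<close> times its squared norm equal to 0.\<close>

lemma charmat_kernel_real:
  assumes "charmat \<mu> *v v = 0" "v \<noteq> 0"
  shows "\<mu> \<in> \<real>"
proof (rule ccontr)
  assume "\<mu> \<notin> \<real>"
  then have ne: "\<mu> - cnj \<mu> \<noteq> 0" by (simp add: complex_is_Real_iff complex_eq_iff)
  let ?u = "flow \<sigma> \<mu> (init v)"
  have u: "sys_solution \<sigma> \<mu> (\<lambda>x. (0, 0)) ?u" using flow(2)[OF L2_\<sigma>] by (simp add: zero_prod_def)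
  have p: "primitive_on 0 pi (\<lambda>x. wronskian (?u x) (?u x)) (\<lambda>x. (\<mu> - cnj \<mu>) * cinner (fst (?u x)) (fst (?u x)))"
    using Lagrange_identity[OF u u] by (simp add: cinner_simps)
  have "wronskian (?u 0) (?u 0) = 0" using bc1_init[of v] 
    by (intro wronskian_boundary_form[OF T1 H1]) (auto simp: bc1_def flow(1)[OF L2_\<sigma>])
  moreover have "wronskian (?u pi) (?u pi) = 0" using assms(1)
    by (intro wronskian_boundary_form[OF T2 H2]) (auto simp: charmat_mult bc2_def)
  ultimately have "integral {0..pi} (\<lambda>x. (\<mu> - cnj \<mu>) * cinner (fst (?u x)) (fst (?u x))) = 0"
    using primitive_onD(4)[OF p, of pi] by simp
  then have "integral {0..pi} (\<lambda>x. cinner (fst (?u x)) (fst (?u x))) = 0" using ne by simp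
  then show False using flow_integral_zero assms(2) init_eq_0 by blast
qed

text \<open>A nonzero \<open>v\<close> with such a \<open>w\<close> would start a Jordan chain. The
  derivative of the solution in \<mu>, corrected by the solution started from \<open>w\<close>,
  satisfies both boundary conditions and has minus the eigenfunction as forcing; pairing it with the
  eigenfunction in the Lagrange identity makes the norm of the latter vanish.\<close>

lemma charmat_semisimple:
  assumes "\<mu> \<in> \<real>" and v: "charmat \<mu> *v v = 0" and w: "charmat_deriv \<mu> *v v = charmat \<mu> *v w"
  shows "v = 0"
proof -
  let ?u = "flow \<sigma> \<mu> (init v)"
  have u: "sys_solution \<sigma> \<mu> (\<lambda>x. (0, 0)) ?u" using flow(2)[OF L2_\<sigma>] by (simp add: zero_prod_def)
  define q where "q x = flow_deriv \<sigma> \<mu> (init v) x - flow \<sigma> \<mu> (init w) x" for x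
  have q: "sys_solution \<sigma> \<mu> (\<lambda>x. (0, - fst (?u x))) q"
    using sys_solution_diff[OF flow_deriv(2)[OF L2_\<sigma>, of \<mu> "init v"] flow(2)[OF L2_\<sigma>, of \<mu> "init w"]] by (simp add: q_def[abs_def])
  have real: "cnj \<mu> = \<mu>" using assms(1) by (simp add: Reals_cnj_iff)
  have p: "primitive_on 0 pi (\<lambda>x. wronskian (q x) (?u x)) (\<lambda>x. cinner (fst (?u x)) (fst (?u x)))"
    using Lagrange_identity[OF q u] by (simp add: cinner_simps real)
  have "bc1 (q 0) = 0" "bc1 (?u 0) = 0"
    by (simp_all only: q_def flow(1)[OF L2_\<sigma>] flow_deriv(1)[OF L2_\<sigma>] bc1_linear bc1_init diff_zero)
  then have "wronskian (q 0) (?u 0) = 0" unfolding bc1_def by (rule wronskian_boundary_form[OF T1 H1])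
  moreover have "bc2 (q pi) = 0" "bc2 (?u pi) = 0"
    using v w by (simp_all only: q_def bc2_linear charmat_mult charmat_deriv_mult diff_self)
  then have "wronskian (q pi) (?u pi) = 0" unfolding bc2_def by (rule wronskian_boundary_form[OF T2 H2])
  ultimately have "integral {0..pi} (\<lambda>x. cinner (fst (?u x)) (fst (?u x))) = 0"
    using primitive_onD(4)[OF p, of pi] by simp
  then show "v = 0" using flow_integral_zero init_eq_0 by blast
qed

end


subsection \<open>Spectrum and eigenvalues\<close>

lemma L2_add:
  fixes f g :: "real \<Rightarrow> 'a::euclidean_space"
  assumes "L2 f" "L2 g"
  shows "L2 (\<lambda>x. f x + g x)"
proof -
  have m: "(\<lambda>x. f x + g x) \<in> borel_measurable (lebesgue_on {0..pi})"
    using assms by (auto simp: L2_iff)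
  have "(\<lambda>x. (norm (f x + g x))\<^sup>2) absolutely_integrable_on {0..pi}"
  proof (rule measurable_bounded_by_integrable_imp_absolutely_integrable)
    show "(\<lambda>x. (norm (f x + g x))\<^sup>2) \<in> borel_measurable (lebesgue_on {0..pi})"
      using m by measurable
    show "(\<lambda>x. 2 * (norm (f x))\<^sup>2 + 2 * (norm (g x))\<^sup>2) integrable_on {0..pi}"
      using L2_imp_integrable(3)[OF assms(1)] L2_imp_integrable(3)[OF assms(2)]
      by (intro integrable_add integrable_on_mult_right) (auto simp: absolutely_integrable_on_def)
    fix x
    have "(norm (f x + g x))\<^sup>2 \<le> (norm (f x) + norm (g x))\<^sup>2" by (intro power_mono norm_triangle_ineq) auto
    also have "\<dots> \<le> 2 * (norm (f x))\<^sup>2 + 2 * (norm (g x))\<^sup>2"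
      using sum_squares_bound[of "norm (f x)" "norm (g x)"] by (simp add: power2_sum)
    finally show "norm ((norm (f x + g x))\<^sup>2) \<le> 2 * (norm (f x))\<^sup>2 + 2 * (norm (g x))\<^sup>2" by simp
  qed auto
  with m show ?thesis by (simp add: L2_iff)
qed

lemma L2_continuous:
  fixes f :: "real \<Rightarrow> 'a::euclidean_space"
  assumes "continuous_on {0..pi} f"
  shows "L2 f"
  using assms by (auto simp: L2_iff intro!: continuous_imp_measurable_on_sets_lebesgue absolutely_integrable_continuous_real continuous_intros)

lemma L2_norm_continuous_le:
  fixes f :: "real \<Rightarrow> 'a::euclidean_space"
  assumes c: "continuous_on {0..pi} f" and "\<And>x. x \<in> {0..pi} \<Longrightarrow> norm (f x) \<le> B"
  shows "L2_norm f \<le> sqrt pi * B"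
proof -
  have "B \<ge> 0" using order_trans[OF norm_ge_zero assms(2)[of 0]] by simp
  have "integral {0..pi} (\<lambda>x. (norm (f x))\<^sup>2) \<le> integral {0..pi} (\<lambda>x. B\<^sup>2)"
    using assms by (intro integral_le integrable_continuous_real continuous_intros power_mono) auto
  then have "L2_norm f \<le> sqrt (pi * B\<^sup>2)" using L2_norm_eq[OF L2_continuous[OF c]] by simp
  then show ?thesis using \<open>B \<ge> 0\<close> by (simp add: real_sqrt_mult)
qed

lemma integral_norm_le_L2_norm:
  fixes f :: "real \<Rightarrow> 'a::euclidean_space"
  assumes "L2 f"
  shows "integral {0..pi} (\<lambda>x. norm (f x)) \<le> sqrt pi * L2_norm f"
proof -
  note i = L2_imp_integrable[OF assms, unfolded absolutely_integrable_on_def]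
  have "(integral {0..pi} (\<lambda>x. 1 * norm (f x)))\<^sup>2 \<le> integral {0..pi} (\<lambda>x. 1\<^sup>2) * integral {0..pi} (\<lambda>x. (norm (f x))\<^sup>2)"
    using i by (intro Cauchy_Schwarz_integral) auto
  then have "(integral {0..pi} (\<lambda>x. norm (f x)))\<^sup>2 \<le> pi * (L2_norm f)\<^sup>2"
    using i by (simp add: L2_norm_eq[OF assms] integral_nonneg)
  then have "integral {0..pi} (\<lambda>x. norm (f x)) \<le> sqrt (pi * (L2_norm f)\<^sup>2)" by (rule real_le_rsqrt)
  also have "\<dots> = sqrt pi * L2_norm f" using i by (simp add: real_sqrt_mult L2_norm_eq[OF assms] integral_nonneg)
  finally show ?thesis .
qed

lemma det_eq_0_iff_kernel: "det A = 0 \<longleftrightarrow> (\<exists>v. v \<noteq> 0 \<and> A *v v = 0)" for A :: "complex^'n^'n"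
  using invertible_det_nz[of A] invertible_left_inverse[of A] matrix_left_invertible_ker[of A] by blast

context sturm_liouville
begin

lemma bvp_graph_imp_solution:
  assumes F: "L2 F" and Y: "bvp_graph \<sigma> T1 H1 T2 H2 Y (\<lambda>x. F x + \<mu> *s Y x)"
  shows "\<exists>u. sys_solution \<sigma> \<mu> (\<lambda>x. (0, - F x)) u \<and> (\<forall>x. Y x = fst (u x)) \<and> bc1 (u 0) = 0 \<and> bc2 (u pi) = 0"
proof -
  obtain Z where Z: "abs_cont_on 0 pi Y" "abs_cont_on 0 pi Z" "quasi_deriv \<sigma> Y Z" "diff_expr \<sigma> Y Z (\<lambda>x. F x + \<mu> *s Y x)"
      "boundary_form T1 H1 (Y 0) (Z 0) = 0" "boundary_form T2 H2 (Y pi) (Z pi) = 0"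
    using Y unfolding bvp_graph_def by blast
  define u where "u x = (Y x, Z x)" for x
  obtain N where N: "negligible N" "\<And>x. x \<in> {0<..<pi} - N \<Longrightarrow> \<exists>Y'. (Y has_vector_derivative Y') (at x) \<and> Z x = Y' - \<sigma> x *v Y x"
    using Z(3) unfolding quasi_deriv_def by (auto simp: AE_lebesgue_on_iff_negligible)
  obtain M where M: "negligible M" "\<And>x. x \<in> {0<..<pi} - M \<Longrightarrow> \<exists>Z'. (Z has_vector_derivative Z') (at x) \<and>
        F x + \<mu> *s Y x = - Z' - \<sigma> x *v Z x - (\<sigma> x ** \<sigma> x) *v Y x"
    using Z(4) unfolding diff_expr_def by (auto simp: AE_lebesgue_on_iff_negligible)
  have ac: "abs_cont_on 0 pi u"
  proof (rule abs_cont_on_dominated[OF Z(1,2), of 1])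
    show "norm (u y - u x) \<le> 1 * (norm (Y y - Y x) + norm (Z y - Z x))" for x y
      using norm_fst_snd(3)[of "u y - u x"] by (simp add: u_def)
  qed simp
  have "sys_solution \<sigma> \<mu> (\<lambda>x. (0, - F x)) u"
    unfolding sys_solution_def
  proof (rule primitive_onI[OF ac])
    have "(\<lambda>x. - F x) absolutely_integrable_on {0..pi}"
      using absolutely_integrable_linear[OF L2_imp_integrable(1)[OF F], of uminus] bounded_linear_minus[OF bounded_linear_ident] by (simp add: o_def)
    then show "(\<lambda>x. sys \<sigma> \<mu> x (u x) + (0, - F x)) absolutely_integrable_on {0..pi}"
      by (intro set_integral_add(1) linear_ode.A_continuous_integrable[OF linear_ode_sys[OF L2_\<sigma>]] absolutely_integrable_on_snd_forcing
          abs_cont_on_imp_continuous_on[OF ac])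
    show "negligible (N \<union> M)" using N M by (simp add: negligible_Un)
    fix x assume x: "x \<in> {0<..<pi} - (N \<union> M)"
    obtain Y' where Y': "(Y has_vector_derivative Y') (at x)" "Z x = Y' - \<sigma> x *v Y x" using N(2) x by blast
    obtain Z' where Z': "(Z has_vector_derivative Z') (at x)" "F x + \<mu> *s Y x = - Z' - \<sigma> x *v Z x - (\<sigma> x ** \<sigma> x) *v Y x" using M(2) x by blast
    have "Y' = \<sigma> x *v Y x + Z x" using Y'(2) by simp
    moreover have "Z' = - (\<mu> *s Y x) - \<sigma> x *v Z x - (\<sigma> x ** \<sigma> x) *v Y x - F x"
    proof -
      have "- (\<mu> *s Y x) - \<sigma> x *v Z x - (\<sigma> x ** \<sigma> x) *v Y x - F x = - (F x + \<mu> *s Y x) - \<sigma> x *v Z x - (\<sigma> x ** \<sigma> x) *v Y x"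
        by simp
      also have "\<dots> = Z'" unfolding Z'(2) by simp
      finally show ?thesis by simp
    qed
    ultimately have "sys \<sigma> \<mu> x (u x) + (0, - F x) = (Y', Z')" by (simp add: sys_def u_def)
    then show "(u has_vector_derivative sys \<sigma> \<mu> x (u x) + (0, - F x)) (at x)"
      unfolding u_def using Y'(1) Z'(1) by (auto intro: has_vector_derivative_Pair)
  qed
  then show ?thesis using Z(5,6) by (intro exI[of _ u]) (simp add: u_def bc1_def bc2_def)
qed

lemma solution_imp_bvp_graph:
  assumes F: "L2 F" and u: "sys_solution \<sigma> \<mu> (\<lambda>x. (0, - F x)) u" "bc1 (u 0) = 0" "bc2 (u pi) = 0"
  shows "bvp_graph \<sigma> T1 H1 T2 H2 (\<lambda>x. if x \<in> {0..pi} then fst (u x) else 0)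
     (\<lambda>x. F x + \<mu> *s (if x \<in> {0..pi} then fst (u x) else 0))"
proof -
  define Y where "Y x = (if x \<in> {0..pi} then fst (u x) else 0)" for x
  define Z where "Z x = snd (u x)" for x
  have Y: "Y x = fst (u x)" if "x \<in> {0..pi}" for x using that by (simp add: Y_def)
  note ac = primitive_on_abs_cont_on[OF u(1)[unfolded sys_solution_def]]
  have acY: "abs_cont_on 0 pi Y"
  proof (rule abs_cont_on_dominated[OF ac ac, of 1])
    fix x y assume "x \<in> {0..pi}" "y \<in> {0..pi}"
    then show "norm (Y y - Y x) \<le> 1 * (norm (u y - u x) + norm (u y - u x))"
      using norm_fst_snd(1)[of "u y - u x"] norm_ge_zero[of "u y - u x"] by (simp add: Y del: norm_ge_zero)
  qed simp
  have acZ: "abs_cont_on 0 pi Z"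
  proof (rule abs_cont_on_dominated[OF ac ac, of 1])
    fix x y
    show "norm (Z y - Z x) \<le> 1 * (norm (u y - u x) + norm (u y - u x))"
      using norm_fst_snd(2)[of "u y - u x"] norm_ge_zero[of "u y - u x"] by (simp add: Z_def del: norm_ge_zero)
  qed simp
  obtain N where N: "negligible N" "\<And>x. x \<in> {0<..<pi} - N \<Longrightarrow> (u has_vector_derivative (sys \<sigma> \<mu> x (u x) + (0, - F x))) (at x)"
    using primitive_on_has_vector_derivative[OF u(1)[unfolded sys_solution_def]] by blast
  have dY: "(Y has_vector_derivative \<sigma> x *v Y x + Z x) (at x)" if "x \<in> {0<..<pi} - N" for x
  proof (rule has_vector_derivative_transform_within_open[where S = "{0<..<pi}"])
    show "((\<lambda>x. fst (u x)) has_vector_derivative \<sigma> x *v Y x + Z x) (at x)"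
      using bounded_linear.has_vector_derivative[OF bounded_linear_fst N(2)[OF that]] that
      by (simp add: sys_def Y Z_def)
  qed (use that Y in auto)
  have dZ: "(Z has_vector_derivative - (\<mu> *s Y x) - \<sigma> x *v Z x - (\<sigma> x ** \<sigma> x) *v Y x - F x) (at x)" if "x \<in> {0<..<pi} - N" for x
    using bounded_linear.has_vector_derivative[OF bounded_linear_snd N(2)[OF that]] that
    by (simp add: sys_def Y Z_def[abs_def])
  have "quasi_deriv \<sigma> Y Z" "diff_expr \<sigma> Y Z (\<lambda>x. F x + \<mu> *s Y x)"
    unfolding quasi_deriv_def diff_expr_def
    by (subst AE_lebesgue_on_iff_negligible, simp, use N(1) dY dZ in \<open>fastforce intro: exI[of _ N]\<close>)+
  moreover have "L2 (\<lambda>x. F x + \<mu> *s Y x)"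
    by (intro L2_add[OF F] L2_continuous bounded_linear.continuous_on[OF bounded_linear_vector_scalar_mult] abs_cont_on_imp_continuous_on acY)
  moreover have "Y 0 = fst (u 0)" "Y pi = fst (u pi)" by (auto simp: Y)
  ultimately have "bvp_graph \<sigma> T1 H1 T2 H2 Y (\<lambda>x. F x + \<mu> *s Y x)"
    unfolding bvp_graph_def using acY acZ u(2,3)
    by (intro conjI exI[of _ Z]) (auto simp: bc1_def bc2_def Z_def Y_def)
  then show ?thesis by (simp add: Y_def[abs_def])
qed

definition eigenfun :: "complex \<Rightarrow> complex^'m \<Rightarrow> real \<Rightarrow> complex^'m" where
  "eigenfun \<mu> v x = (if x \<in> {0..pi} then fst (flow \<sigma> \<mu> (init v) x) else 0)"

lemma L2_zero: "L2 (\<lambda>x. 0 :: complex^'m)"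
  by (rule L2_continuous) simp

lemma eigenspace_eq: "bvp_eigenspace \<sigma> T1 H1 T2 H2 \<mu> = eigenfun \<mu> ` {v. charmat \<mu> *v v = 0}"
proof (intro set_eqI iffI)
  fix Y assume "Y \<in> bvp_eigenspace \<sigma> T1 H1 T2 H2 \<mu>"
  then have g: "bvp_graph \<sigma> T1 H1 T2 H2 Y (\<lambda>x. 0 + \<mu> *s Y x)" by (simp add: bvp_eigenspace_def)
  obtain u where u: "sys_solution \<sigma> \<mu> (\<lambda>x. (0, - 0)) u" "\<And>x. Y x = fst (u x)" "bc1 (u 0) = 0" "bc2 (u pi) = 0"
    using bvp_graph_imp_solution[OF L2_zero g] by blast
  obtain v where v: "u 0 = init v" using bc1_imp_init[OF u(3)] by blast
  have u': "u x = flow \<sigma> \<mu> (init v) x" if "x \<in> {0..pi}" for x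
    using flow_eqI[OF L2_\<sigma> _ that, of \<mu> u] u(1) v by (simp add: zero_prod_def)
  have "Y = eigenfun \<mu> v"
    using g u' u(2) by (auto simp: eigenfun_def bvp_graph_def fun_eq_iff)
  moreover have "charmat \<mu> *v v = 0" using u(4) u'[of pi] by (simp add: charmat_mult)
  ultimately show "Y \<in> eigenfun \<mu> ` {v. charmat \<mu> *v v = 0}" by blast
next
  fix Y assume "Y \<in> eigenfun \<mu> ` {v. charmat \<mu> *v v = 0}"
  then obtain v where v: "Y = eigenfun \<mu> v" "charmat \<mu> *v v = 0" by blast
  have "bvp_graph \<sigma> T1 H1 T2 H2 Y (\<lambda>x. 0 + \<mu> *s Y x)"
    using solution_imp_bvp_graph[OF L2_zero, of \<mu> "flow \<sigma> \<mu> (init v)"] flow(2)[OF L2_\<sigma>, of \<mu> "init v"] v(2)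
    by (simp add: zero_prod_def flow(1)[OF L2_\<sigma>] bc1_init charmat_mult v(1) eigenfun_def[abs_def])
  then show "Y \<in> bvp_eigenspace \<sigma> T1 H1 T2 H2 \<mu>" by (simp add: bvp_eigenspace_def)
qed

lemma eigenfun_eq_0: "eigenfun \<mu> v = 0 \<longleftrightarrow> v = 0"
proof
  assume 0: "eigenfun \<mu> v = 0"
  have "fst (flow \<sigma> \<mu> (init v) x) = 0" if "x \<in> {0..pi}" for x
    using fun_cong[OF 0, of x] that by (simp add: eigenfun_def)
  then have "flow \<sigma> \<mu> (init v) 0 = 0" by (intro fst_zero_imp_zero[OF flow(2)[OF L2_\<sigma>]]) auto
  then show "v = 0" by (simp add: flow(1)[OF L2_\<sigma>] init_eq_0)
next
  assume "v = 0"
  moreover have "init 0 = csmult 0 (init 0)" using init_linear(2)[of 0 0] by simp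
  ultimately show "eigenfun \<mu> v = 0"
    using flow_csmult[OF L2_\<sigma>, of _ \<mu> 0 "init 0"] by (auto simp: eigenfun_def fun_eq_iff csmult_def)
qed

lemma eigenvalues_eq: "bvp_eigenvalues \<sigma> T1 H1 T2 H2 = {\<mu>. \<exists>v. v \<noteq> 0 \<and> charmat \<mu> *v v = 0}"
  unfolding bvp_eigenvalues_def eigenspace_eq using eigenfun_eq_0 by auto

lemma eigenvalues_eq_det: "bvp_eigenvalues \<sigma> T1 H1 T2 H2 = {\<mu>. det (charmat \<mu>) = 0}"
  unfolding eigenvalues_eq det_eq_0_iff_kernel ..

text \<open>Eigenfunctions depend linearly and injectively on the kernel vectors that parametrize
  their initial data, so the dimensions agree.\<close>

lemma multiplicity_eq: "bvp_multiplicity \<sigma> T1 H1 T2 H2 \<mu> = vec.dim {v. charmat \<mu> *v v = 0}"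
proof -
  interpret F: vector_space "\<lambda>(c::complex) (Y :: real \<Rightarrow> complex^'m) x. c *s Y x" by (rule vector_space_fun_vec)
  interpret P: finite_dimensional_vector_space_pair_1 "(*s)" "cart_basis :: (complex^'m) set" "\<lambda>(c::complex) (Y :: real \<Rightarrow> complex^'m) x. c *s Y x" ..
  have lin: "Vector_Spaces.linear (*s) (\<lambda>(c::complex) (Y :: real \<Rightarrow> complex^'m) x. c *s Y x) (eigenfun \<mu>)"
    by unfold_locales
      (auto simp: eigenfun_def fun_eq_iff init_linear flow_add[OF L2_\<sigma>] flow_csmult[OF L2_\<sigma>] fst_csmult)
  have inj: "inj (eigenfun \<mu>)"
    using eigenfun_eq_0 module_hom.inj_iff_eq_0[OF lin[unfolded linear_iff_module_hom]] by blast
  show ?thesis unfolding bvp_multiplicity_def eigenspace_eq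
    by (rule P.dim_image_eq[OF lin inj_on_subset[OF inj]]) auto
qed

lemma eigenvalues_subset_spectrum: "bvp_eigenvalues \<sigma> T1 H1 T2 H2 \<subseteq> bvp_spectrum \<sigma> T1 H1 T2 H2"
proof
  fix \<mu> assume "\<mu> \<in> bvp_eigenvalues \<sigma> T1 H1 T2 H2"
  then obtain Y where Y: "bvp_graph \<sigma> T1 H1 T2 H2 Y (\<lambda>x. 0 + \<mu> *s Y x)" "Y \<noteq> 0"
    by (auto simp: bvp_eigenvalues_def bvp_eigenspace_def)
  have "0 \<in> bvp_eigenspace \<sigma> T1 H1 T2 H2 \<mu>"
    unfolding eigenspace_eq using eigenfun_eq_0[of \<mu> 0] by (intro image_eqI[of _ _ 0]) auto
  then have "bvp_graph \<sigma> T1 H1 T2 H2 0 (\<lambda>x. 0 + \<mu> *s (0 :: real \<Rightarrow> complex^'m) x)" by (simp add: bvp_eigenspace_def)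
  with Y have "\<not> (\<exists>!Y. bvp_graph \<sigma> T1 H1 T2 H2 Y (\<lambda>x. 0 + \<mu> *s Y x))" by blast
  then show "\<mu> \<in> bvp_spectrum \<sigma> T1 H1 T2 H2" unfolding bvp_spectrum_def using L2_zero by auto
qed

text \<open>Off the eigenvalues \<open>charmat \<mu>\<close> is invertible: a particular solution
  started from 0 is corrected by the homogeneous solution that repairs the second boundary
  condition. The Gronwall bound is uniform in \<open>x\<close> and therefore controls the norm, so
  the spectrum consists of eigenvalues only.\<close>

lemma resolvent_estimate:
  assumes "\<mu> \<notin> bvp_eigenvalues \<sigma> T1 H1 T2 H2"
  shows "\<exists>C. \<forall>F. L2 F \<longrightarrow> (\<exists>!Y. bvp_graph \<sigma> T1 H1 T2 H2 Y (\<lambda>x. F x + \<mu> *s Y x)) \<and>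
     (\<forall>Y. bvp_graph \<sigma> T1 H1 T2 H2 Y (\<lambda>x. F x + \<mu> *s Y x) \<longrightarrow> L2_norm Y \<le> C * L2_norm F)"
proof -
  have "invertible (charmat \<mu>)" using assms by (simp add: eigenvalues_eq_det invertible_det_nz)
  then obtain B where B: "B ** charmat \<mu> = mat 1" "charmat \<mu> ** B = mat 1" unfolding invertible_def by blast
  define E where "E = exp (integral {0..pi} (sys_bound \<sigma> \<mu>))"
  have E: "E > 0" by (simp add: E_def)
  obtain K where K: "K > 0" "\<And>u. norm (bc2 u) \<le> K * norm u"
  proof -
    have "bounded_linear bc2" unfolding linear_conv_bounded_linear[symmetric]
      by (rule linearI) (simp_all add: bc2_linear scaleR_eq_vector_scalar_mult flip: csmult_of_real)
    then show ?thesis using that bounded_linear.pos_bounded[of bc2] by (metis mult.commute)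
  qed
  obtain M where M: "M > 0" "\<And>v. norm (init v) \<le> M * norm v"
  proof -
    have "bounded_linear init" unfolding linear_conv_bounded_linear[symmetric]
      by (rule linearI) (simp_all add: init_linear scaleR_eq_vector_scalar_mult flip: csmult_of_real)
    then show ?thesis using that bounded_linear.pos_bounded[of init] by (metis mult.commute)
  qed
  \<comment> \<open>One factor \<open>sqrt pi\<close> comes from bounding the integral of
    \<open>norm (F x)\<close> by the L2 norm of \<open>F\<close>, the other from bounding the L2
    norm of \<open>Y\<close> by its maximum.\<close>
  define C where "C = sqrt pi * ((1 + M * norm B * K * E) * E * sqrt pi)"
  have main: "(\<exists>!Y. bvp_graph \<sigma> T1 H1 T2 H2 Y (\<lambda>x. F x + \<mu> *s Y x)) \<and>
     (\<forall>Y. bvp_graph \<sigma> T1 H1 T2 H2 Y (\<lambda>x. F x + \<mu> *s Y x) \<longrightarrow> L2_norm Y \<le> C * L2_norm F)" if F: "L2 F" for F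
  proof -
    have Fi: "(\<lambda>x. (0 :: complex^'m, - F x)) absolutely_integrable_on {0..pi}"
      using absolutely_integrable_linear[OF L2_imp_integrable(1)[OF F], of uminus] bounded_linear_minus[OF bounded_linear_ident]
      by (intro absolutely_integrable_on_snd_forcing) (simp add: o_def)
    obtain p where p: "p 0 = 0" "sys_solution \<sigma> \<mu> (\<lambda>x. (0, - F x)) p"
      using sys_solution_exists[OF L2_\<sigma> Fi] by blast
    define v where "v = - (B *v bc2 (p pi))"
    define u where "u x = p x + flow \<sigma> \<mu> (init v) x" for x
    have u: "sys_solution \<sigma> \<mu> (\<lambda>x. (0, - F x)) u"
      using sys_solution_add[OF p(2) flow(2)[OF L2_\<sigma>, of \<mu> "init v"]] by (simp add: u_def[abs_def])
    have u0: "u 0 = init v" by (simp add: u_def p flow(1)[OF L2_\<sigma>])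
    have "charmat \<mu> *v v = - bc2 (p pi)"
      using B(2) by (simp add: v_def matrix_vector_mul_assoc vec.neg)
    then have u\<pi>: "bc2 (u pi) = 0" by (simp add: u_def bc2_linear flip: charmat_mult)
    define Y where "Y x = (if x \<in> {0..pi} then fst (u x) else 0)" for x
    have Y: "bvp_graph \<sigma> T1 H1 T2 H2 Y (\<lambda>x. F x + \<mu> *s Y x)"
      using solution_imp_bvp_graph[OF F u _ u\<pi>] u0 by (simp add: Y_def[abs_def] bc1_init)
    have unique: "Y' = Y" if Y': "bvp_graph \<sigma> T1 H1 T2 H2 Y' (\<lambda>x. F x + \<mu> *s Y' x)" for Y'
    proof -
      obtain u' where u': "sys_solution \<sigma> \<mu> (\<lambda>x. (0, - F x)) u'" "\<And>x. Y' x = fst (u' x)" "bc1 (u' 0) = 0" "bc2 (u' pi) = 0"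
        using bvp_graph_imp_solution[OF F Y'] by blast
      obtain w where w: "u' 0 = init w" using bc1_imp_init[OF u'(3)] by blast
      have d: "sys_solution \<sigma> \<mu> (\<lambda>x. 0) (\<lambda>x. u' x - u x)" using sys_solution_diff[OF u'(1) u] by simp
      have "init (w + (- 1) *s v) = init w - init v" unfolding init_linear by (simp add: csmult_def prod_eq_iff)
      then have i: "u' 0 - u 0 = init (w - v)" by (simp add: w u0)
      have fl: "u' x - u x = flow \<sigma> \<mu> (init (w - v)) x" if "x \<in> {0..pi}" for x
        using flow_eqI[OF L2_\<sigma> d that] i by simp
      have "charmat \<mu> *v (w - v) = bc2 (u' pi - u pi)" by (simp add: charmat_mult fl)
      also have "\<dots> = 0" by (simp only: bc2_linear u' u\<pi> diff_zero)
      finally have "B *v (charmat \<mu> *v (w - v)) = 0" by simp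
      then have "w = v" by (simp add: matrix_vector_mul_assoc B)
      then have "u' x = u x" if "x \<in> {0..pi}" for x
        using fl[OF that] flow_csmult[OF L2_\<sigma> that, of \<mu> 0 "init 0"] init_linear(2)[of 0 0] by (simp add: csmult_def flip: zero_prod_def)
      then show "Y' = Y" using Y' u'(2) by (auto simp: Y_def fun_eq_iff bvp_graph_def)
    qed
    have If: "integral {0..pi} (\<lambda>x. norm (0 :: complex^'m, - F x)) = integral {0..pi} (\<lambda>x. norm (F x))"
      by (simp add: norm_Pair)
    have "norm (u x) \<le> (1 + M * norm B * K * E) * E * (sqrt pi * L2_norm F)" if x: "x \<in> {0..pi}" for x
    proof -
      define J where "J = integral {0..pi} (\<lambda>x. norm (F x))"
      have J: "J \<ge> 0" "J \<le> sqrt pi * L2_norm F"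
        using L2_imp_integrable(2)[OF F] integral_norm_le_L2_norm[OF F] by (auto simp: J_def absolutely_integrable_on_def intro!: integral_nonneg)
      have "norm (p pi) \<le> J * E" using sys_solution_bound[OF L2_\<sigma> Fi p(2), of pi] by (simp add: p If E_def J_def)
      then have "norm (bc2 (p pi)) \<le> K * (J * E)" using K by (meson mult_left_mono less_imp_le order_trans)
      then have "norm v \<le> norm B * (K * (J * E))"
        using norm_matrix_vector_mult_le[of B "bc2 (p pi)"] unfolding v_def norm_minus_cancel
        by (meson mult_left_mono norm_ge_zero order_trans)
      then have "norm (u 0) \<le> M * (norm B * (K * (J * E)))"
        unfolding u0 using M by (meson mult_left_mono less_imp_le order_trans)
      then have "norm (u x) \<le> (M * (norm B * (K * (J * E))) + J) * E"
        using sys_solution_bound[OF L2_\<sigma> Fi u x] E unfolding If J_def[symmetric] E_def[symmetric]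
        by (meson add_right_mono less_imp_le mult_right_mono order_trans)
      also have "\<dots> = (1 + M * norm B * K * E) * E * J" by (simp add: algebra_simps)
      also have "\<dots> \<le> (1 + M * norm B * K * E) * E * (sqrt pi * L2_norm F)"
        using J E M K by (intro mult_left_mono) auto
      finally show ?thesis .
    qed
    then have "L2_norm Y \<le> sqrt pi * ((1 + M * norm B * K * E) * E * (sqrt pi * L2_norm F))"
    proof (intro L2_norm_continuous_le)
      have "continuous_on {0..pi} (\<lambda>x. fst (u x))" by (intro continuous_intros sys_solution_continuous_on[OF u])
      then show "continuous_on {0..pi} Y" by (rule continuous_on_eq) (simp add: Y_def)
      fix x assume x: "x \<in> {0..pi}" and *: "\<And>x. x \<in> {0..pi} \<Longrightarrow> norm (u x) \<le> (1 + M * norm B * K * E) * E * (sqrt pi * L2_norm F)"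
      show "norm (Y x) \<le> (1 + M * norm B * K * E) * E * (sqrt pi * L2_norm F)"
        using *[OF x] norm_fst_snd(1)[of "u x"] x by (simp add: Y_def)
    qed
    then have "L2_norm Y \<le> C * L2_norm F" by (simp add: C_def mult.assoc)
    moreover have "\<exists>!Y. bvp_graph \<sigma> T1 H1 T2 H2 Y (\<lambda>x. F x + \<mu> *s Y x)" using Y unique by (rule ex1I)
    ultimately show ?thesis using unique by blast
  qed
  then show ?thesis by blast
qed

lemma spectrum_eq_eigenvalues: "bvp_spectrum \<sigma> T1 H1 T2 H2 = bvp_eigenvalues \<sigma> T1 H1 T2 H2"
  using eigenvalues_subset_spectrum resolvent_estimate unfolding bvp_spectrum_def by blast

end


section \<open>Zeros of determinants of holomorphic matrices\<close>

lemma holomorphic_on_det: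
  fixes F :: "complex \<Rightarrow> complex^'n^'n"
  assumes "\<And>i j. (\<lambda>z. F z $ i $ j) holomorphic_on S"
  shows "(\<lambda>z. det (F z)) holomorphic_on S"
  unfolding det_def by (intro holomorphic_intros assms)

lemma continuous_on_det:
  fixes F :: "'a::topological_space \<Rightarrow> complex^'n^'n"
  assumes "\<And>i j. continuous_on S (\<lambda>z. F z $ i $ j)"
  shows "continuous_on S (\<lambda>z. det (F z))"
  unfolding det_def by (intro continuous_intros assms)

definition column_matrix :: "('n \<Rightarrow> complex^'m) \<Rightarrow> complex^'n^'m" where
  "column_matrix e = (\<chi> a i. e i $ a)"

lemma column_matrix_mult: "column_matrix e *v x = (\<Sum>i\<in>UNIV. x $ i *s e i)"
  by (simp add: vec_eq_iff column_matrix_def matrix_vector_mult_def mult.commute)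

lemma matrix_mult_column_matrix: "A ** column_matrix e = column_matrix (\<lambda>i. A *v e i)"
  by (simp add: vec_eq_iff column_matrix_def matrix_vector_mult_def matrix_matrix_mult_def)

lemma basis_adapted_to_kernel:
  fixes A :: "complex^'n^'n"
  obtains e :: "'n \<Rightarrow> complex^'n" and I where
    "card I = vec.dim {v. A *v v = 0}" "\<And>i. i \<in> I \<Longrightarrow> A *v e i = 0"
    "\<And>x. column_matrix e *v x = 0 \<Longrightarrow> x = 0"
    "\<And>v. A *v v = 0 \<Longrightarrow> \<exists>y. v = (\<Sum>i\<in>I. y i *s e i)"
proof -
  define K where "K = {v. A *v v = 0}"
  obtain B where B: "B \<subseteq> K" "vec.independent B" "K \<subseteq> vec.span B" "card B = vec.dim K"
    using vec.basis_exists by blast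
  define B' where "B' = vec.extend_basis B"
  have B': "vec.independent B'" "B \<subseteq> B'" "vec.span B' = UNIV"
    unfolding B'_def using B(2) by (simp_all add: vec.independent_extend_basis vec.extend_basis_superset)
  have finB': "finite B'" using B'(1) by (rule vec.finiteI_independent)
  have "card B' = vec.dim (UNIV :: (complex^'n) set)"
    using vec.dim_eq_card[of B' UNIV] B' by simp
  then have "card B' = CARD('n)" by (simp add: vec.dim_UNIV card_cart_basis)
  then obtain e where e: "bij_betw e (UNIV :: 'n set) B'"
    using finite_same_card_bij[of "UNIV :: 'n set" B'] finB' by auto
  define I where "I = {i. e i \<in> B}"
  have eI: "bij_betw e I B" 
    using e B'(2) unfolding bij_betw_def I_def inj_on_def by fastforce
  show ?thesis
  proof (rule that)
    show "card I = vec.dim {v. A *v v = 0}" using bij_betw_same_card[OF eI] B(4) by (simp add: K_def)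
    show "A *v e i = 0" if "i \<in> I" for i using that B(1) by (auto simp: I_def K_def)
    fix x assume "column_matrix e *v x = 0"
    then have "(\<Sum>i\<in>UNIV. x $ i *s e i) = 0" by (simp add: column_matrix_mult)
    moreover have "(\<Sum>i\<in>UNIV. x $ inv_into UNIV e (e i) *s e i) = (\<Sum>b\<in>B'. x $ inv_into UNIV e b *s b)"
      by (rule sum.reindex_bij_betw[OF e])
    ultimately have "(\<Sum>b\<in>B'. x $ inv_into UNIV e b *s b) = 0"
      by (simp add: inv_f_f[OF bij_betw_imp_inj_on[OF e]])
    then have "x $ inv_into UNIV e b = 0" if "b \<in> B'" for b
      using vec.independentD[OF B'(1) finB' subset_refl, of "\<lambda>b. x $ inv_into UNIV e b"] that by blast
    from this[of "e i" for i] have "x $ i = 0" for i using e by (auto simp: bij_betw_def)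
    then show "x = 0" by (simp add: vec_eq_iff)
  next
    fix v assume "A *v v = 0"
    then have "v \<in> vec.span B" using B(3) by (auto simp: K_def)
    then obtain u where "v = (\<Sum>b\<in>B. u b *s b)"
      using vec.span_finite[OF finite_subset[OF B'(2) finB']] by auto
    then have "v = (\<Sum>i\<in>I. u (e i) *s e i)"
      using sum.reindex_bij_betw[OF eI, of "\<lambda>b. u b *s b"] by simp
    then show "\<exists>y. v = (\<Sum>i\<in>I. y i *s e i)" by (intro exI[of _ "\<lambda>i. u (e i)"])
  qed
qed

lemma sum_if_vector_scalar_mult:
  fixes e :: "'n::finite \<Rightarrow> complex^'m"
  shows "(\<Sum>i\<in>UNIV. (if i \<in> I then f i else g i) *s e i) = (\<Sum>i\<in>I. f i *s e i) + (\<Sum>i\<in>-I. g i *s e i)"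
proof -
  have "(\<Sum>i\<in>UNIV. (if i \<in> I then f i else g i) *s e i) =
      (\<Sum>i\<in>UNIV - I. (if i \<in> I then f i else g i) *s e i) + (\<Sum>i\<in>I. (if i \<in> I then f i else g i) *s e i)"
    by (rule sum.subset_diff) auto
  also have "(\<Sum>i\<in>UNIV - I. (if i \<in> I then f i else g i) *s e i) = (\<Sum>i\<in>-I. g i *s e i)"
    by (intro sum.cong) auto
  also have "(\<Sum>i\<in>I. (if i \<in> I then f i else g i) *s e i) = (\<Sum>i\<in>I. f i *s e i)"
    by (intro sum.cong) auto
  finally show ?thesis by (simp add: add.commute)
qed

text \<open>
  Multiplying \<open>F\<close> by a constant matrix whose first columns span the kernel of \<open>F z0\<close>, a factor
  \<open>z - z0\<close> can be extracted from each of these columns. Semisimplicity says precisely that the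
  remaining matrix is invertible at \<open>z0\<close>.
\<close>

lemma semisimple_zero_factorization:
  fixes F :: "complex \<Rightarrow> complex^'n^'n"
  assumes S: "open S" "z0 \<in> S" and hol: "\<And>i j. (\<lambda>z. F z $ i $ j) holomorphic_on S"
    and semisimple: "\<And>v w. \<lbrakk>F z0 *v v = 0; (\<chi> i j. deriv (\<lambda>z. F z $ i $ j) z0) *v v = F z0 *v w\<rbrakk> \<Longrightarrow> v = 0"
  shows "\<exists>(P :: complex^'n^'n) (G :: complex \<Rightarrow> complex^'n^'n) I. det P \<noteq> 0 \<and> (\<forall>i j. (\<lambda>z. G z $ i $ j) holomorphic_on S) \<and>
    det (G z0) \<noteq> 0 \<and> card I = vec.dim {v. F z0 *v v = 0} \<and>
    (\<forall>z\<in>S. F z ** P = G z ** (\<chi> i j. if i = j then (if i \<in> I then z - z0 else 1) else 0))"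
proof -
  obtain e :: "'n \<Rightarrow> complex^'n" and I where e: "card I = vec.dim {v. F z0 *v v = 0}" "\<And>i. i \<in> I \<Longrightarrow> F z0 *v e i = 0"
    "\<And>x. column_matrix e *v x = 0 \<Longrightarrow> x = 0"
    "\<And>v. F z0 *v v = 0 \<Longrightarrow> \<exists>y. v = (\<Sum>i\<in>I. y i *s e i)"
    by (rule basis_adapted_to_kernel[of "F z0"]) blast
  define F' where "F' = (\<chi> i j. deriv (\<lambda>z. F z $ i $ j) z0)"
  define h where "h a i z = (F z *v e i) $ a" for a i z
  have h_hol: "h a i holomorphic_on S" for a i
    unfolding h_def matrix_vector_mult_def by (simp, intro holomorphic_intros hol)
  have h0: "h a i z0 = 0" if "i \<in> I" for a i using e(2)[OF that] by (simp add: h_def)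
  have hderiv: "deriv (h a i) z0 = (F' *v e i) $ a" for a i
  proof -
    have "((\<lambda>z. \<Sum>j\<in>UNIV. F z $ a $ j * e i $ j) has_field_derivative (\<Sum>j\<in>UNIV. deriv (\<lambda>z. F z $ a $ j) z0 * e i $ j)) (at z0)"
      by (intro DERIV_sum DERIV_cmult_right holomorphic_derivI[OF hol S])
    then show ?thesis by (simp add: h_def[abs_def] F'_def matrix_vector_mult_def DERIV_imp_deriv)
  qed
  \<comment> \<open>In a kernel direction the column vanishes at \<open>z0\<close>; its difference
    quotient, completed by the derivative, is holomorphic because the singularity is
    removable.\<close>
  define g where "g i z = (\<chi> a. if i \<in> I then (if z = z0 then deriv (h a i) z0 else (h a i z - h a i z0) / (z - z0)) else h a i z)" for i z
  define G where "G z = column_matrix (\<lambda>i. g i z)" for z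
  have Ghol: "(\<lambda>z. G z $ a $ i) holomorphic_on S" for a i
    using pole_lemma[OF h_hol, of z0 a i] h_hol[of a i] S
    by (cases "i \<in> I") (simp_all add: G_def column_matrix_def g_def interior_open)
  have g: "F z *v e i = (if i \<in> I then z - z0 else 1) *s g i z" if "z \<in> S" for i z
    using e(2)[of i] h0[of i] by (auto simp: g_def vec_eq_iff h_def)
  have "det (G z0) \<noteq> 0"
  proof
    assume "det (G z0) = 0"
    then obtain x where x: "x \<noteq> 0" "G z0 *v x = 0" using det_eq_0_iff_kernel by blast
    \<comment> \<open>Splitting \<open>x\<close> along \<open>I\<close> turns
      \<open>G z0 *v x = 0\<close> into \<open>F' *v v + F z0 *v w = 0\<close> with \<open>v\<close>
      in the kernel of \<open>F z0\<close>. Semisimplicity gives \<open>v = 0\<close>; then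
      \<open>w\<close> lies in the kernel as well, and independence of the vectors
      \<open>e i\<close> forces \<open>x\<close> to vanish.\<close>
    define v where "v = (\<Sum>i\<in>I. x $ i *s e i)"
    define w where "w = (\<Sum>i\<in>-I. x $ i *s e i)"
    have "G z0 *v x = (\<Sum>i\<in>UNIV. x $ i *s g i z0)" by (simp add: G_def column_matrix_mult)
    also have "\<dots> = (\<Sum>i\<in>I. x $ i *s g i z0) + (\<Sum>i\<in>-I. x $ i *s g i z0)"
      using sum.subset_diff[of I UNIV "\<lambda>i. x $ i *s g i z0"] by (simp add: Compl_eq_Diff_UNIV add.commute)
    also have "(\<Sum>i\<in>I. x $ i *s g i z0) = (\<Sum>i\<in>I. F' *v (x $ i *s e i))"
      by (intro sum.cong refl) (simp add: g_def hderiv vec_eq_iff matrix_vector_mult_scale)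
    also have "\<dots> = F' *v v" by (simp add: v_def vec.sum)
    also have "(\<Sum>i\<in>-I. x $ i *s g i z0) = (\<Sum>i\<in>-I. F z0 *v (x $ i *s e i))"
      by (intro sum.cong refl) (simp add: g_def h_def vec_eq_iff matrix_vector_mult_scale)
    also have "\<dots> = F z0 *v w" by (simp add: w_def vec.sum)
    finally have eq: "F' *v v + F z0 *v w = 0" using x by simp
    have "F z0 *v v = (\<Sum>i\<in>I. F z0 *v (x $ i *s e i))" by (simp add: v_def vec.sum)
    also have "\<dots> = 0" by (intro sum.neutral) (simp add: matrix_vector_mult_scale e(2))
    finally have Fv: "F z0 *v v = 0" .
    have "F' *v v = F z0 *v (- w)" using eq by (simp add: vec.neg eq_neg_iff_add_eq_0)
    with Fv have v0: "v = 0" using semisimple[of v "- w"] by (simp add: F'_def)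
    then have "F z0 *v w = 0" using eq by simp
    then obtain y where y: "w = (\<Sum>i\<in>I. y i *s e i)" using e(4) by blast
    have x0: "x $ i = 0" if "i \<in> I" for i
    proof -
      have "column_matrix e *v (\<chi> i. if i \<in> I then x $ i else 0) = (\<Sum>i\<in>I. x $ i *s e i)"
        using sum_if_vector_scalar_mult[of I "\<lambda>i. x $ i" "\<lambda>i. 0" e] by (simp add: column_matrix_mult)
      also have "\<dots> = 0" using v0 by (simp only: v_def)
      finally have "(\<chi> i. if i \<in> I then x $ i else 0) = 0" by (rule e(3))
      then show ?thesis using that by (simp add: vec_eq_iff split: if_splits)
    qed
    have "column_matrix e *v (\<chi> i. if i \<in> I then - y i else x $ i) = (\<Sum>i\<in>I. (- y i) *s e i) + w"
      using sum_if_vector_scalar_mult[of I "\<lambda>i. - y i" "\<lambda>i. x $ i" e] by (simp add: column_matrix_mult w_def)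
    also have "\<dots> = 0" by (simp add: y sum_negf)
    finally have "(\<chi> i. if i \<in> I then - y i else x $ i) = 0" by (rule e(3))
    then have "x $ i = 0" if "i \<notin> I" for i using that by (simp add: vec_eq_iff split: if_splits) blast
    with x0 have "x = 0" by (auto simp: vec_eq_iff)
    with x show False by simp
  qed
  moreover have "det (column_matrix e) \<noteq> 0" using e(3) by (auto simp: det_eq_0_iff_kernel)
  moreover have "F z ** column_matrix e = G z ** (\<chi> i j. if i = j then (if i \<in> I then z - z0 else 1) else 0)" if "z \<in> S" for z
  proof -
    have "(F z ** column_matrix e) $ a $ j = (G z ** (\<chi> i j. if i = j then (if i \<in> I then z - z0 else 1) else 0)) $ a $ j" for a j
    proof -
      let ?d = "\<lambda>k. if k \<in> I then z - z0 else 1"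
      have "(\<Sum>k\<in>UNIV. G z $ a $ k * (if k = j then ?d k else 0)) = (\<Sum>k\<in>UNIV. if k = j then G z $ a $ k * ?d k else 0)"
        by (intro sum.cong refl) simp
      also have "\<dots> = G z $ a $ j * ?d j" by (simp only: sum.delta finite UNIV_I if_True)
      also have "\<dots> = (F z *v e j) $ a" unfolding g[OF that] by (simp add: G_def column_matrix_def)
      finally show ?thesis
        by (simp only: matrix_mult_column_matrix matrix_matrix_mult_def vec_lambda_beta) (simp add: column_matrix_def matrix_vector_mult_def)
    qed
    then show ?thesis by (simp only: vec_eq_iff) blast
  qed
  ultimately show ?thesis using Ghol e(1)
    by (intro exI[of _ "column_matrix e"] exI[of _ G] exI[of _ I] conjI) blast+
qed

text \<open>Multiplied by \<open>P\<close>, the matrix \<open>F z\<close> becomes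
  \<open>G z ** D z\<close>, and the determinant of the diagonal matrix \<open>D z\<close> is
  \<open>(z - z0) ^ card I\<close>; this gives the order. For the second claim, close to
  \<open>z0\<close> the matrix \<open>D z\<close> shrinks vectors at most by the factor
  \<open>dist z z0\<close>, so the bound stays linear even at a multiple zero of the
  determinant.\<close>

lemma
  fixes F :: "complex \<Rightarrow> complex^'n^'n"
  assumes S: "open S" "z0 \<in> S" and hol: "\<And>i j. (\<lambda>z. F z $ i $ j) holomorphic_on S"
    and semisimple: "\<And>v w. \<lbrakk>F z0 *v v = 0; (\<chi> i j. deriv (\<lambda>z. F z $ i $ j) z0) *v v = F z0 *v w\<rbrakk> \<Longrightarrow> v = 0"
  shows zorder_det_semisimple: "zorder (\<lambda>z. det (F z)) z0 = int (vec.dim {v. F z0 *v v = 0})"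
    and semisimple_lower_bound: "\<exists>c>0. \<exists>d>0. \<forall>z v. dist z z0 < d \<longrightarrow> norm (F z *v v) \<ge> c * dist z z0 * norm v"
proof -
  obtain P :: "complex^'n^'n" and G :: "complex \<Rightarrow> complex^'n^'n" and I where P: "det P \<noteq> 0" and G: "\<And>i j. (\<lambda>z. G z $ i $ j) holomorphic_on S" "det (G z0) \<noteq> 0"
    and I: "card I = vec.dim {v. F z0 *v v = 0}"
    and eq: "\<And>z. z \<in> S \<Longrightarrow> F z ** P = G z ** (\<chi> i j. if i = j then (if i \<in> I then z - z0 else 1) else 0)"
    using semisimple_zero_factorization[OF S hol] semisimple by blast
  define D where "D z = ((\<chi> i j. if i = j then (if i \<in> I then z - z0 else 1) else 0) :: complex^'n^'n)" for z
  have detD: "det (D z) = (z - z0) ^ card I" for z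
  proof -
    have "det (D z) = (\<Prod>i\<in>UNIV. D z $ i $ i)" by (rule det_diagonal) (simp add: D_def)
    also have "\<dots> = (\<Prod>i\<in>UNIV. if i \<in> I then z - z0 else 1)" by (simp add: D_def)
    also have "\<dots> = (z - z0) ^ card I" by (simp add: prod.If_cases)
    finally show ?thesis .
  qed
  show "zorder (\<lambda>z. det (F z)) z0 = int (vec.dim {v. F z0 *v v = 0})"
  proof (rule zorder_eqI[OF S, where g = "\<lambda>z. det (G z) / det P"])
    show "(\<lambda>z. det (G z) / det P) holomorphic_on S" using P by (intro holomorphic_intros holomorphic_on_det G) auto
    show "det (G z0) / det P \<noteq> 0" using G P by simp
    fix z assume "z \<in> S"
    have "det (F z) * det P = det (G z) * det (D z)" using eq[OF \<open>z \<in> S\<close>] by (simp add: D_def flip: det_mul)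
    then show "det (F z) = det (G z) / det P * (z - z0) powi int (vec.dim {v. F z0 *v v = 0})"
      using P by (simp add: detD I field_simps)
  qed
  show "\<exists>c>0. \<exists>d>0. \<forall>z v. dist z z0 < d \<longrightarrow> norm (F z *v v) \<ge> c * dist z z0 * norm v"
  proof -
    obtain B where B: "B ** G z0 = mat 1" using G(2) invertible_det_nz[of "G z0"] unfolding invertible_def by blast
    obtain Q where Q: "P ** Q = mat 1" using P invertible_det_nz[of P] unfolding invertible_def by blast
    define nB nP where "nB = norm B + 1" and "nP = norm P + 1"
    have pos: "nB > 0" "nP > 0" by (simp_all add: nB_def nP_def add_nonneg_pos)
    have "continuous (at z0) G"
    proof -
      have "((\<lambda>z. G z $ i $ j) \<longlongrightarrow> G z0 $ i $ j) (at z0)" for i j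
        using holomorphic_on_imp_continuous_on[OF G(1)[of i j]] S by (simp add: continuous_on_eq_continuous_at isCont_def)
      then show ?thesis unfolding isCont_def by (intro vec_tendstoI)
    qed
    then obtain d1 where d1: "d1 > 0" "\<And>z. dist z z0 < d1 \<Longrightarrow> dist (G z) (G z0) < 1 / (2 * nB)"
      unfolding continuous_at_eps_delta using pos by (metis divide_pos_pos mult_pos_pos zero_less_numeral zero_less_one)
    obtain d2 where d2: "d2 > 0" "ball z0 d2 \<subseteq> S" using S openE by blast
    \<comment> \<open>Distances below 1 ensure that the diagonal entries equal to 1 are also at
      least \<open>dist z z0\<close>.\<close>
    define d where "d = min 1 (min d1 d2)"
    have "norm (F z *v v) \<ge> 1 / (2 * nB * nP) * dist z z0 * norm v" if z: "dist z z0 < d" for z v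
    proof -
      have zS: "z \<in> S" using z d2 by (auto simp: d_def dist_commute subset_iff)
      define x where "x = Q *v v"
      have Px: "P *v x = v" by (simp add: x_def matrix_vector_mul_assoc Q)
      define y where "y = D z *v x"
      have "F z *v v = G z *v y"
        using eq[OF zS] unfolding Px[symmetric] y_def D_def by (simp only: matrix_vector_mul_assoc)
      have nv: "norm v \<le> nP * norm x"
        using norm_matrix_vector_mult_le[of P x] Px by (simp add: nP_def algebra_simps add_increasing)
      have "norm y \<ge> dist z z0 * norm x"
      proof -
        have "norm (y $ i) \<ge> dist z z0 * norm (x $ i)" for i
        proof -
          have "y $ i = (if i \<in> I then z - z0 else 1) * x $ i"
            by (simp add: y_def D_def matrix_vector_mult_def if_distrib[of "\<lambda>a. a * _"] cong: if_cong)
          moreover have "dist z z0 \<le> 1" using z by (simp add: d_def)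
          ultimately show ?thesis by (auto simp: norm_mult dist_norm intro: mult_left_le_one_le)
        qed
        then have "L2_set (\<lambda>i. dist z z0 * norm (x $ i)) UNIV \<le> norm y"
          unfolding norm_vec_def[of y] by (intro L2_set_mono) auto
        then show ?thesis by (simp add: L2_set_right_distrib norm_vec_def[of x])
      qed
      moreover have "norm (G z *v y) \<ge> norm y / (2 * nB)"
      proof -
        have "y = B *v (G z0 *v y)" by (simp add: matrix_vector_mul_assoc B)
        then have "norm y \<le> nB * norm (G z0 *v y)"
          using norm_matrix_vector_mult_le[of B "G z0 *v y"] by (simp add: nB_def algebra_simps add_increasing)
        then have "norm y / nB \<le> norm (G z0 *v y)" using pos by (simp add: divide_le_eq mult.commute)
        also have "G z0 *v y = G z *v y - (G z - G z0) *v y" by (simp add: matrix_vector_mult_diff_rdistrib)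
        also have "norm \<dots> \<le> norm (G z *v y) + norm (G z - G z0) * norm y"
          by (rule order_trans[OF norm_triangle_ineq4 add_left_mono[OF norm_matrix_vector_mult_le]])
        also have "norm (G z - G z0) * norm y \<le> 1 / (2 * nB) * norm y"
          using d1(2)[of z] z by (intro mult_right_mono) (auto simp: d_def dist_norm)
        finally have "norm y / nB \<le> norm (G z *v y) + 1 / (2 * nB) * norm y" by simp
        moreover have "norm y / nB = norm y / (2 * nB) + 1 / (2 * nB) * norm y" using pos by (simp add: field_simps)
        ultimately show ?thesis by linarith
      qed
      ultimately have "norm (F z *v v) \<ge> dist z z0 * norm x / (2 * nB)"
        using \<open>F z *v v = G z *v y\<close> pos by (smt (verit) divide_right_mono)
      moreover have "dist z z0 * (norm v / nP) / (2 * nB) \<le> dist z z0 * norm x / (2 * nB)"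
        using nv pos by (intro divide_right_mono mult_left_mono) (auto simp: divide_le_eq mult.commute)
      ultimately show ?thesis by (simp add: mult_ac)
    qed
    moreover have "d > 0" using d1 d2 by (simp add: d_def)
    ultimately show ?thesis using pos by (intro exI[of _ "1 / (2 * nB * nP)"] conjI exI[of _ d]) auto
  qed
qed

section \<open>Counting zeros along a homotopy\<close>

lemma finite_zeros_ball:
  assumes "f holomorphic_on UNIV" "f z0 \<noteq> 0"
  shows "finite {z \<in> cball c R. f z = 0}"
proof (cases "f constant_on UNIV")
  case True
  then obtain y where "\<And>z. f z = y" unfolding constant_on_def by blast
  then have "f z \<noteq> 0" for z using assms(2) by simp
  then show ?thesis by simp
next
  case False
  then show ?thesis using assms by (intro holomorphic_compact_finite_zeros[of f UNIV]) auto
qed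

text \<open>Rouche's theorem on a circle, where the winding numbers that weight the zeros are 1
  inside and 0 outside.\<close>

lemma zero_count_perturbation:
  assumes f: "f holomorphic_on UNIV" and h: "h holomorphic_on UNIV" and "R > 0"
    and less: "\<And>z. z \<in> sphere c R \<Longrightarrow> norm (h z - f z) < norm (f z)"
  shows "(\<Sum>z | z \<in> ball c R \<and> f z = 0. zorder f z) = (\<Sum>z | z \<in> ball c R \<and> h z = 0. zorder h z)"
proof -
  define S where "S = ball c (R + 1)"
  define p where "p = c + of_real R"
  have p: "p \<in> sphere c R" using \<open>R > 0\<close> by (simp add: p_def dist_norm)
  have ne: "f z \<noteq> 0" "h z \<noteq> 0" if "z \<in> sphere c R" for z using less[OF that] by auto
  have fin: "finite {z \<in> S. f z = 0}" "finite {z \<in> S. f z + (h z - f z) = 0}"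
    using finite_subset[OF _ finite_zeros_ball[OF f, of p c "R + 1"]] finite_subset[OF _ finite_zeros_ball[OF h, of p c "R + 1"]] ne[OF p]
    by (auto simp: S_def subset_iff)
  let ?\<gamma> = "circlepath c R"
  have wn: "winding_number ?\<gamma> z = (if z \<in> ball c R then 1 else 0)" if "z \<notin> sphere c R" for z
  proof (cases "z \<in> ball c R")
    case True
    then show ?thesis by (simp add: winding_number_circlepath dist_norm norm_minus_commute)
  next
    case False
    then have "z \<notin> cball c R" using that by auto
    then show ?thesis using False \<open>R > 0\<close>
      by (simp add: winding_number_zero_outside[of _ "cball c R"] path_image_circlepath)
  qed
  have red: "(\<Sum>z | z \<in> S \<and> k z = 0. winding_number ?\<gamma> z * of_int (zorder k z)) = of_int (\<Sum>z | z \<in> ball c R \<and> k z = 0. zorder k z)"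
    if fk: "finite {z \<in> S. k z = 0}" and nk: "\<And>z. z \<in> sphere c R \<Longrightarrow> k z \<noteq> 0" for k
  proof -
    have "(\<Sum>z | z \<in> S \<and> k z = 0. winding_number ?\<gamma> z * of_int (zorder k z)) =
        (\<Sum>z | z \<in> S \<and> k z = 0. if z \<in> ball c R then of_int (zorder k z) else 0)"
    proof (intro sum.cong refl)
      fix z assume "z \<in> {z. z \<in> S \<and> k z = 0}"
      then have "z \<notin> sphere c R" using nk by auto
      from wn[OF this] show "winding_number ?\<gamma> z * of_int (zorder k z) = (if z \<in> ball c R then of_int (zorder k z) else 0)"
        by simp
    qed
    also have "\<dots> = (\<Sum>z\<in>{z \<in> {z. z \<in> S \<and> k z = 0}. z \<in> ball c R}. of_int (zorder k z))"
      using fk by (subst sum.inter_filter) auto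
    also have "{z \<in> {z. z \<in> S \<and> k z = 0}. z \<in> ball c R} = {z. z \<in> ball c R \<and> k z = 0}" by (auto simp: S_def)
    finally show ?thesis by simp
  qed
  have "(\<Sum>z | z \<in> S \<and> f z + (h z - f z) = 0. winding_number ?\<gamma> z * of_int (zorder (\<lambda>z. f z + (h z - f z)) z)) =
     (\<Sum>z | z \<in> S \<and> f z = 0. winding_number ?\<gamma> z * of_int (zorder f z))"
  proof (rule Rouche_theorem)
    show "open S" "connected S" by (auto simp: S_def)
    show "f holomorphic_on S" "(\<lambda>z. h z - f z) holomorphic_on S"
      using f h by (auto intro!: holomorphic_intros intro: holomorphic_on_subset)
    show "valid_path ?\<gamma>" "pathfinish ?\<gamma> = pathstart ?\<gamma>" by auto
    show "path_image ?\<gamma> \<subseteq> S" using \<open>R > 0\<close> by (auto simp: S_def path_image_circlepath)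
    show "\<forall>z\<in>path_image ?\<gamma>. cmod (h z - f z) < cmod (f z)" using less \<open>R > 0\<close> by (auto simp: path_image_circlepath)
    show "\<forall>z. z \<notin> S \<longrightarrow> winding_number ?\<gamma> z = 0" using wn \<open>R > 0\<close> by (auto simp: S_def)
  qed (use fin in auto)
  then have "complex_of_int (\<Sum>z | z \<in> ball c R \<and> h z = 0. zorder h z) = of_int (\<Sum>z | z \<in> ball c R \<and> f z = 0. zorder f z)"
    using red[of f] red[of h] fin ne by simp
  then show ?thesis by (simp only: of_int_eq_iff)
qed

text \<open>By compactness the modulus on the circle stays above some \<open>m > 0\<close> for all
  parameters, and by uniform continuity it changes by less than \<open>m\<close> over parameter
  steps shorter than \<open>d\<close>; finitely many such steps lead from 0 to 1.\<close>

lemma zero_count_homotopy: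
  fixes \<Delta> :: "real \<Rightarrow> complex \<Rightarrow> complex"
  assumes hol: "\<And>t. t \<in> {0..1} \<Longrightarrow> \<Delta> t holomorphic_on UNIV"
    and cont: "continuous_on ({0..1} \<times> UNIV) (\<lambda>p. \<Delta> (fst p) (snd p))"
    and "R > 0" and ne: "\<And>t z. \<lbrakk>t \<in> {0..1}; z \<in> sphere c R\<rbrakk> \<Longrightarrow> \<Delta> t z \<noteq> 0"
  shows "(\<Sum>z | z \<in> ball c R \<and> \<Delta> 0 z = 0. zorder (\<Delta> 0) z) = (\<Sum>z | z \<in> ball c R \<and> \<Delta> 1 z = 0. zorder (\<Delta> 1) z)"
proof -
  define K where "K = {0..1::real} \<times> sphere c R"
  have K: "compact K" "K \<noteq> {}" using \<open>R > 0\<close> by (auto simp: K_def compact_Times)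
  have contK: "continuous_on K (\<lambda>p. \<Delta> (fst p) (snd p))" by (rule continuous_on_subset[OF cont]) (auto simp: K_def)
  obtain p0 where p0: "p0 \<in> K" "\<And>p. p \<in> K \<Longrightarrow> norm (\<Delta> (fst p0) (snd p0)) \<le> norm (\<Delta> (fst p) (snd p))"
    using continuous_attains_inf[OF K continuous_on_norm[OF contK]] by blast
  define m where "m = norm (\<Delta> (fst p0) (snd p0))"
  have m: "m > 0" using ne p0(1) by (auto simp: m_def K_def)
  obtain d where d: "d > 0" "\<And>p q. \<lbrakk>p \<in> K; q \<in> K; dist q p < d\<rbrakk> \<Longrightarrow> dist (\<Delta> (fst q) (snd q)) (\<Delta> (fst p) (snd p)) < m"
    using compact_uniformly_continuous[OF contK K(1)] m unfolding uniformly_continuous_on_def by metis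
  define N where "N t = (\<Sum>z | z \<in> ball c R \<and> \<Delta> t z = 0. zorder (\<Delta> t) z)" for t
  have step: "N s = N t" if st: "s \<in> {0..1}" "t \<in> {0..1}" "\<bar>s - t\<bar> < d" for s t
    unfolding N_def
  proof (rule zero_count_perturbation[OF hol[OF st(1)] hol[OF st(2)] \<open>R > 0\<close>])
    fix z assume z: "z \<in> sphere c R"
    have "dist (\<Delta> t z) (\<Delta> s z) < m"
      using d(2)[of "(s, z)" "(t, z)"] st z by (simp add: K_def dist_Pair_Pair dist_real_def abs_minus_commute)
    also have "m \<le> norm (\<Delta> s z)" using p0(2)[of "(s, z)"] st z by (simp add: K_def m_def)
    finally show "norm (\<Delta> t z - \<Delta> s z) < norm (\<Delta> s z)" by (simp add: dist_norm)
  qed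
  obtain n :: nat where n: "1 / d < real n" using reals_Archimedean2 by blast
  then have n0: "real n > 0" using d(1) by (meson divide_pos_pos less_trans zero_less_one)
  have "N (real k / real n) = N 0" if "k \<le> n" for k
    using that
  proof (induction k)
    case (Suc k)
    have "N (real k / real n) = N (real (Suc k) / real n)"
    proof (rule step)
      have "\<bar>real k / real n - real (Suc k) / real n\<bar> = 1 / real n" using n0 by (simp add: field_simps)
      then show "\<bar>real k / real n - real (Suc k) / real n\<bar> < d" using n n0 d(1) by (simp add: field_simps)
    qed (use Suc.prems n0 in auto)
    with Suc show ?case by simp
  qed simp
  from this[of n] n0 show ?thesis by (simp add: N_def)
qed


lemma dagger_scaleR: "dagger (t *\<^sub>R A) = t *\<^sub>R dagger A"
  by (simp add: dagger_def map_matrix_def transpose_def vec_eq_iff)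

lemma scaleR_matrix_mult: "A ** (t *\<^sub>R B) = t *\<^sub>R (A ** B)" "(t *\<^sub>R A) ** B = t *\<^sub>R (A ** B)" for A B :: "complex^'m^'m"
  by (simp_all add: vec_eq_iff matrix_matrix_mult_def scaleR_sum_right)

subsection \<open>A lower bound for the spectrum\<close>

context sturm_liouville
begin

text \<open>As the value lies in the range of \<open>T\<close>, the boundary condition replaces the
  quasi-derivative by \<open>H\<close> applied to the value. The boundary terms of the energy
  identity thus involve values only.\<close>

lemma cinner_bc_bound:
  assumes T: "T = dagger T" "T = T ** T" and b: "boundary_form T H (fst u) (snd u) = 0"
    and "norm H \<le> h" "norm (fst u) \<le> S"
  shows "\<bar>Re (cinner (snd u) (fst u))\<bar> \<le> h * S\<^sup>2"
proof -
  have u: "T *v fst u = fst u" "T *v snd u = T *v (H *v fst u)" using b by (auto simp: boundary_form_eq_0_iff[OF T(2)])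
  have sT: "cinner (T *v a) b = cinner a (T *v b)" for a b using T(1) cinner_dagger by metis
  have "cinner (snd u) (fst u) = cinner (T *v snd u) (fst u)" using sT u(1) by metis
  also have "\<dots> = cinner (H *v fst u) (fst u)" unfolding u(2) sT u(1) ..
  finally have "\<bar>Re (cinner (snd u) (fst u))\<bar> \<le> norm (cinner (H *v fst u) (fst u))" by (simp add: abs_Re_le_cmod)
  also have "\<dots> \<le> norm (H *v fst u) * norm (fst u)" by (rule norm_cinner_le)
  also have "\<dots> \<le> (norm H * norm (fst u)) * norm (fst u)" by (intro mult_right_mono norm_matrix_vector_mult_le) auto
  also have "\<dots> \<le> (h * S) * S" using assms(4,5) norm_ge_zero[of H] norm_ge_zero[of "fst u"]
    by (intro mult_mono mult_nonneg_nonneg) (auto intro: order_trans simp del: norm_ge_zero)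
  finally show ?thesis by (simp add: power2_eq_square)
qed

text \<open>Energy estimate for an eigenfunction \<open>y\<close> with quasi-derivative
  \<open>z\<close>: the integral of |z|^2 - l |y|^2 - |\<sigma> y|^2 is a boundary term, at most
  \<open>2 * h * S\<^sup>2\<close> with \<open>S\<close> the maximum of |y|. The potential term is
  bounded by \<open>s\<^sup>2 * S\<^sup>2\<close>, so a Sobolev inequality must trade
  \<open>S\<^sup>2\<close> for part of the integral of |z|^2 and a multiple of that of |y|^2. The
  outcome depends on \<open>s\<close> and \<open>h\<close> only and is thus uniform along the
  homotopy.\<close>

lemma charmat_kernel_lower_bound:
  assumes s2: "integral {0..pi} (\<lambda>x. (norm (\<sigma> x))\<^sup>2) \<le> s\<^sup>2" "s \<ge> 0" and h: "norm H1 \<le> h" "norm H2 \<le> h"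
    and v: "charmat (complex_of_real l) *v v = 0" "v \<noteq> 0"
  defines "q \<equiv> s\<^sup>2 + 2 * h"
  shows "l \<ge> - (q * (1 + 4 * s\<^sup>2) + 4 * q\<^sup>2)"
proof -
  define u where "u = flow \<sigma> (complex_of_real l) (init v)"
  define y z where "y x = fst (u x)" and "z x = snd (u x)" for x
  have u: "sys_solution \<sigma> (complex_of_real l) (\<lambda>x. 0) u" unfolding u_def by (rule flow(2)[OF L2_\<sigma>])
  have uc: "continuous_on {0..pi} u" by (rule sys_solution_continuous_on[OF u])
  have yc: "continuous_on {0..pi} y" and zc: "continuous_on {0..pi} z"
    unfolding y_def z_def by (intro continuous_intros uc)+
  have b0: "boundary_form T1 H1 (fst (u 0)) (snd (u 0)) = 0"
    using bc1_init[of v] by (simp add: bc1_def u_def flow(1)[OF L2_\<sigma>])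
  have b1: "boundary_form T2 H2 (fst (u pi)) (snd (u pi)) = 0"
    using v(1) by (simp add: charmat_mult bc2_def u_def)
  obtain x0 where x0: "x0 \<in> {0..pi}" "\<And>x. x \<in> {0..pi} \<Longrightarrow> norm (y x) \<le> norm (y x0)"
    using continuous_attains_sup[of "{0..pi}" "\<lambda>x. norm (y x)"] continuous_on_norm[OF yc] by auto
  obtain x1 where x1: "x1 \<in> {0..pi}" "\<And>x. x \<in> {0..pi} \<Longrightarrow> norm (y x1) \<le> norm (y x)"
    using continuous_attains_inf[of "{0..pi}" "\<lambda>x. norm (y x)"] continuous_on_norm[OF yc] by auto
  define S where "S = norm (y x0)"
  have S: "S \<ge> 0" "\<And>x. x \<in> {0..pi} \<Longrightarrow> norm (y x) \<le> S" using x0 by (auto simp: S_def)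
  define Y2 where "Y2 = integral {0..pi} (\<lambda>x. (norm (y x))\<^sup>2)"
  define Z2 where "Z2 = integral {0..pi} (\<lambda>x. (norm (z x))\<^sup>2)"
  have y2: "(\<lambda>x. (norm (y x))\<^sup>2) integrable_on {0..pi}" and z2: "(\<lambda>x. (norm (z x))\<^sup>2) integrable_on {0..pi}"
    by (intro integrable_continuous_real continuous_intros yc zc)+
  have YZ: "Y2 \<ge> 0" "Z2 \<ge> 0" unfolding Y2_def Z2_def using y2 z2 by (auto intro!: integral_nonneg)
  have Y2pos: "Y2 > 0"
  proof (rule ccontr)
    assume "\<not> Y2 > 0"
    then have "Y2 = 0" using YZ by simp
    then have "y x = 0" if "x \<in> {0..pi}" for x using continuous_integral_norm_zero[OF yc _ that] by (simp add: Y2_def)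
    then have "u 0 = 0" by (intro fst_zero_imp_zero[OF u]) (auto simp: y_def)
    then show False using v(2) by (simp add: u_def flow(1)[OF L2_\<sigma>] init_eq_0)
  qed
  have h0: "h \<ge> 0" using h(1) norm_ge_zero order_trans by blast
  obtain N where N: "negligible N" "\<And>x. x \<in> {0<..<pi} - N \<Longrightarrow> \<sigma> x = dagger (\<sigma> x)"
    using hermitian_\<sigma> AE_lebesgue_on_iff_negligible[of "{0<..<pi}"] by auto
  have neg: "negligible (N \<union> {0, pi})" using N by (simp add: negligible_Un)
  note u' = primitive_on_linear[OF bounded_linear_fst u[unfolded sys_solution_def]] primitive_on_linear[OF bounded_linear_snd u[unfolded sys_solution_def]]
  have energy: "Z2 - l * Y2 - s\<^sup>2 * S\<^sup>2 \<le> 2 * h * S\<^sup>2"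
  proof -
    have p: "primitive_on 0 pi (\<lambda>x. Re (cinner (z x) (y x))) (\<lambda>x. (norm (z x))\<^sup>2 - l * (norm (y x))\<^sup>2 - (norm (\<sigma> x *v y x))\<^sup>2)"
    proof (rule primitive_on_cong[OF primitive_on_linear[OF bounded_linear_Re primitive_on_bilinear[OF bounded_bilinear_cinner u'(2,1)]] _ neg])
      fix x assume x: "x \<in> {0..pi} - (N \<union> {0, pi})"
      then have "\<sigma> x = dagger (\<sigma> x)" by (intro N(2)) auto
      then have sa: "cinner (\<sigma> x *v a) b = cinner a (\<sigma> x *v b)" for a b using cinner_dagger by metis
      have "cinner (snd (u x)) (fst (sys \<sigma> (complex_of_real l) x (u x) + 0)) + cinner (snd (sys \<sigma> (complex_of_real l) x (u x) + 0)) (fst (u x)) =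
        cinner (z x) (z x) - l * cinner (y x) (y x) - cinner (\<sigma> x *v y x) (\<sigma> x *v y x)"
        unfolding sys_def matrix_vector_mul_assoc[symmetric] by (simp add: cinner_simps sa y_def z_def algebra_simps)
      then show "Re (cinner (snd (u x)) (fst (sys \<sigma> (complex_of_real l) x (u x) + 0)) + cinner (snd (sys \<sigma> (complex_of_real l) x (u x) + 0)) (fst (u x))) =
        (norm (z x))\<^sup>2 - l * (norm (y x))\<^sup>2 - (norm (\<sigma> x *v y x))\<^sup>2"
        by (simp add: cinner_self)
    qed (simp add: y_def z_def)
    have s2i: "(\<lambda>x. (norm (\<sigma> x))\<^sup>2) integrable_on {0..pi}" using L2_imp_integrable(3)[OF L2_\<sigma>] by (simp add: absolutely_integrable_on_def)
    have "Z2 - l * Y2 - s\<^sup>2 * S\<^sup>2 \<le> Z2 - l * Y2 - integral {0..pi} (\<lambda>x. (norm (\<sigma> x))\<^sup>2) * S\<^sup>2"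
      using s2 by (simp add: mult_right_mono)
    also have "\<dots> = integral {0..pi} (\<lambda>x. (norm (z x))\<^sup>2 - l * (norm (y x))\<^sup>2 - (norm (\<sigma> x))\<^sup>2 * S\<^sup>2)"
      using y2 z2 s2i by (simp add: Henstock_Kurzweil_Integration.integral_diff integrable_diff integrable_on_mult_right integrable_on_mult_left Y2_def Z2_def)
    also have "\<dots> \<le> integral {0..pi} (\<lambda>x. (norm (z x))\<^sup>2 - l * (norm (y x))\<^sup>2 - (norm (\<sigma> x *v y x))\<^sup>2)"
    proof (rule integral_le)
      show "(\<lambda>x. (norm (z x))\<^sup>2 - l * (norm (y x))\<^sup>2 - (norm (\<sigma> x))\<^sup>2 * S\<^sup>2) integrable_on {0..pi}"
        using y2 z2 s2i by (intro integrable_diff integrable_on_mult_right integrable_on_mult_left)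
      show "(\<lambda>x. (norm (z x))\<^sup>2 - l * (norm (y x))\<^sup>2 - (norm (\<sigma> x *v y x))\<^sup>2) integrable_on {0..pi}"
        by (rule primitive_onD(2)[OF p])
      fix x assume x: "x \<in> {0..pi}"
      have "norm (\<sigma> x *v y x) \<le> norm (\<sigma> x) * S"
        by (rule order_trans[OF norm_matrix_vector_mult_le]) (use S(2)[OF x] in \<open>auto intro: mult_left_mono\<close>)
      then have "(norm (\<sigma> x *v y x))\<^sup>2 \<le> (norm (\<sigma> x) * S)\<^sup>2" by (intro power_mono) auto
      then show "(norm (z x))\<^sup>2 - l * (norm (y x))\<^sup>2 - (norm (\<sigma> x))\<^sup>2 * S\<^sup>2 \<le> (norm (z x))\<^sup>2 - l * (norm (y x))\<^sup>2 - (norm (\<sigma> x *v y x))\<^sup>2"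
        by (simp add: power_mult_distrib)
    qed
    also have "\<dots> = Re (cinner (z pi) (y pi)) - Re (cinner (z 0) (y 0))"
      using primitive_onD(4)[OF p, of pi] by simp
    also have "\<dots> \<le> h * S\<^sup>2 + h * S\<^sup>2"
      using cinner_bc_bound[OF T1 b0 h(1), of S] cinner_bc_bound[OF T2 b1 h(2), of S] S(2)[of 0] S(2)[of pi]
      by (simp add: y_def z_def abs_le_iff)
    finally show ?thesis by simp
  qed
  \<comment> \<open>The square of the minimum of |y| is at most the mean of |y|^2, and the square of
    the maximum exceeds it by at most the integral of the modulus of the derivative of |y|^2, in
    which y' = \<sigma> y + z.\<close>
  have sobolev: "S\<^sup>2 \<le> Y2 / pi + (2 * S * s * sqrt Y2 + 2 * sqrt Z2 * sqrt Y2)"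
  proof -
    have "integral {0..pi} (\<lambda>x. (norm (y x1))\<^sup>2) \<le> Y2" unfolding Y2_def
      using x1 y2 by (intro integral_le power_mono) auto
    then have min: "(norm (y x1))\<^sup>2 \<le> Y2 / pi" by (simp add: field_simps)
    define f where "f x = Re (cinner (y x) (fst (sys \<sigma> (complex_of_real l) x (u x) + 0)) + cinner (fst (sys \<sigma> (complex_of_real l) x (u x) + 0)) (y x))" for x
    have p: "primitive_on 0 pi (\<lambda>x. (norm (y x))\<^sup>2) f"
      using primitive_on_linear[OF bounded_linear_Re primitive_on_bilinear[OF bounded_bilinear_cinner u'(1,1)]]
      by (simp add: f_def[abs_def] y_def[abs_def] cinner_self)
    define g where "g x = 2 * S * (norm (\<sigma> x) * norm (y x)) + 2 * (norm (z x) * norm (y x))" for x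
    have fg: "norm (f x) \<le> g x" if x: "x \<in> {0..pi}" for x
    proof -
      let ?d = "fst (sys \<sigma> (complex_of_real l) x (u x) + 0)"
      have "norm (f x) \<le> norm (cinner (y x) ?d) + norm (cinner ?d (y x))"
        unfolding f_def by (rule order_trans[OF abs_Re_le_cmod[unfolded real_norm_def[symmetric]] norm_triangle_ineq])
      also have "\<dots> \<le> 2 * (norm (y x) * norm ?d)"
        using norm_cinner_le[of "y x" ?d] norm_cinner_le[of ?d "y x"] by (simp add: mult.commute)
      also have "\<dots> \<le> 2 * (norm (y x) * (norm (\<sigma> x) * norm (y x) + norm (z x)))"
        by (intro mult_left_mono) (simp_all add: sys_def y_def z_def norm_triangle_le norm_matrix_vector_mult_le)
      also have "2 * (norm (y x) * (norm (\<sigma> x) * norm (y x) + norm (z x))) = 2 * norm (y x) * (norm (\<sigma> x) * norm (y x)) + 2 * (norm (z x) * norm (y x))"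
        by (simp add: algebra_simps)
      also have "\<dots> \<le> g x" unfolding g_def using S(2)[OF x] by (intro add_right_mono mult_right_mono) auto
      finally show ?thesis by simp
    qed
    have syi: "(\<lambda>x. norm (\<sigma> x) * norm (y x)) integrable_on {0..pi}"
    proof -
      have "(\<lambda>x. norm (y x) * norm (\<sigma> x)) absolutely_integrable_on {0..pi}"
        by (intro absolutely_integrable_on_continuous_bilinear[OF bounded_bilinear_mult] L2_imp_integrable(2)[OF L2_\<sigma>] continuous_intros yc)
      then show ?thesis by (simp add: absolutely_integrable_on_def mult.commute)
    qed
    have zyi: "(\<lambda>x. norm (z x) * norm (y x)) integrable_on {0..pi}"
      by (intro integrable_continuous_real continuous_intros yc zc)
    have gi: "g integrable_on {0..pi}" unfolding g_def using syi zyi by (intro integrable_add integrable_on_mult_right)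
    have diff: "\<bar>(norm (y d))\<^sup>2 - (norm (y c))\<^sup>2\<bar> \<le> integral {0..pi} g" if cd: "0 \<le> c" "c \<le> d" "d \<le> pi" for c d
    proof -
      have "(norm (y d))\<^sup>2 - (norm (y c))\<^sup>2 = integral {c..d} f" by (rule primitive_on_combine[OF p cd])
      also have "\<bar>integral {c..d} f\<bar> \<le> integral {c..d} g"
        using integral_norm_bound_integral[of f "{c..d}" g] primitive_onD(3)[OF p cd(1,3)] fg cd integrable_on_subinterval[OF gi, of c d]
        by auto
      also have "\<dots> \<le> integral {0..pi} g"
      proof -
        have "0 \<le> g x" if "x \<in> {0..pi}" for x using order_trans[OF norm_ge_zero fg[OF that]] .
        then show ?thesis using integrable_on_subinterval[OF gi, of c d] gi cd by (intro integral_subset_le) auto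
      qed
      finally show ?thesis .
    qed
    have "S\<^sup>2 - (norm (y x1))\<^sup>2 \<le> integral {0..pi} g"
      using diff[of x0 x1] diff[of x1 x0] x0(1) x1(1) by (cases "x0 \<le> x1") (auto simp: S_def)
    also have "integral {0..pi} g = 2 * S * integral {0..pi} (\<lambda>x. norm (\<sigma> x) * norm (y x)) + 2 * integral {0..pi} (\<lambda>x. norm (z x) * norm (y x))"
      unfolding g_def using syi zyi by (simp add: Henstock_Kurzweil_Integration.integral_add integrable_on_mult_right)
    also have "integral {0..pi} (\<lambda>x. norm (\<sigma> x) * norm (y x)) \<le> s * sqrt Y2"
    proof -
      have "(integral {0..pi} (\<lambda>x. norm (\<sigma> x) * norm (y x)))\<^sup>2 \<le> integral {0..pi} (\<lambda>x. (norm (\<sigma> x))\<^sup>2) * Y2"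
        unfolding Y2_def using syi y2 L2_imp_integrable(3)[OF L2_\<sigma>]
        by (intro Cauchy_Schwarz_integral) (auto simp: absolutely_integrable_on_def)
      also have "\<dots> \<le> s\<^sup>2 * Y2" using s2 YZ by (intro mult_right_mono)
      finally have "integral {0..pi} (\<lambda>x. norm (\<sigma> x) * norm (y x)) \<le> sqrt (s\<^sup>2 * Y2)" by (rule real_le_rsqrt)
      then show ?thesis using s2(2) by (simp add: real_sqrt_mult)
    qed
    also have "integral {0..pi} (\<lambda>x. norm (z x) * norm (y x)) \<le> sqrt Z2 * sqrt Y2"
    proof -
      have "(integral {0..pi} (\<lambda>x. norm (z x) * norm (y x)))\<^sup>2 \<le> Z2 * Y2"
        unfolding Y2_def Z2_def using zyi y2 z2 by (intro Cauchy_Schwarz_integral)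
      then have "integral {0..pi} (\<lambda>x. norm (z x) * norm (y x)) \<le> sqrt (Z2 * Y2)" by (rule real_le_rsqrt)
      then show ?thesis by (simp add: real_sqrt_mult)
    qed
    finally show ?thesis using min S(1) by (simp add: mult_left_mono mult_right_mono algebra_simps)
  qed
  define Y Z where "Y = sqrt Y2" and "Z = sqrt Z2"
  have YZ': "Y2 = Y\<^sup>2" "Z2 = Z\<^sup>2" using YZ by (auto simp: Y_def Z_def)
  have q0: "q \<ge> 0" using h0 by (simp add: q_def)
  \<comment> \<open>This product is absorbed into half of the \<open>S\<^sup>2\<close> on the
    left-hand side.\<close>
  have "2 * S * s * Y \<le> S\<^sup>2 / 2 + 2 * (s * Y)\<^sup>2"
    using zero_le_power2[of "S - 2 * (s * Y)"] by (simp add: power2_eq_square algebra_simps)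
  moreover have "2 * (Y\<^sup>2 / pi) \<le> Y\<^sup>2" using pi_gt3 zero_le_power2[of Y] by (simp add: field_simps mult_right_mono)
  moreover have "S\<^sup>2 \<le> Y2 / pi + (2 * S * s * Y + 2 * Z * Y)"
    using sobolev unfolding Y_def[symmetric] Z_def[symmetric] .
  moreover have "(1 + 4 * s\<^sup>2) * Y\<^sup>2 + 4 * (Z * Y) = Y\<^sup>2 + 2 * (2 * (s * Y)\<^sup>2) + 2 * (2 * Z * Y)"
    by (simp add: power_mult_distrib algebra_simps)
  ultimately have S2: "S\<^sup>2 \<le> (1 + 4 * s\<^sup>2) * Y\<^sup>2 + 4 * (Z * Y)"
    unfolding YZ'(1) by linarith
  have "q * S\<^sup>2 \<le> q * ((1 + 4 * s\<^sup>2) * Y\<^sup>2 + 4 * (Z * Y))" using S2 q0 by (rule mult_left_mono)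
  \<comment> \<open>Completing the square with \<open>Z - 2 * q * Y\<close> absorbs the mixed term
    into \<open>Z\<^sup>2\<close>, which then cancels against the one in the energy
    inequality.\<close>
  also have "\<dots> \<le> (q * (1 + 4 * s\<^sup>2) + 4 * q\<^sup>2) * Y\<^sup>2 + Z\<^sup>2"
    using zero_le_power2[of "Z - 2 * q * Y"] by (simp add: power2_eq_square algebra_simps)
  finally have "- (q * (1 + 4 * s\<^sup>2) + 4 * q\<^sup>2) * Y\<^sup>2 \<le> l * Y\<^sup>2"
    using energy unfolding YZ' by (simp add: q_def algebra_simps)
  then show ?thesis using Y2pos unfolding YZ'(1) by (simp only: mult_le_cancel_right_pos)
qed

end

subsection \<open>The homotopy to the free problem\<close>

text \<open>Stated with the exported constant, because the parameters of the locale themselves vary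
  with \<open>t\<close>.\<close>

definition charmat_homotopy where
  "charmat_homotopy \<sigma> T1 H1 T2 H2 t = sturm_liouville.charmat (\<lambda>x. t *\<^sub>R \<sigma> x) T1 (t *\<^sub>R H1) T2 (t *\<^sub>R H2)"

context sturm_liouville
begin

abbreviation "cm \<equiv> charmat_homotopy \<sigma> T1 H1 T2 H2"

lemma cm_1: "cm 1 = charmat"
  by (simp add: charmat_homotopy_def)

lemma scaled: "sturm_liouville (\<lambda>x. t *\<^sub>R \<sigma> x) T1 (t *\<^sub>R H1) T2 (t *\<^sub>R H2)"
proof
  show "AE x in lebesgue_on {0<..<pi}. t *\<^sub>R \<sigma> x = dagger (t *\<^sub>R \<sigma> x)"
    using hermitian_\<sigma> by eventually_elim (simp add: dagger_scaleR)
qed (use T1 T2 H1 H2 L2_scaleR[OF L2_\<sigma>] in \<open>simp_all add: dagger_scaleR scaleR_matrix_mult flip: T1 T2 H1 H2\<close>)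

lemma cm_continuous: "continuous_on ({0..1} \<times> UNIV) (\<lambda>p. cm (fst p) (snd p) $ i $ j)"
proof -
  define u where "u t = (T1 *v axis j 1, perp T1 *v axis j 1 + t *\<^sub>R (H1 *v (T1 *v axis j 1)))" for t
  have uc: "continuous_on {0..1} u" unfolding u_def by (intro continuous_intros)
  define w where "w p = flow (\<lambda>x. fst p *\<^sub>R \<sigma> x) (snd p) (u (fst p)) pi" for p
  have wc: "continuous_on ({0..1} \<times> UNIV) w"
    unfolding w_def by (rule continuous_on_flow[OF L2_\<sigma> uc]) simp
  have "cm (fst p) (snd p) $ i $ j = (T2 *v (snd (w p) - fst p *\<^sub>R (H2 *v fst (w p))) - perp T2 *v fst (w p)) $ i" for p
  proof -
    interpret t: sturm_liouville "\<lambda>x. fst p *\<^sub>R \<sigma> x" T1 "fst p *\<^sub>R H1" T2 "fst p *\<^sub>R H2" by (rule scaled)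
    show ?thesis
      by (simp add: charmat_homotopy_def t.charmat_def matrix_def t.bc2_def t.init_def boundary_form_def w_def u_def scaleR_matrix_vector_mult)
  qed
  moreover have "continuous_on ({0..1} \<times> UNIV) (\<lambda>p. (T2 *v (snd (w p) - fst p *\<^sub>R (H2 *v fst (w p))) - perp T2 *v fst (w p)) $ i)"
    by (intro continuous_on_component continuous_on_diff matrix_vector_mult_linear_continuous_on continuous_on_compose2[OF matrix_vector_mult_linear_continuous_on[of UNIV]]
        continuous_on_scaleR continuous_on_fst continuous_on_snd wc continuous_on_id) auto
  ultimately show ?thesis by simp
qed

definition mult :: "real \<Rightarrow> real \<Rightarrow> nat" where
  "mult t x = vec.dim {v. cm t (complex_of_real x) *v v = 0}"

lemma mult_eq_0_iff: "mult t x = 0 \<longleftrightarrow> det (cm t (complex_of_real x)) \<noteq> 0"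
proof -
  have "vec.dim {v. A *v v = 0} = 0 \<longleftrightarrow> det A \<noteq> 0" for A :: "complex^'m^'m"
    using vec.dim_eq_0[of "{v. A *v v = 0}"] by (auto simp: det_eq_0_iff_kernel)
  then show ?thesis by (simp add: mult_def)
qed

lemma cm_det_holomorphic: "(\<lambda>z. det (cm t z)) holomorphic_on UNIV"
  unfolding charmat_homotopy_def by (intro holomorphic_on_det sturm_liouville.charmat_holomorphic scaled)

lemma cm_det_zero_real: "det (cm t z) = 0 \<Longrightarrow> z \<in> \<real>"
  unfolding charmat_homotopy_def using sturm_liouville.charmat_kernel_real[OF scaled] by (auto simp: det_eq_0_iff_kernel)

lemma zorder_det_cm: "zorder (\<lambda>z. det (cm t z)) (complex_of_real x) = int (mult t x)"
proof -
  interpret t: sturm_liouville "\<lambda>x. t *\<^sub>R \<sigma> x" T1 "t *\<^sub>R H1" T2 "t *\<^sub>R H2" by (rule scaled)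
  have cm: "cm t = t.charmat" by (simp add: charmat_homotopy_def)
  have d: "(\<chi> i j. deriv (\<lambda>z. cm t z $ i $ j) \<mu>) = t.charmat_deriv \<mu>" for \<mu>
    unfolding cm by (simp add: vec_eq_iff DERIV_imp_deriv[OF t.charmat_has_derivative])
  show ?thesis unfolding mult_def
  proof (rule zorder_det_semisimple[of UNIV])
    fix v w assume "cm t (complex_of_real x) *v v = 0"
      "(\<chi> i j. deriv (\<lambda>z. cm t z $ i $ j) (complex_of_real x)) *v v = cm t (complex_of_real x) *v w"
    then show "v = 0" unfolding d unfolding cm by (rule t.charmat_semisimple[rotated]) simp
  qed (use t.charmat_holomorphic in \<open>auto simp: cm\<close>)
qed

lemma finite_cm_zeros: "finite {x. x \<in> {a..b} \<and> mult t x \<noteq> 0}"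
proof -
  have "det (cm t \<i>) \<noteq> 0" using cm_det_zero_real[of t \<i>] by (auto simp: complex_is_Real_iff)
  then have "finite {z \<in> cball 0 (\<bar>a\<bar> + \<bar>b\<bar>). det (cm t z) = 0}" by (intro finite_zeros_ball[OF cm_det_holomorphic])
  then have "finite (Re ` {z \<in> cball 0 (\<bar>a\<bar> + \<bar>b\<bar>). det (cm t z) = 0})" by simp
  then show ?thesis
  proof (rule finite_subset[rotated], intro subsetI)
    fix x assume "x \<in> {x. x \<in> {a..b} \<and> mult t x \<noteq> 0}"
    then show "x \<in> Re ` {z \<in> cball 0 (\<bar>a\<bar> + \<bar>b\<bar>). det (cm t z) = 0}"
      by (intro image_eqI[of _ _ "complex_of_real x"]) (auto simp: mult_eq_0_iff dist_norm)
  qed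
qed

text \<open>The disc with diameter (a, b) is used: for every \<open>t\<close> all zeros are real, so
  its boundary circle can meet them only at \<open>a\<close> and \<open>b\<close>, where they are
  excluded.\<close>

lemma count_invariant:
  assumes "a < b" and ne: "\<And>t. t \<in> {0..1} \<Longrightarrow> mult t a = 0 \<and> mult t b = 0"
  shows "(\<Sum>x | x \<in> {a<..<b} \<and> mult 0 x \<noteq> 0. mult 0 x) = (\<Sum>x | x \<in> {a<..<b} \<and> mult 1 x \<noteq> 0. mult 1 x)"
proof -
  define c where "c = complex_of_real ((a + b) / 2)"
  define R where "R = (b - a) / 2"
  have dist_c: "dist c (complex_of_real x) = \<bar>(a + b) / 2 - x\<bar>" for x
    unfolding c_def dist_of_real by (simp add: dist_real_def)
  have conv: "(\<Sum>z | z \<in> ball c R \<and> det (cm t z) = 0. zorder (\<lambda>z. det (cm t z)) z) = int (\<Sum>x | x \<in> {a<..<b} \<and> mult t x \<noteq> 0. mult t x)" for t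
  proof -
    have eq: "{z. z \<in> ball c R \<and> det (cm t z) = 0} = complex_of_real ` {x. x \<in> {a<..<b} \<and> mult t x \<noteq> 0}"
    proof (intro set_eqI iffI)
      fix z assume z: "z \<in> {z. z \<in> ball c R \<and> det (cm t z) = 0}"
      then obtain x where x: "z = complex_of_real x" using cm_det_zero_real Reals_cases by blast
      have "\<bar>(a + b) / 2 - x\<bar> < R" using z x by (simp add: dist_c)
      then have "a < x" "x < b" by (auto simp: R_def abs_less_iff field_simps)
      then show "z \<in> complex_of_real ` {x. x \<in> {a<..<b} \<and> mult t x \<noteq> 0}" using z x by (auto simp: mult_eq_0_iff)
    next
      fix z assume "z \<in> complex_of_real ` {x. x \<in> {a<..<b} \<and> mult t x \<noteq> 0}"
      then obtain x where x: "z = complex_of_real x" "a < x" "x < b" "det (cm t (complex_of_real x)) = 0" by (auto simp: mult_eq_0_iff)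
      have "\<bar>(a + b) / 2 - x\<bar> < R" using x by (auto simp: R_def abs_less_iff field_simps)
      then show "z \<in> {z. z \<in> ball c R \<and> det (cm t z) = 0}" using x by (simp add: dist_c)
    qed
    show ?thesis unfolding eq by (subst sum.reindex) (auto simp: inj_on_def zorder_det_cm)
  qed
  have "(\<Sum>z | z \<in> ball c R \<and> det (cm 0 z) = 0. zorder (\<lambda>z. det (cm 0 z)) z) = (\<Sum>z | z \<in> ball c R \<and> det (cm 1 z) = 0. zorder (\<lambda>z. det (cm 1 z)) z)"
  proof (rule zero_count_homotopy)
    show "(\<lambda>z. det (cm t z)) holomorphic_on UNIV" for t by (rule cm_det_holomorphic)
    show "continuous_on ({0..1} \<times> UNIV) (\<lambda>p. det (cm (fst p) (snd p)))" by (intro continuous_on_det cm_continuous)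
    show "R > 0" using \<open>a < b\<close> by (simp add: R_def)
    fix t z assume t: "t \<in> {0..1::real}" and z: "z \<in> sphere c R"
    show "det (cm t z) \<noteq> 0"
    proof
      assume 0: "det (cm t z) = 0"
      then obtain x where x: "z = complex_of_real x" using cm_det_zero_real Reals_cases by blast
      then have "\<bar>(a + b) / 2 - x\<bar> = R" using z by (simp add: dist_c)
      then have "x = a \<or> x = b" by (auto simp: R_def abs_if field_simps split: if_splits)
      then show False using ne[OF t] 0 x by (auto simp: mult_eq_0_iff)
    qed
  qed
  then show ?thesis unfolding conv by (simp only: of_nat_eq_iff)
qed

lemma cm_lower_bound: "\<exists>M. \<forall>t\<in>{0..1}. \<forall>x. mult t x \<noteq> 0 \<longrightarrow> - M \<le> x"
proof -
  define s2 where "s2 = integral {0..pi} (\<lambda>x. (norm (\<sigma> x))\<^sup>2)"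
  have s2i: "(\<lambda>x. (norm (\<sigma> x))\<^sup>2) integrable_on {0..pi}" using L2_imp_integrable(3)[OF L2_\<sigma>] by (simp add: absolutely_integrable_on_def)
  have s2: "s2 \<ge> 0" unfolding s2_def using s2i by (intro integral_nonneg) auto
  define h where "h = max (norm H1) (norm H2)"
  define q where "q = (sqrt s2)\<^sup>2 + 2 * h"
  have "- (q * (1 + 4 * (sqrt s2)\<^sup>2) + 4 * q\<^sup>2) \<le> x" if t: "t \<in> {0..1}" and m: "mult t x \<noteq> 0" for t x
  proof -
    interpret t: sturm_liouville "\<lambda>x. t *\<^sub>R \<sigma> x" T1 "t *\<^sub>R H1" T2 "t *\<^sub>R H2" by (rule scaled)
    have "det (t.charmat (complex_of_real x)) = 0" using m by (simp add: mult_eq_0_iff charmat_homotopy_def)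
    then obtain v where v: "v \<noteq> 0" "t.charmat (complex_of_real x) *v v = 0" by (auto simp: det_eq_0_iff_kernel)
    have "integral {0..pi} (\<lambda>x. (norm (t *\<^sub>R \<sigma> x))\<^sup>2) = t\<^sup>2 * s2" by (simp add: power_mult_distrib s2_def)
    also have "\<dots> \<le> s2" using t s2 by (intro mult_left_le_one_le) (auto simp: power_le_one)
    finally have "integral {0..pi} (\<lambda>x. (norm (t *\<^sub>R \<sigma> x))\<^sup>2) \<le> (sqrt s2)\<^sup>2" using s2 by simp
    moreover have "norm (t *\<^sub>R H1) \<le> h" "norm (t *\<^sub>R H2) \<le> h"
      using t mult_left_le_one_le[of "norm H1" t] mult_left_le_one_le[of "norm H2" t] by (auto simp: h_def le_max_iff_disj)
    ultimately show ?thesis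
      unfolding q_def using v s2 by (intro t.charmat_kernel_lower_bound) auto
  qed
  then show ?thesis by (intro exI[of _ "q * (1 + 4 * (sqrt s2)\<^sup>2) + 4 * q\<^sup>2"]) auto
qed

end


section \<open>The free problem\<close>

definition kernel_dim :: "complex^'n^'n \<Rightarrow> nat" where "kernel_dim A = vec.dim {v. A *v v = 0}"

lemma kernel_dim_eq_0_iff: "kernel_dim A = 0 \<longleftrightarrow> det A \<noteq> 0"
  unfolding kernel_dim_def using vec.dim_eq_0[of "{v. A *v v = 0}"] by (auto simp: det_eq_0_iff_kernel)

lemma kernel_dim_cong:
  fixes A B :: "complex^'n^'n"
  assumes lin: "Vector_Spaces.linear (*s) (*s) f" and inj: "\<And>v. f v = 0 \<Longrightarrow> v = 0"
    and surj: "\<And>w. B *v w = 0 \<Longrightarrow> \<exists>v. f v = w" and iff: "\<And>v. A *v v = 0 \<longleftrightarrow> B *v f v = 0"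
  shows "kernel_dim A = kernel_dim B"
proof -
  have "inj f" using inj module_hom.inj_iff_eq_0[OF lin[unfolded linear_iff_module_hom]] by blast
  then have "vec.dim (f ` {v. A *v v = 0}) = vec.dim {v. A *v v = 0}"
    by (intro vec.dim_image_eq[OF lin]) (auto intro: inj_on_subset)
  moreover have "f ` {v. A *v v = 0} = {w. B *v w = 0}" using iff surj by auto
  ultimately show ?thesis by (simp add: kernel_dim_def)
qed

lemma map_matrix_mult: "map_matrix ((*) c) A *v v = c *s (A *v v)"
  by (simp add: vec_eq_iff map_matrix_def matrix_vector_mult_def sum_distrib_left mult.assoc)

lemma matrix_vector_mult_2: "A *v (2 * x) = 2 * (A *v x)" "A *v (x * 2) = 2 * (A *v x)" for A :: "complex^'n^'m"
  by (simp_all only: mult_2 mult_2_right matrix_vector_right_distrib)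

lemma cinner_2: "cinner (2 * x) y = 2 * cinner x y" "cinner x (2 * y) = 2 * cinner x y"
  "cinner (x * 2) y = 2 * cinner x y" "cinner x (y * 2) = 2 * cinner x y"
  by (simp_all only: mult_2 mult_2_right cinner_simps)

locale projections =
  fixes T1 T2 :: "complex^'m^'m"
  assumes T1: "T1 = dagger T1" "T1 = T1 ** T1" and T2: "T2 = dagger T2" "T2 = T2 ** T2"
begin

lemma idem: "T1 *v (T1 *v v) = T1 *v v" "T2 *v (T2 *v v) = T2 *v v"
  using T1(2) T2(2) by (metis matrix_vector_mul_assoc)+

lemma symmetric: "cinner (T1 *v a) b = cinner a (T1 *v b)" "cinner (T2 *v a) b = cinner a (T2 *v b)"
  using T1(1) T2(1) cinner_dagger by metis+

lemma perp_mult: "perp T *v v = v - T *v v" for T :: "complex^'m^'m"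
  by (simp add: perp_def matrix_vector_mult_diff_rdistrib)

definition "S1 v = T1 *v v + T1 *v v - v"
definition "S2 v = T2 *v v + T2 *v v - v"
definition "U v = S2 (S1 v)"

text \<open>The sine coefficient alone equals (1 + U)/2, but the cosine coefficient is (S1 - S2)/2.
  These phases on the ranges and kernels of \<open>T2\<close> and \<open>T1\<close>, undone by
  \<open>A'\<close> and \<open>B'\<close>, bring both to functions of \<open>U\<close>
  simultaneously.\<close>

definition "A v = - (T2 *v v) - \<i> *s (v - T2 *v v)"
definition "A' v = - (T2 *v v) + \<i> *s (v - T2 *v v)"
definition "B v = \<i> *s (T1 *v v) + (v - T1 *v v)"
definition "B' v = - \<i> *s (T1 *v v) + (v - T1 *v v)"

lemmas vs_simps = matrix_vector_right_distrib matrix_vector_mult_diff_distrib matrix_vector_mult_scale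
  vec.scale_right_distrib vec.scale_right_diff_distrib vec.scale_left_distrib vec.scale_left_diff_distrib vec.neg idem matrix_vector_mult_2

lemma linear_maps:
  "U (c *s v) = c *s U v" "A (c *s v) = c *s A v" "A (v - w) = A v - A w" "A (v + w) = A v + A w"
  "B (c *s v) = c *s B v" "B (v + w) = B v + B w" "U (v - w) = U v - U w" "U (v + w) = U v + U w"
  by (simp_all add: U_def S1_def S2_def A_def B_def vs_simps vec_eq_iff algebra_simps)

lemma A_inverse: "A' (A v) = v" by (simp add: A_def A'_def vs_simps vec_eq_iff algebra_simps)
lemma B_inverse: "B' (B v) = v" "B (B' v) = v" by (simp_all add: B_def B'_def vs_simps vec_eq_iff algebra_simps)

lemma S_S: "S1 (S1 v) = v" "S2 (S2 v) = v"
  by (simp_all add: S1_def S2_def vs_simps vec_eq_iff algebra_simps)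

lemma S_symmetric: "cinner (S1 a) b = cinner a (S1 b)" "cinner (S2 a) b = cinner a (S2 b)"
  by (simp_all add: S1_def S2_def cinner_simps cinner_2 symmetric)

lemma U_unitary: "cinner (U a) (U b) = cinner a b"
  by (metis U_def S_S S_symmetric)

lemma norm_U: "norm (U v) = norm v"
proof -
  have "complex_of_real ((norm (U v))\<^sup>2) = of_real ((norm v)\<^sup>2)" using U_unitary[of v v] by (simp only: cinner_self)
  then have "(norm (U v))\<^sup>2 = (norm v)\<^sup>2" by (simp only: of_real_eq_iff)
  then show ?thesis by simp
qed

lemma W0_mult_split: "W0 T1 T2 \<rho> *v v =
    sin (\<rho> * of_real pi) *s (T2 *v (T1 *v v) + (v - T1 *v v - T2 *v (v - T1 *v v))) +
    cos (\<rho> * of_real pi) *s ((T1 *v v - T2 *v (T1 *v v)) - T2 *v (v - T1 *v v))"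
  unfolding W0_def matrix_vector_mult_add_rdistrib map_matrix_mult
  by (simp add: matrix_vector_mult_add_rdistrib matrix_vector_mult_diff_rdistrib perp_mult flip: matrix_vector_mul_assoc)

text \<open>
  In terms of the unitary \<open>U = (2 T\<^sub>2 - 1) (2 T\<^sub>1 - 1)\<close>, the two coefficients of \<open>W\<^sup>0\<close> are
  \<open>\<i>/2 A (1 + U) B\<close> and \<open>1/2 A (1 - U) B\<close> with \<open>A\<close>, \<open>B\<close> unitary.
\<close>

lemma W0_coefficients:
  "T2 *v (T1 *v v) + (v - T1 *v v - T2 *v (v - T1 *v v)) = (\<i> / 2) *s A (B v + U (B v))"
  "(T1 *v v - T2 *v (T1 *v v)) - T2 *v (v - T1 *v v) = (1 / 2) *s A (B v - U (B v))"
  by (simp_all add: U_def S1_def S2_def A_def B_def vs_simps vec_eq_iff field_simps)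

lemma cis_trig: "sin z = (exp (\<i> * z) - exp (- \<i> * z)) / (2 * \<i>)" "cos z = (exp (\<i> * z) + exp (- \<i> * z)) / 2" for z :: complex
  by (simp_all add: sin_exp_eq cos_exp_eq)

text \<open>Collecting exponentials turns the trigonometric expression, up to invertible factors,
  into exp (2 i \<rho> \<pi>) - U. Zeros of \<open>w0\<close> thus correspond to eigenvalues of a
  unitary operator.\<close>

lemma W0_mult: "W0 T1 T2 \<rho> *v v =
   (exp (- \<i> * (\<rho> * of_real pi)) / 2) *s A (exp (2 * \<i> * (\<rho> * of_real pi)) *s B v - U (B v))"
proof -
  let ?e = "exp (\<i> * (\<rho> * of_real pi))" and ?f = "exp (- \<i> * (\<rho> * of_real pi))"
  have e2: "exp (2 * \<i> * (\<rho> * of_real pi)) = ?e * ?e" by (simp add: algebra_simps flip: exp_add)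
  have fe: "?f * ?e = 1" by (simp flip: exp_add)
  have fee: "?f * (?e * ?e) = ?e" using fe by (simp flip: mult.assoc)
  have "W0 T1 T2 \<rho> *v v = ((?e - ?f) / 4) *s (A (B v) + A (U (B v))) + ((?e + ?f) / 4) *s (A (B v) - A (U (B v)))"
    unfolding W0_mult_split W0_coefficients cis_trig by (simp add: linear_maps vec_eq_iff field_simps)
  also have "\<dots> = (?e / 2) *s A (B v) - (?f / 2) *s A (U (B v))"
    by (simp add: vec_eq_iff field_simps)
  also have "\<dots> = (?f / 2) *s ((?e * ?e) *s A (B v) - A (U (B v)))"
    using fee by (simp add: vec_eq_iff algebra_simps)
  finally show ?thesis by (simp add: e2 linear_maps)
qed

lemma A_eq_0: "A v = 0 \<longleftrightarrow> v = 0"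
proof
  assume "A v = 0"
  then have "A' (A v) = A' 0" by simp
  then show "v = 0" unfolding A_inverse by (simp add: A'_def)
qed (simp add: A_def)

lemma W0_kernel: "W0 T1 T2 \<rho> *v v = 0 \<longleftrightarrow> U (B v) = exp (2 * \<i> * (\<rho> * of_real pi)) *s B v"
  by (auto simp: W0_mult A_eq_0)

lemma W0_entry: "W0 T1 T2 z $ i $ j = sin (z * of_real pi) * (T2 ** T1 + perp T2 ** perp T1) $ i $ j
      + cos (z * of_real pi) * (perp T2 ** T1 - T2 ** perp T1) $ i $ j"
  by (simp add: W0_def map_matrix_def)

lemma W0_holomorphic: "(\<lambda>z. W0 T1 T2 z $ i $ j) holomorphic_on S"
  unfolding W0_entry by (intro holomorphic_intros)

lemma W0_deriv_mult:
  "(\<chi> i j. deriv (\<lambda>z. W0 T1 T2 z $ i $ j) z) *v v = of_real pi *s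
     (cos (z * of_real pi) *s ((T2 ** T1 + perp T2 ** perp T1) *v v) - sin (z * of_real pi) *s ((perp T2 ** T1 - T2 ** perp T1) *v v))"
proof -
  define M N where "M = T2 ** T1 + perp T2 ** perp T1" and "N = perp T2 ** T1 - T2 ** perp T1"
  have d: "deriv (\<lambda>z. W0 T1 T2 z $ i $ j) z = of_real pi * (cos (z * of_real pi) * M $ i $ j - sin (z * of_real pi) * N $ i $ j)" for i j
    unfolding W0_entry M_def[symmetric] N_def[symmetric]
    by (rule DERIV_imp_deriv) (auto intro!: derivative_eq_intros simp: algebra_simps)
  show ?thesis unfolding d M_def[symmetric] N_def[symmetric]
    by (simp add: vec_eq_iff matrix_vector_mult_def sum_distrib_left sum_subtractf algebra_simps)
qed

text \<open>For a unitary operator the range of \<zeta> - U is orthogonal to the eigenspace of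
  \<zeta>. This excludes Jordan chains, both for \<open>W0\<close> and for \<open>U\<close>
  itself.\<close>

lemma unit_eigen_orthogonal:
  assumes "U b = \<zeta> *s b" "cmod \<zeta> = 1"
  shows "cinner (\<zeta> *s c - U c) b = 0"
proof -
  have z: "\<zeta> * cnj \<zeta> = 1" using assms(2) by (simp add: complex_norm_square[symmetric])
  have "cinner c b = cinner (U c) (U b)" by (simp add: U_unitary)
  also have "\<dots> = cnj \<zeta> * cinner (U c) b" by (simp add: assms(1) cinner_simps)
  finally have "\<zeta> * cinner c b = cinner (U c) b" using z by (simp add: mult.assoc[symmetric])
  then show ?thesis by (simp add: cinner_simps)
qed

text \<open>On the kernel, the derivative acts as a nonzero multiple of \<open>A (B v)\<close>. A
  Jordan chain would therefore put \<open>B v\<close>, an eigenvector of \<open>U\<close>, into the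
  range of \<zeta> - U, to which it is orthogonal.\<close>

lemma W0_semisimple:
  assumes z: "z \<in> \<real>" and v: "W0 T1 T2 z *v v = 0" and w: "(\<chi> i j. deriv (\<lambda>z. W0 T1 T2 z $ i $ j) z) *v v = W0 T1 T2 z *v w"
  shows "v = 0"
proof -
  let ?e = "exp (\<i> * (z * of_real pi))" and ?f = "exp (- \<i> * (z * of_real pi))"
  define \<zeta> where "\<zeta> = exp (2 * \<i> * (z * of_real pi))"
  have \<zeta>: "\<zeta> = ?e * ?e" by (simp add: \<zeta>_def algebra_simps flip: exp_add)
  have fe: "?f * ?e = 1" by (simp flip: exp_add)
  have fee: "?f * (?e * ?e) = ?e" using fe by (simp flip: mult.assoc)
  obtain x where x: "z = complex_of_real x" using z Reals_cases by blast
  have n\<zeta>: "cmod \<zeta> = 1" by (simp add: \<zeta>_def x)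
  have Ub: "U (B v) = \<zeta> *s B v" using v by (simp add: W0_kernel \<zeta>_def)
  have "(\<chi> i j. deriv (\<lambda>z. W0 T1 T2 z $ i $ j) z) *v v = of_real pi *s (cos (z * of_real pi) *s ((\<i> / 2) *s A (B v + U (B v))) - sin (z * of_real pi) *s ((1 / 2) *s A (B v - U (B v))))"
    unfolding W0_deriv_mult W0_coefficients[symmetric]
    by (simp add: matrix_vector_mult_add_rdistrib matrix_vector_mult_diff_rdistrib perp_mult flip: matrix_vector_mul_assoc)
  also have "\<dots> = (of_real pi * \<i> / 2) *s (?e *s A (B v) + ?f *s A (U (B v)))"
    unfolding cis_trig by (simp add: linear_maps vec_eq_iff field_simps)
  also have "\<dots> = (of_real pi * \<i>) *s (?e *s A (B v))"
    using fee unfolding Ub \<zeta> by (simp add: linear_maps vec_eq_iff algebra_simps)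
  finally have "(of_real pi * \<i>) *s (?e *s A (B v)) = (?f / 2) *s A (\<zeta> *s B w - U (B w))"
    using w by (simp add: W0_mult \<zeta>_def)
  \<comment> \<open>The factor \<open>2 * ?e\<close> cancels the prefactor \<open>?f / 2\<close>,
    since \<open>?f * ?e = 1\<close>.\<close>
  then have "(2 * ?e) *s ((of_real pi * \<i>) *s (?e *s A (B v))) = (2 * ?e) *s ((?f / 2) *s A (\<zeta> *s B w - U (B w)))" by simp
  then have "(2 * of_real pi * \<i> * \<zeta>) *s A (B v) = (?f * ?e) *s A (\<zeta> *s B w - U (B w))"
    by (simp add: \<zeta> mult_ac)
  then have "A ((2 * of_real pi * \<i> * \<zeta>) *s B v - (\<zeta> *s B w - U (B w))) = 0"
    unfolding fe by (simp add: linear_maps)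
  then have eq: "(2 * of_real pi * \<i> * \<zeta>) *s B v = \<zeta> *s B w - U (B w)" unfolding A_eq_0 by simp
  have "(2 * of_real pi * \<i> * \<zeta>) * cinner (B v) (B v) = cinner (\<zeta> *s B w - U (B w)) (B v)"
    unfolding eq[symmetric] by (simp add: cinner_simps)
  also have "\<dots> = 0" by (rule unit_eigen_orthogonal[OF Ub n\<zeta>])
  finally have "B v = 0" using n\<zeta> by (auto simp: cnj_inj_zero)
  then show "v = 0" using B_inverse(1)[of v] by (simp add: B'_def)
qed

abbreviation "kd x \<equiv> kernel_dim (W0 T1 T2 (complex_of_real x))"

lemma zorder_w0: "zorder (w0 T1 T2) (complex_of_real x) = int (kd x)"
  unfolding w0_def[abs_def] kernel_dim_def
  by (rule zorder_det_semisimple[of UNIV])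
     (use W0_semisimple[of "complex_of_real x"] W0_holomorphic in auto)

lemma kd_zero_iff: "kd x = 0 \<longleftrightarrow> w0 T1 T2 (complex_of_real x) \<noteq> 0"
  by (simp add: kernel_dim_eq_0_iff w0_def)

lemma W0_periodic: "W0 T1 T2 (\<rho> + of_int n) *v v = (if even n then 1 else - 1) *s (W0 T1 T2 \<rho> *v v)"
proof -
  let ?s = "(if even n then 1 else - 1) :: complex"
  have "sin ((\<rho> + of_int n) * of_real pi) = ?s * sin (\<rho> * of_real pi)" "cos ((\<rho> + of_int n) * of_real pi) = ?s * cos (\<rho> * of_real pi)"
  proof -
    have s: "sin (of_int n * of_real pi :: complex) = 0" "cos (of_int n * of_real pi :: complex) = ?s"
    proof -
      have "sin (of_int n * of_real pi :: complex) = of_real (sin (of_int n * pi))" by (simp flip: sin_of_real)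
      then show "sin (of_int n * of_real pi :: complex) = 0" by (simp add: sin_integer_2pi sin_npi_int mult.commute)
      have "cos (of_int n * of_real pi :: complex) = of_real (cos (of_int n * pi))" by (simp flip: cos_of_real)
      then show "cos (of_int n * of_real pi :: complex) = ?s" by (simp add: cos_npi_int mult.commute)
    qed
    show "sin ((\<rho> + of_int n) * of_real pi) = ?s * sin (\<rho> * of_real pi)" "cos ((\<rho> + of_int n) * of_real pi) = ?s * cos (\<rho> * of_real pi)"
      unfolding distrib_right sin_add cos_add s by simp_all
  qed
  then show ?thesis unfolding W0_mult_split by (simp add: vec_eq_iff algebra_simps)
qed

lemma kd_periodic: "kd (x + of_int n) = kd x"
  unfolding kernel_dim_def using W0_periodic[of "complex_of_real x" n] by (auto simp: vec.scale_eq_0_iff)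

text \<open>The eigenvalues of \<open>U\<close> are counted by deforming \<open>U\<close> to \<open>0\<close> inside the disc of radius 2.\<close>

lemma sum_eigenspace_dims:
  defines "D \<equiv> \<lambda>t \<zeta>. \<chi> i j. (if i = j then \<zeta> else 0) - complex_of_real t * U (axis j 1) $ i"
  shows "(\<Sum>\<zeta> | \<zeta> \<in> ball 0 2 \<and> det (D 1 \<zeta>) = 0. int (kernel_dim (D 1 \<zeta>))) = int CARD('m)"
    and "D t \<zeta> *v v = \<zeta> *s v - complex_of_real t *s U v"
proof -
  have Dv: "D t \<zeta> *v v = \<zeta> *s v - complex_of_real t *s U v" for t \<zeta> v
  proof -
    have "matrix U *v v = U v" by (rule matrix_works) (unfold_locales, simp_all add: linear_maps vs_simps)
    moreover have "(D t \<zeta> *v v) $ i = \<zeta> * v $ i - complex_of_real t * (matrix U *v v) $ i" for i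
      by (simp add: D_def matrix_vector_mult_def matrix_def left_diff_distrib sum_subtractf sum_distrib_left mult.assoc
          if_distrib[of "\<lambda>x. x * _"] cong: if_cong)
    ultimately show ?thesis by (simp add: vec_eq_iff)
  qed
  then show "D t \<zeta> *v v = \<zeta> *s v - complex_of_real t *s U v" .
  have hol: "(\<lambda>\<zeta>. D t \<zeta> $ i $ j) holomorphic_on UNIV" for t i j
    by (cases "i = j") (auto simp: D_def intro!: holomorphic_intros)
  have hold: "(\<lambda>\<zeta>. det (D t \<zeta>)) holomorphic_on UNIV" for t by (intro holomorphic_on_det hol)
  have cont: "continuous_on ({0..1} \<times> UNIV) (\<lambda>p. det (D (fst p) (snd p)))"
  proof (intro continuous_on_det)
    show "continuous_on ({0..1} \<times> UNIV) (\<lambda>p. D (fst p) (snd p) $ i $ j)" for i j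
      by (cases "i = j") (auto simp: D_def intro!: continuous_intros)
  qed
  \<comment> \<open>A kernel vector on the circle would satisfy 2 |v| = t |v| with t at most 1,
    because \<open>U\<close> is isometric; any radius above 1 would do.\<close>
  have ne: "det (D t \<zeta>) \<noteq> 0" if t: "t \<in> {0..1}" and z: "\<zeta> \<in> sphere 0 2" for t \<zeta>
  proof
    assume "det (D t \<zeta>) = 0"
    then obtain v where v: "v \<noteq> 0" "\<zeta> *s v = complex_of_real t *s U v" by (auto simp: det_eq_0_iff_kernel Dv)
    then have "norm (\<zeta> *s v) = norm (complex_of_real t *s U v)" by simp
    then have "2 * norm v = t * norm v" using t z by (simp add: norm_vector_scalar_mult norm_U)
    then show False using t v by simp
  qed
  have count: "(\<Sum>\<zeta> | \<zeta> \<in> ball 0 2 \<and> det (D 0 \<zeta>) = 0. zorder (\<lambda>\<zeta>. det (D 0 \<zeta>)) \<zeta>) =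
     (\<Sum>\<zeta> | \<zeta> \<in> ball 0 2 \<and> det (D 1 \<zeta>) = 0. zorder (\<lambda>\<zeta>. det (D 1 \<zeta>)) \<zeta>)"
    by (rule zero_count_homotopy[OF hold cont _ ne]) auto
  \<comment> \<open>At \<open>t = 0\<close> the only zero is 0, of order \<open>CARD('m)\<close>.
    This total survives to \<open>t = 1\<close>, where semisimplicity turns orders into
    dimensions.\<close>
  have D0: "det (D 0 \<zeta>) = \<zeta> ^ CARD('m)" for \<zeta>
    by (subst det_diagonal) (auto simp: D_def)
  then have "{\<zeta>. \<zeta> \<in> ball 0 2 \<and> det (D 0 \<zeta>) = 0} = {0}" by auto
  moreover have "zorder (\<lambda>\<zeta>. det (D 0 \<zeta>)) 0 = int CARD('m)"
    by (rule zorder_eqI[where S = UNIV and g = "\<lambda>_. 1"]) (auto simp: D0)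
  ultimately have "(\<Sum>\<zeta> | \<zeta> \<in> ball 0 2 \<and> det (D 1 \<zeta>) = 0. zorder (\<lambda>\<zeta>. det (D 1 \<zeta>)) \<zeta>) = int CARD('m)"
    using count by simp
  moreover have "zorder (\<lambda>\<zeta>. det (D 1 \<zeta>)) \<zeta> = int (kernel_dim (D 1 \<zeta>))" for \<zeta>
    unfolding kernel_dim_def
  proof (rule zorder_det_semisimple[of UNIV])
    fix v w assume v: "D 1 \<zeta> *v v = 0" and w: "(\<chi> i j. deriv (\<lambda>z. D 1 z $ i $ j) \<zeta>) *v v = D 1 \<zeta> *v w"
    have "(\<chi> i j. deriv (\<lambda>z. D 1 z $ i $ j) \<zeta>) = mat 1"
      unfolding vec_eq_iff
    proof (intro allI)
      fix i j
      have "((\<lambda>z. D 1 z $ i $ j) has_field_derivative (if i = j then 1 else 0)) (at \<zeta>)"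
        by (cases "i = j") (auto simp: D_def intro!: derivative_eq_intros)
      then show "(\<chi> i j. deriv (\<lambda>z. D 1 z $ i $ j) \<zeta>) $ i $ j = mat 1 $ i $ j"
        by (simp add: DERIV_imp_deriv mat_def)
    qed
    with w have vw: "v = \<zeta> *s w - U w" by (simp add: Dv)
    have Uv: "U v = \<zeta> *s v" using v by (simp add: Dv)
    show "v = 0"
    proof (rule ccontr)
      assume "v \<noteq> 0"
      have "norm (U v) = cmod \<zeta> * norm v" by (simp add: Uv norm_vector_scalar_mult)
      then have "cmod \<zeta> = 1" using \<open>v \<noteq> 0\<close> by (simp add: norm_U)
      from unit_eigen_orthogonal[OF Uv this, of w] have "cinner v v = 0" by (simp add: vw[symmetric])
      then show False using \<open>v \<noteq> 0\<close> by (simp add: cnj_inj_zero)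
    qed
  qed (use hol in auto)
  ultimately show "(\<Sum>\<zeta> | \<zeta> \<in> ball 0 2 \<and> det (D 1 \<zeta>) = 0. int (kernel_dim (D 1 \<zeta>))) = int CARD('m)" by simp
qed

text \<open>The eigenvalues of \<open>U\<close> lie on the unit circle, onto which exp (2 i \<pi> x)
  maps [0, 1) bijectively; so the total of the eigenspace dimensions is the number of zeros on [0,
  1).\<close>

lemma kd_total: "finite {x. x \<in> {0..<1} \<and> kd x \<noteq> 0}" "(\<Sum>x | x \<in> {0..<1} \<and> kd x \<noteq> 0. kd x) = CARD('m)"
proof -
  define D where "D \<zeta> = (\<chi> i j. (if i = j then \<zeta> else 0) - complex_of_real 1 * U (axis j 1) $ i)" for \<zeta>
  have Dv: "D \<zeta> *v v = \<zeta> *s v - U v" for \<zeta> v using sum_eigenspace_dims(2)[of \<zeta> 1 v] by (simp add: D_def)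
  have sum: "(\<Sum>\<zeta> | \<zeta> \<in> ball 0 2 \<and> det (D \<zeta>) = 0. int (kernel_dim (D \<zeta>))) = int CARD('m)"
    using sum_eigenspace_dims(1) by (simp add: D_def)
  define g where "g x = exp (2 * \<i> * (complex_of_real x * of_real pi))" for x
  have kd: "kd x = kernel_dim (D (g x))" for x
  proof (rule kernel_dim_cong)
    show "Vector_Spaces.linear (*s) (*s) B" by unfold_locales (simp_all add: linear_maps vs_simps)
    show "v = 0" if "B v = 0" for v using B_inverse(1)[of v] that by (simp add: B'_def)
    show "\<exists>v. B v = w" for w using B_inverse(2) by blast
    show "W0 T1 T2 (complex_of_real x) *v v = 0 \<longleftrightarrow> D (g x) *v B v = 0" for v by (auto simp: W0_kernel Dv g_def)
  qed
  have inj: "inj_on g {0..<1}"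
  proof (rule inj_onI)
    fix x y assume xy: "x \<in> {0..<1}" "y \<in> {0..<1}" "g x = g y"
    then obtain n :: int where "2 * \<i> * (complex_of_real x * of_real pi) = 2 * \<i> * (complex_of_real y * of_real pi) + of_real (of_int (2 * n) * pi) * \<i>"
      unfolding g_def exp_eq by blast
    then have "2 * \<i> * of_real pi * complex_of_real x = 2 * \<i> * of_real pi * complex_of_real (y + of_int n)"
      by (simp add: algebra_simps)
    then have "complex_of_real x = complex_of_real (y + of_int n)" by simp
    then have "x = y + of_int n" by (simp only: of_real_eq_iff)
    moreover from this have "n = 0" using xy(1,2) by auto
    ultimately show "x = y" by simp
  qed
  have img: "{\<zeta>. \<zeta> \<in> ball 0 2 \<and> det (D \<zeta>) = 0} = g ` {x. x \<in> {0..<1} \<and> kd x \<noteq> 0}"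
  proof (intro set_eqI iffI)
    fix \<zeta> assume z: "\<zeta> \<in> {\<zeta>. \<zeta> \<in> ball 0 2 \<and> det (D \<zeta>) = 0}"
    then obtain v where v: "v \<noteq> 0" "U v = \<zeta> *s v" by (auto simp: det_eq_0_iff_kernel Dv)
    have "norm v = cmod \<zeta> * norm v" using norm_U[of v] unfolding v(2) norm_vector_scalar_mult by simp
    then have "cmod \<zeta> = 1" using v(1) by simp
    then obtain \<theta> where \<theta>: "\<zeta> = cis \<theta>" using cis_Arg[of \<zeta>] by (metis norm_zero zero_neq_one sgn_div_norm scaleR_one inverse_1)
    define x where "x = frac (\<theta> / (2 * pi))"
    have "g x = cis (2 * pi * x)" by (simp add: g_def cis_conv_exp mult_ac)
    also have "2 * pi * x = \<theta> + 2 * pi * of_int (- \<lfloor>\<theta> / (2 * pi)\<rfloor>)" by (simp add: x_def frac_def field_simps)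
    also have "cis \<dots> = \<zeta>" by (simp add: \<theta> cis_multiple_2pi flip: cis_divide)
    finally have gx: "g x = \<zeta>" .
    moreover have "x \<in> {0..<1}" by (simp add: x_def frac_lt_1)
    moreover have "kd x \<noteq> 0" using z by (simp add: kd gx kernel_dim_eq_0_iff)
    ultimately show "\<zeta> \<in> g ` {x. x \<in> {0..<1} \<and> kd x \<noteq> 0}" by blast
  next
    fix \<zeta> assume "\<zeta> \<in> g ` {x. x \<in> {0..<1} \<and> kd x \<noteq> 0}"
    then obtain x where "\<zeta> = g x" "kd x \<noteq> 0" by blast
    moreover have "cmod (g x) = 1" by (simp add: g_def)
    ultimately show "\<zeta> \<in> {\<zeta>. \<zeta> \<in> ball 0 2 \<and> det (D \<zeta>) = 0}" by (auto simp: kd kernel_dim_eq_0_iff)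
  qed
  have inj': "inj_on g {x. x \<in> {0..<1} \<and> kd x \<noteq> 0}" by (rule inj_on_subset[OF inj]) auto
  show "finite {x. x \<in> {0..<1} \<and> kd x \<noteq> 0}"
  proof (rule ccontr)
    assume "infinite {x. x \<in> {0..<1} \<and> kd x \<noteq> 0}"
    then have "infinite {\<zeta>. \<zeta> \<in> ball 0 2 \<and> det (D \<zeta>) = 0}" unfolding img using finite_imageD inj' by blast
    with sum show False by simp
  qed
  have "(\<Sum>x | x \<in> {0..<1} \<and> kd x \<noteq> 0. int (kd x)) = int CARD('m)"
    using sum unfolding img by (subst (asm) sum.reindex[OF inj']) (simp add: kd)
  then have "int (\<Sum>x | x \<in> {0..<1} \<and> kd x \<noteq> 0. kd x) = int CARD('m)" by simp
  then show "(\<Sum>x | x \<in> {0..<1} \<and> kd x \<noteq> 0. kd x) = CARD('m)" by (simp only: of_nat_eq_iff)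
qed

end


section \<open>Quantitative invertibility of W0, and its kernel at 0\<close>

context projections
begin

text \<open>Near a zero of \<open>w0\<close> the semisimple estimate applies with that zero. Near
  any other point \<open>W0\<close> is uniformly invertible, and the fixed zero \<open>x1\<close>
  serves, being at distance at most 1 from every point of [0, 1].\<close>

lemma W0_lower_bound_local:
  assumes "w0 T1 T2 (complex_of_real x1) = 0" "x1 \<in> {0..<1}" "x0 \<in> {0..1}"
  shows "\<exists>c>0. \<exists>d>0. \<forall>x\<in>{0..1}. \<bar>x - x0\<bar> < d \<longrightarrow>
     (\<exists>z. w0 T1 T2 (complex_of_real z) = 0 \<and> (\<forall>v. norm (W0 T1 T2 (complex_of_real x) *v v) \<ge> c * \<bar>x - z\<bar> * norm v))"
proof (cases "w0 T1 T2 (complex_of_real x0) = 0")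
  case True
  have "\<exists>c>0. \<exists>d>0. \<forall>z v. dist z (complex_of_real x0) < d \<longrightarrow> norm (W0 T1 T2 z *v v) \<ge> c * dist z (complex_of_real x0) * norm v"
    by (rule semisimple_lower_bound[of UNIV]) (use W0_semisimple[of "complex_of_real x0"] W0_holomorphic in auto)
  then obtain c d where c: "c > 0" "d > 0" and *: "\<And>z v. dist z (complex_of_real x0) < d \<Longrightarrow> norm (W0 T1 T2 z *v v) \<ge> c * dist z (complex_of_real x0) * norm v"
    by blast
  have "\<exists>z. w0 T1 T2 (complex_of_real z) = 0 \<and> (\<forall>v. norm (W0 T1 T2 (complex_of_real x) *v v) \<ge> c * \<bar>x - z\<bar> * norm v)"
    if "\<bar>x - x0\<bar> < d" for x
    using *[of "complex_of_real x"] that True by (intro exI[of _ x0]) (auto simp: dist_of_real dist_real_def)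
  with c show ?thesis by blast
next
  case False
  then obtain Q where Q: "Q ** W0 T1 T2 (complex_of_real x0) = mat 1"
    using invertible_det_nz[of "W0 T1 T2 (complex_of_real x0)"] unfolding w0_def invertible_def by blast
  define n where "n = norm Q + 1"
  have n: "n > 0" by (simp add: n_def add_nonneg_pos)
  have "continuous (at x0) (\<lambda>x. W0 T1 T2 (complex_of_real x))"
    unfolding isCont_def
  proof (intro vec_tendstoI)
    show "((\<lambda>x. W0 T1 T2 (complex_of_real x) $ i $ j) \<longlongrightarrow> W0 T1 T2 (complex_of_real x0) $ i $ j) (at x0)" for i j
      unfolding W0_entry by (intro tendsto_intros)
  qed
  then obtain d where d: "d > 0" "\<And>x. dist x x0 < d \<Longrightarrow> dist (W0 T1 T2 (complex_of_real x)) (W0 T1 T2 (complex_of_real x0)) < 1 / (2 * n)"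
    unfolding continuous_at_eps_delta using n by (metis divide_pos_pos mult_pos_pos zero_less_numeral zero_less_one)
  have "1 / (2 * n) * \<bar>x - x1\<bar> * norm v \<le> norm (W0 T1 T2 (complex_of_real x) *v v)" if x: "x \<in> {0..1}" "\<bar>x - x0\<bar> < d" for x v
  proof -
    let ?W = "W0 T1 T2 (complex_of_real x)" and ?V = "W0 T1 T2 (complex_of_real x0)"
    have "norm v = norm (Q *v (?V *v v))" by (simp add: matrix_vector_mul_assoc Q)
    also have "\<dots> \<le> n * norm (?V *v v)"
      using norm_matrix_vector_mult_le[of Q "?V *v v"] by (simp add: n_def algebra_simps add_increasing)
    finally have "norm v / n \<le> norm (?V *v v)" using n by (simp add: divide_le_eq mult.commute)
    also have "?V *v v = ?W *v v - (?W - ?V) *v v" by (simp add: matrix_vector_mult_diff_rdistrib)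
    also have "norm \<dots> \<le> norm (?W *v v) + norm (?W - ?V) * norm v"
      by (rule order_trans[OF norm_triangle_ineq4 add_left_mono[OF norm_matrix_vector_mult_le]])
    also have "norm (?W - ?V) * norm v \<le> 1 / (2 * n) * norm v"
      using d(2)[of x] x n by (intro mult_right_mono) (auto simp: dist_norm)
    finally have "norm v / n \<le> norm (?W *v v) + 1 / (2 * n) * norm v" by simp
    moreover have "norm v / n = 1 / (2 * n) * norm v + 1 / (2 * n) * norm v" using n by (simp add: field_simps)
    ultimately have 1: "1 / (2 * n) * norm v \<le> norm (?W *v v)" by linarith
    have "1 / (2 * n) * \<bar>x - x1\<bar> * norm v \<le> 1 / (2 * n) * 1 * norm v"
      using n x(1) assms(2) by (intro mult_right_mono mult_left_mono) auto
    with 1 show ?thesis by simp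
  qed
  then show ?thesis using n d(1) assms(1)
    by (intro exI[of _ "1 / (2 * n)"] conjI exI[of _ d] ballI impI exI[of _ x1]) auto
qed

lemma w0_zero_exists: "\<exists>x\<in>{0..<1}. w0 T1 T2 (complex_of_real x) = 0"
proof (rule ccontr)
  assume "\<not> ?thesis"
  then have "{x. x \<in> {0..<1} \<and> kd x \<noteq> 0} = {}" by (auto simp: kd_zero_iff)
  then have "(\<Sum>x | x \<in> {0..<1} \<and> kd x \<noteq> 0. kd x) = 0" by (simp only: sum.empty)
  then show False using kd_total(2) by simp
qed

text \<open>Compactness of [0, 1] makes the local constants uniform, and periodicity up to sign
  carries the bound to the whole line.\<close>

lemma W0_lower_bound:
  "\<exists>c>0. \<forall>x. \<exists>z. w0 T1 T2 (complex_of_real z) = 0 \<and> (\<forall>v. norm (W0 T1 T2 (complex_of_real x) *v v) \<ge> c * \<bar>x - z\<bar> * norm v)"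
proof -
  define P where "P c x \<longleftrightarrow> (\<exists>z. w0 T1 T2 (complex_of_real z) = 0 \<and> (\<forall>v. norm (W0 T1 T2 (complex_of_real x) *v v) \<ge> c * \<bar>x - z\<bar> * norm v))" for c x
  have Pmono: "P c' x" if "P c x" "c' \<le> c" for c c' x
  proof -
    obtain z where z: "w0 T1 T2 (complex_of_real z) = 0" "\<And>v. norm (W0 T1 T2 (complex_of_real x) *v v) \<ge> c * \<bar>x - z\<bar> * norm v"
      using \<open>P c x\<close> unfolding P_def by blast
    have "c' * \<bar>x - z\<bar> * norm v \<le> norm (W0 T1 T2 (complex_of_real x) *v v)" for v
      by (rule order_trans[OF _ z(2)]) (intro mult_right_mono that, auto)
    with z(1) show ?thesis unfolding P_def by blast
  qed
  obtain x1 where x1: "x1 \<in> {0..<1}" "w0 T1 T2 (complex_of_real x1) = 0" using w0_zero_exists by blast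
  have "\<forall>x0\<in>{0..1}. \<exists>c d. c > 0 \<and> d > 0 \<and> (\<forall>x\<in>{0..1}. \<bar>x - x0\<bar> < d \<longrightarrow> P c x)"
    using W0_lower_bound_local[OF x1(2,1)] unfolding P_def by blast
  then obtain C D where CD: "\<And>x0. x0 \<in> {0..1} \<Longrightarrow> C x0 > 0 \<and> D x0 > 0 \<and> (\<forall>x\<in>{0..1}. \<bar>x - x0\<bar> < D x0 \<longrightarrow> P (C x0) x)"
    by (metis (no_types, lifting))
  have "{0..1} \<subseteq> (\<Union>x0\<in>{0..1}. ball x0 (D x0))" using CD by fastforce
  then obtain F where F: "F \<subseteq> {0..1}" "finite F" "{0..1} \<subseteq> (\<Union>x0\<in>F. ball x0 (D x0))"
    using compactE_image[of "{0..1::real}" "{0..1}" "\<lambda>x0. ball x0 (D x0)"] by auto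
  have Fne: "F \<noteq> {}" using F(3) by auto
  define c where "c = Min (C ` F)"
  have c: "c > 0" using F Fne CD by (auto simp: c_def subset_iff)
  have unit: "P c x" if x: "x \<in> {0..1}" for x
  proof -
    obtain x0 where x0: "x0 \<in> F" "x \<in> ball x0 (D x0)" using F(3) x by blast
    then have "P (C x0) x" using CD[of x0] F(1) x by (auto simp: dist_real_def abs_minus_commute subset_iff)
    then show ?thesis by (rule Pmono) (use F x0 in \<open>auto simp: c_def\<close>)
  qed
  have "P c x" for x
  proof -
    have "frac x \<in> {0..1}" using frac_lt_1[of x] by simp
    from unit[OF this] obtain z where z: "w0 T1 T2 (complex_of_real z) = 0"
      "\<And>v. norm (W0 T1 T2 (complex_of_real (frac x)) *v v) \<ge> c * \<bar>frac x - z\<bar> * norm v" unfolding P_def by blast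
    have x: "complex_of_real x = complex_of_real (frac x) + of_int \<lfloor>x\<rfloor>" by (simp add: frac_def)
    have nw: "norm (W0 T1 T2 (complex_of_real x) *v v) = norm (W0 T1 T2 (complex_of_real (frac x)) *v v)" for v
      unfolding x W0_periodic norm_vector_scalar_mult by auto
    have "kd (z + of_int \<lfloor>x\<rfloor>) = kd z" by (rule kd_periodic)
    then have "w0 T1 T2 (complex_of_real (z + of_int \<lfloor>x\<rfloor>)) = 0" using z(1) kd_zero_iff by metis
    moreover have "norm (W0 T1 T2 (complex_of_real x) *v v) \<ge> c * \<bar>x - (z + of_int \<lfloor>x\<rfloor>)\<bar> * norm v" for v
      using z(2)[of v] unfolding nw by (simp add: frac_def algebra_simps)
    ultimately show ?thesis unfolding P_def by blast
  qed
  with c show ?thesis unfolding P_def by blast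
qed

text \<open>At 0 only the cosine coefficient remains. Its kernel is the direct sum of the common
  range and the common kernel of the two projections; the second summand is what the free problem
  lacks at the eigenvalue 0.\<close>

lemma kd_0: "kd 0 = vec.dim {v. T1 *v v = v \<and> T2 *v v = v} + p_perp T1 T2"
proof -
  define R K where "R = {v. T1 *v v = v \<and> T2 *v v = v}" and "K = {v. T1 *v v = 0} \<inter> {v. T2 *v v = 0}"
  have sub: "vec.subspace R" "vec.subspace K"
    unfolding vec.subspace_def R_def K_def by (auto simp: vs_simps)
  have "{v. W0 T1 T2 (complex_of_real 0) *v v = 0} = {x + y |x y. x \<in> R \<and> y \<in> K}"
  proof (intro set_eqI iffI)
    fix v assume "v \<in> {v. W0 T1 T2 (complex_of_real 0) *v v = 0}"
    then have eq: "T1 *v v - T2 *v (T1 *v v) - T2 *v (v - T1 *v v) = 0" by (simp add: W0_mult_split)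
    then have "T2 *v (T1 *v v - T2 *v (T1 *v v) - T2 *v (v - T1 *v v)) = 0" by simp
    then have 1: "T2 *v (v - T1 *v v) = 0" by (simp add: vs_simps)
    with eq have 2: "T2 *v (T1 *v v) = T1 *v v" by simp
    have "T1 *v v \<in> R" "v - T1 *v v \<in> K" using 1 2 by (auto simp: R_def K_def vs_simps)
    moreover have "v = T1 *v v + (v - T1 *v v)" by simp
    ultimately show "v \<in> {x + y |x y. x \<in> R \<and> y \<in> K}" by blast
  next
    fix v assume "v \<in> {x + y |x y. x \<in> R \<and> y \<in> K}"
    then obtain x y where "v = x + y" "x \<in> R" "y \<in> K" by blast
    then show "v \<in> {v. W0 T1 T2 (complex_of_real 0) *v v = 0}" by (simp add: W0_mult_split R_def K_def vs_simps)
  qed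
  moreover have "R \<inter> K = {0}" using sub by (auto simp: R_def K_def)
  ultimately show ?thesis
    using vec.dim_sums_Int[OF sub] by (simp add: kernel_dim_def p_perp_def R_def K_def)
qed

end

section \<open>The characteristic matrix of the free problem\<close>

context sturm_liouville
begin

sublocale projections T1 T2
  by unfold_locales (fact T1 T2)+

lemma mult_eq_kernel_dim: "mult t x = kernel_dim (cm t (complex_of_real x))"
  by (simp add: mult_def kernel_dim_def)

lemma has_vector_derivative_cscale:
  assumes "(f has_vector_derivative f') (at x within S)"
  shows "((\<lambda>x. of_real (f x) *s (v :: complex^'m)) has_vector_derivative of_real f' *s v) (at x within S)"
  using bounded_linear.has_vector_derivative[OF bounded_linear_scaleR_left[of v] assms]
  by (simp add: scaleR_eq_vector_scalar_mult)

lemma continuous_on_cscale: "continuous_on S f \<Longrightarrow> continuous_on S (\<lambda>x. of_real (f x) *s (v :: complex^'m))"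
  unfolding scaleR_eq_vector_scalar_mult[symmetric] by (intro continuous_intros)

text \<open>The pair \<open>c\<close>, \<open>s\<close> stands for cos (\<rho> x), sin (\<rho> x) /
  \<rho> when l = \<rho>^2, and for 1, x when l = 0, so that both cases share one
  computation.\<close>

lemma flow_zero:
  assumes c: "\<And>x. (c has_vector_derivative - l * s x) (at x)" "c 0 = 1"
    and s: "\<And>x. (s has_vector_derivative c x) (at x)" "s 0 = 0"
  shows "flow (\<lambda>x. 0 :: complex^'m^'m) (complex_of_real l) (a, b) pi =
     (of_real (c pi) *s a + of_real (s pi) *s b, of_real (c pi) *s b - of_real (l * s pi) *s a)"
proof -
  have L2: "L2 (\<lambda>x. 0 :: complex^'m^'m)" by (rule L2_continuous) simp
  define u where "u x = (of_real (c x) *s a + of_real (s x) *s b, of_real (c x) *s b - of_real (l * s x) *s a)" for x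
  have cont: "continuous_on S c" "continuous_on S s" for S
    using c(1) s(1) by (auto intro!: continuous_at_imp_continuous_on has_vector_derivative_continuous)
  define D where "D x = (of_real (- l * s x) *s a + of_real (c x) *s b, of_real (- l * s x) *s b - of_real (l * c x) *s a)" for x
  have D: "sys (\<lambda>x. 0) (complex_of_real l) x (u x) + 0 = D x" for x
    by (simp add: D_def sys_def u_def prod_eq_iff vec_eq_iff algebra_simps)
  have "sys_solution (\<lambda>x. 0) (complex_of_real l) (\<lambda>x. 0) u"
    unfolding sys_solution_def
  proof (rule primitive_on_C1)
    fix x
    have "(u has_vector_derivative D x) (at x within {0..pi})"
      unfolding u_def D_def
      by (intro has_vector_derivative_Pair has_vector_derivative_add has_vector_derivative_diff has_vector_derivative_cscale
          has_vector_derivative_at_within[OF c(1)] has_vector_derivative_at_within[OF s(1)] has_vector_derivative_mult_right)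
    then show "(u has_vector_derivative sys (\<lambda>x. 0) (complex_of_real l) x (u x) + 0) (at x within {0..pi})" unfolding D .
  next
    have "continuous_on {0..pi} D"
      unfolding D_def by (intro continuous_intros continuous_on_cscale cont)
    then show "continuous_on {0..pi} (\<lambda>x. sys (\<lambda>x. 0) (complex_of_real l) x (u x) + 0)" unfolding D .
  qed
  from flow_eqI[OF L2 this, of pi] show ?thesis by (simp add: u_def c s)
qed

lemma cm_0_mult:
  assumes "\<And>x. (c has_vector_derivative - l * s x) (at x)" "c 0 = 1"
    "\<And>x. (s has_vector_derivative c x) (at x)" "s 0 = 0"
  shows "cm 0 (complex_of_real l) *v v = T2 *v (of_real (c pi) *s (v - T1 *v v) - of_real (l * s pi) *s (T1 *v v))
     - (of_real (c pi) *s (T1 *v v) + of_real (s pi) *s (v - T1 *v v) - T2 *v (of_real (c pi) *s (T1 *v v) + of_real (s pi) *s (v - T1 *v v)))"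
proof -
  interpret t: sturm_liouville "\<lambda>x. 0 *\<^sub>R \<sigma> x" T1 "0 *\<^sub>R H1" T2 "0 *\<^sub>R H2" by (rule scaled)
  show ?thesis
    unfolding charmat_homotopy_def t.charmat_mult t.init_def t.bc2_def
    by (simp add: flow_zero[OF assms] boundary_form_def perp_mult)
qed

text \<open>Rescaling the quasi-derivative part of the initial data by \<rho> removes the asymmetry
  between values and derivatives; the characteristic matrix then differs from \<open>W0\<close> only
  by nonzero factors on the range and the kernel of \<open>T2\<close>.\<close>

lemma mult_0_pos:
  assumes "\<rho> > 0"
  shows "mult 0 (\<rho>\<^sup>2) = kd \<rho>"
  unfolding mult_eq_kernel_dim
proof (rule kernel_dim_cong)
  define f where "f v = T1 *v v + complex_of_real (1 / \<rho>) *s (v - T1 *v v)" for v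
  define g where "g v = T1 *v v + complex_of_real \<rho> *s (v - T1 *v v)" for v
  have fg: "f (g v) = v" "g (f v) = v" for v using assms by (simp_all add: f_def g_def vs_simps vec_eq_iff)
  show "Vector_Spaces.linear (*s) (*s) f" by unfold_locales (simp_all add: f_def vs_simps vec_eq_iff algebra_simps)
  show "v = 0" if "f v = 0" for v using fg(2)[of v] that by (simp add: g_def)
  show "\<exists>v. f v = w" for w using fg(1) by blast
  fix v
  have cmv: "cm 0 (complex_of_real (\<rho>\<^sup>2)) *v v = T2 *v (of_real (cos (\<rho> * pi)) *s (v - T1 *v v) - of_real (\<rho>\<^sup>2 * (sin (\<rho> * pi) / \<rho>)) *s (T1 *v v))
     - (of_real (cos (\<rho> * pi)) *s (T1 *v v) + of_real (sin (\<rho> * pi) / \<rho>) *s (v - T1 *v v) - T2 *v (of_real (cos (\<rho> * pi)) *s (T1 *v v) + of_real (sin (\<rho> * pi) / \<rho>) *s (v - T1 *v v)))"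
    using assms by (intro cm_0_mult) (auto simp: has_real_derivative_iff_has_vector_derivative[symmetric] power2_eq_square intro!: derivative_eq_intros)
  define C S where "C = complex_of_real (cos (\<rho> * pi))" and "S = complex_of_real (sin (\<rho> * pi))"
  have cs: "cos (complex_of_real \<rho> * complex_of_real pi) = C" "sin (complex_of_real \<rho> * complex_of_real pi) = S"
    by (simp_all add: C_def S_def flip: cos_of_real sin_of_real)
  define a b where "a = T1 *v v" and "b = complex_of_real (1 / \<rho>) *s (v - T1 *v v)"
  have Ta: "T1 *v a = a" "T1 *v b = 0" by (simp_all add: a_def b_def vs_simps)
  have vb: "v - T1 *v v = complex_of_real \<rho> *s b" using assms by (simp add: b_def)
  have r: "complex_of_real (\<rho>\<^sup>2 * (sin (\<rho> * pi) / \<rho>)) = complex_of_real \<rho> * S" "complex_of_real (sin (\<rho> * pi) / \<rho>) * complex_of_real \<rho> = S"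
    using assms by (simp_all add: S_def power2_eq_square)
  \<comment> \<open>\<open>p\<close> and \<open>q\<close> are the parts in the range and in the
    kernel of \<open>T2\<close>. The two matrices yield \<open>p + q\<close> and
    \<open>- (\<rho> *s p) - q\<close>, which vanish together.\<close>
  define p q where "p = T2 *v (S *s a - C *s b)" and "q = C *s a + S *s b - T2 *v (C *s a + S *s b)"
  have W: "W0 T1 T2 (complex_of_real \<rho>) *v f v = p + q"
  proof -
    have fv: "f v = a + b" by (simp add: f_def a_def b_def)
    have T1ab: "T1 *v (a + b) = a" by (simp add: matrix_vector_right_distrib Ta)
    show ?thesis
      unfolding W0_mult_split cs fv T1ab p_def q_def by (simp add: vs_simps vec_eq_iff algebra_simps)
  qed
  have c: "cm 0 (complex_of_real (\<rho>\<^sup>2)) *v v = - (complex_of_real \<rho> *s p) - q"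
    unfolding cmv unfolding vb unfolding r(1) C_def[symmetric] a_def[symmetric] vec.scale_scale r(2) p_def q_def
    by (simp add: vs_simps vec_eq_iff algebra_simps)
  have Tpq: "T2 *v p = p" "T2 *v q = 0" by (simp_all add: p_def q_def vs_simps)
  have pq: "p = 0 \<and> q = 0" if "\<alpha> *s p + q = 0" "\<alpha> \<noteq> 0" for \<alpha>
  proof -
    have "T2 *v (\<alpha> *s p + q) = \<alpha> *s p" by (simp add: vs_simps Tpq)
    then have "\<alpha> *s p = 0" using that(1) by simp
    then show ?thesis using that by simp
  qed
  show "cm 0 (complex_of_real (\<rho>\<^sup>2)) *v v = 0 \<longleftrightarrow> W0 T1 T2 (complex_of_real \<rho>) *v f v = 0"
  proof
    assume "cm 0 (complex_of_real (\<rho>\<^sup>2)) *v v = 0"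
    then have "complex_of_real \<rho> *s p + q = 0" unfolding c by (metis add.inverse_inverse diff_minus_eq_add eq_iff_diff_eq_0 minus_diff_commute neg_equal_0_iff_equal add.commute minus_add_distrib uminus_add_conv_diff)
    then show "W0 T1 T2 (complex_of_real \<rho>) *v f v = 0" using pq[of "complex_of_real \<rho>"] assms by (simp add: W)
  next
    assume "W0 T1 T2 (complex_of_real \<rho>) *v f v = 0"
    then have "p = 0 \<and> q = 0" using pq[of 1] by (simp add: W)
    then show "cm 0 (complex_of_real (\<rho>\<^sup>2)) *v v = 0" unfolding c by simp
  qed
qed

text \<open>The rescaling degenerates at 0, where solutions are affine, a + x b. Orthogonality
  forces \<open>b = 0\<close> and leaves the constants in the common range, whereas the kernel of
  \<open>W0\<close> at 0 also contains the common kernel.\<close>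

lemma mult_0_zero: "mult 0 0 + p_perp T1 T2 = kd 0"
proof -
  have cmv: "cm 0 (complex_of_real 0) *v v = T2 *v (v - T1 *v v) - (T1 *v v + of_real pi *s (v - T1 *v v) - T2 *v (T1 *v v + of_real pi *s (v - T1 *v v)))" for v
    using cm_0_mult[of "\<lambda>x. 1" 0 "\<lambda>x. x" v] by (simp add: has_vector_derivative_id)
  have "{v. cm 0 (complex_of_real 0) *v v = 0} = {v. T1 *v v = v \<and> T2 *v v = v}"
  proof (intro set_eqI iffI)
    fix v assume "v \<in> {v. cm 0 (complex_of_real 0) *v v = 0}"
    then have eq: "T2 *v (v - T1 *v v) - (T1 *v v + of_real pi *s (v - T1 *v v) - T2 *v (T1 *v v + of_real pi *s (v - T1 *v v))) = 0"
      unfolding mem_Collect_eq cmv .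
    define a b where "a = T1 *v v" and "b = v - T1 *v v"
    have Ta: "T1 *v a = a" "T1 *v b = 0" by (simp_all add: a_def b_def vs_simps)
    have eq': "T2 *v b - (a + of_real pi *s b - T2 *v (a + of_real pi *s b)) = 0" using eq by (simp add: a_def b_def)
    then have "T2 *v (T2 *v b - (a + of_real pi *s b - T2 *v (a + of_real pi *s b))) = 0" by simp
    then have Tb: "T2 *v b = 0" by (simp add: vs_simps)
    with eq' have e2: "a + of_real pi *s b = T2 *v a" by (simp add: vs_simps)
    \<comment> \<open>Since \<open>b\<close> is orthogonal to \<open>a\<close> and annihilated by
      \<open>T2\<close>, pairing with it leaves \<pi> times its squared norm.\<close>
    have "cinner (a + of_real pi *s b) b = cinner a (T2 *v b)" unfolding e2 by (rule symmetric)
    moreover have "cinner a b = 0" using symmetric(1)[of a b] by (simp add: Ta cinner_simps)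
    ultimately have "b = 0" by (simp add: Tb cinner_simps cnj_inj_zero)
    with e2 have "a = T2 *v a" by simp
    with \<open>b = 0\<close> show "v \<in> {v. T1 *v v = v \<and> T2 *v v = v}" by (simp add: a_def b_def)
  next
    fix v assume "v \<in> {v. T1 *v v = v \<and> T2 *v v = v}"
    then show "v \<in> {v. cm 0 (complex_of_real 0) *v v = 0}" unfolding mem_Collect_eq cmv by simp
  qed
  then show ?thesis using kd_0 by (simp add: mult_def)
qed

lemma mult_0_neg:
  assumes "x < 0" shows "mult 0 x = 0"
proof (rule ccontr)
  interpret t: sturm_liouville "\<lambda>x. 0 *\<^sub>R \<sigma> x" T1 "0 *\<^sub>R H1" T2 "0 *\<^sub>R H2" by (rule scaled)
  assume "mult 0 x \<noteq> 0"
  then obtain v where v: "v \<noteq> 0" "t.charmat (complex_of_real x) *v v = 0"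
    by (auto simp: mult_eq_0_iff charmat_homotopy_def det_eq_0_iff_kernel)
  have "- ((0\<^sup>2 + 2 * 0) * (1 + 4 * 0\<^sup>2) + 4 * (0\<^sup>2 + 2 * 0)\<^sup>2) \<le> x"
    by (rule t.charmat_kernel_lower_bound) (use v in auto)
  with assms show False by simp
qed

end


section \<open>Asymptotics of the eigenvalues\<close>

lemma has_vector_derivative_cis_scaled:
  "((\<lambda>s. cis (w * s)) has_vector_derivative of_real w * (\<i> * cis (w * s))) (at s within S)"
proof -
  have "((\<lambda>z. exp (\<i> * of_real w * z)) has_field_derivative (\<i> * of_real w) * exp (\<i> * of_real w * of_real s)) (at (of_real s))"
    by (auto intro!: derivative_eq_intros)
  from has_vector_derivative_real_field[OF this, of S] show ?thesis
    by (simp add: cis_conv_exp mult_ac)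
qed

lemma has_integral_cis:
  fixes k :: int
  shows "((\<lambda>s. cis (2 * of_int k * s)) has_integral (if k = 0 then of_real pi else 0)) {0..pi}"
proof (cases "k = 0")
  case True
  then show ?thesis using has_integral_const_real[of "1 :: complex" 0 pi] by (simp add: scaleR_conv_of_real)
next
  case False
  have "((\<lambda>s. (1 / (2 * of_int k * \<i>)) * cis (2 * of_int k * s)) has_vector_derivative cis (2 * of_int k * s)) (at s within {0..pi})" for s
    using has_vector_derivative_mult_right[OF has_vector_derivative_cis_scaled[of "2 * of_int k" s "{0..pi}"], of "1 / (2 * of_int k * \<i>)"] False by simp
  then have "((\<lambda>s. cis (2 * of_int k * s)) has_integral (1 / (2 * of_int k * \<i>)) * cis (2 * of_int k * pi) - (1 / (2 * of_int k * \<i>)) * cis (2 * of_int k * 0)) {0..pi}"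
    by (intro fundamental_theorem_of_calculus) auto
  moreover have "cis (2 * of_int k * pi) = 1" using cis_multiple_2pi[of "of_int k"] by (simp add: mult_ac)
  ultimately show ?thesis using False by simp
qed

text \<open>Integrating \<open>f\<close> against the sum \<open>g\<close>, built with the conjugated
  coefficients, gives exactly \<open>S\<close>, while orthogonality gives \<open>pi * S\<close> for
  the squared norm of \<open>g\<close>; Cauchy-Schwarz concludes. The factor \<pi> appears because
  the exponentials are not normalized.\<close>

lemma Bessel_inequality:
  fixes f :: "real \<Rightarrow> complex"
  assumes f: "f absolutely_integrable_on {0..pi}" "(\<lambda>s. (norm (f s))\<^sup>2) integrable_on {0..pi}" and I: "finite I"
  shows "(\<Sum>n\<in>I. (norm (integral {0..pi} (\<lambda>s. f s * cis (2 * of_int n * s))))\<^sup>2) \<le> pi * integral {0..pi} (\<lambda>s. (norm (f s))\<^sup>2)"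
proof -
  define c where "c n = integral {0..pi} (\<lambda>s. f s * cis (2 * of_int n * s))" for n :: int
  define g where "g s = (\<Sum>n\<in>I. cnj (c n) * cis (2 * of_int n * s))" for s
  define S where "S = (\<Sum>n\<in>I. (norm (c n))\<^sup>2)"
  have gc: "continuous_on {0..pi} g" unfolding g_def by (intro continuous_intros)
  have fc: "(\<lambda>s. f s * h s) absolutely_integrable_on {0..pi}" if "continuous_on {0..pi} h" for h
    using absolutely_integrable_on_continuous_bilinear[OF bounded_bilinear_mult that f(1)] by (simp add: mult.commute)
  have fci: "(\<lambda>s. f s * cis (2 * of_int n * s)) integrable_on {0..pi}" for n :: int
  proof -
    have "continuous_on {0..pi} (\<lambda>s. cis (2 * of_int n * s))" by (intro continuous_intros)
    from fc[OF this] show ?thesis by (simp add: absolutely_integrable_on_def)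
  qed
  have "integral {0..pi} (\<lambda>s. f s * g s) = integral {0..pi} (\<lambda>s. \<Sum>n\<in>I. cnj (c n) * (f s * cis (2 * of_int n * s)))"
    by (simp add: g_def sum_distrib_left mult_ac)
  also have "\<dots> = (\<Sum>n\<in>I. cnj (c n) * c n)"
    using I fci by (subst integral_sum) (auto simp: c_def intro: integrable_on_mult_right)
  also have "\<dots> = of_real S" unfolding S_def of_real_sum by (intro sum.cong refl) (metis complex_norm_square mult.commute of_real_power)
  finally have fg: "integral {0..pi} (\<lambda>s. f s * g s) = of_real S" .
  have "((\<lambda>s. \<Sum>n\<in>I. \<Sum>m\<in>I. cnj (c n) * c m * cis (2 * of_int (n - m) * s)) has_integral (\<Sum>n\<in>I. \<Sum>m\<in>I. cnj (c n) * c m * (if n - m = 0 then of_real pi else 0))) {0..pi}"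
    by (intro has_integral_sum I has_integral_mult_right has_integral_cis)
  moreover have "(\<Sum>n\<in>I. \<Sum>m\<in>I. cnj (c n) * c m * cis (2 * of_int (n - m) * s)) = of_real ((norm (g s))\<^sup>2)" for s
  proof -
    have "of_real ((norm (g s))\<^sup>2) = g s * cnj (g s)" by (rule complex_norm_square[unfolded of_real_power[symmetric]])
    also have "\<dots> = (\<Sum>n\<in>I. \<Sum>m\<in>I. cnj (c n) * c m * cis (2 * of_int (n - m) * s))"
    proof -
      have "cis (2 * of_int (n - m) * s) = cis (2 * of_int n * s) * cnj (cis (2 * of_int m * s))" for n m :: int
        by (simp add: cis_cnj cis_mult algebra_simps)
      then show ?thesis unfolding g_def cnj_sum sum_product by (intro sum.cong refl) (simp add: mult_ac)
    qed
    finally show ?thesis by simp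
  qed
  moreover have "(\<Sum>n\<in>I. \<Sum>m\<in>I. cnj (c n) * c m * (if n - m = 0 then of_real pi else 0)) = of_real (pi * S)"
  proof -
    have "(\<Sum>m\<in>I. cnj (c n) * c m * (if n - m = 0 then of_real pi else 0)) = of_real pi * of_real ((norm (c n))\<^sup>2)" if "n \<in> I" for n
    proof -
      have "(\<Sum>m\<in>I. cnj (c n) * c m * (if n - m = 0 then of_real pi else 0)) = (\<Sum>m\<in>I. if m = n then cnj (c n) * c n * of_real pi else 0)"
        by (intro sum.cong refl) auto
      also have "\<dots> = c n * cnj (c n) * of_real pi" using I that by simp
      also have "c n * cnj (c n) = of_real ((norm (c n))\<^sup>2)" using complex_norm_square[of "c n"] by (simp only: of_real_power)
      finally show ?thesis by (simp only: mult.commute)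
    qed
    then show ?thesis by (simp add: S_def sum_distrib_left)
  qed
  ultimately have "((\<lambda>s. complex_of_real ((norm (g s))\<^sup>2)) has_integral of_real (pi * S)) {0..pi}" by simp
  from has_integral_linear[OF this bounded_linear_Re]
  have gg: "integral {0..pi} (\<lambda>s. (norm (g s))\<^sup>2) = pi * S" by (simp add: o_def integral_unique)
  have S0: "S \<ge> 0" by (simp add: S_def sum_nonneg)
  have fgi: "(\<lambda>s. norm (f s) * norm (g s)) integrable_on {0..pi}"
    using fc[OF gc] by (simp add: absolutely_integrable_on_def norm_mult)
  have "S = norm (integral {0..pi} (\<lambda>s. f s * g s))" using S0 by (simp add: fg)
  also have "\<dots> \<le> integral {0..pi} (\<lambda>s. norm (f s) * norm (g s))"
    using fc[OF gc] fgi by (intro integral_norm_bound_integral) (auto simp: absolutely_integrable_on_def norm_mult)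
  finally have "S\<^sup>2 \<le> (integral {0..pi} (\<lambda>s. norm (f s) * norm (g s)))\<^sup>2" using S0 by (intro power_mono)
  also have "\<dots> \<le> integral {0..pi} (\<lambda>s. (norm (f s))\<^sup>2) * integral {0..pi} (\<lambda>s. (norm (g s))\<^sup>2)"
    by (intro Cauchy_Schwarz_integral fgi f integrable_continuous_real continuous_intros gc)
  finally have "S\<^sup>2 \<le> integral {0..pi} (\<lambda>s. (norm (f s))\<^sup>2) * (pi * S)" unfolding gg .
  then have "S * S \<le> (pi * integral {0..pi} (\<lambda>s. (norm (f s))\<^sup>2)) * S" by (simp only: power2_eq_square[of S] mult_ac)
  moreover have "0 \<le> pi * integral {0..pi} (\<lambda>s. (norm (f s))\<^sup>2)" using f by (intro mult_nonneg_nonneg integral_nonneg) auto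
  ultimately have "S \<le> pi * integral {0..pi} (\<lambda>s. (norm (f s))\<^sup>2)"
    using S0 by (cases "S = 0") (auto simp: mult_le_cancel_right)
  then show ?thesis by (simp add: S_def c_def)
qed

section \<open>Fourier integrals of a matrix function over [0, x]\<close>

definition mscale :: "complex \<Rightarrow> complex^'n^'m \<Rightarrow> complex^'n^'m" where "mscale c A = map_matrix ((*) c) A"

lemma mscale_nth: "mscale c A $ i $ j = c * A $ i $ j"
  by (simp add: mscale_def map_matrix_def)

lemma mscale_mult: "mscale c A *v v = c *s (A *v v)"
  by (simp add: vec_eq_iff mscale_def map_matrix_def matrix_vector_mult_def sum_distrib_left mult.assoc)

lemma norm_matrix_power2: "(norm (A :: complex^'n^'m))\<^sup>2 = (\<Sum>i\<in>UNIV. \<Sum>j\<in>UNIV. (norm (A $ i $ j))\<^sup>2)"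
  by (simp add: norm_vec_def L2_set_def sum_nonneg)

lemma norm_mscale: "norm (mscale c A) = cmod c * norm A"
proof -
  have "(norm (mscale c A))\<^sup>2 = (cmod c * norm A)\<^sup>2"
    unfolding power_mult_distrib norm_matrix_power2 mscale_nth norm_mult by (simp add: sum_distrib_left)
  then show ?thesis by simp
qed

lemma bounded_bilinear_mscale: "bounded_bilinear mscale"
  unfolding bilinear_conv_bounded_bilinear[symmetric] bilinear_def
  by (auto intro!: linearI simp: vec_eq_iff mscale_nth algebra_simps)

lemma mscale_assoc: "mscale c (mscale d A) = mscale (c * d) A"
  by (simp add: vec_eq_iff mscale_nth mult.assoc)

lemma bounded_bilinear_vector_scalar_mult: "bounded_bilinear ((*s) :: complex \<Rightarrow> complex^'m \<Rightarrow> complex^'m)"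
  unfolding bilinear_conv_bounded_bilinear[symmetric] bilinear_def
  by (auto intro!: linearI simp: vec_eq_iff algebra_simps)

lemma primitive_on_cis: "primitive_on a b (\<lambda>x. cis (w * x)) (\<lambda>x. of_real w * (\<i> * cis (w * x)))"
proof (rule primitive_on_C1)
  show "((\<lambda>s. cis (w * s)) has_vector_derivative of_real w * (\<i> * cis (w * s))) (at s within {a..b})" for s
    by (rule has_vector_derivative_cis_scaled)
qed (intro continuous_intros)

text \<open>The frequency is doubled because two factors exp (i w x) combine in the equations for
  the amplitudes; for integer \<open>w\<close> the resulting exponentials are orthogonal on an
  interval of length \<pi>.\<close>

definition fourier :: "(real \<Rightarrow> complex^'m^'m) \<Rightarrow> real \<Rightarrow> real \<Rightarrow> complex^'m^'m" where
  "fourier \<sigma> w x = integral {0..x} (\<lambda>s. mscale (cis (2 * w * s)) (\<sigma> s))"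

context
  fixes \<sigma> :: "real \<Rightarrow> complex^'m^'m"
  assumes L2: "L2 \<sigma>"
begin

lemma primitive_fourier: "primitive_on 0 pi (fourier \<sigma> w) (\<lambda>s. mscale (cis (2 * w * s)) (\<sigma> s))"
proof -
  have "(\<lambda>s. mscale (cis (2 * w * s)) (\<sigma> s)) absolutely_integrable_on {0..pi}"
    by (intro absolutely_integrable_on_continuous_bilinear[OF bounded_bilinear_mscale _ L2_imp_integrable(1)[OF L2]] continuous_intros)
  from primitive_on_integral[OF this, of 0] show ?thesis by (simp add: fourier_def[abs_def])
qed

lemma fourier_continuous: "continuous_on {0..pi} (fourier \<sigma> w)"
  by (rule primitive_on_continuous_on[OF primitive_fourier])

lemma fourier_0: "fourier \<sigma> w 0 = 0"
  by (simp add: fourier_def)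

lemma norm_fourier_le:
  assumes "x \<in> {0..pi}"
  shows "norm (fourier \<sigma> w x) \<le> integral {0..pi} (\<lambda>s. norm (\<sigma> s))"
proof -
  have i: "(\<lambda>s. norm (\<sigma> s)) integrable_on {0..pi}" using L2_imp_integrable(2)[OF L2] by (simp add: absolutely_integrable_on_def)
  have i': "(\<lambda>s. norm (\<sigma> s)) integrable_on {0..x}" using i by (rule integrable_on_subinterval) (use assms in auto)
  have "norm (fourier \<sigma> w x) \<le> integral {0..x} (\<lambda>s. norm (\<sigma> s))"
    unfolding fourier_def using primitive_onD(3)[OF primitive_fourier, of 0 x w] i' assms
    by (intro integral_norm_bound_integral) (auto simp: norm_mscale)
  also have "\<dots> \<le> integral {0..pi} (\<lambda>s. norm (\<sigma> s))"
    using i i' assms by (intro integral_subset_le) auto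
  finally show ?thesis .
qed

text \<open>Bessel's inequality is applied to each entry of \<sigma> cut off outside [0, x], which
  makes the bound independent of \<open>x\<close>.\<close>

lemma fourier_Bessel:
  assumes x: "x \<in> {0..pi}" and I: "finite I"
  shows "(\<Sum>n\<in>I. (norm (fourier \<sigma> (of_int n) x))\<^sup>2) \<le> pi * integral {0..pi} (\<lambda>s. (norm (\<sigma> s))\<^sup>2)"
proof -
  have m: "\<sigma> \<in> borel_measurable (lebesgue_on {0..pi})" using L2 by (simp add: L2_iff)
  define f where "f i j s = (if s \<in> {0..x} then \<sigma> s $ i $ j else 0)" for i j s
  have bl: "bounded_linear (\<lambda>A :: complex^'m^'m. A $ i $ j)" for i j
    using bounded_linear_compose[OF bounded_linear_vec_nth[of j] bounded_linear_vec_nth[of i]] by simp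
  have ent: "(\<lambda>s. \<sigma> s $ i $ j) absolutely_integrable_on {0..pi}" for i j
    using absolutely_integrable_linear[OF L2_imp_integrable(1)[OF L2] bl[of i j]] by (simp add: o_def)
  have fA: "f i j absolutely_integrable_on {0..pi}" for i j
  proof -
    have "(\<lambda>s. \<sigma> s $ i $ j) absolutely_integrable_on {0..x}"
      by (rule absolutely_integrable_on_subinterval[OF ent]) (use x in auto)
    then have "(\<lambda>s. if s \<in> {0..x} then \<sigma> s $ i $ j else 0) absolutely_integrable_on UNIV"
      unfolding absolutely_integrable_restrict_UNIV .
    then show ?thesis unfolding f_def by (rule absolutely_integrable_on_subinterval) auto
  qed
  have le: "norm (f i j s) \<le> norm (\<sigma> s)" for i j s
    using order_trans[OF Finite_Cartesian_Product.norm_nth_le[of "\<sigma> s $ i" j] Finite_Cartesian_Product.norm_nth_le[of "\<sigma> s" i]] by (auto simp: f_def)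
  have f2: "(\<lambda>s. (norm (f i j s))\<^sup>2) integrable_on {0..pi}" for i j
  proof -
    have "(\<lambda>s. (norm (f i j s))\<^sup>2) absolutely_integrable_on {0..pi}"
    proof (rule measurable_bounded_by_integrable_imp_absolutely_integrable)
      have "f i j \<in> borel_measurable (lebesgue_on {0..pi})" using fA by (rule absolutely_integrable_imp_borel_measurable) auto
      then show "(\<lambda>s. (norm (f i j s))\<^sup>2) \<in> borel_measurable (lebesgue_on {0..pi})" by measurable
      show "(\<lambda>s. (norm (\<sigma> s))\<^sup>2) integrable_on {0..pi}" using L2_imp_integrable(3)[OF L2] by (simp add: absolutely_integrable_on_def)
      show "norm ((norm (f i j s))\<^sup>2) \<le> (norm (\<sigma> s))\<^sup>2" for s using le by (auto intro: power_mono)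
    qed auto
    then show ?thesis by (simp add: absolutely_integrable_on_def)
  qed
  have ent_fourier: "fourier \<sigma> (of_int n) x $ i $ j = integral {0..pi} (\<lambda>s. f i j s * cis (2 * of_int n * s))" for n :: int and i j
  proof -
    have "fourier \<sigma> (of_int n) x $ i $ j = integral {0..x} (\<lambda>s. mscale (cis (2 * of_int n * s)) (\<sigma> s) $ i $ j)"
      unfolding fourier_def
      using integral_linear[OF primitive_onD(3)[OF primitive_fourier, of 0 x "of_int n"] bl[of i j]] x
      by (simp add: o_def)
    also have "\<dots> = integral {0..x} (\<lambda>s. f i j s * cis (2 * of_int n * s))"
      by (intro Henstock_Kurzweil_Integration.integral_cong) (simp add: f_def mscale_nth mult.commute)
    also have "\<dots> = integral {0..pi} (\<lambda>s. if s \<in> {0..x} then f i j s * cis (2 * of_int n * s) else 0)"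
    proof -
      have "{0..x} \<inter> {0..pi} = {0..x}" using x by auto
      then show ?thesis by (simp only: integral_restrict_Int)
    qed
    also have "\<dots> = integral {0..pi} (\<lambda>s. f i j s * cis (2 * of_int n * s))"
      by (intro Henstock_Kurzweil_Integration.integral_cong) (simp add: f_def)
    finally show ?thesis .
  qed
  have "(\<Sum>n\<in>I. (norm (fourier \<sigma> (of_int n) x))\<^sup>2) = (\<Sum>i\<in>UNIV. \<Sum>j\<in>UNIV. \<Sum>n\<in>I. (norm (fourier \<sigma> (of_int n) x $ i $ j))\<^sup>2)"
    unfolding norm_matrix_power2 by (subst sum.swap, rule sum.cong[OF refl], rule sum.swap)
  also have "\<dots> \<le> (\<Sum>i\<in>UNIV. \<Sum>j\<in>UNIV. pi * integral {0..pi} (\<lambda>s. (norm (f i j s))\<^sup>2))"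
    unfolding ent_fourier by (intro sum_mono Bessel_inequality fA f2 I)
  also have "\<dots> = pi * integral {0..pi} (\<lambda>s. \<Sum>i\<in>UNIV. \<Sum>j\<in>UNIV. (norm (f i j s))\<^sup>2)"
    using f2 by (simp add: integral_sum integrable_sum sum_distrib_left)
  also have "\<dots> \<le> pi * integral {0..pi} (\<lambda>s. (norm (\<sigma> s))\<^sup>2)"
  proof (intro mult_left_mono integral_le)
    show "(\<lambda>s. \<Sum>i\<in>UNIV. \<Sum>j\<in>UNIV. (norm (f i j s))\<^sup>2) integrable_on {0..pi}" using f2 by (intro integrable_sum) auto
    show "(\<lambda>s. (norm (\<sigma> s))\<^sup>2) integrable_on {0..pi}" using L2_imp_integrable(3)[OF L2] by (simp add: absolutely_integrable_on_def)
    show "(\<Sum>i\<in>UNIV. \<Sum>j\<in>UNIV. (norm (f i j s))\<^sup>2) \<le> (norm (\<sigma> s))\<^sup>2" for s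
      unfolding norm_matrix_power2 by (intro sum_mono power_mono) (auto simp: f_def)
  qed auto
  finally show ?thesis .
qed

text \<open>Integration by parts moves a bounded change of frequency onto an integrated Fourier term.\<close>

lemma fourier_shift:
  assumes x: "x \<in> {0..pi}"
  shows "norm (fourier \<sigma> (w + d) x) \<le> norm (fourier \<sigma> w x) + 2 * \<bar>d\<bar> * integral {0..pi} (\<lambda>s. norm (fourier \<sigma> w s))"
proof -
  have p: "primitive_on 0 pi (\<lambda>x. mscale (cis ((2 * d) * x)) (fourier \<sigma> w x))
     (\<lambda>x. mscale (cis ((2 * d) * x)) (mscale (cis (2 * w * x)) (\<sigma> x)) + mscale (of_real (2 * d) * (\<i> * cis ((2 * d) * x))) (fourier \<sigma> w x))"
    by (rule primitive_on_bilinear[OF bounded_bilinear_mscale primitive_on_cis primitive_fourier])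
  define g where "g x = mscale (of_real (2 * d) * (\<i> * cis ((2 * d) * x))) (fourier \<sigma> w x)" for x
  have gc: "continuous_on {0..pi} g" unfolding g_def
    by (intro bounded_bilinear.continuous_on[OF bounded_bilinear_mscale] continuous_intros fourier_continuous)
  have gi: "g integrable_on {0..x}" by (rule integrable_continuous_real[OF continuous_on_subset[OF gc]]) (use x in auto)
  have e: "mscale (cis ((2 * d) * x)) (mscale (cis (2 * w * x)) (\<sigma> x)) = mscale (cis (2 * (w + d) * x)) (\<sigma> x)" for x
    by (simp add: mscale_assoc cis_mult algebra_simps)
  have "mscale (cis ((2 * d) * x)) (fourier \<sigma> w x) = integral {0..x} (\<lambda>x. mscale (cis (2 * (w + d) * x)) (\<sigma> x) + g x)"
    using primitive_onD(4)[OF p x] unfolding e g_def[symmetric] by (simp add: fourier_0 mscale_def map_matrix_def vec_eq_iff)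
  also have "\<dots> = fourier \<sigma> (w + d) x + integral {0..x} g"
    using primitive_onD(3)[OF primitive_fourier, of 0 x "w + d"] gi x
    by (simp add: fourier_def Henstock_Kurzweil_Integration.integral_add)
  finally have "fourier \<sigma> (w + d) x = mscale (cis ((2 * d) * x)) (fourier \<sigma> w x) - integral {0..x} g" by simp
  then have "norm (fourier \<sigma> (w + d) x) \<le> norm (mscale (cis ((2 * d) * x)) (fourier \<sigma> w x)) + norm (integral {0..x} g)"
    by (simp only: norm_triangle_ineq4)
  also have "norm (mscale (cis ((2 * d) * x)) (fourier \<sigma> w x)) = norm (fourier \<sigma> w x)" by (simp add: norm_mscale)
  also have "norm (integral {0..x} g) \<le> integral {0..x} (\<lambda>s. 2 * \<bar>d\<bar> * norm (fourier \<sigma> w s))"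
    using x by (intro integral_norm_bound_integral gi integrable_continuous_real continuous_intros continuous_on_subset[OF fourier_continuous])
      (auto simp: g_def norm_mscale norm_mult)
  also have "\<dots> \<le> integral {0..pi} (\<lambda>s. 2 * \<bar>d\<bar> * norm (fourier \<sigma> w s))"
    using x by (intro integral_subset_le integrable_continuous_real continuous_intros fourier_continuous continuous_on_subset[OF fourier_continuous]) auto
  finally show ?thesis by simp
qed

end


text \<open>
  With \<open>z\<close> the quasi-derivative divided by \<open>\<rho>\<close>, the functions \<open>e\<^sup>-\<^sup>i\<^sup>\<rho>\<^sup>x (z + i y)\<close> and \<open>e\<^sup>i\<^sup>\<rho>\<^sup>x (z - i y)\<close> are
  constant for \<open>\<sigma> = 0\<close>. In general they vary slowly: their derivatives only contain the oscillating
  factors \<open>e\<^sup>\<plusminus>\<^sup>2\<^sup>i\<^sup>\<rho>\<^sup>x \<sigma>\<close> and terms of order \<open>1/\<rho>\<close>.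
\<close>

definition amplitude :: "real \<Rightarrow> (real \<Rightarrow> (complex^'m) \<times> (complex^'m)) \<Rightarrow> real \<Rightarrow> real \<Rightarrow> complex^'m" where
  "amplitude \<rho> u \<epsilon> x = cis (- \<epsilon> * \<rho> * x) *s (of_real (1 / \<rho>) *s snd (u x) + (of_real \<epsilon> * \<i>) *s fst (u x))"

context
  fixes \<sigma> :: "real \<Rightarrow> complex^'m^'m" and \<rho> :: real and u
  assumes L2: "L2 \<sigma>" and \<rho>: "\<rho> \<ge> 1" and u: "sys_solution \<sigma> (complex_of_real (\<rho>\<^sup>2)) (\<lambda>x. 0) u"
begin

abbreviation "amp \<equiv> amplitude \<rho> u"

definition "rest x = of_real (1 / \<rho>) *s (\<sigma> x *v (\<sigma> x *v fst (u x)))"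

lemma amp_primitive:
  assumes \<epsilon>: "\<epsilon> * \<epsilon> = 1"
  shows "primitive_on 0 pi (amp \<epsilon>) (\<lambda>x. - (mscale (cis (2 * (- \<epsilon> * \<rho>) * x)) (\<sigma> x) *v amp (- \<epsilon>) x) - cis (- \<epsilon> * \<rho> * x) *s rest x)"
proof -
  have G: "primitive_on 0 pi (\<lambda>x. of_real (1 / \<rho>) *s snd (u x) + (of_real \<epsilon> * \<i>) *s fst (u x))
     (\<lambda>x. of_real (1 / \<rho>) *s snd (sys \<sigma> (complex_of_real (\<rho>\<^sup>2)) x (u x) + 0) + (of_real \<epsilon> * \<i>) *s fst (sys \<sigma> (complex_of_real (\<rho>\<^sup>2)) x (u x) + 0))"
    by (intro primitive_on_add primitive_on_linear[OF bounded_linear_vector_scalar_mult]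
        primitive_on_linear[OF bounded_linear_fst u[unfolded sys_solution_def]] primitive_on_linear[OF bounded_linear_snd u[unfolded sys_solution_def]])
  show ?thesis
  proof (rule primitive_on_cong[OF primitive_on_bilinear[OF bounded_bilinear_vector_scalar_mult primitive_on_cis[of 0 pi "- \<epsilon> * \<rho>"] G], where N = "{}"])
    fix x
    define y z where "y = fst (u x)" and "z = complex_of_real (1 / \<rho>) *s snd (u x)"
    have su: "snd (u x) = complex_of_real \<rho> *s z" using \<rho> by (simp add: z_def)
    have r: "complex_of_real (1 / \<rho>) * complex_of_real (\<rho>\<^sup>2) = complex_of_real \<rho>" "complex_of_real (1 / \<rho>) * complex_of_real \<rho> = 1"
      using \<rho> by (simp_all add: power2_eq_square)
    have ee: "complex_of_real \<epsilon> * complex_of_real \<epsilon> = 1" using \<epsilon> by (metis of_real_1 of_real_mult)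
    have 1: "complex_of_real (1 / \<rho>) *s snd (sys \<sigma> (complex_of_real (\<rho>\<^sup>2)) x (u x) + 0) = - (complex_of_real \<rho> *s y) - \<sigma> x *v z - rest x"
      by (simp add: sys_def su y_def[symmetric] rest_def matrix_vector_mult_scale vec.scale_right_diff_distrib r matrix_vector_mul_assoc del: of_real_divide of_real_power)
    have 2: "(of_real \<epsilon> * \<i>) *s fst (sys \<sigma> (complex_of_real (\<rho>\<^sup>2)) x (u x) + 0) = (of_real \<epsilon> * \<i>) *s (\<sigma> x *v y) + (of_real \<epsilon> * \<i> * of_real \<rho>) *s z"
      by (simp add: sys_def su y_def[symmetric] vec.scale_right_distrib)
    have cc: "cis (2 * (- \<epsilon> * \<rho>) * x) * cis (\<epsilon> * \<rho> * x) = cis (- \<epsilon> * \<rho> * x)" by (simp add: cis_mult algebra_simps)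
    have 3: "mscale (cis (2 * (- \<epsilon> * \<rho>) * x)) (\<sigma> x) *v amp (- \<epsilon>) x = cis (- \<epsilon> * \<rho> * x) *s (\<sigma> x *v z - (of_real \<epsilon> * \<i>) *s (\<sigma> x *v y))"
    proof -
      have "amp (- \<epsilon>) x = cis (\<epsilon> * \<rho> * x) *s (z - (of_real \<epsilon> * \<i>) *s y)"
        by (simp add: amplitude_def z_def y_def vec_eq_iff)
      then show ?thesis
        unfolding mscale_mult by (simp only: matrix_vector_mult_scale vec.scale_scale cc matrix_vector_mult_diff_distrib)
    qed
    \<comment> \<open>The terms with \<rho> cancel: those in \<open>z\<close> directly, those in
      \<open>y\<close> through the factor \<epsilon>^2 - 1.\<close>
    have "cis (- \<epsilon> * \<rho> * x) *s (- (complex_of_real \<rho> *s y) - \<sigma> x *v z - rest x + ((of_real \<epsilon> * \<i>) *s (\<sigma> x *v y) + (of_real \<epsilon> * \<i> * of_real \<rho>) *s z)) +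
          (of_real (- \<epsilon> * \<rho>) * (\<i> * cis (- \<epsilon> * \<rho> * x))) *s (z + (of_real \<epsilon> * \<i>) *s y) =
        cis (- \<epsilon> * \<rho> * x) *s (- (\<sigma> x *v z) - rest x + (of_real \<epsilon> * \<i>) *s (\<sigma> x *v y)) + ((complex_of_real \<epsilon> * complex_of_real \<epsilon> - 1) * of_real \<rho> * cis (- \<epsilon> * \<rho> * x)) *s y"
      by (simp add: vec_eq_iff algebra_simps)
    also have "\<dots> = - (cis (- \<epsilon> * \<rho> * x) *s (\<sigma> x *v z - (of_real \<epsilon> * \<i>) *s (\<sigma> x *v y))) - cis (- \<epsilon> * \<rho> * x) *s rest x"
      unfolding ee by (simp add: vec_eq_iff algebra_simps)
    finally show "cis (- \<epsilon> * \<rho> * x) *s (of_real (1 / \<rho>) *s snd (sys \<sigma> (complex_of_real (\<rho>\<^sup>2)) x (u x) + 0) + (of_real \<epsilon> * \<i>) *s fst (sys \<sigma> (complex_of_real (\<rho>\<^sup>2)) x (u x) + 0)) +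
         (of_real (- \<epsilon> * \<rho>) * (\<i> * cis (- \<epsilon> * \<rho> * x))) *s (of_real (1 / \<rho>) *s snd (u x) + (of_real \<epsilon> * \<i>) *s fst (u x)) =
         - (mscale (cis (2 * (- \<epsilon> * \<rho>) * x)) (\<sigma> x) *v amp (- \<epsilon>) x) - cis (- \<epsilon> * \<rho> * x) *s rest x"
      unfolding 1 2 3 y_def[symmetric] z_def[symmetric] .
  qed (simp_all add: amplitude_def)
qed

lemma fst_amp: "(2 * \<i>) *s fst (u x) = cis (\<rho> * x) *s amp 1 x - cis (- \<rho> * x) *s amp (- 1) x"
  and snd_amp: "2 *s (of_real (1 / \<rho>) *s snd (u x)) = cis (\<rho> * x) *s amp 1 x + cis (- \<rho> * x) *s amp (- 1) x"
proof -
  have c: "cis (\<rho> * x) * cis (- (\<rho> * x)) = 1" by (simp add: cis_mult)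
  have a1: "cis (\<rho> * x) *s amp 1 x = of_real (1 / \<rho>) *s snd (u x) + \<i> *s fst (u x)"
    unfolding amplitude_def vec.scale_scale using c by simp
  have a2: "cis (- \<rho> * x) *s amp (- 1) x = of_real (1 / \<rho>) *s snd (u x) - \<i> *s fst (u x)"
    unfolding amplitude_def vec.scale_scale using c by (simp add: mult.commute vec.scale_minus_left)
  show "(2 * \<i>) *s fst (u x) = cis (\<rho> * x) *s amp 1 x - cis (- \<rho> * x) *s amp (- 1) x"
    unfolding a1 a2 by (simp add: vec_eq_iff)
  show "2 *s (of_real (1 / \<rho>) *s snd (u x)) = cis (\<rho> * x) *s amp 1 x + cis (- \<rho> * x) *s amp (- 1) x"
    unfolding a1 a2 by (simp add: vec_eq_iff)
qed

lemma norm_fst_le_amp: "2 * norm (fst (u x)) \<le> norm (amp 1 x) + norm (amp (- 1) x)"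
proof -
  have "2 * norm (fst (u x)) = norm ((2 * \<i>) *s fst (u x))" unfolding norm_vector_scalar_mult by simp
  also have "\<dots> \<le> norm (cis (\<rho> * x) *s amp 1 x) + norm (cis (- \<rho> * x) *s amp (- 1) x)"
    unfolding fst_amp by (rule norm_triangle_ineq4)
  finally show ?thesis by (simp add: norm_vector_scalar_mult)
qed

lemma norm_rest_le: "norm (rest x) \<le> (norm (\<sigma> x))\<^sup>2 / \<rho> * norm (fst (u x))"
proof -
  have "norm (rest x) = 1 / \<rho> * norm (\<sigma> x *v (\<sigma> x *v fst (u x)))" using \<rho> by (simp add: rest_def norm_vector_scalar_mult norm_divide)
  also have "\<dots> \<le> 1 / \<rho> * (norm (\<sigma> x) * (norm (\<sigma> x) * norm (fst (u x))))"
    using \<rho> by (intro mult_left_mono order_trans[OF norm_matrix_vector_mult_le mult_left_mono[OF norm_matrix_vector_mult_le]]) auto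
  finally show ?thesis by (simp add: power2_eq_square mult.assoc)
qed

lemma amp_deriv_le:
  "norm (- (mscale (cis (2 * (- \<epsilon> * \<rho>) * x)) (\<sigma> x) *v amp (- \<epsilon>) x) - cis (- \<epsilon> * \<rho> * x) *s rest x)
    \<le> norm (\<sigma> x) * norm (amp (- \<epsilon>) x) + (norm (\<sigma> x))\<^sup>2 / \<rho> * norm (fst (u x))"
proof (rule order_trans[OF norm_triangle_ineq4 add_mono])
  show "norm (- (mscale (cis (2 * (- \<epsilon> * \<rho>) * x)) (\<sigma> x) *v amp (- \<epsilon>) x)) \<le> norm (\<sigma> x) * norm (amp (- \<epsilon>) x)"
    using norm_matrix_vector_mult_le[of "mscale (cis (2 * (- \<epsilon> * \<rho>) * x)) (\<sigma> x)" "amp (- \<epsilon>) x"] by (simp add: norm_mscale)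
  show "norm (cis (- \<epsilon> * \<rho> * x) *s rest x) \<le> (norm (\<sigma> x))\<^sup>2 / \<rho> * norm (fst (u x))"
    using norm_rest_le by (simp add: norm_vector_scalar_mult)
qed

lemma amp_continuous: "\<epsilon> * \<epsilon> = 1 \<Longrightarrow> continuous_on {0..pi} (amp \<epsilon>)"
  by (rule primitive_on_continuous_on[OF amp_primitive])

lemma sigma_integrable:
  "(\<lambda>s. norm (\<sigma> s)) absolutely_integrable_on {0..pi}" "(\<lambda>s. (norm (\<sigma> s))\<^sup>2) absolutely_integrable_on {0..pi}"
  by (rule L2_imp_integrable[OF L2])+

text \<open>The derivative of each amplitude contains the other one, so Gronwall's inequality is
  applied to the sum of their norms. As 1/\<rho> is at most 1, the exponent does not depend on
  \<rho>.\<close>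

lemma amp_bound:
  assumes x: "x \<in> {0..pi}"
  shows "norm (amp 1 x) + norm (amp (- 1) x) \<le> (norm (amp 1 0) + norm (amp (- 1) 0)) * exp (integral {0..pi} (\<lambda>s. norm (\<sigma> s) + (norm (\<sigma> s))\<^sup>2))"
proof -
  define N where "N x = norm (amp 1 x) + norm (amp (- 1) x)" for x
  define k where "k s = norm (\<sigma> s) + (norm (\<sigma> s))\<^sup>2" for s
  have ki: "k absolutely_integrable_on {0..pi}" unfolding k_def by (intro set_integral_add sigma_integrable)
  have Nc: "continuous_on {0..pi} N" unfolding N_def by (intro continuous_intros amp_continuous) auto
  have kN: "(\<lambda>s. k s * N s) absolutely_integrable_on {0..pi}"
    using absolutely_integrable_on_continuous_bilinear[OF bounded_bilinear_mult Nc ki] by (simp add: mult.commute)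
  have "N x \<le> N 0 * exp (integral {0..x} k)"
  proof (rule Gronwall_integrable[OF Nc ki _ _ x])
    show "0 \<le> k x" for x by (simp add: k_def)
    fix x assume x: "x \<in> {0..pi}"
    have part: "norm (amp \<epsilon> x) \<le> norm (amp \<epsilon> 0) + integral {0..x} (\<lambda>s. norm (\<sigma> s) * norm (amp (- \<epsilon>) s) + (norm (\<sigma> s))\<^sup>2 * (N s / 2))"
      and int: "(\<lambda>s. norm (\<sigma> s) * norm (amp (- \<epsilon>) s) + (norm (\<sigma> s))\<^sup>2 * (N s / 2)) integrable_on {0..x}" if \<epsilon>: "\<epsilon> * \<epsilon> = 1" for \<epsilon>
    proof -
      have "(\<lambda>s. norm (amp (- \<epsilon>) s) * norm (\<sigma> s) + (N s / 2) * (norm (\<sigma> s))\<^sup>2) absolutely_integrable_on {0..pi}"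
        using that by (intro set_integral_add absolutely_integrable_on_continuous_bilinear[OF bounded_bilinear_mult] sigma_integrable continuous_intros Nc amp_continuous) auto
      then have "(\<lambda>s. norm (amp (- \<epsilon>) s) * norm (\<sigma> s) + (N s / 2) * (norm (\<sigma> s))\<^sup>2) absolutely_integrable_on {0..x}"
        by (rule absolutely_integrable_on_subinterval) (use x in auto)
      then show int: "(\<lambda>s. norm (\<sigma> s) * norm (amp (- \<epsilon>) s) + (norm (\<sigma> s))\<^sup>2 * (N s / 2)) integrable_on {0..x}"
        by (simp add: absolutely_integrable_on_def mult.commute)
      let ?d = "\<lambda>x. - (mscale (cis (2 * (- \<epsilon> * \<rho>) * x)) (\<sigma> x) *v amp (- \<epsilon>) x) - cis (- \<epsilon> * \<rho> * x) *s rest x"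
      have eq: "amp \<epsilon> x = amp \<epsilon> 0 + integral {0..x} ?d" by (rule primitive_onD(4)[OF amp_primitive[OF \<epsilon>] x])
      have "norm (amp \<epsilon> x) \<le> norm (amp \<epsilon> 0) + norm (integral {0..x} ?d)" by (subst eq) (rule norm_triangle_ineq)
      also have "norm (integral {0..x} ?d) \<le> integral {0..x} (\<lambda>s. norm (\<sigma> s) * norm (amp (- \<epsilon>) s) + (norm (\<sigma> s))\<^sup>2 * (N s / 2))"
      proof (rule integral_norm_bound_integral[OF _ int])
        show "?d integrable_on {0..x}" by (rule primitive_onD(3)[OF amp_primitive[OF \<epsilon>]]) (use x in auto)
        fix s
        have "(norm (\<sigma> s))\<^sup>2 / \<rho> * norm (fst (u s)) \<le> (norm (\<sigma> s))\<^sup>2 * (N s / 2)"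
          using norm_fst_le_amp[of s] \<rho> by (intro mult_mono) (auto simp: N_def divide_le_eq mult_le_cancel_left1)
        then show "norm (?d s) \<le> norm (\<sigma> s) * norm (amp (- \<epsilon>) s) + (norm (\<sigma> s))\<^sup>2 * (N s / 2)"
          using amp_deriv_le[of \<epsilon> s] by linarith
      qed
      finally show "norm (amp \<epsilon> x) \<le> norm (amp \<epsilon> 0) + integral {0..x} (\<lambda>s. norm (\<sigma> s) * norm (amp (- \<epsilon>) s) + (norm (\<sigma> s))\<^sup>2 * (N s / 2))" by simp
    qed
    have "N x \<le> N 0 + (integral {0..x} (\<lambda>s. norm (\<sigma> s) * norm (amp (- 1) s) + (norm (\<sigma> s))\<^sup>2 * (N s / 2)) + integral {0..x} (\<lambda>s. norm (\<sigma> s) * norm (amp (- (- 1)) s) + (norm (\<sigma> s))\<^sup>2 * (N s / 2)))"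
      using part[of 1] part[of "- 1"] unfolding N_def by simp
    also have "integral {0..x} (\<lambda>s. norm (\<sigma> s) * norm (amp (- 1) s) + (norm (\<sigma> s))\<^sup>2 * (N s / 2)) + integral {0..x} (\<lambda>s. norm (\<sigma> s) * norm (amp (- (- 1)) s) + (norm (\<sigma> s))\<^sup>2 * (N s / 2))
       = integral {0..x} (\<lambda>s. k s * N s)"
    proof (subst Henstock_Kurzweil_Integration.integral_add[symmetric])
      show "(\<lambda>s. norm (\<sigma> s) * norm (amp (- 1) s) + (norm (\<sigma> s))\<^sup>2 * (N s / 2)) integrable_on {0..x}" using int[of 1] by simp
      show "(\<lambda>s. norm (\<sigma> s) * norm (amp (- (- 1)) s) + (norm (\<sigma> s))\<^sup>2 * (N s / 2)) integrable_on {0..x}" by (rule int) simp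
      show "integral {0..x} (\<lambda>s. norm (\<sigma> s) * norm (amp (- 1) s) + (norm (\<sigma> s))\<^sup>2 * (N s / 2) + (norm (\<sigma> s) * norm (amp (- (- 1)) s) + (norm (\<sigma> s))\<^sup>2 * (N s / 2))) = integral {0..x} (\<lambda>s. k s * N s)"
        by (intro Henstock_Kurzweil_Integration.integral_cong) (simp add: k_def N_def algebra_simps)
    qed
    finally show "N x \<le> N 0 + integral {0..x} (\<lambda>s. k s * N s)" .
  qed
  also have "\<dots> \<le> N 0 * exp (integral {0..pi} k)"
  proof -
    have "integral {0..x} k \<le> integral {0..pi} k"
      using ki x by (intro integral_subset_le) (auto simp: k_def absolutely_integrable_on_def intro: integrable_on_subinterval)
    then show ?thesis by (intro mult_left_mono) (auto simp: N_def)
  qed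
  finally show ?thesis by (simp add: N_def k_def[abs_def])
qed

text \<open>Taking norms in the equation would only show that the variation is bounded. Integration
  by parts, realized by adding \<open>fourier \<sigma> w x *v amp (- \<epsilon>) x\<close>, removes
  the oscillating term; what remains is a boundary term, a weighted mean of Fourier integrals, and
  terms of order 1/\<rho>.\<close>

lemma amp_variation:
  assumes \<epsilon>: "\<epsilon> * \<epsilon> = 1" and N: "\<And>x. x \<in> {0..pi} \<Longrightarrow> norm (amp 1 x) + norm (amp (- 1) x) \<le> N"
  shows "norm (amp \<epsilon> pi - amp \<epsilon> 0) \<le> N * (norm (fourier \<sigma> (- \<epsilon> * \<rho>) pi)
     + integral {0..pi} (\<lambda>s. norm (\<sigma> s) * norm (fourier \<sigma> (- \<epsilon> * \<rho>) s))
     + (integral {0..pi} (\<lambda>s. norm (\<sigma> s)) + 1) * integral {0..pi} (\<lambda>s. (norm (\<sigma> s))\<^sup>2) / \<rho>)"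
proof -
  define w where "w = - \<epsilon> * \<rho>"
  define s1 s2 where "s1 = integral {0..pi} (\<lambda>s. norm (\<sigma> s))" and "s2 = integral {0..pi} (\<lambda>s. (norm (\<sigma> s))\<^sup>2)"
  have N0: "N \<ge> 0" by (rule order_trans[OF add_nonneg_nonneg[OF norm_ge_zero norm_ge_zero] N[of 0]]) simp
  have e1: "norm (amp e x) \<le> N" if "x \<in> {0..pi}" "e * e = 1" for e x
  proof -
    have "e = 1 \<or> e = - 1" using that(2) by (simp add: square_eq_1_iff)
    then show ?thesis using N[OF that(1)] norm_ge_zero[of "amp 1 x"] norm_ge_zero[of "amp (- 1) x"] by (auto simp del: norm_ge_zero)
  qed
  have ym: "norm (fst (u x)) \<le> N" if "x \<in> {0..pi}" for x
    using norm_fst_le_amp[of x] N[OF that] N0 by linarith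
  have \<epsilon>': "- \<epsilon> * - \<epsilon> = 1" using \<epsilon> by simp
  define D where "D x = - (mscale (cis (2 * (- (- \<epsilon>) * \<rho>) * x)) (\<sigma> x) *v amp (- (- \<epsilon>)) x) - cis (- (- \<epsilon>) * \<rho> * x) *s rest x" for x
  have pQ: "primitive_on 0 pi (amp (- \<epsilon>)) D" unfolding D_def by (rule amp_primitive[OF \<epsilon>'])
  have pF: "primitive_on 0 pi (\<lambda>x. fourier \<sigma> w x *v amp (- \<epsilon>) x) (\<lambda>x. fourier \<sigma> w x *v D x + mscale (cis (2 * w * x)) (\<sigma> x) *v amp (- \<epsilon>) x)"
    by (rule primitive_on_bilinear[OF bounded_bilinear_matrix_vector_mult primitive_fourier[OF L2] pQ])
  \<comment> \<open>The product rule for the added term reproduces the oscillating term with the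
    opposite sign, so it drops out of the sum.\<close>
  have p: "primitive_on 0 pi (\<lambda>x. amp \<epsilon> x + fourier \<sigma> w x *v amp (- \<epsilon>) x)
     (\<lambda>x. (- (mscale (cis (2 * w * x)) (\<sigma> x) *v amp (- \<epsilon>) x) - cis (w * x) *s rest x) + (fourier \<sigma> w x *v D x + mscale (cis (2 * w * x)) (\<sigma> x) *v amp (- \<epsilon>) x))"
    using primitive_on_add[OF amp_primitive[OF \<epsilon>] pF] unfolding w_def .
  define d where "d x = fourier \<sigma> w x *v D x - cis (w * x) *s rest x" for x
  have p': "primitive_on 0 pi (\<lambda>x. amp \<epsilon> x + fourier \<sigma> w x *v amp (- \<epsilon>) x) d"
    using p by (rule primitive_on_cong[where N = "{}"]) (auto simp: d_def)
  have fi: "(\<lambda>s. norm (\<sigma> s) * norm (fourier \<sigma> w s)) integrable_on {0..pi}"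
    using absolutely_integrable_on_continuous_bilinear[OF bounded_bilinear_mult continuous_on_norm[OF fourier_continuous[OF L2]] sigma_integrable(1), of w]
    by (simp add: absolutely_integrable_on_def mult.commute)
  have s2i: "(\<lambda>s. (norm (\<sigma> s))\<^sup>2) integrable_on {0..pi}" using sigma_integrable(2) by (simp add: absolutely_integrable_on_def)
  have s0: "s1 \<ge> 0" "s2 \<ge> 0" unfolding s1_def s2_def using sigma_integrable by (auto simp: absolutely_integrable_on_def intro!: integral_nonneg)
  have "amp \<epsilon> pi - amp \<epsilon> 0 = integral {0..pi} d - fourier \<sigma> w pi *v amp (- \<epsilon>) pi"
  proof -
    have "amp \<epsilon> pi + fourier \<sigma> w pi *v amp (- \<epsilon>) pi = amp \<epsilon> 0 + integral {0..pi} d"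
      using primitive_onD(4)[OF p', of pi] by (simp add: fourier_0[OF L2])
    then have "amp \<epsilon> pi = amp \<epsilon> 0 + integral {0..pi} d - fourier \<sigma> w pi *v amp (- \<epsilon>) pi" by (simp add: eq_diff_eq)
    then show ?thesis by simp
  qed
  then have "norm (amp \<epsilon> pi - amp \<epsilon> 0) \<le> norm (integral {0..pi} d) + norm (fourier \<sigma> w pi *v amp (- \<epsilon>) pi)"
    by (simp only: norm_triangle_ineq4)
  also have "norm (fourier \<sigma> w pi *v amp (- \<epsilon>) pi) \<le> norm (fourier \<sigma> w pi) * N"
    by (rule order_trans[OF norm_matrix_vector_mult_le mult_left_mono[OF e1[OF _ \<epsilon>']]]) auto
  also have "norm (integral {0..pi} d) \<le> integral {0..pi} (\<lambda>s. N * (norm (\<sigma> s) * norm (fourier \<sigma> w s)) + N * ((s1 + 1) / \<rho>) * (norm (\<sigma> s))\<^sup>2)"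
  proof (rule integral_norm_bound_integral)
    show "d integrable_on {0..pi}" by (rule primitive_onD(2)[OF p'])
    show "(\<lambda>s. N * (norm (\<sigma> s) * norm (fourier \<sigma> w s)) + N * ((s1 + 1) / \<rho>) * (norm (\<sigma> s))\<^sup>2) integrable_on {0..pi}"
      by (intro integrable_add integrable_on_mult_right fi s2i)
    fix x assume x: "x \<in> {0..pi}"
    have "norm (D x) \<le> norm (\<sigma> x) * norm (amp (- (- \<epsilon>)) x) + (norm (\<sigma> x))\<^sup>2 / \<rho> * norm (fst (u x))"
      unfolding D_def by (rule amp_deriv_le)
    also have "\<dots> \<le> norm (\<sigma> x) * N + (norm (\<sigma> x))\<^sup>2 / \<rho> * N"
      using e1[OF x, of "- (- \<epsilon>)"] \<epsilon> ym[OF x] \<rho> by (intro add_mono mult_left_mono) auto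
    finally have D: "norm (D x) \<le> norm (\<sigma> x) * N + (norm (\<sigma> x))\<^sup>2 / \<rho> * N" .
    have "norm (d x) \<le> norm (fourier \<sigma> w x) * norm (D x) + norm (rest x)"
      unfolding d_def
      by (rule order_trans[OF norm_triangle_ineq4 add_mono[OF norm_matrix_vector_mult_le]]) (simp add: norm_vector_scalar_mult)
    also have "\<dots> \<le> norm (fourier \<sigma> w x) * (norm (\<sigma> x) * N + (norm (\<sigma> x))\<^sup>2 / \<rho> * N) + (norm (\<sigma> x))\<^sup>2 / \<rho> * N"
    proof (intro add_mono mult_left_mono D)
      show "norm (rest x) \<le> (norm (\<sigma> x))\<^sup>2 / \<rho> * N"
        by (rule order_trans[OF norm_rest_le mult_left_mono[OF ym[OF x]]]) (use \<rho> in auto)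
    qed auto
    also have "\<dots> = N * (norm (\<sigma> x) * norm (fourier \<sigma> w x)) + (norm (fourier \<sigma> w x) + 1) * ((norm (\<sigma> x))\<^sup>2 / \<rho> * N)"
      by (simp add: algebra_simps add_divide_distrib)
    also have "\<dots> \<le> N * (norm (\<sigma> x) * norm (fourier \<sigma> w x)) + (s1 + 1) * ((norm (\<sigma> x))\<^sup>2 / \<rho> * N)"
      using norm_fourier_le[OF L2 x, of w] N0 \<rho> by (intro add_left_mono mult_right_mono) (auto simp: s1_def)
    finally show "norm (d x) \<le> N * (norm (\<sigma> x) * norm (fourier \<sigma> w x)) + N * ((s1 + 1) / \<rho>) * (norm (\<sigma> x))\<^sup>2"
      by (simp add: mult_ac)
  qed
  also have "\<dots> = N * integral {0..pi} (\<lambda>s. norm (\<sigma> s) * norm (fourier \<sigma> w s)) + N * ((s1 + 1) / \<rho>) * s2"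
    unfolding s2_def using fi s2i
    by (subst Henstock_Kurzweil_Integration.integral_add) (simp_all only: integrable_on_mult_right integral_mult_right)
  finally show ?thesis by (simp add: w_def s1_def s2_def distrib_left algebra_simps add_divide_distrib)
qed

end


section \<open>The square summable remainder\<close>

lemma fourier_scaleR:
  fixes \<sigma> :: "real \<Rightarrow> complex^'m^'m"
  assumes "L2 \<sigma>" "x \<in> {0..pi}"
  shows "fourier (\<lambda>x. t *\<^sub>R \<sigma> x) w x = t *\<^sub>R fourier \<sigma> w x"
proof -
  have e: "mscale c (t *\<^sub>R A) = t *\<^sub>R mscale c A" for c and A :: "complex^'m^'m"
    by (simp add: vec_eq_iff mscale_nth)
  show ?thesis unfolding fourier_def by (simp only: e integral_cmul)
qed

text \<open>Both signs of the frequency occur, because the two amplitudes belong to \<epsilon> = 1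
  and \<epsilon> = - 1.\<close>

definition fourier_pair :: "(real \<Rightarrow> complex^'m^'m) \<Rightarrow> nat \<Rightarrow> real \<Rightarrow> real" where
  "fourier_pair \<sigma> n x = norm (fourier \<sigma> (real n) x) + norm (fourier \<sigma> (- real n) x)"

text \<open>For |\<rho> - n| at most 2, \<open>fourier_shift\<close> replaces the frequency \<rho>
  by \<open>n\<close> at the cost of four times the integral of the Fourier terms. This cost is paid
  once at the endpoint and once under the integral against \<open>norm (\<sigma> s)\<close>, which
  explains the first two summands.\<close>

definition remainder_weight :: "(real \<Rightarrow> complex^'m^'m) \<Rightarrow> real \<Rightarrow> real" where
  "remainder_weight \<sigma> x = 4 + 4 * integral {0..pi} (\<lambda>s. norm (\<sigma> s)) + norm (\<sigma> x)"

text \<open>\<open>3 / real n\<close> dominates 1/\<rho> when \<rho> is at least 1 and within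
  distance 2 of \<open>n\<close>. The added 1 lets the last term also cover the contributions of
  order 1/\<rho> from \<open>H1\<close> and \<open>H2\<close>.\<close>

definition remainder :: "(real \<Rightarrow> complex^'m^'m) \<Rightarrow> nat \<Rightarrow> real" where
  "remainder \<sigma> n = fourier_pair \<sigma> n pi + integral {0..pi} (\<lambda>x. remainder_weight \<sigma> x * fourier_pair \<sigma> n x)
     + ((integral {0..pi} (\<lambda>s. norm (\<sigma> s)) + 1) * integral {0..pi} (\<lambda>s. (norm (\<sigma> s))\<^sup>2) + 1) * (3 / real n)"

context
  fixes \<sigma> :: "real \<Rightarrow> complex^'m^'m"
  assumes L2: "L2 \<sigma>"
begin

lemma fourier_pair_continuous: "continuous_on {0..pi} (fourier_pair \<sigma> n)"
  unfolding fourier_pair_def by (intro continuous_intros fourier_continuous[OF L2])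

lemma sigma_integrals:
  "(\<lambda>s. norm (\<sigma> s)) integrable_on {0..pi}" "(\<lambda>s. (norm (\<sigma> s))\<^sup>2) integrable_on {0..pi}"
  "integral {0..pi} (\<lambda>s. norm (\<sigma> s)) \<ge> 0" "integral {0..pi} (\<lambda>s. (norm (\<sigma> s))\<^sup>2) \<ge> 0"
  using L2_imp_integrable[OF L2] by (auto simp: absolutely_integrable_on_def intro!: integral_nonneg)

lemma remainder_weight_integrable: "remainder_weight \<sigma> absolutely_integrable_on {0..pi}" "remainder_weight \<sigma> x \<ge> 4"
  unfolding remainder_weight_def using L2_imp_integrable(2)[OF L2] sigma_integrals
  by (auto intro!: set_integral_add absolutely_integrable_on_const)

lemma weight_mult_integrable:
  assumes "continuous_on {0..pi} f"
  shows "(\<lambda>x. remainder_weight \<sigma> x * f x) integrable_on {0..pi}"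
  using absolutely_integrable_on_continuous_bilinear[OF bounded_bilinear_mult assms remainder_weight_integrable(1)]
  by (simp add: absolutely_integrable_on_def mult.commute)

lemma fourier_pair_sum_le:
  assumes x: "x \<in> {0..pi}"
  shows "(\<Sum>n\<le>N. (fourier_pair \<sigma> n x)\<^sup>2) \<le> 4 * pi * integral {0..pi} (\<lambda>s. (norm (\<sigma> s))\<^sup>2)"
proof -
  have "(\<Sum>n\<le>N. (fourier_pair \<sigma> n x)\<^sup>2) \<le> (\<Sum>n\<le>N. 2 * (norm (fourier \<sigma> (real n) x))\<^sup>2 + 2 * (norm (fourier \<sigma> (- real n) x))\<^sup>2)"
  proof (rule sum_mono)
    fix n
    show "(fourier_pair \<sigma> n x)\<^sup>2 \<le> 2 * (norm (fourier \<sigma> (real n) x))\<^sup>2 + 2 * (norm (fourier \<sigma> (- real n) x))\<^sup>2"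
      using sum_squares_bound[of "norm (fourier \<sigma> (real n) x)" "norm (fourier \<sigma> (- real n) x)"]
      unfolding fourier_pair_def power2_sum by linarith
  qed
  also have "\<dots> = 2 * (\<Sum>n\<le>N. (norm (fourier \<sigma> (real n) x))\<^sup>2) + 2 * (\<Sum>n\<le>N. (norm (fourier \<sigma> (- real n) x))\<^sup>2)"
    by (simp add: sum.distrib sum_distrib_left)
  also have "(\<Sum>n\<le>N. (norm (fourier \<sigma> (real n) x))\<^sup>2) = (\<Sum>k\<in>int ` {..N}. (norm (fourier \<sigma> (of_int k) x))\<^sup>2)"
    by (subst sum.reindex) (auto simp: inj_on_def)
  also have "\<dots> \<le> pi * integral {0..pi} (\<lambda>s. (norm (\<sigma> s))\<^sup>2)" by (rule fourier_Bessel[OF L2 x]) simp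
  also have "(\<Sum>n\<le>N. (norm (fourier \<sigma> (- real n) x))\<^sup>2) = (\<Sum>k\<in>(\<lambda>n. - int n) ` {..N}. (norm (fourier \<sigma> (of_int k) x))\<^sup>2)"
    by (subst sum.reindex) (auto simp: inj_on_def)
  also have "\<dots> \<le> pi * integral {0..pi} (\<lambda>s. (norm (\<sigma> s))\<^sup>2)" by (rule fourier_Bessel[OF L2 x]) simp
  finally show ?thesis by simp
qed

lemma remainder_nonneg: "remainder \<sigma> n \<ge> 0" "3 / real n \<le> remainder \<sigma> n"
proof -
  have i: "integral {0..pi} (\<lambda>x. remainder_weight \<sigma> x * fourier_pair \<sigma> n x) \<ge> 0"
    using remainder_weight_integrable(2) by (intro integral_nonneg weight_mult_integrable fourier_pair_continuous mult_nonneg_nonneg)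
      (auto simp: fourier_pair_def intro: order_trans[of 0 4])
  have p: "fourier_pair \<sigma> n pi \<ge> 0" by (simp add: fourier_pair_def)
  have "1 * (3 / real n) \<le> ((integral {0..pi} (\<lambda>s. norm (\<sigma> s)) + 1) * integral {0..pi} (\<lambda>s. (norm (\<sigma> s))\<^sup>2) + 1) * (3 / real n)"
    using sigma_integrals by (intro mult_right_mono) auto
  with i p show "3 / real n \<le> remainder \<sigma> n" by (simp add: remainder_def)
  then show "remainder \<sigma> n \<ge> 0" by (rule order_trans[rotated]) simp
qed

text \<open>For fixed \<open>x\<close> the squares of the Fourier terms have a sum bounded uniformly
  in \<open>x\<close> by Bessel's inequality. Cauchy-Schwarz with respect to the integrable weight,
  split into two square roots, moves the square under the integral, where the finite sums can be
  formed first.\<close>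

lemma remainder_summable: "summable (\<lambda>n. (remainder \<sigma> n)\<^sup>2)"
proof -
  define B where "B = 4 * pi * integral {0..pi} (\<lambda>s. (norm (\<sigma> s))\<^sup>2)"
  define W where "W = integral {0..pi} (remainder_weight \<sigma>)"
  define J where "J n = integral {0..pi} (\<lambda>x. remainder_weight \<sigma> x * fourier_pair \<sigma> n x)" for n
  define K where "K = ((integral {0..pi} (\<lambda>s. norm (\<sigma> s)) + 1) * integral {0..pi} (\<lambda>s. (norm (\<sigma> s))\<^sup>2) + 1) * 3"
  have w0: "remainder_weight \<sigma> x \<ge> 0" for x using remainder_weight_integrable(2)[of x] by simp
  have wi: "remainder_weight \<sigma> integrable_on {0..pi}" using remainder_weight_integrable(1) by (simp add: absolutely_integrable_on_def)
  have W0: "W \<ge> 0" unfolding W_def using wi w0 by (intro integral_nonneg) auto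
  have 1: "summable (\<lambda>n. (fourier_pair \<sigma> n pi)\<^sup>2)"
  proof (rule bounded_imp_summable)
    show "(\<Sum>k\<le>N. (fourier_pair \<sigma> k pi)\<^sup>2) \<le> B" for N unfolding B_def by (rule fourier_pair_sum_le) simp
  qed simp
  have J2: "(J n)\<^sup>2 \<le> W * integral {0..pi} (\<lambda>x. remainder_weight \<sigma> x * (fourier_pair \<sigma> n x)\<^sup>2)" for n
  proof -
    have "(integral {0..pi} (\<lambda>x. sqrt (remainder_weight \<sigma> x) * (sqrt (remainder_weight \<sigma> x) * fourier_pair \<sigma> n x)))\<^sup>2
      \<le> integral {0..pi} (\<lambda>x. (sqrt (remainder_weight \<sigma> x))\<^sup>2) * integral {0..pi} (\<lambda>x. (sqrt (remainder_weight \<sigma> x) * fourier_pair \<sigma> n x)\<^sup>2)"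
    proof (rule Cauchy_Schwarz_integral)
      show "(\<lambda>x. sqrt (remainder_weight \<sigma> x) * (sqrt (remainder_weight \<sigma> x) * fourier_pair \<sigma> n x)) integrable_on {0..pi}"
        using weight_mult_integrable[OF fourier_pair_continuous[of n]] w0 by (simp flip: mult.assoc)
      show "(\<lambda>x. (sqrt (remainder_weight \<sigma> x))\<^sup>2) integrable_on {0..pi}" using wi w0 by simp
      show "(\<lambda>x. (sqrt (remainder_weight \<sigma> x) * fourier_pair \<sigma> n x)\<^sup>2) integrable_on {0..pi}"
        using weight_mult_integrable[OF continuous_on_power[OF fourier_pair_continuous[of n]], of 2] w0 by (simp add: power_mult_distrib)
    qed
    then show ?thesis using w0 by (simp add: J_def W_def power_mult_distrib flip: mult.assoc)
  qed
  have 2: "summable (\<lambda>n. (J n)\<^sup>2)"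
  proof (rule bounded_imp_summable)
    fix N
    have i: "(\<lambda>x. remainder_weight \<sigma> x * (fourier_pair \<sigma> n x)\<^sup>2) integrable_on {0..pi}" for n
      by (intro weight_mult_integrable continuous_intros fourier_pair_continuous)
    have "(\<Sum>k\<le>N. (J k)\<^sup>2) \<le> (\<Sum>k\<le>N. W * integral {0..pi} (\<lambda>x. remainder_weight \<sigma> x * (fourier_pair \<sigma> k x)\<^sup>2))"
      by (intro sum_mono J2)
    also have "\<dots> = W * integral {0..pi} (\<lambda>x. \<Sum>k\<le>N. remainder_weight \<sigma> x * (fourier_pair \<sigma> k x)\<^sup>2)"
      using i by (simp add: integral_sum sum_distrib_left)
    also have "\<dots> \<le> W * integral {0..pi} (\<lambda>x. remainder_weight \<sigma> x * B)"
    proof (intro mult_left_mono integral_le W0)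
      show "(\<lambda>x. \<Sum>k\<le>N. remainder_weight \<sigma> x * (fourier_pair \<sigma> k x)\<^sup>2) integrable_on {0..pi}" using i by (intro integrable_sum) auto
      show "(\<lambda>x. remainder_weight \<sigma> x * B) integrable_on {0..pi}" using wi by (intro integrable_on_mult_left)
      show "(\<Sum>k\<le>N. remainder_weight \<sigma> x * (fourier_pair \<sigma> k x)\<^sup>2) \<le> remainder_weight \<sigma> x * B" if "x \<in> {0..pi}" for x
        using fourier_pair_sum_le[OF that] w0[of x] unfolding B_def by (simp add: mult_left_mono flip: sum_distrib_left)
    qed
    also have "\<dots> = W * (W * B)" by (simp add: W_def)
    finally show "(\<Sum>k\<le>N. (J k)\<^sup>2) \<le> W * (W * B)" .
  qed simp
  have 3: "summable (\<lambda>n. K\<^sup>2 * (1 / (real n)\<^sup>2))"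
    using inverse_power_summable[of 2, where 'a = real] by (intro summable_mult) (simp add: divide_inverse)
  show ?thesis
  proof (rule summable_comparison_test'[where N = 0])
    show "summable (\<lambda>n. 3 * ((fourier_pair \<sigma> n pi)\<^sup>2 + (J n)\<^sup>2 + K\<^sup>2 * (1 / (real n)\<^sup>2)))"
      by (intro summable_mult summable_add 1 2 3)
    fix n
    have sq: "(a + b + c)\<^sup>2 \<le> 3 * (a\<^sup>2 + b\<^sup>2 + c\<^sup>2)" for a b c :: real
      using zero_le_power2[of "a - b"] zero_le_power2[of "a - c"] zero_le_power2[of "b - c"]
      by (simp add: power2_eq_square algebra_simps)
    have "remainder \<sigma> n = fourier_pair \<sigma> n pi + J n + K * (1 / real n)" by (simp add: remainder_def J_def K_def)
    then show "norm ((remainder \<sigma> n)\<^sup>2) \<le> 3 * ((fourier_pair \<sigma> n pi)\<^sup>2 + (J n)\<^sup>2 + K\<^sup>2 * (1 / (real n)\<^sup>2))"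
      using sq[of "fourier_pair \<sigma> n pi" "J n" "K * (1 / real n)"] by (simp add: power_divide power_mult_distrib)
  qed
qed

text \<open>Uniform in \<open>t\<close>, because scaling \<sigma> by a number in [0, 1] can only
  decrease each term.\<close>

lemma variation_le_remainder:
  assumes t: "t \<in> {0..1}" and n: "n \<ge> 1" and \<rho>: "\<rho> \<ge> 1" "\<bar>\<rho> - real n\<bar> \<le> 2" and \<epsilon>: "\<epsilon> * \<epsilon> = 1"
  shows "norm (fourier (\<lambda>x. t *\<^sub>R \<sigma> x) (- \<epsilon> * \<rho>) pi)
     + integral {0..pi} (\<lambda>s. norm (t *\<^sub>R \<sigma> s) * norm (fourier (\<lambda>x. t *\<^sub>R \<sigma> x) (- \<epsilon> * \<rho>) s))
     + (integral {0..pi} (\<lambda>s. norm (t *\<^sub>R \<sigma> s)) + 1) * integral {0..pi} (\<lambda>s. (norm (t *\<^sub>R \<sigma> s))\<^sup>2) / \<rho> \<le> remainder \<sigma> n"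
proof -
  define s1 s2 where "s1 = integral {0..pi} (\<lambda>s. norm (\<sigma> s))" and "s2 = integral {0..pi} (\<lambda>s. (norm (\<sigma> s))\<^sup>2)"
  note s = sigma_integrals[folded s1_def s2_def]
  define A where "A = integral {0..pi} (fourier_pair \<sigma> n)"
  have Ai: "fourier_pair \<sigma> n integrable_on {0..pi}" by (intro integrable_continuous_real fourier_pair_continuous)
  have fp0: "fourier_pair \<sigma> n x \<ge> 0" for x by (simp add: fourier_pair_def)
  have \<epsilon>1: "\<epsilon> = 1 \<or> \<epsilon> = - 1" using \<epsilon> by (simp add: square_eq_1_iff)
  have F: "norm (fourier (\<lambda>x. t *\<^sub>R \<sigma> x) (- \<epsilon> * \<rho>) x) \<le> fourier_pair \<sigma> n x + 4 * A" if x: "x \<in> {0..pi}" for x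
  proof -
    have "norm (fourier (\<lambda>x. t *\<^sub>R \<sigma> x) (- \<epsilon> * \<rho>) x) \<le> 1 * norm (fourier \<sigma> (- \<epsilon> * \<rho>) x)"
      unfolding fourier_scaleR[OF L2 x] norm_scaleR using t by (intro mult_right_mono) auto
    also have "\<dots> = 1 * norm (fourier \<sigma> (- \<epsilon> * real n + - \<epsilon> * (\<rho> - real n)) x)" by (simp add: algebra_simps)
    also have "1 * norm (fourier \<sigma> (- \<epsilon> * real n + - \<epsilon> * (\<rho> - real n)) x) \<le>
       norm (fourier \<sigma> (- \<epsilon> * real n) x) + 2 * \<bar>- \<epsilon> * (\<rho> - real n)\<bar> * integral {0..pi} (\<lambda>s. norm (fourier \<sigma> (- \<epsilon> * real n) s))"
      using fourier_shift[OF L2 x, of "- \<epsilon> * real n" "- \<epsilon> * (\<rho> - real n)"] by simp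
    also have "\<dots> \<le> fourier_pair \<sigma> n x + 4 * A"
    proof (intro add_mono mult_mono)
      show "norm (fourier \<sigma> (- \<epsilon> * real n) x) \<le> fourier_pair \<sigma> n x" using \<epsilon>1 by (auto simp: fourier_pair_def)
      show "2 * \<bar>- \<epsilon> * (\<rho> - real n)\<bar> \<le> 4" using \<epsilon>1 \<rho>(2) by (auto simp: abs_mult)
      show "integral {0..pi} (\<lambda>s. norm (fourier \<sigma> (- \<epsilon> * real n) s)) \<le> A"
        unfolding A_def
      proof (rule integral_le[OF _ Ai])
        show "(\<lambda>s. norm (fourier \<sigma> (- \<epsilon> * real n) s)) integrable_on {0..pi}"
          by (intro integrable_continuous_real continuous_intros fourier_continuous[OF L2])
      qed (use \<epsilon>1 in \<open>auto simp: fourier_pair_def\<close>)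
      show "0 \<le> integral {0..pi} (\<lambda>s. norm (fourier \<sigma> (- \<epsilon> * real n) s))"
        by (intro integral_nonneg integrable_continuous_real continuous_intros fourier_continuous[OF L2]) auto
    qed auto
    finally show ?thesis .
  qed
  have tL2: "L2 (\<lambda>x. t *\<^sub>R \<sigma> x)" by (rule L2_scaleR[OF L2])
  have sfi: "(\<lambda>x. norm (\<sigma> x) * fourier_pair \<sigma> n x) integrable_on {0..pi}"
    using absolutely_integrable_on_continuous_bilinear[OF bounded_bilinear_mult fourier_pair_continuous[of n] L2_imp_integrable(2)[OF L2]]
    by (simp add: absolutely_integrable_on_def mult.commute)
  have gi: "(\<lambda>s. norm (\<sigma> s) * fourier_pair \<sigma> n s + 4 * A * norm (\<sigma> s)) integrable_on {0..pi}"
    using sfi s by (intro integrable_add integrable_on_mult_right)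
  have "integral {0..pi} (\<lambda>s. norm (t *\<^sub>R \<sigma> s) * norm (fourier (\<lambda>x. t *\<^sub>R \<sigma> x) (- \<epsilon> * \<rho>) s)) \<le> integral {0..pi} (\<lambda>s. norm (\<sigma> s) * fourier_pair \<sigma> n s + 4 * A * norm (\<sigma> s))"
  proof (rule integral_le[OF _ gi])
    have "(\<lambda>s. norm (fourier (\<lambda>x. t *\<^sub>R \<sigma> x) (- \<epsilon> * \<rho>) s) * norm (t *\<^sub>R \<sigma> s)) absolutely_integrable_on {0..pi}"
      by (intro absolutely_integrable_on_continuous_bilinear[OF bounded_bilinear_mult] L2_imp_integrable(2)[OF tL2] continuous_intros fourier_continuous[OF tL2])
    then show "(\<lambda>s. norm (t *\<^sub>R \<sigma> s) * norm (fourier (\<lambda>x. t *\<^sub>R \<sigma> x) (- \<epsilon> * \<rho>) s)) integrable_on {0..pi}"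
      by (simp add: absolutely_integrable_on_def mult.commute)
    fix x assume x: "x \<in> {0..pi}"
    have "norm (t *\<^sub>R \<sigma> x) * norm (fourier (\<lambda>x. t *\<^sub>R \<sigma> x) (- \<epsilon> * \<rho>) x) \<le> (1 * norm (\<sigma> x)) * (fourier_pair \<sigma> n x + 4 * A)"
      using t F[OF x] unfolding norm_scaleR by (intro mult_mono mult_nonneg_nonneg) auto
    then show "norm (t *\<^sub>R \<sigma> x) * norm (fourier (\<lambda>x. t *\<^sub>R \<sigma> x) (- \<epsilon> * \<rho>) x) \<le> norm (\<sigma> x) * fourier_pair \<sigma> n x + 4 * A * norm (\<sigma> x)"
      by (simp add: algebra_simps)
  qed
  also have "\<dots> = integral {0..pi} (\<lambda>s. norm (\<sigma> s) * fourier_pair \<sigma> n s) + 4 * A * s1"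
    unfolding s1_def using sfi s by (simp add: Henstock_Kurzweil_Integration.integral_add integrable_on_mult_right)
  finally have I2: "integral {0..pi} (\<lambda>s. norm (t *\<^sub>R \<sigma> s) * norm (fourier (\<lambda>x. t *\<^sub>R \<sigma> x) (- \<epsilon> * \<rho>) s)) \<le> integral {0..pi} (\<lambda>s. norm (\<sigma> s) * fourier_pair \<sigma> n s) + 4 * A * s1" .
  have "integral {0..pi} (\<lambda>x. remainder_weight \<sigma> x * fourier_pair \<sigma> n x) = integral {0..pi} (\<lambda>x. (4 + 4 * s1) * fourier_pair \<sigma> n x + norm (\<sigma> x) * fourier_pair \<sigma> n x)"
    by (simp add: remainder_weight_def s1_def distrib_right)
  also have "\<dots> = (4 + 4 * s1) * A + integral {0..pi} (\<lambda>s. norm (\<sigma> s) * fourier_pair \<sigma> n s)"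
    unfolding A_def using sfi Ai by (subst Henstock_Kurzweil_Integration.integral_add) (auto intro: integrable_on_mult_right)
  finally have W: "integral {0..pi} (\<lambda>x. remainder_weight \<sigma> x * fourier_pair \<sigma> n x) = (4 + 4 * s1) * A + integral {0..pi} (\<lambda>s. norm (\<sigma> s) * fourier_pair \<sigma> n s)" .
  have "(integral {0..pi} (\<lambda>s. norm (t *\<^sub>R \<sigma> s)) + 1) * integral {0..pi} (\<lambda>s. (norm (t *\<^sub>R \<sigma> s))\<^sup>2) / \<rho> = (t * s1 + 1) * (t\<^sup>2 * s2) * (1 / \<rho>)"
    using t by (simp add: s1_def s2_def power_mult_distrib)
  also have "\<dots> \<le> (1 * s1 + 1) * (1 * s2) * (3 / real n)"
  proof (intro mult_mono add_mono)
    show "t\<^sup>2 \<le> 1" using t by (simp add: power_le_one)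
    show "1 / \<rho> \<le> 3 / real n" using n \<rho> by (simp add: field_simps abs_le_iff)
  qed (use t s n \<rho> in auto)
  also have "\<dots> \<le> ((s1 + 1) * s2 + 1) * (3 / real n)" using n by (simp add: divide_right_mono)
  finally have I3: "(integral {0..pi} (\<lambda>s. norm (t *\<^sub>R \<sigma> s)) + 1) * integral {0..pi} (\<lambda>s. (norm (t *\<^sub>R \<sigma> s))\<^sup>2) / \<rho> \<le> ((s1 + 1) * s2 + 1) * (3 / real n)" .
  show ?thesis
    using F[of pi] I2 I3 unfolding remainder_def W s1_def[symmetric] s2_def[symmetric] by (simp add: algebra_simps)
qed

end


context sturm_liouville
begin

text \<open>
  At an eigenvalue \<open>\<rho>\<^sup>2\<close>, a rescaled initial vector is almost in the kernel of \<open>W\<^sup>0(\<rho>)\<close>; the lower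
  bound for \<open>W\<^sup>0\<close> then forces \<open>\<rho>\<close> to be close to a zero of \<open>w\<^sup>0\<close>.
\<close>

lemma eigenvalue_near_zero:
  "\<exists>C>0. \<forall>t\<in>{0..1}. \<forall>n\<ge>1. \<forall>\<rho>\<ge>1. \<bar>\<rho> - real n\<bar> \<le> 2 \<longrightarrow> mult t (\<rho>\<^sup>2) \<noteq> 0 \<longrightarrow>
     (\<exists>z. w0 T1 T2 (complex_of_real z) = 0 \<and> \<bar>\<rho> - z\<bar> \<le> C * remainder \<sigma> n)"
proof -
  obtain c where c: "c > 0" "\<And>x. \<exists>z. w0 T1 T2 (complex_of_real z) = 0 \<and> (\<forall>v. norm (W0 T1 T2 (complex_of_real x) *v v) \<ge> c * \<bar>x - z\<bar> * norm v)"
    using W0_lower_bound by blast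
  define s1 s2 where "s1 = integral {0..pi} (\<lambda>s. norm (\<sigma> s))" and "s2 = integral {0..pi} (\<lambda>s. (norm (\<sigma> s))\<^sup>2)"
  note s = sigma_integrals[OF L2_\<sigma>, folded s1_def s2_def]
  define h where "h = max (norm H1) (norm H2)"
  define \<tau> where "\<tau> = max (norm T1) (norm T2)"
  \<comment> \<open>Per unit norm of the rescaled vector \<open>v\<close>, \<open>m0\<close> bounds
    each amplitude at 0 and \<open>N1\<close> the sum of the two on the whole interval;
    \<open>C0\<close> adds up the five error terms \<open>n1\<close> to \<open>n5\<close>. None of
    them depends on \<open>t\<close>, \<open>n\<close> or \<rho>.\<close>
  define m0 where "m0 = (1 + \<tau>) + (1 + h) * \<tau>"
  define N1 where "N1 = 2 * m0 * exp (s1 + s2)"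
  define C0 where "C0 = \<tau> * (h * N1) + \<tau> * N1 + \<tau> * (h * \<tau>) + (1 + \<tau>) * N1 + (1 + \<tau>) * (h * \<tau>)"
  have h0: "h \<ge> 0" "norm H1 \<le> h" "norm H2 \<le> h" unfolding h_def by (auto simp: le_max_iff_disj)
  have \<tau>0: "\<tau> \<ge> 0" "norm T1 \<le> \<tau>" "norm T2 \<le> \<tau>" unfolding \<tau>_def by (auto simp: le_max_iff_disj)
  have m0: "m0 \<ge> 1" using h0 \<tau>0 by (simp add: m0_def)
  have N1: "N1 > 0" using m0 by (simp add: N1_def)
  have mb: "norm (A *v v) \<le> a * x" if "norm A \<le> a" "norm v \<le> x" for A :: "complex^'m^'m" and v a x
    by (rule order_trans[OF norm_matrix_vector_mult_le mult_mono]) (use that order_trans[OF norm_ge_zero[of A]] in auto)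
  have perpb: "norm (v - T *v v) \<le> (1 + \<tau>) * x" if "norm T \<le> \<tau>" "norm v \<le> x" for T :: "complex^'m^'m" and v x
    using norm_triangle_ineq4[of v "T *v v"] mb[OF that] that(2) by (simp add: distrib_right)
  have main: "\<exists>z. w0 T1 T2 (complex_of_real z) = 0 \<and> \<bar>\<rho> - z\<bar> \<le> (C0 + 1) / c * remainder \<sigma> n"
    if t: "t \<in> {0..1}" and n: "n \<ge> 1" and \<rho>: "\<rho> \<ge> 1" "\<bar>\<rho> - real n\<bar> \<le> 2" and m: "mult t (\<rho>\<^sup>2) \<noteq> 0" for t n \<rho>
  proof -
    interpret t: sturm_liouville "\<lambda>x. t *\<^sub>R \<sigma> x" T1 "t *\<^sub>R H1" T2 "t *\<^sub>R H2" by (rule scaled)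
    define \<kappa> where "\<kappa> = remainder \<sigma> n"
    have \<kappa>: "\<kappa> \<ge> 0" "3 / real n \<le> \<kappa>" unfolding \<kappa>_def by (rule remainder_nonneg[OF L2_\<sigma>])+
    have r\<kappa>: "1 / \<rho> \<le> \<kappa>"
    proof -
      have "1 / \<rho> \<le> 3 / real n" using n \<rho> by (simp add: field_simps abs_le_iff)
      with \<kappa>(2) show ?thesis by simp
    qed
    obtain v' where v': "v' \<noteq> 0" "t.charmat (complex_of_real (\<rho>\<^sup>2)) *v v' = 0"
      using m by (auto simp: mult_eq_0_iff charmat_homotopy_def det_eq_0_iff_kernel)
    \<comment> \<open>The same rescaling as for the free problem: the part of the initial vector in
      the kernel of \<open>T1\<close> is divided by \<rho>.\<close>
    define a b where "a = T1 *v v'" and "b = complex_of_real (1 / \<rho>) *s (v' - T1 *v v')"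
    define v where "v = a + b"
    have Ta: "T1 *v a = a" "T1 *v b = 0" by (simp_all add: a_def b_def vs_simps)
    have Tv: "T1 *v v = a" by (simp add: v_def matrix_vector_right_distrib Ta)
    have bv: "v - T1 *v v = b" by (simp add: Tv) (simp add: v_def)
    have \<rho>b: "complex_of_real \<rho> *s b = v' - T1 *v v'" using \<rho> by (simp add: b_def)
    have v0: "v \<noteq> 0"
    proof
      assume "v = 0"
      then have "a = 0" using Tv by simp
      moreover from this \<open>v = 0\<close> have "b = 0" by (simp add: v_def)
      ultimately have "v' = 0" using \<rho>b by (simp add: a_def)
      with v' show False by simp
    qed
    define V where "V = norm v"
    have V: "V > 0" using v0 by (simp add: V_def)
    define u where "u = flow (\<lambda>x. t *\<^sub>R \<sigma> x) (complex_of_real (\<rho>\<^sup>2)) (t.init v')"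
    have u: "sys_solution (\<lambda>x. t *\<^sub>R \<sigma> x) (complex_of_real (\<rho>\<^sup>2)) (\<lambda>x. 0) u"
      unfolding u_def by (rule flow(2)[OF t.L2_\<sigma>])
    have u0: "fst (u 0) = a" "snd (u 0) = complex_of_real \<rho> *s b + t *\<^sub>R (H1 *v a)"
      unfolding u_def flow(1)[OF t.L2_\<sigma>] t.init_def by (simp_all add: a_def perp_mult scaleR_matrix_vector_mult \<rho>b)
    \<comment> \<open>The deviation from free initial data caused by \<open>H1\<close>; it is of
      order 1/\<rho>, hence of order \<kappa>.\<close>
    define g where "g = complex_of_real (t / \<rho>) *s (H1 *v a)"
    define z0 where "z0 = complex_of_real (1 / \<rho>) *s snd (u 0)"
    have z0: "z0 = b + g"
      using \<rho> by (simp add: z0_def u0 g_def vec.scale_right_distrib scaleR_eq_vector_scalar_mult)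
    have an: "norm a \<le> \<tau> * V" using mb[OF \<tau>0(2), of v V] by (simp add: Tv V_def)
    have bn: "norm b \<le> (1 + \<tau>) * V" using perpb[OF \<tau>0(2), of v V] by (simp add: bv V_def)
    have gn: "norm g \<le> h * (\<tau> * V) * (1 / \<rho>)"
    proof -
      have "norm g = (t / \<rho>) * norm (H1 *v a)" using t \<rho> by (simp add: g_def norm_vector_scalar_mult norm_divide)
      also have "\<dots> \<le> (1 / \<rho>) * (h * (\<tau> * V))"
        by (rule mult_mono[OF divide_right_mono mb[OF h0(2) an]]) (use t \<rho> in auto)
      finally show ?thesis by (simp add: mult.commute)
    qed
    have gn1: "norm g \<le> h * (\<tau> * V)"
      by (rule order_trans[OF gn mult_left_le]) (use \<rho> h0 \<tau>0 V in auto)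
    have gn\<kappa>: "norm g \<le> h * (\<tau> * V) * \<kappa>"
      using gn mult_left_mono[OF r\<kappa>, of "h * (\<tau> * V)"] h0 \<tau>0 V by simp
    let ?amp = "amplitude \<rho> u"
    have amp0: "norm (?amp \<epsilon> 0) \<le> m0 * V" if "\<bar>\<epsilon>\<bar> = 1" for \<epsilon>
    proof -
      have "?amp \<epsilon> 0 = z0 + (of_real \<epsilon> * \<i>) *s a" by (simp add: amplitude_def z0_def u0(1))
      then have "norm (?amp \<epsilon> 0) \<le> norm b + norm g + norm ((of_real \<epsilon> * \<i>) *s a)"
        unfolding z0 by (metis norm_triangle_mono norm_triangle_ineq order_refl)
      also have "norm ((of_real \<epsilon> * \<i>) *s a) = norm a" using that by (simp add: norm_vector_scalar_mult norm_mult)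
      finally have "norm (?amp \<epsilon> 0) \<le> (1 + \<tau>) * V + h * (\<tau> * V) + \<tau> * V" using an bn gn1 by linarith
      then show ?thesis by (simp add: m0_def algebra_simps)
    qed
    define N where "N = N1 * V"
    have Nbound: "norm (?amp 1 x) + norm (?amp (- 1) x) \<le> N" if x: "x \<in> {0..pi}" for x
    proof -
      have "norm (?amp 1 x) + norm (?amp (- 1) x) \<le> (norm (?amp 1 0) + norm (?amp (- 1) 0)) * exp (integral {0..pi} (\<lambda>s. norm (t *\<^sub>R \<sigma> s) + (norm (t *\<^sub>R \<sigma> s))\<^sup>2))"
        by (rule amp_bound[OF t.L2_\<sigma> \<rho>(1) u x])
      also have "\<dots> \<le> (m0 * V + m0 * V) * exp (s1 + s2)"
      proof (intro mult_mono add_mono amp0)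
        have i: "(\<lambda>s. norm (t *\<^sub>R \<sigma> s)) integrable_on {0..pi}" "(\<lambda>s. (norm (t *\<^sub>R \<sigma> s))\<^sup>2) integrable_on {0..pi}"
          by (rule sigma_integrals[OF t.L2_\<sigma>])+
        have "integral {0..pi} (\<lambda>s. norm (t *\<^sub>R \<sigma> s) + (norm (t *\<^sub>R \<sigma> s))\<^sup>2) \<le> integral {0..pi} (\<lambda>s. norm (\<sigma> s) + (norm (\<sigma> s))\<^sup>2)"
        proof (rule integral_le)
          show "norm (t *\<^sub>R \<sigma> x) + (norm (t *\<^sub>R \<sigma> x))\<^sup>2 \<le> norm (\<sigma> x) + (norm (\<sigma> x))\<^sup>2" for x
            using t by (intro add_mono power_mono) (auto simp: mult_left_le_one_le)
        qed (intro integrable_add i s)+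
        also have "\<dots> = s1 + s2" unfolding s1_def s2_def using s by (intro Henstock_Kurzweil_Integration.integral_add)
        finally show "exp (integral {0..pi} (\<lambda>s. norm (t *\<^sub>R \<sigma> s) + (norm (t *\<^sub>R \<sigma> s))\<^sup>2)) \<le> exp (s1 + s2)" by simp
      qed (use m0 V in auto)
      finally show ?thesis by (simp add: N_def N1_def mult_ac)
    qed
    have N0: "N \<ge> 0" using N1 V by (simp add: N_def)
    have var: "norm (?amp \<epsilon> pi - ?amp \<epsilon> 0) \<le> N * \<kappa>" if \<epsilon>: "\<epsilon> * \<epsilon> = 1" for \<epsilon>
      by (rule order_trans[OF amp_variation[OF t.L2_\<sigma> \<rho>(1) u \<epsilon> Nbound] mult_left_mono[OF variation_le_remainder[OF L2_\<sigma> t n \<rho> \<epsilon>, folded \<kappa>_def] N0]])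
    define y z where "y = fst (u pi)" and "z = complex_of_real (1 / \<rho>) *s snd (u pi)"
    define Cc Ss where "Cc = complex_of_real (cos (\<rho> * pi))" and "Ss = complex_of_real (sin (\<rho> * pi))"
    have cs1: "norm Cc \<le> 1" "norm Ss \<le> 1" by (simp_all add: Cc_def Ss_def)
    have cis: "cis (\<rho> * pi) = Cc + \<i> * Ss" "cis (- \<rho> * pi) = Cc - \<i> * Ss"
      by (simp_all add: Cc_def Ss_def complex_eq_iff)
    have amp0': "?amp 1 0 = z0 + \<i> *s a" "?amp (- 1) 0 = z0 - \<i> *s a"
      by (simp_all add: amplitude_def z0_def u0(1) vec.scale_minus_left)
    have half: "norm x \<le> e" if "k *s x = (e1 :: complex) *s x1 - e2 *s x2 \<or> k *s x = e1 *s x1 + e2 *s x2" "norm k = 2" "norm e1 = 1" "norm e2 = 1" "norm x1 \<le> e" "norm x2 \<le> e"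
      for k x e1 x1 e2 x2 and e :: real
    proof -
      have "2 * norm x = norm (k *s x)" using that(2) by (simp only: norm_vector_scalar_mult)
      also have "\<dots> \<le> norm (e1 *s x1) + norm (e2 *s x2)" using that(1) norm_triangle_ineq4[of "e1 *s x1" "e2 *s x2"] norm_triangle_ineq[of "e1 *s x1" "e2 *s x2"] by metis
      also have "\<dots> = norm x1 + norm x2" using that(3,4) by (simp add: norm_vector_scalar_mult)
      finally show ?thesis using that(5,6) by linarith
    qed
    have ydiff: "norm (y - (Cc *s a + Ss *s z0)) \<le> N * \<kappa>"
    proof (rule half[OF disjI1])
      show "(2 * \<i>) *s (y - (Cc *s a + Ss *s z0)) = cis (\<rho> * pi) *s (?amp 1 pi - ?amp 1 0) - cis (- \<rho> * pi) *s (?amp (- 1) pi - ?amp (- 1) 0)"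
        using fst_amp[OF t.L2_\<sigma> \<rho>(1) u, of pi] unfolding amp0' cis y_def by (simp add: vec_eq_iff algebra_simps)
    qed (use var in auto)
    have zdiff: "norm (z - (Cc *s z0 - Ss *s a)) \<le> N * \<kappa>"
    proof (rule half[OF disjI2])
      show "2 *s (z - (Cc *s z0 - Ss *s a)) = cis (\<rho> * pi) *s (?amp 1 pi - ?amp 1 0) + cis (- \<rho> * pi) *s (?amp (- 1) pi - ?amp (- 1) 0)"
        using snd_amp[OF t.L2_\<sigma> \<rho>(1) u, of pi] unfolding amp0' cis z_def by (simp add: vec_eq_iff algebra_simps)
    qed (use var in auto)
    have yn: "norm y \<le> N"
      using norm_fst_le_amp[OF t.L2_\<sigma> \<rho>(1) u, of pi] Nbound[of pi] N0 by (simp add: y_def)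
    have bc: "boundary_form T2 (t *\<^sub>R H2) (fst (u pi)) (snd (u pi)) = 0"
      using v'(2) by (simp add: t.charmat_mult t.bc2_def u_def)
    have Ty: "T2 *v y = y" and Tz: "T2 *v z = complex_of_real (t / \<rho>) *s (T2 *v (H2 *v y))"
      using bc unfolding boundary_form_eq_0_iff[OF T2(2)]
      by (simp_all add: y_def z_def matrix_vector_mult_scale scaleR_matrix_vector_mult matrix_vector_mult_scaleR scaleR_eq_vector_scalar_mult)
    have trig: "sin (complex_of_real \<rho> * of_real pi) = Ss" "cos (complex_of_real \<rho> * of_real pi) = Cc"
      by (simp_all add: Cc_def Ss_def flip: sin_of_real cos_of_real)
    define dy dz where "dy = y - (Cc *s a + Ss *s z0)" and "dz = z - (Cc *s z0 - Ss *s a)"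
    \<comment> \<open>Up to \<open>g\<close>, \<open>W0\<close> applied to \<open>v\<close> is what
      free evolution would contribute to the second boundary condition. The true solution satisfies
      that condition exactly: \<open>y\<close> has no part outside the range of \<open>T2\<close>,
      and \<open>T2 *v z\<close> is of order 1/\<rho>. Hence only error terms are left.\<close>
    have W: "W0 T1 T2 (complex_of_real \<rho>) *v v = - (T2 *v z) + T2 *v dz + T2 *v (Cc *s g) - (dy - T2 *v dy) - (Ss *s g - T2 *v (Ss *s g))"
    proof -
      have y': "y - T2 *v y = 0" by (simp add: Ty)
      have "W0 T1 T2 (complex_of_real \<rho>) *v v = - (T2 *v (Cc *s b - Ss *s a)) + ((Cc *s a + Ss *s b) - T2 *v (Cc *s a + Ss *s b))"
        unfolding W0_mult_split trig Tv bv[unfolded Tv] by (simp add: vs_simps vec_eq_iff algebra_simps)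
      also have "\<dots> = - (T2 *v z) + T2 *v dz + T2 *v (Cc *s g) - (dy - T2 *v dy) - (Ss *s g - T2 *v (Ss *s g)) + (y - T2 *v y)"
        unfolding dy_def dz_def z0 by (simp add: vs_simps vec_eq_iff algebra_simps)
      finally show ?thesis by (simp add: y')
    qed
    have n1: "norm (T2 *v z) \<le> \<tau> * (h * N) * \<kappa>"
    proof -
      have "norm (T2 *v z) = (t / \<rho>) * norm (T2 *v (H2 *v y))" unfolding Tz using t \<rho> by (simp add: norm_vector_scalar_mult norm_divide)
      also have "\<dots> \<le> \<kappa> * (\<tau> * (h * N))"
      proof (rule mult_mono)
        have "t / \<rho> \<le> 1 / \<rho>" using t \<rho> by (intro divide_right_mono) auto
        then show "t / \<rho> \<le> \<kappa>" using r\<kappa> by simp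
      qed (use mb[OF \<tau>0(3) mb[OF h0(3) yn]] \<kappa> in auto)
      finally show ?thesis by (simp add: mult.commute)
    qed
    have n2: "norm (T2 *v dz) \<le> \<tau> * (N * \<kappa>)" using mb[OF \<tau>0(3) zdiff] by (simp add: dz_def)
    have gC: "norm (Cc *s g) \<le> h * (\<tau> * V) * \<kappa>" "norm (Ss *s g) \<le> h * (\<tau> * V) * \<kappa>"
      using mult_right_mono[OF cs1(1), of "norm g"] mult_right_mono[OF cs1(2), of "norm g"] gn\<kappa> by (simp_all add: norm_vector_scalar_mult)
    have n3: "norm (T2 *v (Cc *s g)) \<le> \<tau> * (h * (\<tau> * V) * \<kappa>)" by (rule mb[OF \<tau>0(3) gC(1)])
    have n4: "norm (dy - T2 *v dy) \<le> (1 + \<tau>) * (N * \<kappa>)" using perpb[OF \<tau>0(3) ydiff] by (simp add: dy_def)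
    have n5: "norm (Ss *s g - T2 *v (Ss *s g)) \<le> (1 + \<tau>) * (h * (\<tau> * V) * \<kappa>)" by (rule perpb[OF \<tau>0(3) gC(2)])
    have "norm (W0 T1 T2 (complex_of_real \<rho>) *v v) \<le> norm (T2 *v z) + norm (T2 *v dz) + norm (T2 *v (Cc *s g)) + norm (dy - T2 *v dy) + norm (Ss *s g - T2 *v (Ss *s g))"
      unfolding W
      using norm_triangle_ineq4[of "- (T2 *v z) + T2 *v dz + T2 *v (Cc *s g) - (dy - T2 *v dy)" "Ss *s g - T2 *v (Ss *s g)"]
        norm_triangle_ineq4[of "- (T2 *v z) + T2 *v dz + T2 *v (Cc *s g)" "dy - T2 *v dy"]
        norm_triangle_ineq[of "- (T2 *v z) + T2 *v dz" "T2 *v (Cc *s g)"] norm_triangle_ineq[of "- (T2 *v z)" "T2 *v dz"]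
      unfolding norm_minus_cancel by linarith
    also have "\<dots> \<le> \<tau> * (h * N) * \<kappa> + \<tau> * (N * \<kappa>) + \<tau> * (h * (\<tau> * V) * \<kappa>) + (1 + \<tau>) * (N * \<kappa>) + (1 + \<tau>) * (h * (\<tau> * V) * \<kappa>)"
      by (intro add_mono n1 n2 n3 n4 n5)
    also have "\<dots> = C0 * \<kappa> * V" by (simp add: C0_def N_def algebra_simps)
    finally have Wle: "norm (W0 T1 T2 (complex_of_real \<rho>) *v v) \<le> C0 * \<kappa> * V" .
    obtain x where x: "w0 T1 T2 (complex_of_real x) = 0" "c * \<bar>\<rho> - x\<bar> * norm v \<le> norm (W0 T1 T2 (complex_of_real \<rho>) *v v)"
      using c(2)[of \<rho>] by blast
    have "c * \<bar>\<rho> - x\<bar> * V \<le> C0 * \<kappa> * V" using x(2) Wle by (simp add: V_def)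
    then have "c * \<bar>\<rho> - x\<bar> \<le> C0 * \<kappa>" using V by simp
    also have "\<dots> \<le> (C0 + 1) * \<kappa>" using \<kappa> by (simp add: mult_right_mono)
    finally have "\<bar>\<rho> - x\<bar> \<le> (C0 + 1) / c * \<kappa>" using c(1) by (simp add: field_simps)
    with x(1) show ?thesis by (auto simp: \<kappa>_def)
  qed
  have "C0 \<ge> 0" using h0 \<tau>0 N1 by (simp add: C0_def)
  then have "(C0 + 1) / c > 0" using c(1) by simp
  with main show ?thesis by (intro exI[of _ "(C0 + 1) / c"]) auto
qed

end


section \<open>Counting and enumerating a discrete multiset of reals\<close>

definition count_below :: "(real \<Rightarrow> nat) \<Rightarrow> real \<Rightarrow> nat" where
  "count_below \<mu> y = (\<Sum>x | x < y \<and> \<mu> x \<noteq> 0. \<mu> x)"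

text \<open>The \<open>j\<close>-th point, starting from \<open>j = 0\<close>, of the multiset with multiplicity function \<open>\<mu>\<close>.\<close>

definition nth_point :: "(real \<Rightarrow> nat) \<Rightarrow> nat \<Rightarrow> real" where
  "nth_point \<mu> j = (THE x. count_below \<mu> x \<le> j \<and> j < count_below \<mu> x + \<mu> x)"

context
  fixes \<mu> :: "real \<Rightarrow> nat"
  assumes fin: "\<And>b. finite {x. x \<le> b \<and> \<mu> x \<noteq> 0}"
begin

lemma finite_points_below: "finite {x. x < b \<and> \<mu> x \<noteq> 0}"
  by (rule finite_subset[OF _ fin[of b]]) auto

lemma count_below_add: "count_below \<mu> x + \<mu> x = (\<Sum>z | z \<le> x \<and> \<mu> z \<noteq> 0. \<mu> z)"
proof (cases "\<mu> x = 0")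
  case True
  then have "{z. z \<le> x \<and> \<mu> z \<noteq> 0} = {z. z < x \<and> \<mu> z \<noteq> 0}" by (auto simp: order_le_less)
  with True show ?thesis by (simp add: count_below_def)
next
  case False
  then have "{z. z \<le> x \<and> \<mu> z \<noteq> 0} = insert x {z. z < x \<and> \<mu> z \<noteq> 0}" by auto
  then show ?thesis by (simp add: count_below_def finite_points_below del: neq0_conv)
qed

lemma count_below_step: "x < y \<Longrightarrow> count_below \<mu> x + \<mu> x \<le> count_below \<mu> y"
  unfolding count_below_add unfolding count_below_def
  by (rule sum_mono2[OF finite_points_below]) auto

text \<open>The least point whose cumulative count exceeds \<open>j\<close> works: by
  \<open>last\<close>, the count strictly below it is the cumulative count at its
  predecessor.\<close>

lemma nth_point_exists:
  assumes "j < count_below \<mu> y"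
  shows "\<exists>x. count_below \<mu> x \<le> j \<and> j < count_below \<mu> x + \<mu> x"
proof -
  define S where "S = {x. x < y \<and> \<mu> x \<noteq> 0}"
  define S' where "S' = {x \<in> S. j < count_below \<mu> x + \<mu> x}"
  have fS: "finite S" unfolding S_def by (rule finite_points_below)
  then have fS': "finite S'" by (simp add: S'_def)
  have last: "count_below \<mu> z = count_below \<mu> (Max A) + \<mu> (Max A)"
    if A: "A = {x. x < z \<and> \<mu> x \<noteq> 0}" "A \<noteq> {}" for z A
  proof -
    have f: "finite A" unfolding A by (rule finite_points_below)
    have eq: "{x. x < z \<and> \<mu> x \<noteq> 0} = {x. x \<le> Max A \<and> \<mu> x \<noteq> 0}"
      using Max_in[OF f A(2)] Max_ge[OF f] unfolding A(1) by fastforce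
    have "count_below \<mu> z = (\<Sum>x | x \<le> Max A \<and> \<mu> x \<noteq> 0. \<mu> x)" by (simp only: count_below_def eq)
    then show ?thesis by (simp only: count_below_add)
  qed
  have "S \<noteq> {}" using assms unfolding S_def count_below_def by (metis (no_types) less_nat_zero_code sum.empty)
  then have "Max S \<in> S'" using last[of S y] assms Max_in[OF fS] by (simp add: S'_def S_def)
  then have ne: "S' \<noteq> {}" by auto
  define x where "x = Min S'"
  have x: "x \<in> S'" unfolding x_def by (rule Min_in[OF fS' ne])
  have "count_below \<mu> x \<le> j"
  proof (cases "{z. z < x \<and> \<mu> z \<noteq> 0} = {}")
    case True
    then show ?thesis unfolding count_below_def by (metis (no_types) le0 sum.empty)
  next
    case False
    define z where "z = Max {z. z < x \<and> \<mu> z \<noteq> 0}"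
    have z: "z < x" "\<mu> z \<noteq> 0" using Max_in[OF finite_points_below False] by (auto simp: z_def)
    have "z \<notin> S'" using Min_le[OF fS', of z] z by (auto simp: x_def)
    moreover have "z \<in> S" using z x by (auto simp: S_def S'_def)
    ultimately show ?thesis using last[OF refl False] by (auto simp: S'_def z_def)
  qed
  with x show ?thesis by (auto simp: S'_def)
qed

lemma nth_point_eq_iff:
  assumes "j < count_below \<mu> y"
  shows "nth_point \<mu> j = x \<longleftrightarrow> count_below \<mu> x \<le> j \<and> j < count_below \<mu> x + \<mu> x"
proof -
  let ?P = "\<lambda>x. count_below \<mu> x \<le> j \<and> j < count_below \<mu> x + \<mu> x"
  have "x = x'" if "?P x" "?P x'" for x x'
    using that count_below_step[of x x'] count_below_step[of x' x] by (cases x x' rule: linorder_cases) auto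
  then have "\<exists>!x. ?P x" using nth_point_exists[OF assms] by blast
  then show ?thesis unfolding nth_point_def by (metis (mono_tags, lifting) the1_equality theI')
qed

text \<open>This equivalence turns equality of counting functions into the location of individual
  points. The number \<open>z\<close> witnesses that a \<open>j\<close>-th point exists.\<close>

lemma nth_point_less_iff:
  assumes "j < count_below \<mu> z"
  shows "nth_point \<mu> j < y \<longleftrightarrow> j < count_below \<mu> y"
proof -
  have "count_below \<mu> (nth_point \<mu> j) \<le> j" "j < count_below \<mu> (nth_point \<mu> j) + \<mu> (nth_point \<mu> j)"
    using nth_point_eq_iff[OF assms, of "nth_point \<mu> j"] by simp_all
  then show ?thesis
    using count_below_step[of "nth_point \<mu> j" y] count_below_step[of y "nth_point \<mu> j"]
    by (cases y "nth_point \<mu> j" rule: linorder_cases) auto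
qed

lemma nth_point_mono:
  assumes "j \<le> j'" "j' < count_below \<mu> z"
  shows "nth_point \<mu> j \<le> nth_point \<mu> j'"
proof -
  have j: "j < count_below \<mu> z" using assms by simp
  show ?thesis
    using nth_point_less_iff[OF assms(2), of "nth_point \<mu> j"] nth_point_less_iff[OF j, of "nth_point \<mu> j"] assms(1)
    by (meson less_irrefl not_le_imp_less le_less_trans)
qed

end

lemma count_below_eq_card:
  fixes f :: "nat \<Rightarrow> real"
  assumes fibre: "\<And>x. finite {j. f j = x}" "\<And>x. card {j. f j = x} = \<mu> x" and fin: "finite {x. x < y \<and> \<mu> x \<noteq> 0}"
  shows "finite {j. f j < y}" "card {j. f j < y} = count_below \<mu> y"
proof -
  have U: "{j. f j < y} = (\<Union>x\<in>{x. x < y \<and> \<mu> x \<noteq> 0}. {j. f j = x})"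
  proof -
    have "\<mu> (f j) \<noteq> 0" for j using fibre(1)[of "f j"] by (auto simp flip: fibre(2))
    then show ?thesis by auto
  qed
  show "finite {j. f j < y}" unfolding U using fin fibre(1) by blast
  have "card {j. f j < y} = (\<Sum>x | x < y \<and> \<mu> x \<noteq> 0. card {j. f j = x})"
    unfolding U by (rule card_UN_disjoint) (use fin fibre(1) in auto)
  then show "card {j. f j < y} = count_below \<mu> y" by (simp add: count_below_def fibre(2))
qed

text \<open>The counterpart of \<open>nth_point_less_iff\<close> for an explicitly given sequence;
  together they let two spectra be compared through their counts.\<close>

lemma less_iff_less_card:
  fixes f :: "nat \<Rightarrow> real"
  assumes "mono f" "finite {j. f j < y}"
  shows "f j < y \<longleftrightarrow> j < card {j. f j < y}"
proof
  assume "f j < y"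
  then have "{..j} \<subseteq> {j. f j < y}" using monoD[OF assms(1)] by (auto intro: le_less_trans)
  then have "card {..j} \<le> card {j. f j < y}" by (rule card_mono[OF assms(2)])
  then show "j < card {j. f j < y}" by simp
next
  assume j: "j < card {j. f j < y}"
  show "f j < y"
  proof (rule ccontr)
    assume "\<not> f j < y"
    then have "i < j" if "f i < y" for i using that monoD[OF assms(1), of j i] by (cases "j \<le> i") auto
    then have "{j. f j < y} \<subseteq> {..<j}" by auto
    then have "card {j. f j < y} \<le> card {..<j}" by (rule card_mono[OF finite_lessThan])
    with j show False by simp
  qed
qed

lemma branch_sqrt_of_real:
  assumes "x > 0"
  shows "branch_sqrt (complex_of_real x) = complex_of_real (sqrt x)"
  unfolding branch_sqrt_def
proof (rule the_equality)
  show "(complex_of_real (sqrt x))\<^sup>2 = complex_of_real x \<and> Arg (complex_of_real (sqrt x)) \<in> {- (pi / 2)..<pi / 2}"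
    using assms by (simp add: Arg_of_real flip: of_real_power)
next
  fix \<rho> assume \<rho>: "\<rho>\<^sup>2 = complex_of_real x \<and> Arg \<rho> \<in> {- (pi / 2)..<pi / 2}"
  then have "\<rho>\<^sup>2 = (complex_of_real (sqrt x))\<^sup>2" using assms by (simp flip: of_real_power)
  then have "\<rho> = complex_of_real (sqrt x) \<or> \<rho> = complex_of_real (- sqrt x)" by (simp add: power2_eq_iff)
  then show "\<rho> = complex_of_real (sqrt x)"
  proof
    assume "\<rho> = complex_of_real (- sqrt x)"
    then have "Arg \<rho> = pi" using assms by (simp only: Arg_of_real) simp
    with \<rho> show ?thesis using pi_gt_zero by auto
  qed
qed


section \<open>Enumeration of the zeros of w0 and of the free spectrum\<close>

context projections
begin

text \<open>The cut-off to [0, 1) makes the general enumeration list precisely the numbers r_k, with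
  indices starting at 0.\<close>

definition base_mult :: "real \<Rightarrow> nat" where
  "base_mult x = (if x \<in> {0..<1} then kd x else 0)"

definition w0_root :: "nat \<Rightarrow> real" where
  "w0_root = nth_point base_mult"

lemma base_mult_set: "{x. x < 1 \<and> base_mult x \<noteq> 0} = {x. x \<in> {0..<1} \<and> kd x \<noteq> 0}"
  by (auto simp: base_mult_def split: if_splits)

lemma finite_base_mult: "finite {x. x \<le> b \<and> base_mult x \<noteq> 0}"
  by (rule finite_subset[OF _ kd_total(1)]) (auto simp: base_mult_def split: if_splits)

lemma count_base_mult: "count_below base_mult 1 = CARD('m)"
proof -
  have "count_below base_mult 1 = (\<Sum>x | x \<in> {0..<1} \<and> kd x \<noteq> 0. kd x)"
    unfolding count_below_def base_mult_set by (rule sum.cong) (auto simp: base_mult_def)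
  then show ?thesis by (simp only: kd_total(2))
qed

lemma w0_root_eq_iff: "j < CARD('m) \<Longrightarrow> w0_root j = x \<longleftrightarrow> count_below base_mult x \<le> j \<and> j < count_below base_mult x + base_mult x"
  unfolding w0_root_def by (rule nth_point_eq_iff[OF finite_base_mult, of _ 1]) (simp only: count_base_mult)

lemma w0_root_bounds:
  assumes "j < CARD('m)"
  shows "0 \<le> w0_root j" "w0_root j < 1" "kd (w0_root j) \<noteq> 0"
proof -
  have "base_mult (w0_root j) \<noteq> 0" using w0_root_eq_iff[OF assms, of "w0_root j"] by auto
  then show "0 \<le> w0_root j" "w0_root j < 1" "kd (w0_root j) \<noteq> 0" by (auto simp: base_mult_def split: if_splits)
qed

lemma w0_root_mono: "i \<le> j \<Longrightarrow> j < CARD('m) \<Longrightarrow> w0_root i \<le> w0_root j"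
  unfolding w0_root_def by (rule nth_point_mono[OF finite_base_mult, of _ _ 1]) (simp_all only: count_base_mult)

lemma card_w0_root_fibre: "card {j\<in>{..<CARD('m)}. w0_root j = x} = base_mult x"
proof (cases "x < 1")
  case True
  then have "count_below base_mult x + base_mult x \<le> CARD('m)"
    using count_below_step[OF finite_base_mult True] by (simp only: count_base_mult)
  then have "j < CARD('m) \<and> w0_root j = x \<longleftrightarrow> count_below base_mult x \<le> j \<and> j < count_below base_mult x + base_mult x" for j
    using w0_root_eq_iff[of j x] by (cases "j < CARD('m)") auto
  then have "{j\<in>{..<CARD('m)}. w0_root j = x} = {count_below base_mult x..<count_below base_mult x + base_mult x}"
    by (simp add: set_eq_iff)
  then show ?thesis by simp
next
  case False
  then have "{j\<in>{..<CARD('m)}. w0_root j = x} = {}" using w0_root_bounds(2) by fastforce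
  with False show ?thesis by (simp only: base_mult_def) simp
qed

lemma zeros_listing_w0_root: "zeros_listing (w0 T1 T2) CARD('m) (\<lambda>k. w0_root (k - 1))"
  unfolding zeros_listing_def
proof (intro conjI ballI)
  show "mono_on {1..CARD('m)} (\<lambda>k. w0_root (k - 1))"
    by (rule mono_onI) (auto intro!: w0_root_mono)
  have im: "(\<lambda>k. w0_root (k - 1)) ` {1..CARD('m)} = {x. x \<in> {0..<1} \<and> kd x \<noteq> 0}"
  proof (intro equalityI subsetI)
    fix x assume "x \<in> (\<lambda>k. w0_root (k - 1)) ` {1..CARD('m)}"
    then show "x \<in> {x. x \<in> {0..<1} \<and> kd x \<noteq> 0}" using w0_root_bounds by auto
  next
    fix x assume "x \<in> {x. x \<in> {0..<1} \<and> kd x \<noteq> 0}"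
    then have "card {j\<in>{..<CARD('m)}. w0_root j = x} \<noteq> 0" unfolding card_w0_root_fibre by (simp add: base_mult_def)
    then have "{j\<in>{..<CARD('m)}. w0_root j = x} \<noteq> {}" by (rule contrapos_nn) (simp only: card.empty)
    then obtain j where j: "j < CARD('m)" "w0_root j = x" by auto
    then have "x = w0_root (Suc j - 1)" "Suc j \<in> {1..CARD('m)}" by auto
    then show "x \<in> (\<lambda>k. w0_root (k - 1)) ` {1..CARD('m)}" by blast
  qed
  show "complex_of_real ` (\<lambda>k. w0_root (k - 1)) ` {1..CARD('m)} = {z. w0 T1 T2 z = 0 \<and> z \<in> complex_of_real ` {0..<1}}"
    unfolding im kd_zero_iff by auto
  fix x assume "x \<in> (\<lambda>k. w0_root (k - 1)) ` {1..CARD('m)}"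
  then have x: "x \<in> {0..<1}" unfolding im by simp
  have "{k\<in>{1..CARD('m)}. w0_root (k - 1) = x} = Suc ` {j\<in>{..<CARD('m)}. w0_root j = x}"
  proof (intro equalityI subsetI)
    fix k assume "k \<in> {k\<in>{1..CARD('m)}. w0_root (k - 1) = x}"
    then have "k = Suc (k - 1)" "k - 1 \<in> {j\<in>{..<CARD('m)}. w0_root j = x}" by auto
    then show "k \<in> Suc ` {j\<in>{..<CARD('m)}. w0_root j = x}" by blast
  qed auto
  then have "card {k\<in>{1..CARD('m)}. w0_root (k - 1) = x} = base_mult x"
    by (simp only: card_image[OF inj_Suc[THEN inj_on_subset[OF _ subset_UNIV]]] card_w0_root_fibre)
  then show "int (card {k\<in>{1..CARD('m)}. w0_root (k - 1) = x}) = zorder (w0 T1 T2) (complex_of_real x)"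
    using x by (simp only: zorder_w0 base_mult_def if_True)
qed

text \<open>All nonnegative zeros n + r_k in one nondecreasing sequence: \<open>N\<close> encodes n
  as its quotient and k - 1 as its remainder modulo \<open>CARD('m)\<close>.\<close>

definition free :: "nat \<Rightarrow> real" where
  "free N = real (N div CARD('m)) + w0_root (N mod CARD('m))"

lemma free_bounds: "real (N div CARD('m)) \<le> free N" "free N < real (N div CARD('m)) + 1"
  using w0_root_bounds[of "N mod CARD('m)"] by (simp_all add: free_def)

lemma kd_free: "kd (free N) \<noteq> 0"
  using w0_root_bounds(3)[of "N mod CARD('m)"] kd_periodic[of "w0_root (N mod CARD('m))" "int (N div CARD('m))"]
  by (simp add: free_def add.commute)

lemma free_mono: "N \<le> N' \<Longrightarrow> free N \<le> free N'"
proof (cases "N div CARD('m) = N' div CARD('m)")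
  case True
  assume "N \<le> N'"
  then have "N mod CARD('m) \<le> N' mod CARD('m)"
    using div_mult_mod_eq[of N "CARD('m)"] div_mult_mod_eq[of N' "CARD('m)"] unfolding True by linarith
  then show ?thesis unfolding free_def True by (simp add: w0_root_mono)
next
  case False
  assume "N \<le> N'"
  with False have "Suc (N div CARD('m)) \<le> N' div CARD('m)" using div_le_mono[of N N' "CARD('m)"] by simp
  then have "real (N div CARD('m)) + 1 \<le> real (N' div CARD('m))" by linarith
  then show ?thesis using free_bounds[of N] free_bounds[of N'] by linarith
qed

lemma free_fibre:
  assumes "x \<ge> 0"
  shows "finite {N. free N = x}" "card {N. free N = x} = kd x"
proof -
  define n where "n = nat \<lfloor>x\<rfloor>"
  have n: "real n = of_int \<lfloor>x\<rfloor>" using assms by (simp add: n_def)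
  have xn: "x - real n \<in> {0..<1}" unfolding n by (simp add: floor_correct) linarith
  have eq: "{N. free N = x} = (\<lambda>j. n * CARD('m) + j) ` {j\<in>{..<CARD('m)}. w0_root j = x - real n}"
  proof (intro equalityI subsetI)
    fix N assume "N \<in> {N. free N = x}"
    then have N: "free N = x" by simp
    have "N div CARD('m) = n" using free_bounds[of N] xn unfolding N by auto
    then have "N = n * CARD('m) + N mod CARD('m)" "w0_root (N mod CARD('m)) = x - real n"
      using N div_mult_mod_eq[of N "CARD('m)"] by (simp_all add: free_def)
    then show "N \<in> (\<lambda>j. n * CARD('m) + j) ` {j\<in>{..<CARD('m)}. w0_root j = x - real n}"
      by (intro image_eqI[of _ _ "N mod CARD('m)"]) auto
  qed (auto simp: free_def)
  show "finite {N. free N = x}" unfolding eq by simp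
  have "card {N. free N = x} = base_mult (x - real n)"
    unfolding eq by (subst card_image) (simp_all only: card_w0_root_fibre, auto simp: inj_on_def)
  also have "\<dots> = kd (x - real n)" using xn by (simp only: base_mult_def if_True)
  also have "\<dots> = kd x" using kd_periodic[of "x - real n" "int n"] by simp
  finally show "card {N. free N = x} = kd x" .
qed

lemma p_perp_le: "p_perp T1 T2 \<le> kd 0" "kd 0 \<le> CARD('m)"
proof -
  show "p_perp T1 T2 \<le> kd 0" unfolding kd_0 by (rule le_add2)
  show "kd 0 \<le> CARD('m)"
  proof (cases "kd 0 = 0")
    case False
    then have "kd 0 \<le> (\<Sum>x | x \<in> {0..<1} \<and> kd x \<noteq> 0. kd x)"
      by (intro member_le_sum kd_total(1)) auto
    then show ?thesis by (simp only: kd_total(2))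
  qed simp
qed

text \<open>The value 0 occurs \<open>kd 0\<close> times, which is at least
  \<open>p_perp T1 T2\<close>, and the sequence is nondecreasing and nonnegative; so it starts with
  that many zeros.\<close>

lemma free_eq_0:
  assumes "N < p_perp T1 T2"
  shows "free N = 0"
proof (rule ccontr)
  assume "free N \<noteq> 0"
  then have "free N > 0" using free_bounds(1)[of N] by (smt (verit) of_nat_0_le_iff)
  then have "{N. free N = 0} \<subseteq> {..<N}" using free_mono[of N] by (force simp: not_less[symmetric])
  then have "card {N. free N = 0} \<le> card {..<N}" by (rule card_mono[OF finite_lessThan])
  then show False using free_fibre(2)[of 0] p_perp_le(1) assms by simp
qed

text \<open>Only copies of 0 are dropped. The squares of what remains are the eigenvalues of the
  free problem with their multiplicities, see \<open>mult_0_fibre\<close>.\<close>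

definition free_root :: "nat \<Rightarrow> real" where
  "free_root j = free (j + p_perp T1 T2)"

lemma free_root_nonneg: "free_root j \<ge> 0"
  using free_bounds(1)[of "j + p_perp T1 T2"] unfolding free_root_def by (rule order_trans[rotated]) simp

lemma free_root_fibre:
  assumes "x \<ge> 0"
  shows "finite {j. free_root j = x}" "card {j. free_root j = x} + (if x = 0 then p_perp T1 T2 else 0) = kd x"
proof -
  let ?A = "(\<lambda>j. j + p_perp T1 T2) ` {j. free_root j = x}"
  let ?B = "if x = 0 then {..<p_perp T1 T2} else {}"
  have U: "{N. free N = x} = ?A \<union> ?B"
  proof (intro equalityI subsetI)
    fix N assume "N \<in> {N. free N = x}"
    then have N: "free N = x" by simp
    show "N \<in> ?A \<union> ?B"
    proof (cases "N < p_perp T1 T2")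
      case False
      then have "N = (N - p_perp T1 T2) + p_perp T1 T2" "free_root (N - p_perp T1 T2) = x"
        using N by (simp_all add: free_root_def)
      then show ?thesis by blast
    qed (use N free_eq_0[of N] in auto)
  qed (auto simp: free_root_def free_eq_0 split: if_splits)
  have f: "finite ?A" using free_fibre(1)[OF assms] unfolding U by simp
  then show "finite {j. free_root j = x}" by (rule finite_imageD) (simp add: inj_on_def)
  have "kd x = card (?A \<union> ?B)" using free_fibre(2)[OF assms] unfolding U by simp
  also have "\<dots> = card ?A + card ?B" by (rule card_Un_disjoint[OF f]) auto
  also have "card ?A = card {j. free_root j = x}" by (rule card_image) (simp add: inj_on_def)
  finally show "card {j. free_root j = x} + (if x = 0 then p_perp T1 T2 else 0) = kd x" by simp
qed

text \<open>By periodicity, two zeros at distance below 1 can be shifted by a common integer into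
  [-1, 2], where there are only finitely many.\<close>

lemma zeros_separated: "\<exists>d>0. d \<le> 1 \<and> (\<forall>x y. kd x \<noteq> 0 \<longrightarrow> kd y \<noteq> 0 \<longrightarrow> x \<noteq> y \<longrightarrow> d \<le> \<bar>x - y\<bar>)"
proof -
  define F where "F = {x. x \<in> {0..<1} \<and> kd x \<noteq> 0}"
  define G where "G = {x. x \<in> {- 1..2} \<and> kd x \<noteq> 0}"
  define D where "D = insert 1 ((\<lambda>(x, y). \<bar>x - y\<bar>) ` {(x, y). x \<in> G \<and> y \<in> G \<and> x \<noteq> y})"
  have frac: "x - of_int \<lfloor>x\<rfloor> \<in> {0..<1}" for x :: real by (simp add: floor_correct) linarith
  have kds: "kd (x - of_int k) = kd x" for x k using kd_periodic[of x "- k"] by simp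
  have "G \<subseteq> (\<Union>k\<in>{- 1..2}. (\<lambda>x. x + of_int k) ` F)"
  proof
    fix x assume x: "x \<in> G"
    have "x - of_int \<lfloor>x\<rfloor> \<in> F" using frac[of x] kds[of x] x by (simp add: F_def G_def)
    moreover have "\<lfloor>x\<rfloor> \<in> {- 1..2}" using x by (auto simp: G_def le_floor_iff floor_le_iff)
    ultimately show "x \<in> (\<Union>k\<in>{- 1..2}. (\<lambda>x. x + of_int k) ` F)"
      by (intro UN_I[of "\<lfloor>x\<rfloor>"] image_eqI[of _ _ "x - of_int \<lfloor>x\<rfloor>"]) auto
  qed
  then have "finite G" by (rule finite_subset) (use kd_total(1) in \<open>simp add: F_def\<close>)
  then have "finite {(x, y). x \<in> G \<and> y \<in> G \<and> x \<noteq> y}" by (rule_tac finite_subset[of _ "G \<times> G"]) auto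
  then have D: "finite D" "D \<noteq> {}" by (simp_all add: D_def)
  define d where "d = Min D"
  have "\<forall>e\<in>D. e > 0" by (auto simp: D_def)
  then have "d > 0" using Min_in[OF D] by (simp add: d_def)
  moreover have d1: "d \<le> 1" unfolding d_def by (rule Min_le[OF D(1)]) (simp add: D_def)
  moreover have "d \<le> \<bar>x - y\<bar>" if z: "kd x \<noteq> 0" "kd y \<noteq> 0" "x \<noteq> y" for x y
  proof (cases "\<bar>x - y\<bar> < 1")
    case True
    define k where "k = \<lfloor>x\<rfloor>"
    have "x - of_int k \<in> {0..<1}" unfolding k_def by (rule frac)
    then have "x - of_int k \<in> G" "y - of_int k \<in> G"
      using z True kds[of x k] kds[of y k] by (auto simp: G_def)
    then have "(x - of_int k, y - of_int k) \<in> {(x, y). x \<in> G \<and> y \<in> G \<and> x \<noteq> y}" using z(3) by simp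
    then have "\<bar>x - y\<bar> \<in> D"
      unfolding D_def by (intro insertI2 image_eqI[of _ _ "(x - of_int k, y - of_int k)"]) auto
    then show ?thesis unfolding d_def by (rule Min_le[OF D(1)])
  qed (use d1 in simp)
  ultimately show ?thesis by blast
qed

end


section \<open>Comparison of the eigenvalues with the free spectrum\<close>

context sturm_liouville
begin

lemma finite_mult:
  assumes "t \<in> {0..1}"
  shows "finite {x. x \<le> b \<and> mult t x \<noteq> 0}"
proof -
  obtain M where "\<forall>t\<in>{0..1}. \<forall>x. mult t x \<noteq> 0 \<longrightarrow> - M \<le> x" using cm_lower_bound by blast
  then have "{x. x \<le> b \<and> mult t x \<noteq> 0} \<subseteq> {x. x \<in> {- M..b} \<and> mult t x \<noteq> 0}" using assms by auto
  then show ?thesis by (rule finite_subset[OF _ finite_cm_zeros])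
qed

lemma mult_0_fibre: "finite {j. (free_root j)\<^sup>2 = x}" "card {j. (free_root j)\<^sup>2 = x} = mult 0 x"
proof -
  have "finite {j. (free_root j)\<^sup>2 = x} \<and> card {j. (free_root j)\<^sup>2 = x} = mult 0 x"
  proof (cases x "0 :: real" rule: linorder_cases)
    case less
    then have e: "{j. (free_root j)\<^sup>2 = x} = {}" by (auto simp: not_less[symmetric])
    show ?thesis unfolding e mult_0_neg[OF less] by simp
  next
    case equal
    have e: "{j. (free_root j)\<^sup>2 = x} = {j. free_root j = 0}" using equal by simp
    show ?thesis unfolding e unfolding equal using free_root_fibre[of 0] mult_0_zero by simp
  next
    case greater
    then have s: "sqrt x > 0" "(sqrt x)\<^sup>2 = x" by simp_all
    have e: "{j. (free_root j)\<^sup>2 = x} = {j. free_root j = sqrt x}"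
      using s real_sqrt_unique[OF _ free_root_nonneg] by auto
    show ?thesis unfolding e using free_root_fibre[of "sqrt x"] s mult_0_pos[OF s(1)] by simp
  qed
  then show "finite {j. (free_root j)\<^sup>2 = x}" "card {j. (free_root j)\<^sup>2 = x} = mult 0 x" by blast+
qed

lemma free_root_mono: "i \<le> j \<Longrightarrow> free_root i \<le> free_root j"
  unfolding free_root_def by (rule free_mono) simp

lemma count_mult_0: "(free_root j)\<^sup>2 < y \<longleftrightarrow> j < count_below (mult 0) y"
proof -
  have f: "finite {x. x < y \<and> mult 0 x \<noteq> 0}" by (rule finite_subset[OF _ finite_mult[of 0 y]]) auto
  have "mono (\<lambda>j. (free_root j)\<^sup>2)" by (rule monoI) (intro power_mono free_root_mono free_root_nonneg)
  from less_iff_less_card[OF this count_below_eq_card(1)[OF mult_0_fibre f]] show ?thesis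
    unfolding count_below_eq_card(2)[OF mult_0_fibre f] .
qed

text \<open>The lower bound uniform in \<open>t\<close> supplies a left endpoint that no eigenvalue
  reaches, so \<open>count_invariant\<close> covers everything below \<open>b\<close>.\<close>

lemma count_gap:
  assumes "\<And>t. t \<in> {0..1} \<Longrightarrow> mult t b = 0"
  shows "count_below (mult 0) b = count_below (mult 1) b"
proof -
  obtain M where M: "\<And>t x. t \<in> {0..1} \<Longrightarrow> mult t x \<noteq> 0 \<Longrightarrow> - M \<le> x" using cm_lower_bound by blast
  define a where "a = min (- M) b - 1"
  have "{x. x < b \<and> mult t x \<noteq> 0} = {x. x \<in> {a<..<b} \<and> mult t x \<noteq> 0}" if "t \<in> {0..1}" for t
    using M[OF that] by (fastforce simp: a_def)
  moreover have "mult t a = 0" if "t \<in> {0..1}" for t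
    using M[OF that, of a] by (force simp: a_def)
  moreover have "a < b" by (simp add: a_def)
  ultimately show ?thesis using count_invariant[of a b] assms by (simp add: count_below_def)
qed

abbreviation eigenvalue :: "nat \<Rightarrow> real" where
  "eigenvalue \<equiv> nth_point (mult 1)"

text \<open>
  No eigenvalue crosses a point that stays away from the zeros of \<open>w\<^sup>0\<close> during the deformation of
  \<open>\<sigma>, H\<^sub>1, H\<^sub>2\<close> to \<open>0\<close>, so below such points there are as many eigenvalues as in the free problem.
\<close>

lemma eigenvalue_asymptotics:
  obtains C n0 where "n0 \<ge> 1" "\<And>j. \<exists>y. j < count_below (mult 1) y"
    "\<And>j n. n = (j + p_perp T1 T2) div CARD('m) \<Longrightarrow> n0 \<le> n \<Longrightarrow>
       eigenvalue j > 0 \<and> \<bar>sqrt (eigenvalue j) - free_root j\<bar> \<le> C * remainder \<sigma> n"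
proof -
  obtain C where C: "C > 0" "\<And>t n \<rho>. \<lbrakk>t \<in> {0..1}; n \<ge> 1; \<rho> \<ge> 1; \<bar>\<rho> - real n\<bar> \<le> 2; mult t (\<rho>\<^sup>2) \<noteq> 0\<rbrakk> \<Longrightarrow>
     \<exists>z. w0 T1 T2 (complex_of_real z) = 0 \<and> \<bar>\<rho> - z\<bar> \<le> C * remainder \<sigma> n"
    using eigenvalue_near_zero by blast
  obtain d where d: "d > 0" "d \<le> 1" "\<And>x y. \<lbrakk>kd x \<noteq> 0; kd y \<noteq> 0; x \<noteq> y\<rbrakk> \<Longrightarrow> d \<le> \<bar>x - y\<bar>"
    using zeros_separated by blast
  \<comment> \<open>Zeros are \<open>3 * \<delta>\<close> apart and the roots of eigenvalues stay
    closer than \<delta> to a zero, so points at distance exactly \<delta> from a zero are never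
    met.\<close>
  define \<delta> where "\<delta> = d / 3"
  have \<delta>: "0 < \<delta>" "\<delta> < 1" "d = 3 * \<delta>" using d by (simp_all add: \<delta>_def)
  have "(\<lambda>n. (remainder \<sigma> n)\<^sup>2) \<longlonglongrightarrow> 0" by (rule summable_LIMSEQ_zero[OF remainder_summable[OF L2_\<sigma>]])
  then have "(\<lambda>n. sqrt ((remainder \<sigma> n)\<^sup>2)) \<longlonglongrightarrow> sqrt 0" by (rule tendsto_real_sqrt)
  then have "(\<lambda>n. C * remainder \<sigma> n) \<longlonglongrightarrow> C * 0"
    using remainder_nonneg(1)[OF L2_\<sigma>] by (intro tendsto_mult_left) simp
  then have "\<forall>\<^sub>F n in sequentially. C * remainder \<sigma> n < \<delta>" using \<delta>(1) by (intro order_tendstoD(2)) auto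
  then obtain n1 where n1: "\<And>n. n1 \<le> n \<Longrightarrow> C * remainder \<sigma> n < \<delta>" by (auto simp: eventually_sequentially)
  \<comment> \<open>The margin 2 keeps \<open>f - \<delta>\<close> above \<open>n1 + 1\<close>, as
    \<open>gap\<close> requires, and makes \<open>f\<close> at least 2.\<close>
  define n0 where "n0 = n1 + 2"
  have gap: "mult t (g\<^sup>2) = 0" if g: "g \<ge> real n1 + 1" "\<And>z. kd z \<noteq> 0 \<Longrightarrow> \<delta> \<le> \<bar>g - z\<bar>" and t: "t \<in> {0..1}" for g t
  proof (rule ccontr)
    assume ne: "mult t (g\<^sup>2) \<noteq> 0"
    define n where "n = nat \<lfloor>g\<rfloor>"
    have n: "real n \<le> g" "g < real n + 1" using g(1) by (simp_all add: n_def)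
    then have n': "n \<ge> 1" "n \<ge> n1" using g(1) by linarith+
    obtain z where z: "w0 T1 T2 (complex_of_real z) = 0" "\<bar>g - z\<bar> \<le> C * remainder \<sigma> n"
      using C(2)[OF t n'(1) _ _ ne] n g(1) by auto
    show False using g(2)[of z] z n1[OF n'(2)] by (simp add: kd_zero_iff)
  qed
  have kdf: "kd (free_root j) \<noteq> 0" for j unfolding free_root_def by (rule kd_free)
  have count: "count_below (mult 0) ((free_root j + \<epsilon>)\<^sup>2) = count_below (mult 1) ((free_root j + \<epsilon>)\<^sup>2)"
    if j: "free_root j \<ge> real n0" and \<epsilon>: "\<bar>\<epsilon>\<bar> = \<delta>" for j \<epsilon>
  proof (rule count_gap)
    fix t :: real assume t: "t \<in> {0..1}"
    show "mult t ((free_root j + \<epsilon>)\<^sup>2) = 0"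
    proof (rule gap[OF _ _ t])
      show "free_root j + \<epsilon> \<ge> real n1 + 1" using j \<epsilon> \<delta> unfolding n0_def of_nat_add by (auto simp: abs_if split: if_splits)
      fix z assume "kd z \<noteq> 0"
      then show "\<delta> \<le> \<bar>free_root j + \<epsilon> - z\<bar>"
        using d(3)[OF kdf[of j], of z] \<epsilon> \<delta> by (cases "z = free_root j") auto
    qed
  qed
  have large: "real ((j + p_perp T1 T2) div CARD('m)) \<le> free_root j" "free_root j < real ((j + p_perp T1 T2) div CARD('m)) + 1" for j
    unfolding free_root_def by (rule free_bounds)+
  have unbounded: "\<exists>y. j < count_below (mult 1) y" for j
  proof -
    define j' where "j' = max j (n0 * CARD('m))"
    have "n0 \<le> (j' + p_perp T1 T2) div CARD('m)"
      unfolding less_eq_div_iff_mult_less_eq[OF zero_less_card_finite] by (simp add: j'_def)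
    then have j': "real n0 \<le> free_root j'" using large(1)[of j'] by (meson of_nat_le_iff order_trans)
    have "(free_root j')\<^sup>2 < (free_root j' + \<delta>)\<^sup>2" using \<delta> free_root_nonneg[of j'] by (intro power_strict_mono) auto
    then have "j' < count_below (mult 1) ((free_root j' + \<delta>)\<^sup>2)"
      using count[OF j', of \<delta>] \<delta> by (simp add: count_mult_0)
    then show ?thesis by (intro exI[of _ "(free_root j' + \<delta>)\<^sup>2"]) (simp add: j'_def)
  qed
  have asymp: "eigenvalue j > 0 \<and> \<bar>sqrt (eigenvalue j) - free_root j\<bar> \<le> C * remainder \<sigma> n"
    if n: "n = (j + p_perp T1 T2) div CARD('m)" "n0 \<le> n" for j n
  proof -
    define f where "f = free_root j"
    have f: "real n \<le> f" "f < real n + 1" using large[of j] by (simp_all add: n f_def)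
    have fn: "real n0 \<le> f" using f(1) n(2) by linarith
    then have f2: "f \<ge> 2" by (simp add: n0_def)
    obtain y where y: "j < count_below (mult 1) y" using unbounded by blast
    note less = nth_point_less_iff[OF finite_mult y]
    \<comment> \<open>The counts below \<open>(f + \<delta>)\<^sup>2\<close> and below
      \<open>(f - \<delta>)\<^sup>2\<close> agree with the free ones, which places the
      \<open>j\<close>-th eigenvalue between these two points, just as the \<open>j\<close>-th free
      one.\<close>
    have "f\<^sup>2 < (f + \<delta>)\<^sup>2" using \<delta> f2 by (intro power_strict_mono) auto
    then have up: "eigenvalue j < (f + \<delta>)\<^sup>2"
      using less count[of j \<delta>] fn \<delta> unfolding f_def by (simp add: count_mult_0)
    have "(f - \<delta>)\<^sup>2 < f\<^sup>2" using \<delta> f2 by (intro power_strict_mono) auto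
    then have "\<not> f\<^sup>2 < (f - \<delta>)\<^sup>2" by simp
    then have "\<not> eigenvalue j < (f - \<delta>)\<^sup>2"
      using less count[of j "- \<delta>"] fn \<delta> unfolding f_def by (simp add: count_mult_0)
    then have lo: "(f - \<delta>)\<^sup>2 \<le> eigenvalue j" by simp
    have "0 < (f - \<delta>)\<^sup>2" using f2 \<delta> by simp
    then have pos: "eigenvalue j > 0" by (rule less_le_trans[OF _ lo])
    define \<rho> where "\<rho> = sqrt (eigenvalue j)"
    have \<rho>: "f - \<delta> \<le> \<rho>" "\<rho> < f + \<delta>"
      unfolding \<rho>_def using lo up f2 \<delta> by (auto intro!: real_le_rsqrt real_less_lsqrt)
    have "mult 1 (eigenvalue j) \<noteq> 0" using nth_point_eq_iff[OF finite_mult y, of "eigenvalue j"] by auto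
    then have ne: "mult 1 (\<rho>\<^sup>2) \<noteq> 0" using pos by (simp add: \<rho>_def)
    have n': "n \<ge> 1" "n \<ge> n1" using n(2) by (simp_all add: n0_def)
    \<comment> \<open>The coarse localization identifies the nearby zero as \<open>f\<close> itself,
      after which the sharp estimate by \<open>remainder\<close> holds with
      \<open>f\<close>.\<close>
    obtain z where z: "w0 T1 T2 (complex_of_real z) = 0" "\<bar>\<rho> - z\<bar> \<le> C * remainder \<sigma> n"
      using C(2)[OF _ n'(1) _ _ ne] \<rho> f f2 \<delta> by (auto simp: abs_le_iff)
    have "\<bar>\<rho> - z\<bar> < \<delta>" using z(2) n1[OF n'(2)] by simp
    then have "\<bar>f - z\<bar> < d" using \<rho> \<delta>(3) by linarith
    then have "z = f" using d(3)[OF kdf[of j, folded f_def], of z] z(1) by (auto simp: kd_zero_iff)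
    with z(2) pos show ?thesis by (simp add: \<rho>_def f_def)
  qed
  show thesis by (rule that[of n0 C]) (use unbounded asymp in \<open>auto simp: n0_def\<close>)
qed

text \<open>Position of (n, k) in the lexicographic order of the index set, counted from 0; the
  subtraction accounts for the absent pairs (0, k) with k at most
  \<open>p_perp T1 T2\<close>.\<close>

definition index :: "nat \<Rightarrow> nat \<Rightarrow> nat" where
  "index n k = n * CARD('m) + (k - 1) - p_perp T1 T2"

lemma index_add: "(n, k) \<in> index_set T1 T2 \<Longrightarrow> index n k + p_perp T1 T2 = n * CARD('m) + (k - 1) \<and> k - 1 < CARD('m) \<and> k \<ge> 1"
proof -
  assume a: "(n, k) \<in> index_set T1 T2"
  have "p_perp T1 T2 \<le> n * CARD('m) + (k - 1)"
  proof (cases "n = 0")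
    case False
    then have "1 * CARD('m) \<le> n * CARD('m)" by (intro mult_le_mono1) simp
    then show ?thesis using p_perp_le by linarith
  qed (use a in \<open>auto simp: index_set_def\<close>)
  moreover have "k \<ge> 1" "k \<le> CARD('m)" using a by (auto simp: index_set_def)
  ultimately show ?thesis unfolding index_def by linarith
qed

lemma index_div_mod:
  assumes "(n, k) \<in> index_set T1 T2"
  shows "(index n k + p_perp T1 T2) div CARD('m) = n" "(index n k + p_perp T1 T2) mod CARD('m) = k - 1"
proof -
  have "(n * CARD('m) + i) div CARD('m) = n \<and> (n * CARD('m) + i) mod CARD('m) = i" if "i < CARD('m)" for i
    using that by simp
  from this[of "k - 1"] index_add[OF assms]
  show "(index n k + p_perp T1 T2) div CARD('m) = n" "(index n k + p_perp T1 T2) mod CARD('m) = k - 1"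
    by metis+
qed

lemma index_bij: "bij_betw (\<lambda>(n, k). index n k) (index_set T1 T2) UNIV"
proof (rule bij_betw_imageI)
  show "inj_on (\<lambda>(n, k). index n k) (index_set T1 T2)"
  proof (rule inj_onI)
    fix a b assume ab: "a \<in> index_set T1 T2" "b \<in> index_set T1 T2" "(\<lambda>(n, k). index n k) a = (\<lambda>(n, k). index n k) b"
    obtain n k n' k' where e: "a = (n, k)" "b = (n', k')" by fastforce
    have i: "index n k = index n' k'" using ab(3) by (simp add: e)
    have "n = n'" using index_div_mod(1)[OF ab(1)[unfolded e]] index_div_mod(1)[OF ab(2)[unfolded e]] by (simp add: i)
    moreover have "k - 1 = k' - 1" using index_div_mod(2)[OF ab(1)[unfolded e]] index_div_mod(2)[OF ab(2)[unfolded e]] by (simp add: i)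
    moreover from this have "k = k'" using index_add[OF ab(1)[unfolded e]] index_add[OF ab(2)[unfolded e]] by linarith
    ultimately show "a = b" by (simp add: e)
  qed
  have "j \<in> (\<lambda>(n, k). index n k) ` index_set T1 T2" for j
  proof -
    define N where "N = j + p_perp T1 T2"
    define n k where "n = N div CARD('m)" and "k = N mod CARD('m) + 1"
    have N: "N = n * CARD('m) + (k - 1)" by (simp add: n_def k_def)
    have "k \<le> CARD('m)" unfolding k_def by (simp add: Suc_le_eq)
    moreover have "k \<ge> p_perp T1 T2 + 1" if "n = 0"
    proof -
      have "k - 1 = N" using N that by simp
      then show ?thesis by (simp add: N_def k_def)
    qed
    ultimately have "(n, k) \<in> index_set T1 T2" by (cases "n = 0") (auto simp: index_set_def k_def)
    moreover have "index n k = j" unfolding index_def N[symmetric] by (simp add: N_def)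
    ultimately show ?thesis by (intro image_eqI[of _ _ "(n, k)"]) auto
  qed
  then show "(\<lambda>(n, k). index n k) ` index_set T1 T2 = UNIV" by blast
qed

lemma index_mono:
  assumes "(n, k) \<in> index_set T1 T2" "(n', k') \<in> index_set T1 T2" "n < n' \<or> n = n' \<and> k < k'"
  shows "index n k \<le> index n' k'"
proof -
  have "n * CARD('m) + (k - 1) \<le> n' * CARD('m) + (k' - 1)"
    using assms(3)
  proof
    assume "n < n'"
    then have "Suc n * CARD('m) \<le> n' * CARD('m)" by (intro mult_le_mono1) simp
    then show ?thesis using index_add[OF assms(1)] unfolding mult_Suc by linarith
  qed auto
  then show ?thesis unfolding index_def by (rule diff_le_mono)
qed

lemma eigenvalue_fibre:
  assumes "\<And>j. \<exists>y. j < count_below (mult 1) y"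
  shows "finite {(n, k) \<in> index_set T1 T2. eigenvalue (index n k) = x}"
    "card {(n, k) \<in> index_set T1 T2. eigenvalue (index n k) = x} = mult 1 x"
proof -
  let ?A = "{(n, k) \<in> index_set T1 T2. eigenvalue (index n k) = x}"
  have inj: "inj_on (\<lambda>(n, k). index n k) ?A"
    by (rule inj_on_subset[OF bij_betw_imp_inj_on[OF index_bij]]) auto
  have "eigenvalue j = x \<longleftrightarrow> count_below (mult 1) x \<le> j \<and> j < count_below (mult 1) x + mult 1 x" for j
  proof -
    obtain y where y: "j < count_below (mult 1) y" using assms by blast
    show ?thesis by (rule nth_point_eq_iff[OF finite_mult y]) simp
  qed
  then have "{j. eigenvalue j = x} = {count_below (mult 1) x..<count_below (mult 1) x + mult 1 x}"
    by (simp add: set_eq_iff)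
  moreover have "{j. eigenvalue j = x} = (\<lambda>(n, k). index n k) ` ?A"
  proof (intro equalityI subsetI)
    fix j assume j: "j \<in> {j. eigenvalue j = x}"
    obtain i where "i \<in> index_set T1 T2" "j = (\<lambda>(n, k). index n k) i"
      using bij_betw_imp_surj_on[OF index_bij] by (metis (no_types, lifting) UNIV_I imageE)
    with j show "j \<in> (\<lambda>(n, k). index n k) ` ?A" by (intro image_eqI[of _ _ i]) auto
  qed auto
  ultimately have im: "(\<lambda>(n, k). index n k) ` ?A = {count_below (mult 1) x..<count_below (mult 1) x + mult 1 x}" by simp
  show "finite ?A" by (rule finite_imageD[OF _ inj]) (simp only: im finite_atLeastLessThan)
  show "card ?A = mult 1 x" unfolding card_image[OF inj, symmetric] im by simp
qed

lemma summable_on_Times_finite: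
  fixes f :: "nat \<times> nat \<Rightarrow> real"
  assumes "finite K" "\<And>k. k \<in> K \<Longrightarrow> summable (\<lambda>n. f (n, k))" "\<And>x. f x \<ge> 0"
  shows "f summable_on (UNIV \<times> K)"
  using assms(1,2)
proof (induction K)
  case (insert k K)
  have "(\<lambda>n. f (n, k)) summable_on UNIV"
    using insert.prems assms(3) by (simp add: summable_on_UNIV_nonneg_real_iff)
  then have "f summable_on range (\<lambda>n. (n, k))"
    by (subst summable_on_reindex) (auto simp: inj_on_def o_def)
  moreover have "f summable_on (UNIV \<times> K)" using insert by simp
  moreover have "range (\<lambda>n. (n, k)) \<inter> UNIV \<times> K = {}" using insert.hyps by auto
  ultimately have "f summable_on (range (\<lambda>n. (n, k)) \<union> UNIV \<times> K)" by (rule summable_on_Un_disjoint)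
  moreover have eq: "UNIV \<times> insert k K = range (\<lambda>n. (n, k)) \<union> UNIV \<times> K" by auto
  ultimately show ?case unfolding eq by blast
qed simp

end

theorem theorem2p3:
  fixes \<sigma> :: "real \<Rightarrow> complex^'m^'m"
    and T1 T2 H1 H2 :: "complex^'m^'m"
  assumes "L2 \<sigma>" and "AE x in lebesgue_on {0<..<pi}. \<sigma> x = dagger (\<sigma> x)"
    and "T1 = dagger T1" and "T1 = T1 ** T1"
    and "T2 = dagger T2" and "T2 = T2 ** T2"
    and "H1 = dagger H1" and "H1 = T1 ** H1 ** T1"
    and "H2 = dagger H2" and "H2 = T2 ** H2 ** T2"
  shows "\<exists>(lam :: nat \<Rightarrow> nat \<Rightarrow> real) (r :: nat \<Rightarrow> real).
     bvp_spectrum \<sigma> T1 H1 T2 H2 = bvp_eigenvalues \<sigma> T1 H1 T2 H2 \<and>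
     bvp_spectrum \<sigma> T1 H1 T2 H2 = (\<lambda>(n, k). complex_of_real (lam n k)) ` index_set T1 T2 \<and>
     (\<forall>\<mu>\<in>bvp_spectrum \<sigma> T1 H1 T2 H2.
        finite {(n, k) \<in> index_set T1 T2. complex_of_real (lam n k) = \<mu>} \<and>
        card {(n, k) \<in> index_set T1 T2. complex_of_real (lam n k) = \<mu>}
          = bvp_multiplicity \<sigma> T1 H1 T2 H2 \<mu>) \<and>
     (\<forall>(n1, k1)\<in>index_set T1 T2. \<forall>(n2, k2)\<in>index_set T1 T2.
        ((n1, k1), (n2, k2)) \<in> less_than <*lex*> less_than \<longrightarrow> lam n1 k1 \<le> lam n2 k2) \<and>
     zeros_listing (w0 T1 T2) CARD('m) r \<and>
     (\<lambda>(n, k). (norm (branch_sqrt (complex_of_real (lam n k)) - of_nat n - of_real (r k)))\<^sup>2)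
        summable_on index_set T1 T2"
proof -
  interpret sturm_liouville \<sigma> T1 H1 T2 H2 by unfold_locales (fact assms)+
  obtain C n0 where n0: "n0 \<ge> 1" and unb: "\<And>j. \<exists>y. j < count_below (mult 1) y"
    and asymp: "\<And>j n. n = (j + p_perp T1 T2) div CARD('m) \<Longrightarrow> n0 \<le> n \<Longrightarrow>
       eigenvalue j > 0 \<and> \<bar>sqrt (eigenvalue j) - free_root j\<bar> \<le> C * remainder \<sigma> n"
    by (rule eigenvalue_asymptotics) (rule that; blast)
  define lam where "lam n k = eigenvalue (index n k)" for n k
  define r where "r k = w0_root (k - 1)" for k
  have spec: "bvp_spectrum \<sigma> T1 H1 T2 H2 = {\<mu>. det (cm 1 \<mu>) = 0}"
    unfolding spectrum_eq_eigenvalues eigenvalues_eq_det cm_1 ..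
  have fibre: "finite {(n, k) \<in> index_set T1 T2. lam n k = x}" "card {(n, k) \<in> index_set T1 T2. lam n k = x} = mult 1 x" for x
    unfolding lam_def by (rule eigenvalue_fibre[OF unb])+
  have mem: "complex_of_real x \<in> bvp_spectrum \<sigma> T1 H1 T2 H2 \<longleftrightarrow> mult 1 x \<noteq> 0" for x
    unfolding spec mult_eq_0_iff by simp
  have real: "\<exists>x. \<mu> = complex_of_real x" if "\<mu> \<in> bvp_spectrum \<sigma> T1 H1 T2 H2" for \<mu>
    using that cm_det_zero_real[of 1 \<mu>] unfolding spec by (auto elim: Reals_cases)
  have image: "bvp_spectrum \<sigma> T1 H1 T2 H2 = (\<lambda>(n, k). complex_of_real (lam n k)) ` index_set T1 T2"
  proof (intro equalityI subsetI)
    fix \<mu> assume \<mu>: "\<mu> \<in> bvp_spectrum \<sigma> T1 H1 T2 H2"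
    then obtain x where x: "\<mu> = complex_of_real x" using real by blast
    then have "card {(n, k) \<in> index_set T1 T2. lam n k = x} \<noteq> 0" using \<mu> mem unfolding fibre(2) by simp
    then have "{(n, k) \<in> index_set T1 T2. lam n k = x} \<noteq> {}" by (rule contrapos_nn) (simp only: card.empty)
    then obtain i where "i \<in> index_set T1 T2" "lam (fst i) (snd i) = x" by auto
    then show "\<mu> \<in> (\<lambda>(n, k). complex_of_real (lam n k)) ` index_set T1 T2"
      unfolding x by (intro image_eqI[of _ _ i]) (auto simp: case_prod_beta)
  next
    fix \<mu> assume "\<mu> \<in> (\<lambda>(n, k). complex_of_real (lam n k)) ` index_set T1 T2"
    then obtain n k where nk: "(n, k) \<in> index_set T1 T2" "\<mu> = complex_of_real (lam n k)" by auto
    then have "{(n', k') \<in> index_set T1 T2. lam n' k' = lam n k} \<noteq> {}" by auto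
    then have "mult 1 (lam n k) \<noteq> 0" unfolding fibre(2)[symmetric] using fibre(1) by simp
    then show "\<mu> \<in> bvp_spectrum \<sigma> T1 H1 T2 H2" unfolding nk(2) mem .
  qed
  have card: "finite {(n, k) \<in> index_set T1 T2. complex_of_real (lam n k) = \<mu>} \<and>
     card {(n, k) \<in> index_set T1 T2. complex_of_real (lam n k) = \<mu>} = bvp_multiplicity \<sigma> T1 H1 T2 H2 \<mu>"
    if \<mu>: "\<mu> \<in> bvp_spectrum \<sigma> T1 H1 T2 H2" for \<mu>
  proof -
    obtain x where x: "\<mu> = complex_of_real x" using real[OF \<mu>] by blast
    show ?thesis unfolding x of_real_eq_iff fibre(2) multiplicity_eq mult_def cm_1 using fibre(1) by simp
  qed
  have mono: "lam n1 k1 \<le> lam n2 k2"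
    if "(n1, k1) \<in> index_set T1 T2" "(n2, k2) \<in> index_set T1 T2" "((n1, k1), (n2, k2)) \<in> less_than <*lex*> less_than" for n1 k1 n2 k2
  proof -
    obtain y where y: "index n2 k2 < count_below (mult 1) y" using unb by blast
    show ?thesis unfolding lam_def
      by (rule nth_point_mono[OF finite_mult index_mono y]) (use that in auto)
  qed
  let ?f = "\<lambda>(n, k). (norm (branch_sqrt (complex_of_real (lam n k)) - of_nat n - of_real (r k)))\<^sup>2"
  \<comment> \<open>Each of the finitely many k is treated separately over all n. Pairs with n = 0
    outside the index set are included for convenience and removed by restriction to a subset at the
    end.\<close>
  have "summable (\<lambda>n. ?f (n, k))" if k: "k \<in> {1..CARD('m)}" for k
  proof (rule summable_comparison_test'[where N = n0])
    show "summable (\<lambda>n. C\<^sup>2 * (remainder \<sigma> n)\<^sup>2)" by (rule summable_mult[OF remainder_summable[OF L2_\<sigma>]])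
    fix n assume n: "n \<ge> n0"
    then have J: "(n, k) \<in> index_set T1 T2" using k n0 by (auto simp: index_set_def)
    have fr: "free_root (index n k) = real n + r k"
      unfolding free_root_def free_def index_div_mod[OF J] r_def ..
    have a: "lam n k > 0 \<and> \<bar>sqrt (lam n k) - (real n + r k)\<bar> \<le> C * remainder \<sigma> n"
      using asymp[OF index_div_mod(1)[OF J, symmetric] n] unfolding lam_def fr .
    have "branch_sqrt (complex_of_real (lam n k)) - of_nat n - of_real (r k) = complex_of_real (sqrt (lam n k) - (real n + r k))"
      using branch_sqrt_of_real a by simp
    then have "?f (n, k) = \<bar>sqrt (lam n k) - (real n + r k)\<bar>\<^sup>2" by (simp only: norm_of_real prod.case)
    also have "\<dots> \<le> (C * remainder \<sigma> n)\<^sup>2" using a by (intro power_mono) auto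
    finally show "norm (?f (n, k)) \<le> C\<^sup>2 * (remainder \<sigma> n)\<^sup>2" by (simp add: power_mult_distrib)
  qed
  then have "?f summable_on (UNIV \<times> {1..CARD('m)})"
    by (intro summable_on_Times_finite) auto
  then have "?f summable_on index_set T1 T2"
    by (rule summable_on_subset_banach) (auto simp: index_set_def)
  with spectrum_eq_eigenvalues image card mono zeros_listing_w0_root[folded r_def]
  show ?thesis by (intro exI[of _ lam] exI[of _ r]) blast
qed


end
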